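(* Let $(U_1,U_2,A)$ be strip-admissible analytic data with values in $U(2)$ and $GL(2,\mathbb C)$, admitting a dominated splitting $E^s\oplus E^u$, over a translation $\tau\in\mathrm{DC}(c,\nu)$ for some $c>0$, $\nu\ge1$. Then: (1) every measurable eigensection of $T_A$ is carried a.e. by $E^s$ or carried a.e. by $E^u$; (2) if $c_1(E^s)\ne0$ and $c_1(E^u)\ne0$, then $T_A$ has no measurable eigensections at all (for any $\lambda\in\mathbb C$); in particular the point spectrum of $T_A$ on $\mathcal H_U$ is empty; (3) if exactly one of the classes $c_1(E^s),c_1(E^u)$ vanishes, every measurable eigensection is carried a.e. by the topologically trivial line; (4) for $i\in\{s,u\}$, the line $E^i$ carries a measurable eigensection if and only if $c_1(E^i)=0$ and the multiplier winding vector $k(E^i)$ is $0$, in which case the set of eigenvalues it contributes is the coset $\lambda_0\{\mathrm e^{-2\pi\mathrm i\nu\cdot\tau}:\nu\in\mathbb Z^2\}$ with $\lambda_0=\exp(\langle\log|q|\rangle+2\pi\mathrm i\langle g\rangle)$ computed from the multiplier of $E^i$; the invariants $c_1(E^i)$ and $k(E^i)$ do not determine this coset (there exist data satisfying all the hypotheses for which these invariants agree but the cosets differ).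
   Context: Notation. $\mathbb T^2=\mathbb R^2/\mathbb Z^2$, $w=(w_1,w_2)$, Haar probability measure $\mu$; $e_1=(1,0)$, $e_2=(0,1)$; $\langle h\rangle=\int_{\mathbb T^2}h\,d\mu$; the inner product on $\mathbb C^2$ is conjugate-linear in the first slot; $\tau=(\alpha,\beta)\in\mathbb R^2$, $Sw=w+\tau$. Sewing system and cocycle. A continuous unitary sewing system is a pair of continuous $U_1,U_2\colon\mathbb R^2\to U(2)$ with (K1) $U_1(w+e_2)U_2(w)=U_2(w+e_1)U_1(w)$; it presents the rank-two Hermitian bundle $V\to\mathbb T^2$ given as the quotient of $\mathbb R^2\times\mathbb C^2$ by the action generated by $(w,\xi)\mapsto(w+e_j,U_j(w)\xi)$. Measurable sections of $V$ are measurable $F\colon\mathbb R^2\to\mathbb C^2$ with $F(w+e_j)=U_j(w)F(w)$ a.e.; $\mathcal H_U$ is the Hilbert space of those with $\int_{[0,1)^2}|F|^2<\infty$ (mod null sets). A continuous equivariant cocycle is a continuous $A\colon\mathbb R^2\to GL(2,\mathbb C)$ with (K2) $A(w+e_j)U_j(w)=U_j(Sw)A(w)$. The transfer operator is $(T_AF)(w)=A(w-\tau)F(w-\tau)$; $T_AF=\lambda F$ is equivalent to $A(w)F(w)=\lambda F(Sw)$ a.e. A measurable eigensection is a measurable section, not a.e. zero, satisfying this for some $\lambda\in\mathbb C$ (its eigenvalue). Invariant line. A continuous map $\ell\colon\mathbb R^2\to\mathbb{CP}^1$ with $\ell(w+e_j)=U_j(w)\ell(w)$ and $A(w)\ell(w)=\ell(Sw)$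 for all $w$; it induces a line subbundle $L\subset V$. $F$ is carried by $L$ if $F(w)\in\ell(w)$ a.e. Charge and multiplier. There are a continuous $e\colon\mathbb R^2\to\mathbb C^2$ with $|e|=1$, $e(w)\in\ell(w)$, and a unique integer $m$ with $e(w+e_1)=U_1(w)e(w)$, $e(w+e_2)=\mathrm e^{2\pi\mathrm i m w_1}U_2(w)e(w)$. The multiplier of $L$ is $q(w)=\langle e(Sw),A(w)e(w)\rangle$, so $A(w)e(w)=q(w)e(Sw)$; it is continuous, zero-free, and $|q|$ is $\mathbb Z^2$-periodic. The function $p(w)=\frac{q(w)}{|q(w)|}\mathrm e^{2\pi\mathrm i m\alpha w_2}$ is continuous, $\mathbb Z^2$-periodic, unimodular; $k=k(L)\in\mathbb Z^2$ is its winding vector (independent of $e$) and $g\colon\mathbb T^2\to\mathbb R$ is continuous with $p(w)=\mathrm e^{2\pi\mathrm i(k\cdot w+g(w))}$. Strip-admissible. For $\delta>0$ let $\Omega_\delta=\{w\in\mathbb C^2:|\operatorname{Im}w_1|\le\delta,|\operatorname{Im}w_2|\le\delta\}$. $(U_1,U_2,A)$ is strip-admissible if for some $\delta_0>0$ the maps $U_1,U_2,A$ extend to matrix functions holomorphic on an open neighborhood of $\Omega_{\delta_0}$ and bounded on $\Omega_{\delta_0}$, with $U_j(w)$ unitary and $\det A(w)\ne0$ for real $w$, and (K1), (K2) holding on $\mathbb R^2$. Dominated splitting. A pair of invariant lines $\ell_s,\ell_u$ with $\ell_s(w)\ne\ell_u(w)$ for all $w$, inducing $E^s,E^u$ with $V=E^s\oplus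 E^u$, such that for some integer $N\ge1$ and $0<\kappa_0<1$, $\|A^{(N)}(z)|_{\ell_s(z)}\|/\mathfrak m(A^{(N)}(z)|_{\ell_u(z)})\le\kappa_0^2$ for all $z\in\mathbb R^2$, where $A^{(N)}(w)=A(S^{N-1}w)\cdots A(w)$ and $\mathfrak m(M)=\min_{|v|=1}|Mv|$. Diophantine condition. $\tau\in\mathrm{DC}(c,\nu)$, $c>0,\nu\ge1$, means $\|\nu_1'\alpha+\nu_2'\beta\|_{\mathbb R/\mathbb Z}\ge c\,(|\nu_1'|+|\nu_2'|)^{-\nu}$ for all $(\nu_1',\nu_2')\in\mathbb Z^2\setminus\{0\}$, where $\|x\|_{\mathbb R/\mathbb Z}$ is the distance to the nearest integer. *)

theory Defs
  imports "HOL-Analysis.Analysis"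
begin

type_synonym plane = "real \<times> real"
type_synonym cvec = "complex^2"
type_synonym cmat = "complex^2^2"

abbreviation e1 :: plane where "e1 \<equiv> (1, 0)"
abbreviation e2 :: plane where "e2 \<equiv> (0, 1)"

definition cinner :: "cvec \<Rightarrow> cvec \<Rightarrow> complex"
  where "cinner x y = (\<Sum>i\<in>UNIV. cnj (x $ i) * y $ i)"

definition unitary_mat :: "cmat \<Rightarrow> bool"
  where "unitary_mat U \<longleftrightarrow>
    (\<chi> i j. cnj (U $ j $ i)) ** U = mat 1 \<and> U ** (\<chi> i j. cnj (U $ j $ i)) = mat 1"

definition K1 :: "(plane \<Rightarrow> cmat) \<Rightarrow> (plane \<Rightarrow> cmat) \<Rightarrow> bool"
  where "K1 U1 U2 \<longleftrightarrow> (\<forall>w. U1 (w + e2) ** U2 w = U2 (w + e1) ** U1 w)"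

definition K2 :: "plane \<Rightarrow> (plane \<Rightarrow> cmat) \<Rightarrow> (plane \<Rightarrow> cmat) \<Rightarrow> (plane \<Rightarrow> cmat) \<Rightarrow> bool"
  where "K2 \<tau> U1 U2 A \<longleftrightarrow>
    (\<forall>w. A (w + e1) ** U1 w = U1 (w + \<tau>) ** A w) \<and>
    (\<forall>w. A (w + e2) ** U2 w = U2 (w + \<tau>) ** A w)"

definition sewing_system :: "(plane \<Rightarrow> cmat) \<Rightarrow> (plane \<Rightarrow> cmat) \<Rightarrow> bool"
  where "sewing_system U1 U2 \<longleftrightarrow>
    continuous_on UNIV U1 \<and> continuous_on UNIV U2 \<and>
    (\<forall>w. unitary_mat (U1 w)) \<and> (\<forall>w. unitary_mat (U2 w)) \<and> K1 U1 U2"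

definition equivariant_cocycle ::
    "plane \<Rightarrow> (plane \<Rightarrow> cmat) \<Rightarrow> (plane \<Rightarrow> cmat) \<Rightarrow> (plane \<Rightarrow> cmat) \<Rightarrow> bool"
  where "equivariant_cocycle \<tau> U1 U2 A \<longleftrightarrow>
    continuous_on UNIV A \<and> (\<forall>w. det (A w) \<noteq> 0) \<and> K2 \<tau> U1 U2 A"


definition measurable_section :: "(plane \<Rightarrow> cmat) \<Rightarrow> (plane \<Rightarrow> cmat) \<Rightarrow> (plane \<Rightarrow> cvec) \<Rightarrow> bool"
  where "measurable_section U1 U2 F \<longleftrightarrow>
    F \<in> borel_measurable lebesgue \<and>
    (AE w in lebesgue. F (w + e1) = U1 w *v F w) \<and>
    (AE w in lebesgue. F (w + e2) = U2 w *v F w)"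

definition fundamental_square :: "plane set"
  where "fundamental_square = {0..<1} \<times> {0..<1}"

text \<open>Representatives of the elements of the Hilbert space of sections; two of them are
  identified when they agree almost everywhere.\<close>

definition L2_sections :: "(plane \<Rightarrow> cmat) \<Rightarrow> (plane \<Rightarrow> cmat) \<Rightarrow> (plane \<Rightarrow> cvec) set"
  where "L2_sections U1 U2 = {F. measurable_section U1 U2 F \<and>
    set_integrable lebesgue fundamental_square (\<lambda>w. (norm (F w))\<^sup>2)}"

definition transfer :: "plane \<Rightarrow> (plane \<Rightarrow> cmat) \<Rightarrow> (plane \<Rightarrow> cvec) \<Rightarrow> plane \<Rightarrow> cvec"
  where "transfer \<tau> A F w = A (w - \<tau>) *v F (w - \<tau>)"

definition eigensection ::
    "plane \<Rightarrow> (plane \<Rightarrow> cmat) \<Rightarrow> (plane \<Rightarrow> cmat) \<Rightarrow> (plane \<Rightarrow> cmat) \<Rightarrow> complex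
      \<Rightarrow> (plane \<Rightarrow> cvec) \<Rightarrow> bool"
  where "eigensection \<tau> U1 U2 A \<rho> F \<longleftrightarrow>
    measurable_section U1 U2 F \<and> \<not> (AE w in lebesgue. F w = 0) \<and>
    (AE w in lebesgue. transfer \<tau> A F w = \<rho> *s F w)"

definition point_spectrum ::
    "plane \<Rightarrow> (plane \<Rightarrow> cmat) \<Rightarrow> (plane \<Rightarrow> cmat) \<Rightarrow> (plane \<Rightarrow> cmat) \<Rightarrow> complex set"
  where "point_spectrum \<tau> U1 U2 A =
    {\<rho>. \<exists>F\<in>L2_sections U1 U2. \<not> (AE w in lebesgue. F w = 0) \<and>
      (AE w in lebesgue. transfer \<tau> A F w = \<rho> *s F w)}"


text \<open>The complex projective line: the complex lines through the origin, with the quotient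
  topology from the nonzero vectors.\<close>

definition line_through :: "cvec \<Rightarrow> cvec set"
  where "line_through v = range (\<lambda>c. c *s v)"

definition CP1 :: "cvec set topology"
  where "CP1 = topology (\<lambda>\<U>. \<U> \<subseteq> line_through ` (- {0}) \<and>
    open {v. v \<noteq> 0 \<and> line_through v \<in> \<U>})"

lemma openin_CP1:
  "openin CP1 \<U> \<longleftrightarrow> \<U> \<subseteq> line_through ` (- {0}) \<and> open {v. v \<noteq> 0 \<and> line_through v \<in> \<U>}"
proof -
  let ?P = "\<lambda>\<U>. \<U> \<subseteq> line_through ` (- {0}) \<and> open {v. v \<noteq> 0 \<and> line_through v \<in> \<U>}"
  have "istopology ?P"
    unfolding istopology_def
  proof (intro conjI allI impI)
    fix S T assume "?P S" "?P T"
    moreover have "{v. v \<noteq> 0 \<and> line_through v \<in> S \<inter> T} =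
      {v. v \<noteq> 0 \<and> line_through v \<in> S} \<inter> {v. v \<noteq> 0 \<and> line_through v \<in> T}"
      by blast
    ultimately show "open {v. v \<noteq> 0 \<and> line_through v \<in> S \<inter> T}"
      "S \<inter> T \<subseteq> line_through ` (- {0})"
      by (auto simp only: open_Int)
  next
    fix \<K> assume K: "\<forall>K\<in>\<K>. ?P K"
    have "{v. v \<noteq> 0 \<and> line_through v \<in> \<Union>\<K>} = (\<Union>K\<in>\<K>. {v. v \<noteq> 0 \<and> line_through v \<in> K})"
      by blast
    with K show "open {v. v \<noteq> 0 \<and> line_through v \<in> \<Union>\<K>}"
      by (simp add: open_UN)
    from K show "\<Union>\<K> \<subseteq> line_through ` (- {0})"
      by blast
  qed
  then show ?thesis
    by (simp add: CP1_def topology_inverse')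
qed

definition invariant_line ::
    "plane \<Rightarrow> (plane \<Rightarrow> cmat) \<Rightarrow> (plane \<Rightarrow> cmat) \<Rightarrow> (plane \<Rightarrow> cmat) \<Rightarrow> (plane \<Rightarrow> cvec set) \<Rightarrow> bool"
  where "invariant_line \<tau> U1 U2 A l \<longleftrightarrow>
    continuous_map euclidean CP1 l \<and>
    (\<forall>w. l (w + e1) = (\<lambda>v. U1 w *v v) ` l w) \<and>
    (\<forall>w. l (w + e2) = (\<lambda>v. U2 w *v v) ` l w) \<and>
    (\<forall>w. (\<lambda>v. A w *v v) ` l w = l (w + \<tau>))"

definition carried_by :: "(plane \<Rightarrow> cvec) \<Rightarrow> (plane \<Rightarrow> cvec set) \<Rightarrow> bool"
  where "carried_by F l \<longleftrightarrow> (AE w in lebesgue. F w \<in> l w)"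

definition unit_frame :: "(plane \<Rightarrow> cvec set) \<Rightarrow> (plane \<Rightarrow> cvec) \<Rightarrow> bool"
  where "unit_frame l e \<longleftrightarrow>
    continuous_on UNIV e \<and> (\<forall>w. norm (e w) = 1) \<and> (\<forall>w. e w \<in> l w)"

text \<open>The first Chern class of the line bundle on the torus induced by \<open>l\<close>, evaluated on the
  fundamental class. In a unit frame \<open>e\<close> of the pullback to the plane the bundle has the factor
  of automorphy \<open>cis (2 * pi * f\<^sub>j w)\<close>; the connecting homomorphism of the exponential sequence
  sends its class to the integer \<open>n\<close> below, which does not depend on \<open>e\<close>, \<open>f1\<close>, \<open>f2\<close>.
  The sign is the usual one: \<open>n\<close> is the number of zeros, counted with sign, of a generic
  section.\<close>

definition first_chern ::
    "(plane \<Rightarrow> cmat) \<Rightarrow> (plane \<Rightarrow> cmat) \<Rightarrow> (plane \<Rightarrow> cvec set) \<Rightarrow> int"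
  where "first_chern U1 U2 l = (THE n. \<exists>e f1 f2. unit_frame l e \<and>
    continuous_on UNIV f1 \<and> continuous_on UNIV f2 \<and>
    (\<forall>w. U1 w *v e w = cis (2 * pi * f1 w) *s e (w + e1)) \<and>
    (\<forall>w. U2 w *v e w = cis (2 * pi * f2 w) *s e (w + e2)) \<and>
    (\<forall>w. f1 (w + e2) + f2 w - f2 (w + e1) - f1 w = real_of_int n))"

definition normalized_frame ::
    "(plane \<Rightarrow> cmat) \<Rightarrow> (plane \<Rightarrow> cmat) \<Rightarrow> (plane \<Rightarrow> cvec set) \<Rightarrow> int \<Rightarrow> (plane \<Rightarrow> cvec) \<Rightarrow> bool"
  where "normalized_frame U1 U2 l m e \<longleftrightarrow>
    unit_frame l e \<and>
    (\<forall>w. e (w + e1) = U1 w *v e w) \<and>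
    (\<forall>w. e (w + e2) = cis (2 * pi * real_of_int m * fst w) *s (U2 w *v e w))"

text \<open>The charge \<open>m\<close> of a normalized frame is a value of \<open>n\<close> in the definition of
  \<^const>\<open>first_chern\<close>.\<close>

lemma normalized_frame_chern_datum:
  assumes "normalized_frame U1 U2 l m e"
  shows "\<exists>e f1 f2. unit_frame l e \<and>
    continuous_on UNIV f1 \<and> continuous_on UNIV f2 \<and>
    (\<forall>w. U1 w *v e w = cis (2 * pi * f1 w) *s e (w + e1)) \<and>
    (\<forall>w. U2 w *v e w = cis (2 * pi * f2 w) *s e (w + e2)) \<and>
    (\<forall>w. f1 (w + e2) + f2 w - f2 (w + e1) - f1 w = real_of_int m)"
proof (intro exI conjI)
  show "unit_frame l e"
    using assms by (simp add: normalized_frame_def)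
  show "continuous_on UNIV (\<lambda>w::plane. 0::real)"
    "continuous_on UNIV (\<lambda>w::plane. - (real_of_int m * fst w))"
    by (intro continuous_intros)+
  show "\<forall>w. U1 w *v e w = cis (2 * pi * 0) *s e (w + e1)"
    using assms by (simp add: normalized_frame_def)
  show "\<forall>w. U2 w *v e w = cis (2 * pi * - (real_of_int m * fst w)) *s e (w + e2)"
    using assms by (simp add: normalized_frame_def vector_smult_assoc cis_mult)
  show "\<forall>w::plane. 0 + - (real_of_int m * fst w) - - (real_of_int m * fst (w + e1)) - 0
      = real_of_int m"
    by (simp add: algebra_simps)
qed

text \<open>\<open>q\<close> is the multiplier of \<open>l\<close> in some normalized frame, and \<open>k\<close>, \<open>g\<close> are the winding
  vector and the phase of the periodic unimodular function obtained from it.\<close>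

definition multiplier_data ::
    "plane \<Rightarrow> (plane \<Rightarrow> cmat) \<Rightarrow> (plane \<Rightarrow> cmat) \<Rightarrow> (plane \<Rightarrow> cmat) \<Rightarrow> (plane \<Rightarrow> cvec set)
      \<Rightarrow> (plane \<Rightarrow> complex) \<Rightarrow> int \<times> int \<Rightarrow> (plane \<Rightarrow> real) \<Rightarrow> bool"
  where "multiplier_data \<tau> U1 U2 A l q k g \<longleftrightarrow>
    (\<exists>m e. normalized_frame U1 U2 l m e \<and>
      (\<forall>w. q w = cinner (e (w + \<tau>)) (A w *v e w)) \<and>
      continuous_on UNIV g \<and> (\<forall>w. g (w + e1) = g w) \<and> (\<forall>w. g (w + e2) = g w) \<and>
      (\<forall>w. q w / complex_of_real (norm (q w)) * cis (2 * pi * real_of_int m * fst \<tau> * snd w) =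
        cis (2 * pi * (real_of_int (fst k) * fst w + real_of_int (snd k) * snd w + g w))))"

definition winding_vector ::
    "plane \<Rightarrow> (plane \<Rightarrow> cmat) \<Rightarrow> (plane \<Rightarrow> cmat) \<Rightarrow> (plane \<Rightarrow> cmat) \<Rightarrow> (plane \<Rightarrow> cvec set)
      \<Rightarrow> int \<times> int"
  where "winding_vector \<tau> U1 U2 A l = (THE k. \<exists>q g. multiplier_data \<tau> U1 U2 A l q k g)"

definition torus_mean :: "(plane \<Rightarrow> real) \<Rightarrow> real"
  where "torus_mean h = (LINT w:fundamental_square|lebesgue. h w)"

definition lambda0 :: "(plane \<Rightarrow> complex) \<Rightarrow> (plane \<Rightarrow> real) \<Rightarrow> complex"
  where "lambda0 q g = exp (complex_of_real (torus_mean (\<lambda>w. ln (norm (q w)))) +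
    2 * complex_of_real pi * \<i> * complex_of_real (torus_mean g))"

definition eigenvalue_coset :: "plane \<Rightarrow> complex \<Rightarrow> complex set"
  where "eigenvalue_coset \<tau> \<rho> =
    {\<rho> * exp (- 2 * complex_of_real pi * \<i> *
        complex_of_real (real_of_int n1 * fst \<tau> + real_of_int n2 * snd \<tau>)) | n1 n2. True}"

definition carried_eigenvalues ::
    "plane \<Rightarrow> (plane \<Rightarrow> cmat) \<Rightarrow> (plane \<Rightarrow> cmat) \<Rightarrow> (plane \<Rightarrow> cmat) \<Rightarrow> (plane \<Rightarrow> cvec set)
      \<Rightarrow> complex set"
  where "carried_eigenvalues \<tau> U1 U2 A l =
    {\<rho>. \<exists>F. eigensection \<tau> U1 U2 A \<rho> F \<and> carried_by F l}"


definition closed_strip :: "real \<Rightarrow> (complex \<times> complex) set"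
  where "closed_strip \<delta> = {z. \<bar>Im (fst z)\<bar> \<le> \<delta> \<and> \<bar>Im (snd z)\<bar> \<le> \<delta>}"

definition holomorphic2_on :: "(complex \<times> complex \<Rightarrow> complex) \<Rightarrow> (complex \<times> complex) set \<Rightarrow> bool"
  where "holomorphic2_on f W \<longleftrightarrow>
    (\<forall>z\<in>W. \<exists>a b. (f has_derivative (\<lambda>h. a * fst h + b * snd h)) (at z))"

definition strip_extendable :: "real \<Rightarrow> (plane \<Rightarrow> cmat) \<Rightarrow> bool"
  where "strip_extendable \<delta> M \<longleftrightarrow>
    (\<exists>W G. open W \<and> closed_strip \<delta> \<subseteq> W \<and>
      (\<forall>i j. holomorphic2_on (\<lambda>z. G z $ i $ j) W) \<and>
      bounded (G ` closed_strip \<delta>) \<and>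
      (\<forall>w. G (complex_of_real (fst w), complex_of_real (snd w)) = M w))"

definition strip_admissible ::
    "plane \<Rightarrow> (plane \<Rightarrow> cmat) \<Rightarrow> (plane \<Rightarrow> cmat) \<Rightarrow> (plane \<Rightarrow> cmat) \<Rightarrow> bool"
  where "strip_admissible \<tau> U1 U2 A \<longleftrightarrow>
    sewing_system U1 U2 \<and> equivariant_cocycle \<tau> U1 U2 A \<and>
    (\<exists>\<delta>>0. strip_extendable \<delta> U1 \<and> strip_extendable \<delta> U2 \<and> strip_extendable \<delta> A)"


primrec cocycle_iterate :: "plane \<Rightarrow> (plane \<Rightarrow> cmat) \<Rightarrow> nat \<Rightarrow> plane \<Rightarrow> cmat"
  where
    "cocycle_iterate \<tau> A 0 w = mat 1"
  | "cocycle_iterate \<tau> A (Suc n) w = A (w + real n *\<^sub>R \<tau>) ** cocycle_iterate \<tau> A n w"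

definition restricted_norm :: "cmat \<Rightarrow> cvec set \<Rightarrow> real"
  where "restricted_norm M l = (SUP v\<in>{v\<in>l. norm v = 1}. norm (M *v v))"

definition restricted_conorm :: "cmat \<Rightarrow> cvec set \<Rightarrow> real"
  where "restricted_conorm M l = (INF v\<in>{v\<in>l. norm v = 1}. norm (M *v v))"

definition dominated_splitting ::
    "plane \<Rightarrow> (plane \<Rightarrow> cmat) \<Rightarrow> (plane \<Rightarrow> cmat) \<Rightarrow> (plane \<Rightarrow> cmat)
      \<Rightarrow> (plane \<Rightarrow> cvec set) \<Rightarrow> (plane \<Rightarrow> cvec set) \<Rightarrow> bool"
  where "dominated_splitting \<tau> U1 U2 A ls lu \<longleftrightarrow>
    invariant_line \<tau> U1 U2 A ls \<and> invariant_line \<tau> U1 U2 A lu \<and>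
    (\<forall>w. ls w \<noteq> lu w) \<and>
    (\<exists>N \<kappa>. 1 \<le> N \<and> 0 < \<kappa> \<and> \<kappa> < 1 \<and>
      (\<forall>z. restricted_norm (cocycle_iterate \<tau> A N z) (ls z) /
        restricted_conorm (cocycle_iterate \<tau> A N z) (lu z) \<le> \<kappa>\<^sup>2))"


definition dist_nearest_int :: "real \<Rightarrow> real"
  where "dist_nearest_int x = \<bar>x - of_int (round x)\<bar>"

definition diophantine :: "real \<Rightarrow> real \<Rightarrow> plane \<Rightarrow> bool"
  where "diophantine c \<nu> \<tau> \<longleftrightarrow>
    (\<forall>n1 n2 :: int. (n1, n2) \<noteq> (0, 0) \<longrightarrow>
      dist_nearest_int (real_of_int n1 * fst \<tau> + real_of_int n2 * snd \<tau>)
        \<ge> c * real_of_int (\<bar>n1\<bar> + \<bar>n2\<bar>) powr (- \<nu>))"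

end

theory Submission
  imports Defs "HOL-Complex_Analysis.Cauchy_Integral_Formula"
begin

text \<open>
  The lines of a dominated splitting are as regular as the cocycle. In the coordinates of the splitting
  a power of the cocycle acts on the directions near the dominating line as a contraction of a disc. The
  contraction survives when one coordinate of the base point is moved a little into the complex domain,
  so its fixed point, which is the line, depends holomorphically on this coordinate, on a disc whose
  radius does not depend on the base point (\<open>dominating_line_analytic\<close>, \<open>dominated_lines_analytic\<close>).
  Such a line has normalized frames with as many derivatives along the coordinate axes as one likes
  (\<open>smooth_unit_frame\<close>, \<open>smooth_normalized_frame\<close>). In such a frame the multiplier is \<open>exp G\<close> times the
  character of the winding vector \<open>k\<close> and a phase determined by the charge \<open>m\<close>, and the Fourier coefficients
  of \<open>G\<close> decay quickly enough to beat the small divisors of a Diophantine translation. Hence \<open>G\<close> is its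
  mean plus a coboundary (\<open>cohomological_equation\<close>), and rescaling the frame leaves a multiplier that
  consists of a constant \<open>\<mu> = exp (mean G)\<close>, the character and the phase (\<open>invariant_line_reduced\<close>). The
  charge, the winding vector and the coset of \<open>\<mu>\<close> do not depend on the frame (\<open>chern_unique\<close>,
  \<open>multiplier_compare\<close>), so these are the invariants of the line that occur in the theorem.

  An eigensection with eigenvalue \<open>\<rho>\<close> is a combination of the two reduced frames, and each coefficient
  \<open>a\<close> solves a scalar equation: \<open>a (w + \<tau>)\<close> is \<open>a w\<close> times \<open>\<mu> / \<rho>\<close>, the character and the phase. The
  translation preserves the measure of the torus, so a coefficient that is not almost everywhere zero
  forces \<open>cmod \<mu> = cmod \<rho>\<close> (\<open>modulus_rigidity\<close>). Domination makes the constants of the two lines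
  differ in modulus (\<open>dominated_modulus\<close>), so one of the coefficients vanishes and the eigensection is
  carried by a single line. For the other coefficient, the products of \<open>a (w + s)\<close> with the conjugate
  of \<open>a w\<close> are, up to a phase, eigenfunctions of the translation whose eigenvalue varies with \<open>s\<close> unless
  \<open>m = 0\<close> and \<open>k = 0\<close>; but the translation has only countably many eigenvalues, the values of the
  characters at \<open>\<tau>\<close> (\<open>rotation_eigenvalue\<close>, \<open>twisted_rigidity\<close>). So \<open>m\<close> and \<open>k\<close> vanish, \<open>a\<close> is
  itself an eigenfunction of the translation, and \<open>\<rho>\<close> lies in the coset of \<open>\<mu>\<close>. Conversely, when \<open>m\<close>
  and \<open>k\<close> vanish, the products of the reduced frame with the characters are eigensections for all
  elements of the coset (\<open>trivial_line_eigensection\<close>).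

  Constant diagonal cocycles on the trivial bundle show that the charge and the winding vector do not
  determine the coset (\<open>constant_examples\<close>). Translations satisfying a Diophantine condition exist:
  for \<open>(sqrt 2, sqrt 3)\<close> it is read off from the norm of the field generated by the two roots
  (\<open>diophantine_example\<close>).
\<close>

section \<open>Differentiability along a coordinate direction\<close>

text \<open>Mixed derivatives never enter: the decay of the Fourier coefficients needs only the pure derivatives
  along the two coordinate directions, and these are inherited from analyticity in one coordinate
  at a time.\<close>

primrec Ck_along :: "plane \<Rightarrow> nat \<Rightarrow> (plane \<Rightarrow> complex) \<Rightarrow> bool" where
  "Ck_along v 0 f = continuous_on UNIV f"
| "Ck_along v (Suc r) f = (continuous_on UNIV f \<and> (\<exists>g. Ck_along v r g \<and>
     (\<forall>w. ((\<lambda>t. f (w + t *\<^sub>R v)) has_vector_derivative g w) (at 0))))"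

lemma Ck_along_continuous: "Ck_along v r f \<Longrightarrow> continuous_on UNIV f"
  by (cases r) auto

lemma Ck_along_SucI:
  "\<lbrakk>continuous_on UNIV f; Ck_along v r g; \<And>w. ((\<lambda>t. f (w + t *\<^sub>R v)) has_vector_derivative g w) (at 0)\<rbrakk>
    \<Longrightarrow> Ck_along v (Suc r) f"
  by auto

declare Ck_along.simps(2) [simp del]

lemma Ck_along_SucE:
  assumes "Ck_along v (Suc r) f"
  obtains g where "continuous_on UNIV f" "Ck_along v r g"
    "\<And>w. ((\<lambda>t. f (w + t *\<^sub>R v)) has_vector_derivative g w) (at 0)"
  using assms by (auto simp: Ck_along.simps(2))

lemma Ck_along_SucD:
  assumes "Ck_along v (Suc r) f"
  shows "\<exists>g. Ck_along v r g \<and> (\<forall>w. ((\<lambda>t. f (w + t *\<^sub>R v)) has_vector_derivative g w) (at 0))"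
  using assms by (auto simp: Ck_along.simps(2))

lemma Ck_along_Suc_imp: "Ck_along v (Suc r) f \<Longrightarrow> Ck_along v r f"
proof (induction r arbitrary: f)
  case (Suc r)
  from Suc.prems obtain g where "continuous_on UNIV f" "Ck_along v (Suc r) g"
    "\<And>w. ((\<lambda>t. f (w + t *\<^sub>R v)) has_vector_derivative g w) (at 0)"
    by (rule Ck_along_SucE) blast
  with Suc.IH[of g] show ?case by (intro Ck_along_SucI[of _ _ _ g])
qed (auto elim: Ck_along_SucE)

lemma Ck_along_along_const:
  assumes "continuous_on UNIV f" "\<And>w t. f (w + t *\<^sub>R v) = f w"
  shows "Ck_along v r f"
proof (cases r)
  case (Suc r')
  have z: "Ck_along v r'' (\<lambda>w. 0)" for r''
  proof (induction r'')
    case (Suc r'')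
    then show ?case by (intro Ck_along_SucI[OF _ Suc]) auto
  qed auto
  show ?thesis unfolding Suc
    by (rule Ck_along_SucI[OF assms(1) z]) (simp add: assms(2))
qed (use assms in auto)

lemma Ck_along_const: "Ck_along v r (\<lambda>w. c)"
  by (rule Ck_along_along_const) auto

lemma Ck_along_add: "Ck_along v r f \<Longrightarrow> Ck_along v r g \<Longrightarrow> Ck_along v r (\<lambda>w. f w + g w)"
proof (induction r arbitrary: f g)
  case (Suc r)
  obtain f' g' where "Ck_along v r f'" "Ck_along v r g'"
    "\<forall>w. ((\<lambda>t. f (w + t *\<^sub>R v)) has_vector_derivative f' w) (at 0)"
    "\<forall>w. ((\<lambda>t. g (w + t *\<^sub>R v)) has_vector_derivative g' w) (at 0)"
    using Suc.prems[THEN Ck_along_SucD] by blast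
  then show ?case using Suc Ck_along_continuous
    by (intro Ck_along_SucI[of _ _ _ "\<lambda>w. f' w + g' w"] continuous_on_add has_vector_derivative_add) blast+
qed (auto intro: continuous_intros)

lemma Ck_along_mult: "Ck_along v r f \<Longrightarrow> Ck_along v r g \<Longrightarrow> Ck_along v r (\<lambda>w. f w * g w)"
proof (induction r arbitrary: f g)
  case (Suc r)
  obtain f' g' where d: "Ck_along v r f'" "Ck_along v r g'"
    "\<forall>w. ((\<lambda>t. f (w + t *\<^sub>R v)) has_vector_derivative f' w) (at 0)"
    "\<forall>w. ((\<lambda>t. g (w + t *\<^sub>R v)) has_vector_derivative g' w) (at 0)"
    using Suc.prems[THEN Ck_along_SucD] by blast
  have "Ck_along v r (\<lambda>w. f w * g' w + f' w * g w)"
    using Suc d Ck_along_Suc_imp by (intro Ck_along_add) blast+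
  moreover have "((\<lambda>t. f (w + t *\<^sub>R v) * g (w + t *\<^sub>R v)) has_vector_derivative
      f w * g' w + f' w * g w) (at 0)" for w
    using has_vector_derivative_mult[OF d(3)[rule_format, of w] d(4)[rule_format, of w]] by simp
  ultimately show ?case using Suc.prems Ck_along_continuous
    by (intro Ck_along_SucI[of _ _ _ "\<lambda>w. f w * g' w + f' w * g w"] continuous_on_mult) blast+
qed (auto intro: continuous_intros)

lemma Ck_along_minus: "Ck_along v r f \<Longrightarrow> Ck_along v r (\<lambda>w. - f w)"
  using Ck_along_mult[OF Ck_along_const[of v r "-1"]] by simp

lemma Ck_along_diff: "Ck_along v r f \<Longrightarrow> Ck_along v r g \<Longrightarrow> Ck_along v r (\<lambda>w. f w - g w)"
  using Ck_along_add[OF _ Ck_along_minus] by simp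

lemma Ck_along_sum: "(\<And>i. i \<in> I \<Longrightarrow> Ck_along v r (f i)) \<Longrightarrow> Ck_along v r (\<lambda>w. \<Sum>i\<in>I. f i w)"
  by (induction I rule: infinite_finite_induct) (auto intro: Ck_along_const Ck_along_add)

lemma Ck_along_cnj: "Ck_along v r f \<Longrightarrow> Ck_along v r (\<lambda>w. cnj (f w))"
proof (induction r arbitrary: f)
  case (Suc r)
  obtain f' where "Ck_along v r f'" "\<forall>w. ((\<lambda>t. f (w + t *\<^sub>R v)) has_vector_derivative f' w) (at 0)"
    using Suc.prems[THEN Ck_along_SucD] by blast
  then show ?case using Suc Ck_along_continuous
    by (intro Ck_along_SucI[of _ _ _ "\<lambda>w. cnj (f' w)"] continuous_on_cnj has_vector_derivative_cnj) blast+
qed (auto intro: continuous_intros)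

lemma Ck_along_translate: "Ck_along v r f \<Longrightarrow> Ck_along v r (\<lambda>w. f (w + a))"
proof (induction r arbitrary: f)
  case 0
  then show ?case by (auto intro!: continuous_on_compose2[of UNIV f] continuous_intros)
next
  case (Suc r)
  obtain f' where f': "Ck_along v r f'"
    "\<And>w. ((\<lambda>t. f (w + t *\<^sub>R v)) has_vector_derivative f' w) (at 0)" using Suc.prems(1)[THEN Ck_along_SucD] by blast
  have "((\<lambda>t. f (w + t *\<^sub>R v + a)) has_vector_derivative f' (w + a)) (at 0)" for w
    using f'(2)[of "w + a"] by (simp add: ac_simps)
  moreover have "continuous_on UNIV (\<lambda>w. f (w + a))"
    using Ck_along_continuous[OF Suc.prems] by (auto intro!: continuous_on_compose2[of UNIV f] continuous_intros)
  ultimately show ?case using Suc.IH[OF f'(1)] by (intro Ck_along_SucI)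
qed

lemma Ck_along_inverse:
  assumes "Ck_along v r f" "\<And>w. f w \<noteq> 0"
  shows "Ck_along v r (\<lambda>w. inverse (f w))"
  using assms
proof (induction r arbitrary: f)
  case (Suc r)
  obtain f' where f': "Ck_along v r f'"
    "\<And>w. ((\<lambda>t. f (w + t *\<^sub>R v)) has_vector_derivative f' w) (at 0)" using Suc.prems(1)[THEN Ck_along_SucD] by blast
  have "((\<lambda>t. inverse (f (w + t *\<^sub>R v))) has_vector_derivative - (f' w * inverse (f w) * inverse (f w))) (at 0)" for w
  proof -
    have "(inverse has_field_derivative - (inverse (f w) ^ Suc (Suc 0))) (at (f (w + 0 *\<^sub>R v)))"
      by (rule derivative_eq_intros refl | use Suc.prems(2) in \<open>simp add: power2_eq_square\<close>)+
    from field_vector_diff_chain_at[OF f'(2) this] show ?thesis by (simp add: o_def algebra_simps)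
  qed
  moreover have "Ck_along v r (\<lambda>w. - (f' w * inverse (f w) * inverse (f w)))"
    using Suc f' Ck_along_Suc_imp by (intro Ck_along_minus Ck_along_mult) blast+
  ultimately show ?case using Suc.prems Ck_along_continuous[OF Suc.prems(1)]
    by (intro Ck_along_SucI continuous_on_inverse) auto
qed (auto intro!: continuous_intros)

lemma Ck_along_exp: "Ck_along v r f \<Longrightarrow> Ck_along v r (\<lambda>w. exp (f w))"
proof (induction r arbitrary: f)
  case (Suc r)
  obtain f' where f': "Ck_along v r f'"
    "\<And>w. ((\<lambda>t. f (w + t *\<^sub>R v)) has_vector_derivative f' w) (at 0)" using Suc.prems(1)[THEN Ck_along_SucD] by blast
  have "((\<lambda>t. exp (f (w + t *\<^sub>R v))) has_vector_derivative (f' w * exp (f w))) (at 0)" for w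
    using field_vector_diff_chain_at[OF f'(2) DERIV_exp, of w] by (simp add: o_def)
  moreover have "Ck_along v r (\<lambda>w. f' w * exp (f w))"
    using Suc f' Ck_along_Suc_imp by (intro Ck_along_mult) blast+
  ultimately show ?case using Ck_along_continuous[OF Suc.prems(1)]
    by (intro Ck_along_SucI continuous_on_exp)
qed (auto intro!: continuous_intros)

text \<open>Near any point \<open>L\<close> is a constant plus the principal logarithm of a quotient of values of \<open>f\<close>,
  so the regularity of a nonvanishing function passes to each of its continuous logarithms.\<close>

lemma Ck_along_log:
  assumes "Ck_along v r f" "continuous_on UNIV L" "\<And>w. f w = exp (L w)"
  shows "Ck_along v r L"
  using assms
proof (induction r arbitrary: f)
  case (Suc r)
  obtain f' where f': "Ck_along v r f'"
    "\<And>w. ((\<lambda>t. f (w + t *\<^sub>R v)) has_vector_derivative f' w) (at 0)" using Suc.prems(1)[THEN Ck_along_SucD] by blast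
  have fnz: "f w \<noteq> 0" for w by (simp add: Suc.prems)
  have "((\<lambda>t. L (w + t *\<^sub>R v)) has_vector_derivative (f' w * inverse (f w))) (at 0)" for w
  proof -
    let ?d = "\<lambda>t. L w + Ln (f (w + t *\<^sub>R v) * inverse (f w))"
    have "((\<lambda>t. f (w + t *\<^sub>R v) * inverse (f w)) has_vector_derivative (f' w * inverse (f w))) (at 0)"
      using bounded_linear.has_vector_derivative[OF bounded_linear_mult_left f'(2)] by blast
    moreover have "(Ln has_field_derivative 1) (at (f (w + 0 *\<^sub>R v) * inverse (f w)))"
      using fnz has_field_derivative_Ln[of 1] by simp
    ultimately have "((\<lambda>t. Ln (f (w + t *\<^sub>R v) * inverse (f w))) has_vector_derivative (f' w * inverse (f w))) (at 0)"
      using field_vector_diff_chain_at by (fastforce simp: o_def)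
    then have *: "(?d has_vector_derivative (f' w * inverse (f w))) (at 0)"
      using has_vector_derivative_add[OF has_vector_derivative_const[of "L w"]] by fastforce
    have "isCont (\<lambda>t. L (w + t *\<^sub>R v)) 0"
      using Suc.prems(2) by (intro continuous_on_interior[of UNIV])
        (auto intro!: continuous_on_compose2[of UNIV L] continuous_intros)
    then have "((\<lambda>t. L (w + t *\<^sub>R v)) \<longlongrightarrow> L w) (at 0)"
      by (simp add: isCont_def)
    then have ev: "eventually (\<lambda>t. dist (L (w + t *\<^sub>R v)) (L w) < pi) (at 0)"
      by (rule tendstoD) simp
    have eq: "?d t = L (w + t *\<^sub>R v)" if "dist (L (w + t *\<^sub>R v)) (L w) < pi" for t
    proof -
      have "\<bar>Im (L (w + t *\<^sub>R v) - L w)\<bar> < pi"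
        using that abs_Im_le_cmod[of "L (w + t *\<^sub>R v) - L w"] by (simp add: dist_norm)
      then have "Ln (exp (L (w + t *\<^sub>R v) - L w)) = L (w + t *\<^sub>R v) - L w"
        by (intro Ln_exp) auto
      then show ?thesis by (simp add: Suc.prems exp_diff divide_inverse)
    qed
    have "eventually (\<lambda>t. ?d t = L (w + t *\<^sub>R v)) (nhds 0)"
      using eventually_mono[OF ev eq] fnz by (simp add: eventually_nhds_conv_at)
    then obtain T where T: "open T" "0 \<in> T" "\<And>t. t \<in> T \<Longrightarrow> ?d t = L (w + t *\<^sub>R v)"
      unfolding eventually_nhds by blast
    show ?thesis
      by (rule has_vector_derivative_transform_within_open[OF * T])
  qed
  moreover have "Ck_along v r (\<lambda>w. f' w * inverse (f w))"
    using Suc f' Ck_along_Suc_imp fnz by (intro Ck_along_mult Ck_along_inverse) blast+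
  ultimately show ?case using Suc.prems(2)
    by (intro Ck_along_SucI)
qed auto

text \<open>This serves for limits of sequences that become stationary near each point.\<close>

lemma Ck_along_local:
  assumes "\<And>w0. \<exists>S f'. open S \<and> w0 \<in> S \<and> Ck_along v r f' \<and> (\<forall>w\<in>S. f w = f' w)"
  shows "Ck_along v r f"
  using assms
proof (induction r arbitrary: f)
  case 0
  show ?case unfolding Ck_along.simps continuous_on_eq_continuous_at[OF open_UNIV]
  proof
    fix w0 :: plane
    obtain S f' where S: "open S" "w0 \<in> S" "Ck_along v 0 f'" "\<forall>w\<in>S. f w = f' w" using 0 by blast
    then show "isCont f w0"
      by (metis Ck_along.simps(1) continuous_on_cong continuous_on_eq_continuous_at continuous_on_subset subset_UNIV)
  qed
next
  case (Suc r)
  define g where "g w = vector_derivative (\<lambda>t. f (w + t *\<^sub>R v)) (at 0)" for w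
  have loc: "\<exists>S f'. open S \<and> w0 \<in> S \<and> Ck_along v r f' \<and> (\<forall>w\<in>S. g w = f' w \<and> 
     ((\<lambda>t. f (w + t *\<^sub>R v)) has_vector_derivative g w) (at 0))" for w0
  proof -
    obtain S f' where S: "open S" "w0 \<in> S" "Ck_along v (Suc r) f'" "\<forall>w\<in>S. f w = f' w" using Suc.prems by blast
    then obtain g' where g': "Ck_along v r g'"
      "\<And>w. ((\<lambda>t. f' (w + t *\<^sub>R v)) has_vector_derivative g' w) (at 0)" using Ck_along_SucD by blast
    have "((\<lambda>t. f (w + t *\<^sub>R v)) has_vector_derivative g' w) (at 0)" if "w \<in> S" for w
    proof -
      have "isCont (\<lambda>t. w + t *\<^sub>R v) 0" by (intro continuous_intros)
      then have "((\<lambda>t. w + t *\<^sub>R v) \<longlongrightarrow> w) (nhds 0)"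
        by (simp add: isCont_def filterlim_at tendsto_nhds_iff)
      then have "eventually (\<lambda>t. w + t *\<^sub>R v \<in> S) (nhds 0)"
        using S(1) that topological_tendstoD by blast
      then obtain T where T: "open T" "0 \<in> T" "\<And>t. t \<in> T \<Longrightarrow> w + t *\<^sub>R v \<in> S"
        unfolding eventually_nhds by blast
      show ?thesis
        by (rule has_vector_derivative_transform_within_open[OF g'(2) T(1,2)]) (use S(4) T(3) in auto)
    qed
    then have "\<forall>w\<in>S. g w = g' w \<and> ((\<lambda>t. f (w + t *\<^sub>R v)) has_vector_derivative g w) (at 0)"
      unfolding g_def by (metis vector_derivative_at)
    then show ?thesis using S g' by blast
  qed
  have "Ck_along v r g"
  proof (rule Suc.IH)
    fix w0
    obtain S f' where "open S" "w0 \<in> S" "Ck_along v r f'" "\<forall>w\<in>S. g w = f' w"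
      using loc[of w0] by metis
    then show "\<exists>S f'. open S \<and> w0 \<in> S \<and> Ck_along v r f' \<and> (\<forall>w\<in>S. g w = f' w)"
      by (intro exI conjI)
  qed
  moreover have "continuous_on UNIV f"
  proof -
    have "\<exists>S f'. open S \<and> w0 \<in> S \<and> continuous_on UNIV f' \<and> (\<forall>w\<in>S. f w = f' w)" for w0
      using Suc.prems[of w0] Ck_along_continuous by blast
    then show ?thesis unfolding continuous_on_eq_continuous_at[OF open_UNIV]
      by (metis UNIV_I continuous_on_cong continuous_on_eq_continuous_at continuous_on_subset subset_UNIV)
  qed
  moreover have "((\<lambda>t. f (w + t *\<^sub>R v)) has_vector_derivative g w) (at 0)" for w
    using loc[of w] by metis
  ultimately show ?case by (intro Ck_along_SucI[of _ _ _ g])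
qed

lemma Ck_along_real_obtain:
  fixes p :: "real \<Rightarrow> real"
  assumes "Ck_along v (Suc r) (\<lambda>w. of_real (p (w \<bullet> v)))" "v \<bullet> v = 1"
  obtains p' where "Ck_along v r (\<lambda>w. of_real (p' (w \<bullet> v)))"
    "\<And>x. (p has_real_derivative p' x) (at x)"
proof -
  obtain g where g: "Ck_along v r g"
    "\<And>w. ((\<lambda>t. complex_of_real (p ((w + t *\<^sub>R v) \<bullet> v))) has_vector_derivative g w) (at 0)"
    using assms(1)[THEN Ck_along_SucD] by blast
  have d: "((\<lambda>t. complex_of_real (p (w \<bullet> v + t))) has_vector_derivative g w) (at 0)" for w
    using g(2)[of w] assms(2) by (simp add: inner_add_left)
  define p' where "p' x = Re (g (x *\<^sub>R v))" for x
  have d2: "((\<lambda>t. p (w \<bullet> v + t)) has_real_derivative Re (g w)) (at 0)" for w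
    using bounded_linear.has_vector_derivative[OF bounded_linear_Re d[of w]]
    by (simp add: has_real_derivative_iff_has_vector_derivative)
  have d3: "(p has_real_derivative p' x) (at x)" for x
    using d2[of "x *\<^sub>R v"] assms(2) unfolding p'_def
    by (simp add: DERIV_at_within_shift[of p _ x 0 UNIV, simplified] add.commute)
  have "g w = of_real (p' (w \<bullet> v))" for w
  proof -
    have "((\<lambda>t. complex_of_real (p (w \<bullet> v + t))) has_vector_derivative of_real (Re (g w))) (at 0)"
      using bounded_linear.has_vector_derivative[OF bounded_linear_of_real, of "\<lambda>t. p (w \<bullet> v + t)"]
       d2[of w] by (simp add: has_real_derivative_iff_has_vector_derivative)
    then have "g w = of_real (Re (g w))" using d vector_derivative_unique_at by blast
    moreover have "Re (g w) = p' (w \<bullet> v)"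
    proof -
      have "(p has_real_derivative Re (g w)) (at (w \<bullet> v))"
        using d2[of w] by (simp add: DERIV_at_within_shift[of p _ "w \<bullet> v" 0 UNIV, simplified] add.commute)
      with d3 show ?thesis using DERIV_unique by blast
    qed
    ultimately show ?thesis by simp
  qed
  then have "g = (\<lambda>w. of_real (p' (w \<bullet> v)))" by blast
  with g(1) have "Ck_along v r (\<lambda>w. of_real (p' (w \<bullet> v)))" by simp
  with d3 show thesis using that by blast
qed

text \<open>Reparametrization by \<open>\<gamma>\<close> is harmless when \<open>\<gamma>\<close> moves points lying on a line of direction \<open>v\<close>
  along a line of the same direction: the chain rule then uses only derivatives along \<open>v\<close>.\<close>

lemma Ck_along_reparam:
  assumes "Ck_along v r f" "Ck_along v r (\<lambda>w. of_real (p (w \<bullet> v)))" "v \<bullet> v = 1"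
    "continuous_on UNIV \<gamma>" "\<And>w t. \<gamma> (w + t *\<^sub>R v) = \<gamma> w + (p (w \<bullet> v + t) - p (w \<bullet> v)) *\<^sub>R v"
  shows "Ck_along v r (\<lambda>w. f (\<gamma> w))"
  using assms(1,2)
proof (induction r arbitrary: f)
  case 0
  then show ?case using assms(4) by (auto intro!: continuous_on_compose2[of UNIV f])
next
  case (Suc r)
  obtain f' where f': "Ck_along v r f'"
    "\<And>w. ((\<lambda>t. f (w + t *\<^sub>R v)) has_vector_derivative f' w) (at 0)" using Suc.prems[THEN Ck_along_SucD] by blast
  obtain p' where p': "Ck_along v r (\<lambda>w. of_real (p' (w \<bullet> v)))"
    "\<And>x. (p has_real_derivative p' x) (at x)"
    using Ck_along_real_obtain[OF Suc.prems(2) assms(3)] by blast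
  have "((\<lambda>t. f (\<gamma> (w + t *\<^sub>R v))) has_vector_derivative (of_real (p' (w \<bullet> v)) * f' (\<gamma> w))) (at 0)" for w
  proof -
    have 1: "((\<lambda>t. p (w \<bullet> v + t) - p (w \<bullet> v)) has_vector_derivative p' (w \<bullet> v)) (at 0)"
      using p'(2)[of "w \<bullet> v"]
      unfolding has_real_derivative_iff_has_vector_derivative[symmetric]
      by (auto intro!: derivative_eq_intros simp: DERIV_at_within_shift[of p _ "w \<bullet> v" 0 UNIV, simplified] add.commute)
    have 2: "((\<lambda>t. f (\<gamma> w + t *\<^sub>R v)) has_vector_derivative f' (\<gamma> w)) (at (p (w \<bullet> v + 0) - p (w \<bullet> v)))"
      using f'(2) by simp
    from vector_diff_chain_at[OF 1 2] show ?thesis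
      by (simp add: o_def assms(5) scaleR_conv_of_real)
  qed
  moreover have "Ck_along v r (\<lambda>w. of_real (p' (w \<bullet> v)) * f' (\<gamma> w))"
    by (rule Ck_along_mult[OF p'(1) Suc.IH[OF f'(1) Ck_along_Suc_imp[OF Suc.prems(2)]]])
  moreover have "continuous_on UNIV (\<lambda>w. f (\<gamma> w))"
    using continuous_on_compose2[OF Ck_along_continuous[OF Suc.prems(1)] assms(4)] by simp
  ultimately show ?case by (intro Ck_along_SucI)
qed

text \<open>Plateau functions of finite smoothness suffice, so powers replace the usual \<open>exp (- 1 / x)\<close>.\<close>

definition truncated_power :: "nat \<Rightarrow> real \<Rightarrow> real" where
  "truncated_power r x = (if x \<le> 0 then 0 else x ^ Suc r)"

lemma truncated_power_cont: "continuous_on UNIV (truncated_power r)"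
proof -
  have "truncated_power r = (\<lambda>x. (max 0 x) ^ Suc r)" by (auto simp: truncated_power_def max_def)
  then show ?thesis by (auto intro!: continuous_intros)
qed

lemma truncated_power_deriv: "(truncated_power (Suc r) has_real_derivative (real r + 2) * truncated_power r x) (at x)"
proof -
  consider "x < 0" | "x > 0" | "x = 0" by linarith
  then show ?thesis
  proof cases
    case 1
    have "((\<lambda>x. 0) has_real_derivative 0) (at x)" by simp
    then have "(truncated_power (Suc r) has_real_derivative 0) (at x)"
      by (rule has_field_derivative_transform_within_open[of _ _ _ "{..<0}"]) (use 1 in \<open>auto simp: truncated_power_def\<close>)
    with 1 show ?thesis by (simp add: truncated_power_def)
  next
    case 2
    have "((\<lambda>x. x ^ Suc (Suc r)) has_real_derivative (real r + 2) * truncated_power r x) (at x)"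
      by (rule derivative_eq_intros refl | use 2 in \<open>simp add: truncated_power_def algebra_simps\<close>)+
    then show ?thesis
      by (rule has_field_derivative_transform_within_open[of _ _ _ "{0<..}"]) (use 2 in \<open>auto simp: truncated_power_def\<close>)
  next
    case 3
    have "((\<lambda>y. (truncated_power (Suc r) y - truncated_power (Suc r) 0) / (y - 0)) \<longlongrightarrow> 0) (at 0)"
    proof (rule tendsto_sandwich[of "\<lambda>y. 0" _ _ "\<lambda>y. truncated_power r y"])
      show "(truncated_power r \<longlongrightarrow> 0) (at 0)"
        using truncated_power_cont[of r] unfolding continuous_on_eq_continuous_at[OF open_UNIV] isCont_def
        by (metis UNIV_I truncated_power_def order.refl)
    qed (auto intro!: always_eventually simp: truncated_power_def field_simps)
    then show ?thesis using 3
      by (auto simp: has_field_derivative_iff truncated_power_def)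
  qed
qed

lemma truncated_power_Ck_along: "v \<bullet> v = 1 \<Longrightarrow> Ck_along v r (\<lambda>w. of_real (truncated_power r (w \<bullet> v)))"
proof (induction r)
  case 0
  then show ?case by (auto intro!: continuous_intros continuous_on_compose2[OF truncated_power_cont])
next
  case (Suc r)
  have "((\<lambda>t. complex_of_real (truncated_power (Suc r) ((w + t *\<^sub>R v) \<bullet> v))) has_vector_derivative
      of_real (real r + 2) * of_real (truncated_power r (w \<bullet> v))) (at 0)" for w
  proof -
    have "((\<lambda>t. truncated_power (Suc r) (w \<bullet> v + t)) has_real_derivative (real r + 2) * truncated_power r (w \<bullet> v)) (at 0)"
      using truncated_power_deriv[of r "w \<bullet> v"]
      by (simp add: DERIV_at_within_shift[of "truncated_power (Suc r)" _ "w \<bullet> v" 0 UNIV, simplified] add.commute)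
    then have "((\<lambda>t. complex_of_real (truncated_power (Suc r) (w \<bullet> v + t))) has_vector_derivative
        of_real ((real r + 2) * truncated_power r (w \<bullet> v))) (at 0)"
      by (intro bounded_linear.has_vector_derivative[OF bounded_linear_of_real])
         (simp add: has_real_derivative_iff_has_vector_derivative)
    then show ?thesis using Suc.prems by (simp add: inner_add_left)
  qed
  moreover have "Ck_along v r (\<lambda>w. of_real (real r + 2) * of_real (truncated_power r (w \<bullet> v)))"
    using Suc by (intro Ck_along_mult Ck_along_const) auto
  moreover have "continuous_on UNIV (\<lambda>w. complex_of_real (truncated_power (Suc r) (w \<bullet> v)))"
    by (intro continuous_intros continuous_on_compose2[OF truncated_power_cont]) auto
  ultimately show ?case
    by (intro Ck_along_SucI)
qed

definition cutoff :: "nat \<Rightarrow> real \<Rightarrow> real" where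
  "cutoff r x = truncated_power r x / (truncated_power r x + truncated_power r (1 - x))"

lemma cutoff_denominator: "truncated_power r x + truncated_power r (1 - x) > 0"
proof (cases "x \<le> 0")
  case False
  then have "truncated_power r x > 0" by (simp add: truncated_power_def)
  moreover have "truncated_power r (1 - x) \<ge> 0" by (simp add: truncated_power_def)
  ultimately show ?thesis by simp
qed (auto simp: truncated_power_def)

lemma cutoff_0: "x \<le> 0 \<Longrightarrow> cutoff r x = 0"
  and cutoff_1: "x \<ge> 1 \<Longrightarrow> cutoff r x = 1"
  and cutoff_range: "0 \<le> cutoff r x" "cutoff r x \<le> 1"
  using cutoff_denominator[of r x] by (auto simp: cutoff_def truncated_power_def divide_simps)

lemma truncated_power_affine_Ck_along:
  assumes "v \<bullet> v = 1"
  shows "Ck_along v r (\<lambda>w. of_real (truncated_power r (c * (w \<bullet> v) + d)))"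
proof -
  have "Ck_along v r (\<lambda>w. complex_of_real (c * (w \<bullet> v)))"
  proof -
    have "Ck_along v r' (\<lambda>w. complex_of_real (c * (w \<bullet> v)))" for r'
    proof (cases r')
      case (Suc r'')
      have "((\<lambda>t. complex_of_real (c * ((w + t *\<^sub>R v) \<bullet> v))) has_vector_derivative complex_of_real c) (at 0)" for w
        using assms by (auto intro!: derivative_eq_intros simp: inner_add_left distrib_left)
      then show ?thesis using Suc by (auto simp del: Ck_along.simps of_real_mult intro!: Ck_along_SucI[OF _ Ck_along_const] continuous_intros)
    qed (auto intro!: continuous_intros)
    then show ?thesis .
  qed
  then have "Ck_along v r (\<lambda>w. of_real (truncated_power r (((c * (w \<bullet> v) + d) *\<^sub>R v) \<bullet> v)))"
    by (intro Ck_along_reparam[OF truncated_power_Ck_along[OF assms], where p = "\<lambda>x. c * x"] assms)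
       (auto intro!: continuous_intros simp: inner_add_left assms algebra_simps)
  then show ?thesis by (simp add: assms)
qed

lemma cutoff_Ck_along:
  assumes "v \<bullet> v = 1"
  shows "Ck_along v r (\<lambda>w. of_real (cutoff r (c * (w \<bullet> v) + d)))"
proof -
  let ?D = "\<lambda>w. complex_of_real (truncated_power r (c * (w \<bullet> v) + d)) + complex_of_real (truncated_power r (-c * (w \<bullet> v) + (1 - d)))"
  have 0: "?D w \<noteq> 0" for w
  proof -
    have "truncated_power r (c * (w \<bullet> v) + d) + truncated_power r (-c * (w \<bullet> v) + (1 - d)) > 0"
      using cutoff_denominator[of r "c * (w \<bullet> v) + d"] by (simp add: algebra_simps)
    then show ?thesis by (metis of_real_add of_real_eq_0_iff less_irrefl)
  qed
  have "Ck_along v r (\<lambda>w. complex_of_real (truncated_power r (c * (w \<bullet> v) + d)) * inverse (?D w))"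
    by (intro Ck_along_mult truncated_power_affine_Ck_along Ck_along_inverse Ck_along_add assms 0)
  then show ?thesis by (simp add: cutoff_def divide_inverse algebra_simps)
qed

section \<open>Functions that are uniformly analytic along a direction\<close>

text \<open>The constants \<open>\<delta>\<close> and \<open>K\<close> are explicit because they have to be kept uniform over the base
  points of a family of such functions.\<close>

definition bdd_hol :: "real \<Rightarrow> real \<Rightarrow> (complex \<Rightarrow> complex) \<Rightarrow> bool" where
  "bdd_hol \<delta> K F \<longleftrightarrow> F holomorphic_on ball 0 \<delta> \<and> (\<forall>t\<in>ball 0 \<delta>. norm (F t) \<le> K)"

text \<open>Analyticity in the direction \<open>v\<close>, with a radius and a bound that do not depend on the base
  point. Holomorphic extensions are asked for in one real variable at a time, which keeps every
  argument within functions of one complex variable.\<close>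

definition analytic_along :: "plane \<Rightarrow> (plane \<Rightarrow> complex) \<Rightarrow> bool" where
  "analytic_along v f \<longleftrightarrow> (\<exists>\<delta>>0. \<exists>K. \<forall>w. \<exists>F. bdd_hol \<delta> K F \<and> (\<forall>t::real. \<bar>t\<bar> < \<delta> \<longrightarrow> F (of_real t) = f (w + t *\<^sub>R v)))"

lemma bdd_holD: "bdd_hol \<delta> K F \<Longrightarrow> norm t < \<delta> \<Longrightarrow> norm (F t) \<le> K"
  by (auto simp: bdd_hol_def)

lemma bdd_hol_mono: "bdd_hol \<delta> K F \<Longrightarrow> \<delta>' \<le> \<delta> \<Longrightarrow> K \<le> K' \<Longrightarrow> bdd_hol \<delta>' K' F"
  unfolding bdd_hol_def
  by (meson holomorphic_on_subset order_trans subsetD subset_ball)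

lemma bdd_hol_const: "norm c \<le> K \<Longrightarrow> bdd_hol \<delta> K (\<lambda>t. c)"
  by (auto simp: bdd_hol_def)

lemma bdd_hol_add: "bdd_hol \<delta> K F \<Longrightarrow> bdd_hol \<delta> K' G \<Longrightarrow> bdd_hol \<delta> (K + K') (\<lambda>t. F t + G t)"
  unfolding bdd_hol_def by (auto intro!: holomorphic_intros norm_triangle_mono)

lemma bdd_hol_mult: "bdd_hol \<delta> K F \<Longrightarrow> bdd_hol \<delta> K' G \<Longrightarrow> 0 < \<delta> \<Longrightarrow> bdd_hol \<delta> (K * K') (\<lambda>t. F t * G t)"
proof -
  assume a: "bdd_hol \<delta> K F" "bdd_hol \<delta> K' G" "0 < \<delta>"
  have "0 \<le> K" using bdd_holD[OF a(1), of 0] a(3) norm_ge_zero[of "F 0"] by (simp del: norm_ge_zero)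
  then show ?thesis using a
  unfolding bdd_hol_def by (auto intro!: holomorphic_intros mult_mono simp: norm_mult)
qed

text \<open>Conjugation of functions on the real line becomes, after extension, reflection at the real
  axis. This keeps expressions such as \<open>x $ i * cnj (x $ j)\<close> analytic.\<close>

lemma bdd_hol_cnj: "bdd_hol \<delta> K F \<Longrightarrow> bdd_hol \<delta> K (\<lambda>t. cnj (F (cnj t)))"
proof -
  assume a: "bdd_hol \<delta> K F"
  have "cnj ` ball 0 \<delta> = ball 0 \<delta>"
    by (auto simp: image_iff intro!: bexI[of _ "cnj _"])
  then have "(cnj \<circ> F \<circ> cnj) holomorphic_on ball 0 \<delta>"
    using a holomorphic_on_compose_cnj_cnj[of F "ball 0 \<delta>"] by (simp add: bdd_hol_def)
  then show ?thesis using a by (auto simp: bdd_hol_def o_def)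
qed

text \<open>Cauchy's estimate on half of the disc.\<close>

lemma bdd_hol_deriv:
  assumes "bdd_hol \<delta> K F" "\<delta> > 0"
  shows "bdd_hol (\<delta> / 2) (2 * K / \<delta>) (deriv F)"
  unfolding bdd_hol_def
proof safe
  have hol: "F holomorphic_on ball 0 \<delta>" using assms by (simp add: bdd_hol_def)
  have "deriv F holomorphic_on ball 0 \<delta>" using hol by (intro holomorphic_deriv) auto
  then show "deriv F holomorphic_on ball 0 (\<delta> / 2)"
    by (rule holomorphic_on_subset) (use assms in auto)
  fix t :: complex assume t: "t \<in> ball 0 (\<delta> / 2)"
  have sub: "cball t (\<delta> / 2) \<subseteq> ball 0 \<delta>"
  proof
    fix x assume "x \<in> cball t (\<delta> / 2)"
    then show "x \<in> ball 0 \<delta>" using t norm_triangle_sub[of x t]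
      by (auto simp: dist_norm norm_minus_commute)
  qed
  have "norm ((deriv ^^ 1) F t) \<le> fact 1 * K / (\<delta>/2) ^ 1"
  proof (rule Cauchy_inequality)
    show "F holomorphic_on ball t (\<delta> / 2)"
      using hol sub by (meson ball_subset_cball holomorphic_on_subset order_trans)
    show "continuous_on (cball t (\<delta> / 2)) F"
      using hol sub by (meson holomorphic_on_imp_continuous_on continuous_on_subset)
    show "norm (F x) \<le> K" if "norm (t - x) = \<delta> / 2" for x
    proof -
      have "x \<in> cball t (\<delta>/2)" using that by (simp add: dist_norm)
      then show ?thesis using sub assms by (auto simp: bdd_hol_def)
    qed
  qed (use assms in auto)
  then show "norm (deriv F t) \<le> 2 * K / \<delta>" by (simp add: field_simps)
qed

lemma bdd_hol_lipschitz:
  assumes "bdd_hol \<delta> K F" "\<delta> > 0" "norm s < \<delta> / 2" "norm t < \<delta> / 2"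
  shows "norm (F s - F t) \<le> 2 * K / \<delta> * norm (s - t)"
proof (rule field_differentiable_bound[of "ball 0 (\<delta> / 2)" F "deriv F"])
  fix z :: complex assume z: "z \<in> ball 0 (\<delta> / 2)"
  have "F holomorphic_on ball 0 \<delta>" using assms by (simp add: bdd_hol_def)
  then have "(F has_field_derivative deriv F z) (at z)"
    using z assms by (intro holomorphic_derivI[of _ "ball 0 \<delta>"]) auto
  then show "(F has_field_derivative deriv F z) (at z within ball 0 (\<delta> / 2))"
    by (rule has_field_derivative_at_within)
  show "norm (deriv F z) \<le> 2 * K / \<delta>"
    using bdd_hol_deriv[OF assms(1,2)] z by (auto simp: bdd_hol_def)
qed (use assms in auto)

text \<open>A Lipschitz bound keeps \<open>F\<close> away from zero on a disc whose size depends only on the bounds.\<close>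

lemma bdd_hol_inverse:
  assumes "bdd_hol \<delta> K F" "\<delta> > 0" "norm (F 0) \<ge> d" "d > 0"
  shows "bdd_hol (min (\<delta>/2) (d * \<delta> / (4 * K))) (2 / d) (\<lambda>t. inverse (F t))" (is "bdd_hol ?r _ _")
    and "K > 0"
proof -
  show K: "K > 0" using bdd_holD[OF assms(1), of 0] assms by simp
  have lb: "norm (F t) \<ge> d / 2" if "norm t < ?r" for t
  proof -
    have "norm (F t - F 0) \<le> 2 * K / \<delta> * norm (t - 0)"
      using that assms by (intro bdd_hol_lipschitz) auto
    also have "\<dots> \<le> 2 * K / \<delta> * (d * \<delta> / (4 * K))"
      using that assms K by (intro mult_left_mono) auto
    also have "\<dots> = d / 2" using K assms by (simp add: field_simps)
    finally show ?thesis using assms(3) norm_triangle_ineq3[of "F t" "F 0"] by (simp add: norm_minus_commute)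
  qed
  have "F holomorphic_on ball 0 ?r" using assms by (auto simp: bdd_hol_def elim: holomorphic_on_subset)
  moreover have "F t \<noteq> 0" if "norm t < ?r" for t using lb[OF that] assms by auto
  moreover have "norm (inverse (F t)) \<le> 2 / d" if "norm t < ?r" for t
  proof -
    have "inverse (norm (F t)) \<le> inverse (d / 2)"
      using lb[OF that] assms by (intro le_imp_inverse_le) auto
    then show ?thesis by (simp add: norm_inverse)
  qed
  ultimately show "bdd_hol ?r (2 / d) (\<lambda>t. inverse (F t))"
    unfolding bdd_hol_def by (auto intro!: holomorphic_on_inverse)
qed

lemma analytic_alongI:
  assumes "\<delta> > 0" "\<And>w. bdd_hol \<delta> K (F w)" "\<And>w t. \<bar>t\<bar> < \<delta> \<Longrightarrow> F w (of_real t) = f (w + t *\<^sub>R v)"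
  shows "analytic_along v f"
proof -
  have "\<forall>w. \<exists>F. bdd_hol \<delta> K F \<and> (\<forall>t::real. \<bar>t\<bar> < \<delta> \<longrightarrow> F (of_real t) = f (w + t *\<^sub>R v))"
    using assms(2,3) by blast
  then show ?thesis unfolding analytic_along_def using assms(1) by blast
qed

lemma analytic_alongE:
  assumes "analytic_along v f"
  obtains \<delta> K F where "\<delta> > 0" "K > 0" "\<And>w. bdd_hol \<delta> K (F w)" "\<And>w t. \<bar>t\<bar> < \<delta> \<Longrightarrow> F w (of_real t) = f (w + t *\<^sub>R v)"
proof -
  obtain \<delta> K where d: "\<delta> > 0" "\<forall>w. \<exists>F. bdd_hol \<delta> K F \<and> (\<forall>t::real. \<bar>t\<bar> < \<delta> \<longrightarrow> F (of_real t) = f (w + t *\<^sub>R v))"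
    using assms unfolding analytic_along_def by blast
  then obtain F where F: "\<And>w. bdd_hol \<delta> K (F w) \<and> (\<forall>t::real. \<bar>t\<bar> < \<delta> \<longrightarrow> F w (of_real t) = f (w + t *\<^sub>R v))"
    by metis
  show thesis
  proof (rule that[of \<delta> "max K 1" F])
    show "bdd_hol \<delta> (max K 1) (F w)" for w using F[of w] by (auto intro: bdd_hol_mono)
  qed (use d(1) F in simp_all)
qed

lemma analytic_along_const: "analytic_along v (\<lambda>w. c)"
  by (rule analytic_alongI[of 1 "norm c" "\<lambda>w t. c"]) (auto intro: bdd_hol_const)

lemma analytic_along_translate: "analytic_along v f \<Longrightarrow> analytic_along v (\<lambda>w. f (w + a))"
proof -
  assume "analytic_along v f"
  then obtain \<delta> K F where "\<delta> > 0" "K > 0" "\<And>w. bdd_hol \<delta> K (F w)" "\<And>w t. \<bar>t\<bar> < \<delta> \<Longrightarrow> F w (of_real t) = f (w + t *\<^sub>R v)"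
    by (rule analytic_alongE) blast
  then show ?thesis by (intro analytic_alongI[of \<delta> K "\<lambda>w. F (w + a)"]) (auto simp: ac_simps)
qed

lemma analytic_alongE2:
  assumes "analytic_along v f" "analytic_along v g"
  obtains \<delta> K F G where "\<delta> > 0" "K > 0" "\<And>w. bdd_hol \<delta> K (F w)" "\<And>w t. \<bar>t\<bar> < \<delta> \<Longrightarrow> F w (of_real t) = f (w + t *\<^sub>R v)"
    "\<And>w. bdd_hol \<delta> K (G w)" "\<And>w t. \<bar>t\<bar> < \<delta> \<Longrightarrow> G w (of_real t) = g (w + t *\<^sub>R v)"
proof -
  obtain \<delta>1 K1 F where 1: "\<delta>1 > 0" "K1 > 0" "\<And>w. bdd_hol \<delta>1 K1 (F w)" "\<And>w t. \<bar>t\<bar> < \<delta>1 \<Longrightarrow> F w (of_real t) = f (w + t *\<^sub>R v)"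
    using analytic_alongE[OF assms(1)] by blast
  obtain \<delta>2 K2 G where 2: "\<delta>2 > 0" "K2 > 0" "\<And>w. bdd_hol \<delta>2 K2 (G w)" "\<And>w t. \<bar>t\<bar> < \<delta>2 \<Longrightarrow> G w (of_real t) = g (w + t *\<^sub>R v)"
    using analytic_alongE[OF assms(2)] by blast
  show thesis
  proof (rule that[of "min \<delta>1 \<delta>2" "max K1 K2" F G])
    show "bdd_hol (min \<delta>1 \<delta>2) (max K1 K2) (F w)" for w by (rule bdd_hol_mono[OF 1(3)]) auto
    show "bdd_hol (min \<delta>1 \<delta>2) (max K1 K2) (G w)" for w by (rule bdd_hol_mono[OF 2(3)]) auto
  qed (use 1 2 in simp_all)
qed

lemma analytic_along_add: assumes "analytic_along v f" "analytic_along v g" shows "analytic_along v (\<lambda>w. f w + g w)"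
proof -
  obtain \<delta> K F G where "\<delta> > 0" "K > 0" "\<And>w. bdd_hol \<delta> K (F w)" "\<And>w t. \<bar>t\<bar> < \<delta> \<Longrightarrow> F w (of_real t) = f (w + t *\<^sub>R v)"
    "\<And>w. bdd_hol \<delta> K (G w)" "\<And>w t. \<bar>t\<bar> < \<delta> \<Longrightarrow> G w (of_real t) = g (w + t *\<^sub>R v)"
    using analytic_alongE2[OF assms] by blast
  then show ?thesis by (intro analytic_alongI[of \<delta> "K + K" "\<lambda>w t. F w t + G w t"] bdd_hol_add) auto
qed

lemma analytic_along_mult: assumes "analytic_along v f" "analytic_along v g" shows "analytic_along v (\<lambda>w. f w * g w)"
proof -
  obtain \<delta> K F G where "\<delta> > 0" "K > 0" "\<And>w. bdd_hol \<delta> K (F w)" "\<And>w t. \<bar>t\<bar> < \<delta> \<Longrightarrow> F w (of_real t) = f (w + t *\<^sub>R v)"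
    "\<And>w. bdd_hol \<delta> K (G w)" "\<And>w t. \<bar>t\<bar> < \<delta> \<Longrightarrow> G w (of_real t) = g (w + t *\<^sub>R v)"
    using analytic_alongE2[OF assms] by blast
  then show ?thesis by (intro analytic_alongI[of \<delta> "K * K" "\<lambda>w t. F w t * G w t"] bdd_hol_mult) auto
qed

lemma analytic_along_minus: "analytic_along v f \<Longrightarrow> analytic_along v (\<lambda>w. - f w)"
  using analytic_along_mult[OF analytic_along_const[of v "-1"]] by simp

lemma analytic_along_diff: "analytic_along v f \<Longrightarrow> analytic_along v g \<Longrightarrow> analytic_along v (\<lambda>w. f w - g w)"
  using analytic_along_add[OF _ analytic_along_minus] by simp

lemma analytic_along_inverse:
  assumes "analytic_along v f" "\<And>w. norm (f w) \<ge> d" "d > 0"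
  shows "analytic_along v (\<lambda>w. inverse (f w))"
proof -
  obtain \<delta> K F where F: "\<delta> > 0" "K > 0" "\<And>w. bdd_hol \<delta> K (F w)" "\<And>w t. \<bar>t\<bar> < \<delta> \<Longrightarrow> F w (of_real t) = f (w + t *\<^sub>R v)"
    using analytic_alongE[OF assms(1)] by blast
  have "norm (F w 0) \<ge> d" for w using F(4)[of 0 w] F(1) assms(2) by simp
  then have "bdd_hol (min (\<delta>/2) (d * \<delta> / (4 * K))) (2 / d) (\<lambda>t. inverse (F w t))" for w
    using bdd_hol_inverse F assms by blast
  then show ?thesis using F assms
    by (intro analytic_alongI[of "min (\<delta>/2) (d * \<delta> / (4 * K))" "2 / d" "\<lambda>w t. inverse (F w t)"]) auto
qed

lemma analytic_along_small:
  assumes "analytic_along v f" "e > 0"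
  obtains \<eta> where "\<eta> > 0" "\<And>w t. \<bar>t\<bar> \<le> \<eta> \<Longrightarrow> norm (f (w + t *\<^sub>R v) - f w) \<le> e"
proof -
  obtain \<delta> K F where F: "\<delta> > 0" "K > 0" "\<And>w. bdd_hol \<delta> K (F w)" "\<And>w t. \<bar>t\<bar> < \<delta> \<Longrightarrow> F w (of_real t) = f (w + t *\<^sub>R v)"
    using analytic_alongE[OF assms(1)] by blast
  show thesis
  proof (rule that[of "min (\<delta> / 4) (e * \<delta> / (2 * K))"])
    fix w and t :: real assume t: "\<bar>t\<bar> \<le> min (\<delta> / 4) (e * \<delta> / (2 * K))"
    have "norm (F w (of_real t) - F w (of_real 0)) \<le> 2 * K / \<delta> * norm (complex_of_real t - of_real 0)"
      by (rule bdd_hol_lipschitz[OF F(3)]) (use F t in auto)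
    also have "\<dots> \<le> 2 * K / \<delta> * (e * \<delta> / (2 * K))"
      using F t by (intro mult_left_mono) auto
    also have "\<dots> = e" using F by simp
    finally show "norm (f (w + t *\<^sub>R v) - f w) \<le> e"
      using F(1) F(4)[of t w] F(4)[of 0 w] t by simp
  qed (use F assms in auto)
qed

text \<open>Continuity of the derivative in the base point does not follow from analyticity along the lines
  of direction \<open>v\<close> alone; it comes from the Lipschitz estimate for the difference quotients, which
  makes them converge uniformly to the derivative.\<close>

lemma analytic_along_derivative:
  assumes "analytic_along v f" "continuous_on UNIV f"
  obtains g where "analytic_along v g" "continuous_on UNIV g"
    "\<And>w. ((\<lambda>t. f (w + t *\<^sub>R v)) has_vector_derivative g w) (at 0)"
proof -
  obtain \<delta> K F where F: "\<delta> > 0" "K > 0" "\<And>w. bdd_hol \<delta> K (F w)" "\<And>w t. \<bar>t\<bar> < \<delta> \<Longrightarrow> F w (of_real t) = f (w + t *\<^sub>R v)"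
    using analytic_alongE[OF assms(1)] by blast
  define g where "g w = deriv (F w) 0" for w
  have fd: "(F w has_field_derivative deriv (F w) z) (at z)" if "norm z < \<delta>" for w z
    using F(3)[of w] that unfolding bdd_hol_def by (intro holomorphic_derivI[of _ "ball 0 \<delta>"]) auto
  have d: "((\<lambda>s. f (w + s *\<^sub>R v)) has_vector_derivative deriv (F w) (of_real t)) (at t)" if "\<bar>t\<bar> < \<delta>" for w t
  proof -
    have "((\<lambda>s. F w (of_real s)) has_vector_derivative deriv (F w) (of_real t)) (at t)"
      using fd that by (intro has_vector_derivative_real_field) auto
    then show ?thesis
      by (rule has_vector_derivative_transform_within_open[of _ _ _ "{-\<delta><..<\<delta>}"])
         (use that F(4) in \<open>simp_all add: abs_less_iff\<close>)
  qed
  have g: "((\<lambda>t. f (w + t *\<^sub>R v)) has_vector_derivative g w) (at 0)" for w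
    using d[of 0 w] F(1) by (simp add: g_def)
  have g2: "deriv (F w) (of_real t) = g (w + t *\<^sub>R v)" if "\<bar>t\<bar> < \<delta>" for w t
  proof -
    have "((\<lambda>s. f (w + (t + s) *\<^sub>R v)) has_vector_derivative deriv (F w) (of_real t)) (at 0)"
    proof -
      have "((\<lambda>s. t + s) has_vector_derivative 1) (at 0)"
        by (auto intro!: derivative_eq_intros simp: has_real_derivative_iff_has_vector_derivative[symmetric])
      from vector_diff_chain_at[OF this, of "\<lambda>s. f (w + s *\<^sub>R v)"] d[OF that, of w] show ?thesis
        by (simp add: o_def)
    qed
    moreover have "((\<lambda>s. f (w + (t + s) *\<^sub>R v)) has_vector_derivative g (w + t *\<^sub>R v)) (at 0)"
      using g[of "w + t *\<^sub>R v"] by (simp add: algebra_simps)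
    ultimately show ?thesis by (rule vector_derivative_unique_at)
  qed
  have hbd: "bdd_hol (\<delta>/2) (2 * K / \<delta>) (deriv (F w))" for w using bdd_hol_deriv F by blast
  have UAg: "analytic_along v g"
    by (rule analytic_alongI[of "\<delta>/2" "2 * K / \<delta>" "\<lambda>w. deriv (F w)"]) (use F hbd g2 in auto)
  define C where "C = 2 * (2 * K / \<delta>) / (\<delta> / 2)"
  have C: "C > 0" unfolding C_def by (intro divide_pos_pos mult_pos_pos F(1,2)) (use F(1) in simp_all)
  have est: "norm ((f (w + h *\<^sub>R v) - f w) / complex_of_real h - g w) \<le> C * h" if h: "0 < h" "h < \<delta> / 4" for w and h :: real
  proof -
    let ?G = "\<lambda>z. F w z - g w * z"
    have "norm (?G (of_real h) - ?G 0) \<le> C * h * norm (complex_of_real h - 0)"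
    proof (rule field_differentiable_bound[of "cball 0 h" ?G "\<lambda>z. deriv (F w) z - g w"])
      fix z :: complex assume z: "z \<in> cball 0 h"
      show "(?G has_field_derivative deriv (F w) z - g w) (at z within cball 0 h)"
        using z h by (intro has_field_derivative_at_within[OF DERIV_diff[OF fd DERIV_cmult_Id]]) simp
      have "norm (deriv (F w) z - deriv (F w) 0) \<le> C * norm (z - 0)"
        unfolding C_def by (rule bdd_hol_lipschitz[OF hbd]) (use z h F(1) in simp_all)
      also have "\<dots> \<le> C * h" using z C by (intro mult_left_mono) auto
      finally show "norm (deriv (F w) z - g w) \<le> C * h" by (simp add: g_def)
    qed (use h in auto)
    moreover have "F w 0 = f w" "F w (of_real h) = f (w + h *\<^sub>R v)"
      using F(4)[of 0 w] F(4)[of h w] h F(1) by auto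
    ultimately have "norm (f (w + h *\<^sub>R v) - f w - g w * of_real h) \<le> C * h * h"
      using h(1) by (simp add: diff_diff_eq add.commute)
    moreover have "(f (w + h *\<^sub>R v) - f w) / of_real h - g w = (f (w + h *\<^sub>R v) - f w - g w * of_real h) / of_real h"
      using h(1) by (simp add: diff_divide_distrib)
    ultimately show ?thesis using h by (simp add: norm_divide divide_le_eq)
  qed
  define h where "h n = (\<delta> / 8) * inverse (real (Suc n))" for n
  have h: "0 < h n" "h n < \<delta> / 4" for n
  proof -
    have "inverse (real (Suc n)) \<le> 1" by (simp add: inverse_le_1_iff)
    then have "h n \<le> \<delta> / 8 * 1" unfolding h_def using F(1) by (intro mult_left_mono) auto
    then show "h n < \<delta> / 4" using F(1) by simp
    show "0 < h n" using F(1) by (simp add: h_def)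
  qed
  have hlim: "h \<longlonglongrightarrow> 0"
    unfolding h_def using tendsto_mult[OF tendsto_const LIMSEQ_inverse_real_of_nat] by simp
  have "uniform_limit UNIV (\<lambda>n w. (f (w + h n *\<^sub>R v) - f w) / of_real (h n)) g sequentially"
  proof (rule uniform_limitI)
    fix e :: real assume "e > 0"
    then have "eventually (\<lambda>n. h n < e / C) sequentially"
      using order_tendstoD(2)[OF hlim, of "e / C"] C by simp
    then show "\<forall>\<^sub>F n in sequentially. \<forall>w\<in>UNIV. dist ((f (w + h n *\<^sub>R v) - f w) / of_real (h n)) (g w) < e"
    proof eventually_elim
      case (elim n)
      have "norm ((f (w + h n *\<^sub>R v) - f w) / of_real (h n) - g w) < e" for w
        using est[of "h n" w] h[of n] elim C by (simp add: field_simps)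
      then show ?case by (simp add: dist_norm)
    qed
  qed
  moreover have "continuous_on UNIV (\<lambda>w. (f (w + h n *\<^sub>R v) - f w) / of_real (h n))" for n
  proof -
    have "continuous_on UNIV (\<lambda>w. f (w + h n *\<^sub>R v))"
      by (rule continuous_on_compose2[OF assms(2)]) (auto intro!: continuous_intros)
    moreover have "complex_of_real (h n) \<noteq> 0" using h[of n] by simp
    ultimately show ?thesis using assms(2) by (intro continuous_intros) auto
  qed
  ultimately have "continuous_on UNIV g"
    by (intro uniform_limit_theorem[of _ "\<lambda>n w. (f (w + h n *\<^sub>R v) - f w) / of_real (h n)" sequentially]) auto
  with UAg g show thesis using that by blast
qed

lemma analytic_along_imp_Ck_along:
  assumes "analytic_along v f" "continuous_on UNIV f"
  shows "Ck_along v r f"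
  using assms
proof (induction r arbitrary: f)
  case (Suc r)
  obtain g where "analytic_along v g" "continuous_on UNIV g"
    "\<And>w. ((\<lambda>t. f (w + t *\<^sub>R v)) has_vector_derivative g w) (at 0)"
    using analytic_along_derivative[OF Suc.prems] by blast
  then show ?case using Suc by (intro Ck_along_SucI)
qed auto

lemma strip_extendable_analytic_along:
  assumes "strip_extendable \<delta> M" "\<delta> > 0" "v = e1 \<or> v = e2"
  shows "analytic_along v (\<lambda>w. M w $ i $ j)"
proof -
  obtain W G where W: "open W" "closed_strip \<delta> \<subseteq> W" "\<And>i j. holomorphic2_on (\<lambda>z. G z $ i $ j) W"
    "bounded (G ` closed_strip \<delta>)" "\<And>w. G (complex_of_real (fst w), complex_of_real (snd w)) = M w"
    using assms(1) unfolding strip_extendable_def by blast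
  obtain K where K: "\<And>z. z \<in> closed_strip \<delta> \<Longrightarrow> norm (G z) \<le> K"
    using W(4) by (auto simp: bounded_iff)
  define pt where "pt w t = (complex_of_real (fst w) + t * of_real (fst v), complex_of_real (snd w) + t * of_real (snd v))"
    for w :: plane and t :: complex
  have inS: "pt w t \<in> closed_strip \<delta>" if "norm t < \<delta>" for w t
    using that abs_Im_le_cmod[of t] assms(3) by (auto simp: pt_def closed_strip_def)
  show ?thesis
  proof (rule analytic_alongI[of \<delta> K "\<lambda>w t. G (pt w t) $ i $ j"])
    fix w
    have "((\<lambda>t. G (pt w t) $ i $ j) has_field_derivative a * of_real (fst v) + b * of_real (snd v)) (at t)"
      if t: "((\<lambda>z. G z $ i $ j) has_derivative (\<lambda>h. a * fst h + b * snd h)) (at (pt w t))" for a b t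
    proof -
      have "(pt w has_derivative (\<lambda>h. (h * of_real (fst v), h * of_real (snd v)))) (at t)"
        unfolding pt_def by (auto intro!: derivative_eq_intros)
      from has_derivative_compose[OF this t]
      have "((\<lambda>t. G (pt w t) $ i $ j) has_derivative
          (\<lambda>h. a * (h * of_real (fst v)) + b * (h * of_real (snd v)))) (at t)" by simp
      moreover have "(\<lambda>h. a * (h * of_real (fst v)) + b * (h * of_real (snd v)))
          = (*) (a * of_real (fst v) + b * complex_of_real (snd v))"
        by (auto simp: algebra_simps)
      ultimately show ?thesis by (simp add: has_field_derivative_def)
    qed
    note der = this
    have "\<exists>f'. ((\<lambda>t. G (pt w t) $ i $ j) has_field_derivative f') (at t)" if "norm t < \<delta>" for t
    proof -
      have "pt w t \<in> W" using inS[OF that, of w] W(2) by blast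
      then obtain a b where "((\<lambda>z. G z $ i $ j) has_derivative (\<lambda>h. a * fst h + b * snd h)) (at (pt w t))"
        using W(3)[of i j] unfolding holomorphic2_on_def by blast
      from der[OF this] show ?thesis by blast
    qed
    then have "(\<lambda>t. G (pt w t) $ i $ j) holomorphic_on ball 0 \<delta>"
      by (subst holomorphic_on_open) simp_all
    moreover have "norm (G (pt w t) $ i $ j) \<le> K" if "norm t < \<delta>" for t
      using K[OF inS[OF that, of w]] Finite_Cartesian_Product.norm_nth_le[of "G (pt w t) $ i" j]
        Finite_Cartesian_Product.norm_nth_le[of "G (pt w t)" i] by linarith
    ultimately show "bdd_hol \<delta> K (\<lambda>t. G (pt w t) $ i $ j)" by (auto simp: bdd_hol_def)
  next
    fix w t assume "\<bar>t\<bar> < \<delta>"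
    show "G (pt w (of_real t)) $ i $ j = M (w + t *\<^sub>R v) $ i $ j"
      using W(5)[of "w + t *\<^sub>R v"] by (simp add: pt_def)
  qed (use assms in auto)
qed

section \<open>Dominated lines are uniformly analytic\<close>

text \<open>It measures the transversality of two lines, and a matrix \<open>M\<close> multiplies it by \<open>det M\<close>.\<close>

definition wedge :: "cvec \<Rightarrow> cvec \<Rightarrow> complex" where
  "wedge x y = x $ 1 * y $ 2 - x $ 2 * y $ 1"

lemma norm_cvec: "(norm (x::cvec))\<^sup>2 = (cmod (x $ 1))\<^sup>2 + (cmod (x $ 2))\<^sup>2"
  by (simp add: norm_vec_def L2_set_def sum_2)

lemma component_le_norm: "cmod ((x::cvec) $ i) \<le> norm x"
  by (rule Finite_Cartesian_Product.norm_nth_le)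

lemma wedge_bound: "cmod (wedge x y) \<le> 2 * norm x * norm y"
proof -
  have "cmod (wedge x y) \<le> cmod (x $ 1) * cmod (y $ 2) + cmod (x $ 2) * cmod (y $ 1)"
    unfolding wedge_def by (metis norm_mult norm_triangle_ineq4)
  also have "\<dots> \<le> norm x * norm y + norm x * norm y"
    by (intro add_mono mult_mono component_le_norm) auto
  finally show ?thesis by simp
qed

lemma wedge_add_left: "wedge (x + x') y = wedge x y + wedge x' y"
  and wedge_smult_left: "wedge (c *s x) y = c * wedge x y"
  and wedge_smult_right: "wedge y (c *s x) = c * wedge y x"
  and wedge_self: "wedge x x = 0"
  and wedge_swap: "wedge x y = - wedge y x"
  by (simp_all add: wedge_def algebra_simps)

lemma matrix_vector_mult_2: "((M::cmat) *v x) $ i = M $ i $ 1 * x $ 1 + M $ i $ 2 * x $ 2"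
  by (simp add: matrix_vector_mult_def sum_2)

lemma wedge_matrix: "wedge (M *v x) (M *v y) = det (M::cmat) * wedge x y"
  by (simp add: wedge_def matrix_vector_mult_2 det_2 algebra_simps)

lemma wedge_decompose: "wedge a b *s z = wedge z b *s a + wedge a z *s b"
  by (simp add: vec_eq_iff forall_2 wedge_def algebra_simps)

lemma wedge_zero_parallel:
  assumes "wedge y x = 0" "y \<noteq> 0"
  obtains c where "x = c *s y"
proof (cases "y $ 1 = 0")
  case True
  then have "y $ 2 \<noteq> 0" using assms(2) by (auto simp: vec_eq_iff forall_2)
  then have "x = (x $ 2 / y $ 2) *s y"
    using assms(1) True by (auto simp: vec_eq_iff forall_2 wedge_def)
  then show ?thesis using that by blast
next
  case False
  then have "x = (x $ 1 / y $ 1) *s y"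
    using assms(1) by (auto simp: vec_eq_iff forall_2 wedge_def field_simps)
  then show ?thesis using that by blast
qed

lemma norm_smult: "norm (c *s (x::cvec)) = cmod c * norm x"
proof -
  have "(norm (c *s x))\<^sup>2 = (cmod c * norm x)\<^sup>2"
    by (simp add: norm_cvec power_mult_distrib norm_mult distrib_left)
  then show ?thesis by (simp add: power2_eq_iff_nonneg)
qed

lemma norm_sq_complex: "complex_of_real ((norm (x::cvec))\<^sup>2) = x $ 1 * cnj (x $ 1) + x $ 2 * cnj (x $ 2)"
  unfolding norm_cvec of_real_add by (simp add: complex_norm_square[symmetric])

text \<open>The orthogonal projection onto a line can be computed from any vector on it. The right side
  depends on \<open>y\<close> through \<open>y\<close> and \<open>cnj y\<close> only, so it extends holomorphically when \<open>y\<close> does.\<close>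

lemma projection_parallel:
  assumes "wedge y x = 0" "y \<noteq> 0" "norm x = 1"
  shows "x $ i * cnj (x $ j) = y $ i * cnj (y $ j) * inverse (y $ 1 * cnj (y $ 1) + y $ 2 * cnj (y $ 2))"
proof -
  obtain c where c: "x = c *s y" using wedge_zero_parallel[OF assms(1,2)] by blast
  have "cmod c * norm y = 1" using assms(3) c by (simp add: norm_smult)
  then have "(cmod c)\<^sup>2 * (norm y)\<^sup>2 = 1" by (metis power_mult_distrib power_one)
  then have 1: "c * cnj c * complex_of_real ((norm y)\<^sup>2) = 1"
    by (metis complex_norm_square of_real_1 of_real_mult)
  then have "inverse (complex_of_real ((norm y)\<^sup>2)) = c * cnj c"
    by (metis inverse_unique mult.commute)
  then show ?thesis unfolding norm_sq_complex[symmetric] using c by simp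
qed

lemma bdd_hol_wedge:
  fixes M :: "complex \<Rightarrow> cmat"
  assumes "\<And>i j. bdd_hol \<delta> K (\<lambda>t. M t $ i $ j)" "norm x \<le> 1" "norm y \<le> 1" "\<delta> > 0"
  shows "bdd_hol \<delta> (4 * K) (\<lambda>t. wedge (M t *v x) y)"
proof -
  have K: "0 \<le> K" using bdd_holD[OF assms(1)[of 1 1], of 0] assms(4) by (metis norm_ge_zero norm_zero order_trans)
  have e: "bdd_hol \<delta> K (\<lambda>t. M t $ i $ j * (c * x $ k * y $ l))" if "cmod c = 1" for i j k l c
  proof -
    have "cmod (x $ k) * cmod (y $ l) \<le> 1 * 1"
      using component_le_norm[of x k] component_le_norm[of y l] assms(2,3) by (intro mult_mono) auto
    then have "bdd_hol \<delta> 1 (\<lambda>t. c * x $ k * y $ l)"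
      by (intro bdd_hol_const) (simp add: norm_mult that)
    from bdd_hol_mult[OF assms(1) this assms(4)] show ?thesis by simp
  qed
  have "bdd_hol \<delta> ((K + K) + (K + K)) (\<lambda>t. (M t $ 1 $ 1 * (1 * x $ 1 * y $ 2) + M t $ 1 $ 2 * (1 * x $ 2 * y $ 2))
     + (M t $ 2 $ 1 * ((-1) * x $ 1 * y $ 1) + M t $ 2 $ 2 * ((-1) * x $ 2 * y $ 1)))"
    by (intro bdd_hol_add e) auto
  moreover have "(\<lambda>t. (M t $ 1 $ 1 * (1 * x $ 1 * y $ 2) + M t $ 1 $ 2 * (1 * x $ 2 * y $ 2))
     + (M t $ 2 $ 1 * ((-1) * x $ 1 * y $ 1) + M t $ 2 $ 2 * ((-1) * x $ 2 * y $ 1)))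
     = (\<lambda>t. wedge (M t *v x) y)"
    by (simp add: wedge_def matrix_vector_mult_2 algebra_simps)
  ultimately show ?thesis by simp
qed

text \<open>The graph transform of a matrix \<open>(c11, c12; c21, c22)\<close> that is close to \<open>diag (1, z)\<close> with
  \<open>cmod z \<le> \<kappa>\<close> is a strict contraction of the closed unit disc of slopes, where the
  slope \<open>s\<close> stands for the direction \<open>(1, s)\<close>. The value of \<open>\<eta>\<close> leaves
  room for both the invariance of the disc and the bound \<open>q < 1\<close>.\<close>

lemma cone_contraction:
  fixes c11 c12 c21 c22 s s' :: complex
  assumes "0 \<le> \<kappa>" "\<kappa> < 1" "\<eta> = (1 - \<kappa>) / 16"
    and c: "cmod (c11 - 1) \<le> \<eta>" "cmod c12 \<le> \<eta>" "cmod c21 \<le> \<eta>" "cmod c22 \<le> \<kappa> + \<eta>"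
    and q: "q = ((1 + \<eta>) * (\<kappa> + \<eta>) + \<eta> * \<eta>) / (1 - 2 * \<eta>)\<^sup>2"
    and s: "cmod s \<le> 1" "cmod s' \<le> 1"
  shows "c11 + c12 * s \<noteq> 0" "cmod ((c21 + c22 * s) / (c11 + c12 * s)) \<le> 1"
    "cmod ((c21 + c22 * s) / (c11 + c12 * s) - (c21 + c22 * s') / (c11 + c12 * s')) \<le> q * cmod (s - s')"
    "0 \<le> q" "q < 1"
proof -
  have \<eta>: "0 < \<eta>" "\<kappa> = 1 - 16 * \<eta>" "\<eta> \<le> 1/16" using assms by auto
  have den: "cmod (c11 + c12 * z) \<ge> 1 - 2 * \<eta>" if "cmod z \<le> 1" for z
  proof -
    have "cmod (c12 * z) \<le> \<eta> * 1" unfolding norm_mult using c that \<eta> by (intro mult_mono) auto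
    moreover have "cmod c11 \<ge> 1 - \<eta>" using c(1) norm_triangle_ineq3[of c11 1] by simp
    ultimately show ?thesis using norm_diff_ineq[of c11 "c12 * z"] by linarith
  qed
  have pos: "1 - 2 * \<eta> > 0" using \<eta> by simp
  show nz: "c11 + c12 * s \<noteq> 0" using den[OF s(1)] pos by auto
  have nz': "c11 + c12 * s' \<noteq> 0" using den[OF s(2)] pos by auto
  have "cmod (c22 * s) \<le> (\<kappa> + \<eta>) * 1" unfolding norm_mult using c s \<eta> assms(1) by (intro mult_mono) auto
  then have "cmod (c21 + c22 * s) \<le> \<eta> + (\<kappa> + \<eta>)" using c(3) norm_triangle_ineq[of c21 "c22 * s"] by simp
  also have "\<dots> \<le> 1 - 2 * \<eta>" using \<eta> by linarith
  also have "\<dots> \<le> cmod (c11 + c12 * s)" by (rule den[OF s(1)])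
  finally show "cmod ((c21 + c22 * s) / (c11 + c12 * s)) \<le> 1"
    using nz by (simp add: norm_divide divide_le_eq)
  have "cmod (c11 * c22 - c12 * c21) \<le> (1 + \<eta>) * (\<kappa> + \<eta>) + \<eta> * \<eta>"
  proof -
    have "cmod c11 \<le> 1 + \<eta>" using c(1) norm_triangle_sub[of c11 1] by simp
    then have "cmod (c11 * c22) \<le> (1 + \<eta>) * (\<kappa> + \<eta>)" unfolding norm_mult using c \<eta> by (intro mult_mono) auto
    moreover have "cmod (c12 * c21) \<le> \<eta> * \<eta>" unfolding norm_mult using c \<eta> by (intro mult_mono) auto
    ultimately show ?thesis using norm_triangle_ineq4[of "c11 * c22" "c12 * c21"] by linarith
  qed
  moreover have "(1 - 2 * \<eta>)\<^sup>2 \<le> cmod (c11 + c12 * s) * cmod (c11 + c12 * s')"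
    unfolding power2_eq_square using den s pos by (intro mult_mono) auto
  moreover have "(1 - 2 * \<eta>)\<^sup>2 > 0" using pos by simp
  moreover have "0 \<le> (1 + \<eta>) * (\<kappa> + \<eta>) + \<eta> * \<eta>"
    using \<eta>(1) assms(1) by (intro add_nonneg_nonneg mult_nonneg_nonneg) auto
  ultimately have "cmod (c11 * c22 - c12 * c21) / (cmod (c11 + c12 * s) * cmod (c11 + c12 * s')) \<le> q"
    unfolding q by (intro frac_le)
  then have "cmod (c11 * c22 - c12 * c21) / (cmod (c11 + c12 * s) * cmod (c11 + c12 * s')) * cmod (s - s') \<le> q * cmod (s - s')"
    by (rule mult_right_mono) auto
  moreover have "(c21 + c22 * s) / (c11 + c12 * s) - (c21 + c22 * s') / (c11 + c12 * s')
     = (c11 * c22 - c12 * c21) * (s - s') / ((c11 + c12 * s) * (c11 + c12 * s'))"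
    using nz nz' by (simp add: divide_simps) (simp add: algebra_simps)
  ultimately show "cmod ((c21 + c22 * s) / (c11 + c12 * s) - (c21 + c22 * s') / (c11 + c12 * s')) \<le> q * cmod (s - s')"
    by (simp add: norm_mult norm_divide)
  show "0 \<le> q" unfolding q using \<eta> assms(1) pos by (intro divide_nonneg_nonneg add_nonneg_nonneg mult_nonneg_nonneg) auto
  have "(1 + \<eta>) * (\<kappa> + \<eta>) + \<eta> * \<eta> = 1 - 14 * \<eta> - 14 * \<eta> * \<eta>"
    unfolding \<eta>(2) by (simp add: algebra_simps)
  moreover have "(1 - 2 * \<eta>)\<^sup>2 = 1 - 4 * \<eta> + 4 * \<eta> * \<eta>" by (simp add: power2_eq_square algebra_simps)
  moreover have "\<eta> * \<eta> \<ge> 0" by simp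
  ultimately have "(1 + \<eta>) * (\<kappa> + \<eta>) + \<eta> * \<eta> < (1 - 2 * \<eta>)\<^sup>2" using \<eta>(1) by linarith
  then show "q < 1" unfolding q using pos by simp
qed

lemma analytic_along_matrix_obtain:
  assumes "\<And>i j. analytic_along v (\<lambda>w. B w $ i $ j)"
  obtains \<delta> K and M :: "plane \<Rightarrow> complex \<Rightarrow> cmat" where "\<delta> > 0" "K > 0"
    "\<And>w i j. bdd_hol \<delta> K (\<lambda>t. M w t $ i $ j)" "\<And>w t. \<bar>t\<bar> < \<delta> \<Longrightarrow> M w (of_real t) = B (w + t *\<^sub>R v)"
proof -
  have "\<forall>i j. \<exists>\<delta> K F. \<delta> > 0 \<and> K > 0 \<and> (\<forall>w. bdd_hol \<delta> K (F w)) \<and> (\<forall>w t. \<bar>t\<bar> < \<delta> \<longrightarrow> F w (of_real t) = B (w + t *\<^sub>R v) $ i $ j)"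
    using analytic_alongE[OF assms] by metis
  then obtain \<delta> K F where F: "\<And>i j. \<delta> i j > 0" "\<And>i j. K i j > 0" "\<And>i j w. bdd_hol (\<delta> i j) (K i j) (F i j w)"
     "\<And>i j w t. \<bar>t\<bar> < \<delta> i j \<Longrightarrow> F i j w (of_real t) = B (w + t *\<^sub>R v) $ i $ j" by metis
  define \<delta>' where "\<delta>' = min (min (\<delta> 1 1) (\<delta> 1 2)) (min (\<delta> 2 1) (\<delta> 2 2))"
  define K' where "K' = max (max (K 1 1) (K 1 2)) (max (K 2 1) (K 2 2))"
  have le: "\<delta>' \<le> \<delta> i j" "K i j \<le> K'" for i j
    using exhaust_2[of i] exhaust_2[of j] by (auto simp: \<delta>'_def K'_def)
  show thesis
  proof (rule that[of \<delta>' K' "\<lambda>w t. \<chi> i j. F i j w t"])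
    show "\<delta>' > 0" using F(1) by (simp add: \<delta>'_def)
    show "K' > 0" using F(2)[of 1 1] le(2)[of 1 1] by simp
    show "bdd_hol \<delta>' K' (\<lambda>t. (\<chi> i j. F i j w t) $ i $ j)" for w i j
      using bdd_hol_mono[OF F(3) le] by simp
    fix w and t :: real assume "\<bar>t\<bar> < \<delta>'"
    then have "\<bar>t\<bar> < \<delta> i j" for i j using le(1)[of i j] by simp
    then show "(\<chi> i j. F i j w (complex_of_real t)) = B (w + t *\<^sub>R v)"
      by (simp add: vec_eq_iff F(4))
  qed
qed

text \<open>The line of \<open>a\<close> is expanded more strongly than that of \<open>b\<close> in a single step; in the application
  \<open>B\<close> is an iterate of the cocycle or its inverse. The unit vectors are arbitrary choices and need not
  vary continuously.\<close>

locale dominated_pair =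
  fixes v \<sigma> :: plane and B :: "plane \<Rightarrow> cmat" and a b :: "plane \<Rightarrow> cvec" and \<alpha> \<beta> :: "plane \<Rightarrow> complex"
    and d c0 \<kappa> :: real
  assumes UAB: "\<And>i j. analytic_along v (\<lambda>w. B w $ i $ j)"
    and det: "\<And>w. det (B w) \<noteq> 0"
    and unit: "\<And>w. norm (a w) = 1" "\<And>w. norm (b w) = 1"
    and wd: "\<And>w. d \<le> cmod (wedge (a w) (b w))" "d > 0"
    and Ba: "\<And>w. B w *v a w = \<alpha> w *s a (w + \<sigma>)"
    and Bb: "\<And>w. B w *v b w = \<beta> w *s b (w + \<sigma>)"
    and al: "\<And>w. c0 \<le> cmod (\<alpha> w)" "c0 > 0"
    and dom: "\<And>w. cmod (\<beta> w) \<le> \<kappa> * cmod (\<alpha> w)" "0 \<le> \<kappa>" "\<kappa> < 1"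
begin

text \<open>In the frame \<open>a\<close>, \<open>b\<close> the matrix \<open>B\<close> is, up to a scalar, diagonal with entries \<open>1\<close> and at most
  \<open>\<kappa>\<close>. Moving the coordinate along \<open>v\<close> to a small complex value perturbs this matrix by at most
  \<open>\<eta>\<close>, uniformly in the base point, while the frame is kept fixed. So the graph transforms remain
  contractions of the disc of slopes, and pushing the slope \<open>0\<close> forward along the past orbit gives
  functions holomorphic in the complexified coordinate that converge uniformly to a slope \<open>G w\<close>. For real
  values of the coordinate the limit is the line spanned by \<open>a\<close>: pushed forward \<open>n\<close> times, a
  direction that stays away from \<open>b\<close> approaches \<open>a\<close> at the rate \<open>\<kappa> ^ n\<close>. The conclusion is phrased for the
  projection onto the line since \<open>a\<close> itself is an arbitrary choice of unit vectors.\<close>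

lemma dominating_line_analytic: "analytic_along v (\<lambda>w. a w $ i * cnj (a w $ j))"
proof -
  obtain \<delta> K M where M: "\<delta> > 0" "K > 0" "\<And>w i j. bdd_hol \<delta> K (\<lambda>t. M w t $ i $ j)"
    "\<And>w t. \<bar>t\<bar> < \<delta> \<Longrightarrow> M w (of_real t) = B (w + t *\<^sub>R v)"
    using analytic_along_matrix_obtain[of v B] UAB by blast
  define \<eta> where "\<eta> = (1 - \<kappa>) / 16"
  define q where "q = ((1 + \<eta>) * (\<kappa> + \<eta>) + \<eta> * \<eta>) / (1 - 2 * \<eta>)\<^sup>2"
  have eta: "\<eta> > 0" using dom by (simp add: \<eta>_def)
  define D where "D w = wedge (a (w + \<sigma>)) (b (w + \<sigma>)) * \<alpha> w" for w
  have Dlb: "cmod (D w) \<ge> d * c0" for w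
    unfolding D_def norm_mult using wd al by (intro mult_mono) auto
  have D0: "D w \<noteq> 0" for w using Dlb[of w] mult_pos_pos[OF wd(2) al(2)] by auto
  define c11 where "c11 w t = wedge (M w t *v a w) (b (w + \<sigma>)) * inverse (D w)" for w t
  define c12 where "c12 w t = wedge (M w t *v b w) (b (w + \<sigma>)) * inverse (D w)" for w t
  define c21 where "c21 w t = - (wedge (M w t *v a w) (a (w + \<sigma>)) * inverse (D w))" for w t
  define c22 where "c22 w t = - (wedge (M w t *v b w) (a (w + \<sigma>)) * inverse (D w))" for w t
  define K' where "K' = 4 * K * inverse (d * c0)"
  have K': "K' > 0" using M(2) wd(2) al(2) by (simp add: K'_def)
  have hb1: "bdd_hol \<delta> K' (\<lambda>t. wedge (M w t *v x) y * inverse (D w))" if "norm x = 1" "norm y = 1" for x y w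
  proof -
    have "inverse (cmod (D w)) \<le> inverse (d * c0)"
      by (rule le_imp_inverse_le[OF Dlb mult_pos_pos[OF wd(2) al(2)]])
    then have "bdd_hol \<delta> (inverse (d * c0)) (\<lambda>t. inverse (D w))" by (intro bdd_hol_const) (simp add: norm_inverse)
    moreover have "bdd_hol \<delta> (4 * K) (\<lambda>t. wedge (M w t *v x) y)"
      using M(1) that by (intro bdd_hol_wedge M(3)) auto
    ultimately show ?thesis unfolding K'_def using M(1) by (intro bdd_hol_mult)
  qed
  define r where "r = min (\<delta> / 2) (\<eta> * \<delta> / (2 * K'))"
  have r: "r > 0" "r \<le> \<delta> / 2" using M(1) eta K' by (auto simp: r_def)
  have small: "cmod (F t - F 0) \<le> \<eta>" if "bdd_hol \<delta> K' F" "cmod t < r" for F t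
  proof -
    have "cmod (F t - F 0) \<le> 2 * K' / \<delta> * cmod (t - 0)"
      using that r M(1) by (intro bdd_hol_lipschitz) auto
    also have "\<dots> \<le> 2 * K' / \<delta> * (\<eta> * \<delta> / (2 * K'))"
      using that M(1) K' by (intro mult_left_mono) (auto simp: r_def)
    also have "\<dots> = \<eta>" using M(1) K' by (simp add: field_simps)
    finally show ?thesis .
  qed
  have M0: "M w 0 = B w" for w using M(4)[of 0 w] M(1) by simp
  have e11: "cmod (c11 w t - 1) \<le> \<eta>" if "cmod t < r" for w t
  proof -
    have "c11 w 0 = 1" using D0[of w] by (simp add: c11_def M0 Ba wedge_smult_left D_def field_simps)
    moreover have "cmod (c11 w t - c11 w 0) \<le> \<eta>" unfolding c11_def by (rule small[OF hb1[OF unit(1,2)] that])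
    ultimately show ?thesis by simp
  qed
  have e12: "cmod (c12 w t) \<le> \<eta>" if "cmod t < r" for w t
  proof -
    have "c12 w 0 = 0" by (simp add: c12_def M0 Bb wedge_smult_left wedge_self)
    moreover have "cmod (c12 w t - c12 w 0) \<le> \<eta>" unfolding c12_def by (rule small[OF hb1[OF unit(2,2)] that])
    ultimately show ?thesis by simp
  qed
  have e21: "cmod (c21 w t) \<le> \<eta>" if "cmod t < r" for w t
  proof -
    have "c21 w 0 = 0" by (simp add: c21_def M0 Ba wedge_smult_left wedge_self)
    moreover have "cmod (- c21 w t - - c21 w 0) \<le> \<eta>" unfolding c21_def minus_minus by (rule small[OF hb1[OF unit(1,1)] that])
    ultimately show ?thesis by simp
  qed
  have e22: "cmod (c22 w t) \<le> \<kappa> + \<eta>" if "cmod t < r" for w t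
  proof -
    have a0: "\<alpha> w \<noteq> 0" using al(1)[of w] al(2) by auto
    have "c22 w 0 * \<alpha> w = \<beta> w"
    proof -
      have "c22 w 0 * D w = - (\<beta> w * wedge (b (w + \<sigma>)) (a (w + \<sigma>)))"
        using D0[of w] by (simp add: c22_def M0 Bb wedge_smult_left)
      also have "\<dots> = \<beta> w * wedge (a (w + \<sigma>)) (b (w + \<sigma>))"
        using wedge_swap[of "b (w + \<sigma>)" "a (w + \<sigma>)"] by simp
      finally have "(c22 w 0 * \<alpha> w) * wedge (a (w + \<sigma>)) (b (w + \<sigma>)) = \<beta> w * wedge (a (w + \<sigma>)) (b (w + \<sigma>))"
        by (simp add: D_def mult_ac)
      then show ?thesis using D0[of w] by (simp add: D_def)
    qed
    then have "cmod (c22 w 0) * cmod (\<alpha> w) \<le> \<kappa> * cmod (\<alpha> w)"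
      using dom(1)[of w] by (metis norm_mult)
    then have "cmod (c22 w 0) \<le> \<kappa>" using a0 by simp
    moreover have "cmod (- c22 w t - - c22 w 0) \<le> \<eta>" unfolding c22_def minus_minus by (rule small[OF hb1[OF unit(2,1)] that])
    then have "cmod (c22 w t - c22 w 0) \<le> \<eta>" by (simp add: norm_minus_commute)
    ultimately show ?thesis using norm_triangle_sub[of "c22 w t" "c22 w 0"] by linarith
  qed
  define \<Phi> where "\<Phi> w t s = (c21 w t + c22 w t * s) / (c11 w t + c12 w t * s)" for w t s
  have cone: "c11 w t + c12 w t * s \<noteq> 0" "cmod ((c21 w t + c22 w t * s) / (c11 w t + c12 w t * s)) \<le> 1"
    "cmod ((c21 w t + c22 w t * s) / (c11 w t + c12 w t * s) - (c21 w t + c22 w t * s') / (c11 w t + c12 w t * s'))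
      \<le> q * cmod (s - s')" "0 \<le> q" "q < 1"
    if "cmod t < r" "cmod s \<le> 1" "cmod s' \<le> 1" for w t s s'
    by (fact cone_contraction[OF dom(2,3) \<eta>_def e11[OF that(1)] e12[OF that(1)] e21[OF that(1)] e22[OF that(1)] q_def that(2,3)])+
  have c0: "cmod 0 < r" "cmod 0 \<le> 1" using r by simp_all
  have q: "0 \<le> q" "q < 1" by (fact cone(4,5)[OF c0 c0(2)])+
  have \<Phi>1: "cmod (\<Phi> w t s) \<le> 1" if "cmod t < r" "cmod s \<le> 1" for w t s
    unfolding \<Phi>_def by (rule cone(2)[OF that that(2)])
  have \<Phi>2: "cmod (\<Phi> w t s - \<Phi> w t s') \<le> q * cmod (s - s')" if "cmod t < r" "cmod s \<le> 1" "cmod s' \<le> 1" for w t s s'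
    unfolding \<Phi>_def by (rule cone(3)[OF that])
  \<comment> \<open>\<open>g n w t s\<close>: the slope \<open>s\<close> placed \<open>n\<close> steps in the past of \<open>w\<close>, pushed forward to \<open>w\<close>\<close>
  define g where "g = rec_nat (\<lambda>w t s. s) (\<lambda>n h w t s. \<Phi> (w - \<sigma>) t (h (w - \<sigma>) t s))"
  have g0: "g 0 w t s = s" and gS: "g (Suc n) w t s = \<Phi> (w - \<sigma>) t (g n (w - \<sigma>) t s)" for n w t s
    by (simp_all add: g_def)
  have g1: "cmod (g n w t s) \<le> 1" if "cmod t < r" "cmod s \<le> 1" for n w t s
    by (induction n arbitrary: w) (simp_all add: g0 gS that \<Phi>1)
  have g2: "cmod (g n w t s - g n w t s') \<le> q ^ n * cmod (s - s')"
    if "cmod t < r" "cmod s \<le> 1" "cmod s' \<le> 1" for n w t s s'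
  proof (induction n arbitrary: w)
    case (Suc n)
    have "cmod (g (Suc n) w t s - g (Suc n) w t s') \<le> q * cmod (g n (w - \<sigma>) t s - g n (w - \<sigma>) t s')"
      unfolding gS by (intro \<Phi>2 g1 that)
    also have "\<dots> \<le> q * (q ^ n * cmod (s - s'))" by (intro mult_left_mono Suc q)
    finally show ?case by simp
  qed (simp add: g0)
  have shift: "w - \<sigma> - real k *\<^sub>R \<sigma> = w - real (Suc k) *\<^sub>R \<sigma>" for w k
    unfolding of_nat_Suc scaleR_add_left by (simp add: algebra_simps)
  have gshift: "g (Suc n) w t s = g n w t (\<Phi> (w - real (Suc n) *\<^sub>R \<sigma>) t s)" for n w t s
  proof (induction n arbitrary: w)
    case (Suc n)
    show ?case using Suc[of "w - \<sigma>"] gS[of "Suc n" w t s] unfolding shift gS[of n w] by simp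
  qed (simp add: g0 gS)
  have holc: "c11 w holomorphic_on ball 0 r" "c12 w holomorphic_on ball 0 r"
    "c21 w holomorphic_on ball 0 r" "c22 w holomorphic_on ball 0 r" for w
  proof -
    have "(\<lambda>t. wedge (M w t *v x) y * inverse (D w)) holomorphic_on ball 0 r" if "norm x = 1" "norm y = 1" for x y
      using hb1[OF that, of w] r M(1) unfolding bdd_hol_def by (auto elim: holomorphic_on_subset)
    note h = this
    show "c11 w holomorphic_on ball 0 r" unfolding c11_def[abs_def] by (rule h[OF unit(1,2)])
    show "c12 w holomorphic_on ball 0 r" unfolding c12_def[abs_def] by (rule h[OF unit(2,2)])
    show "c21 w holomorphic_on ball 0 r" unfolding c21_def[abs_def] by (rule holomorphic_on_minus[OF h[OF unit(1,1)]])
    show "c22 w holomorphic_on ball 0 r" unfolding c22_def[abs_def] by (rule holomorphic_on_minus[OF h[OF unit(2,1)]])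
  qed
  have ghol: "(\<lambda>t. g n w t 0) holomorphic_on ball 0 r" for n w
  proof (induction n arbitrary: w)
    case (Suc n)
    show ?case unfolding gS \<Phi>_def
    proof (intro holomorphic_intros holc Suc)
      show "c11 (w - \<sigma>) t + c12 (w - \<sigma>) t * g n (w - \<sigma>) t 0 \<noteq> 0" if "t \<in> ball 0 r" for t
        using that by (intro cone(1)[OF _ _ c0(2)] g1) simp_all
    qed
  qed (simp add: g0)
  define G where "G w t = (\<Sum>n. g (Suc n) w t 0 - g n w t 0)" for w t
  have unif: "uniform_limit (ball 0 r) (\<lambda>n t. g n w t 0) (G w) sequentially" for w
  proof -
    have "uniform_limit (ball 0 r) (\<lambda>n t. \<Sum>i<n. g (Suc i) w t 0 - g i w t 0) (\<lambda>t. \<Sum>i. g (Suc i) w t 0 - g i w t 0) sequentially"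
    proof (rule Weierstrass_m_test)
      show "norm (g (Suc n) w t 0 - g n w t 0) \<le> q ^ n" if "t \<in> ball 0 r" for n t
      proof -
        have "norm (g n w t (\<Phi> (w - real (Suc n) *\<^sub>R \<sigma>) t 0) - g n w t 0) \<le> q ^ n * cmod (\<Phi> (w - real (Suc n) *\<^sub>R \<sigma>) t 0 - 0)"
          using that by (intro g2 \<Phi>1) auto
        also have "\<dots> \<le> q ^ n * 1"
          using that q \<Phi>1[of t 0] by (intro mult_left_mono) auto
        finally show ?thesis by (simp add: gshift)
      qed
      show "summable (\<lambda>n. q ^ n)" using q by (intro summable_geometric) auto
    qed
    moreover have "(\<Sum>i<n. g (Suc i) w t 0 - g i w t 0) = g n w t 0" for n t
      using sum_lessThan_telescope[of "\<lambda>n. g n w t 0" n] by (simp add: g0)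
    ultimately show ?thesis by (simp add: G_def[abs_def])
  qed
  have Ghol: "G w holomorphic_on ball 0 r" for w
  proof (rule holomorphic_uniform_sequence[of "ball 0 r" "\<lambda>n t. g n w t 0"])
    fix x :: complex assume "x \<in> ball 0 r"
    then obtain e where e: "e > 0" "cball x e \<subseteq> ball 0 r" using open_contains_cball[of "ball 0 r"] open_ball by blast
    then show "\<exists>d>0. cball x d \<subseteq> ball 0 r \<and> uniform_limit (cball x d) (\<lambda>n t. g n w t 0) (G w) sequentially"
      using uniform_limit_on_subset[OF unif] by blast
  qed (use ghol in auto)
  have Glim: "(\<lambda>n. g n w t 0) \<longlonglongrightarrow> G w t" if "cmod t < r" for w t
    by (rule tendsto_uniform_limitI[OF unif]) (use that in simp)
  have G1: "cmod (G w t) \<le> 1" if "cmod t < r" for w t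
    by (rule Lim_bounded[OF tendsto_norm[OF Glim[OF that]]]) (use g1[OF that] in simp)
  \<comment> \<open>for real \<open>t\<close> the direction approaches \<open>a (w + t *\<^sub>R v)\<close>; a quotient of wedges measures how fast\<close>
  have ind: "cmod (wedge (a w + g n w (of_real t) s *s b w) (a (w + t *\<^sub>R v))) *
      cmod (wedge (a (w - real n *\<^sub>R \<sigma>) + s *s b (w - real n *\<^sub>R \<sigma>)) (b (w - real n *\<^sub>R \<sigma> + t *\<^sub>R v)))
     \<le> \<kappa> ^ n * cmod (wedge (a w + g n w (of_real t) s *s b w) (b (w + t *\<^sub>R v))) *
      cmod (wedge (a (w - real n *\<^sub>R \<sigma>) + s *s b (w - real n *\<^sub>R \<sigma>)) (a (w - real n *\<^sub>R \<sigma> + t *\<^sub>R v)))"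
    if t: "\<bar>t\<bar> < r" and s: "cmod s \<le> 1" for n w t s
  proof (induction n arbitrary: w)
    case 0
    then show ?case by (simp add: g0)
  next
    case (Suc n)
    define u where "u = w - \<sigma>"
    have wu: "w = u + \<sigma>" by (simp add: u_def)
    have tr: "cmod (complex_of_real t) < r" using t by simp
    define y where "y = a u + g n u (of_real t) s *s b u"
    define y' where "y' = a w + g (Suc n) w (of_real t) s *s b w"
    define z where "z = w - real (Suc n) *\<^sub>R \<sigma>"
    have zu: "z = u - real n *\<^sub>R \<sigma>" unfolding z_def u_def shift ..
    define Xa where "Xa = cmod (wedge (a z + s *s b z) (a (z + t *\<^sub>R v)))"
    define Xb where "Xb = cmod (wedge (a z + s *s b z) (b (z + t *\<^sub>R v)))"
    define m where "m = \<alpha> u * (c11 u (of_real t) + c12 u (of_real t) * g n u (of_real t) s)"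
    have nz: "c11 u (of_real t) + c12 u (of_real t) * g n u (of_real t) s \<noteq> 0"
      by (rule cone(1)[OF tr g1[OF tr s] c0(2)])
    have m0: "m \<noteq> 0" using nz al(1)[of u] al(2) by (auto simp: m_def)
    have Bt: "B (u + t *\<^sub>R v) = M u (of_real t)" using M(4)[of t u] t r(2) M(1) by simp
    have By: "B (u + t *\<^sub>R v) *v y = m *s y'"
    proof -
      have dd: "wedge (a w) (b w) \<noteq> 0" using wd(1)[of w] wd(2) by auto
      have "wedge (a w) (b w) *s (B (u + t *\<^sub>R v) *v y) = wedge (B (u + t *\<^sub>R v) *v y) (b w) *s a w + wedge (a w) (B (u + t *\<^sub>R v) *v y) *s b w"
        by (rule wedge_decompose)
      also have "wedge (B (u + t *\<^sub>R v) *v y) (b w) = D u * (c11 u (of_real t) + c12 u (of_real t) * g n u (of_real t) s)"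
        using D0[of u] by (simp add: y_def Bt c11_def c12_def wu matrix_vector_right_distrib vector_smult_assoc
           matrix_vector_mult_scaleR wedge_add_left wedge_smult_left vec.scale field_simps)
      also have "wedge (a w) (B (u + t *\<^sub>R v) *v y) = D u * (c21 u (of_real t) + c22 u (of_real t) * g n u (of_real t) s)"
        using D0[of u] unfolding wedge_swap[of "a w"]
        by (simp add: y_def Bt c21_def c22_def wu matrix_vector_right_distrib
           wedge_add_left wedge_smult_left vec.scale field_simps)
      also have "D u * (c11 u (of_real t) + c12 u (of_real t) * g n u (of_real t) s) *s a w +
          D u * (c21 u (of_real t) + c22 u (of_real t) * g n u (of_real t) s) *s b w
          = wedge (a w) (b w) *s (m *s y')"
      proof -
        define s' where "s' = g n u (of_real t) s"
        define X where "X = c11 u (of_real t) + c12 u (of_real t) * s'"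
        define Z where "Z = c21 u (of_real t) + c22 u (of_real t) * s'"
        have X0: "X \<noteq> 0" using nz by (simp add: X_def s'_def)
        have "y' = a w + (Z / X) *s b w" by (simp add: y'_def gS u_def[symmetric] \<Phi>_def X_def Z_def s'_def)
        moreover have "m = \<alpha> u * X" by (simp add: m_def X_def s'_def)
        moreover have "D u = wedge (a w) (b w) * \<alpha> u" by (simp add: D_def wu)
        ultimately show ?thesis
          using X0 unfolding X_def[symmetric] Z_def[symmetric] s'_def[symmetric]
          by (simp add: vec_eq_iff distrib_left)
      qed
      finally show ?thesis using dd by (metis vec.scale_cancel_left)
    qed
    have Ya: "cmod m * cmod (\<alpha> (u + t *\<^sub>R v)) * cmod (wedge y' (a (w + t *\<^sub>R v))) =
       cmod (det (B (u + t *\<^sub>R v))) * cmod (wedge y (a (u + t *\<^sub>R v)))"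
    proof -
      have "m * (\<alpha> (u + t *\<^sub>R v) * wedge y' (a (w + t *\<^sub>R v))) = wedge (m *s y') (\<alpha> (u + t *\<^sub>R v) *s a (w + t *\<^sub>R v))"
        by (simp add: wedge_smult_left wedge_smult_right)
      also have "\<dots> = wedge (B (u + t *\<^sub>R v) *v y) (B (u + t *\<^sub>R v) *v a (u + t *\<^sub>R v))"
        unfolding By Ba by (simp add: wu ac_simps)
      finally show ?thesis by (simp add: wedge_matrix norm_mult[symmetric] mult.assoc)
    qed
    have Yb: "cmod m * cmod (\<beta> (u + t *\<^sub>R v)) * cmod (wedge y' (b (w + t *\<^sub>R v))) =
       cmod (det (B (u + t *\<^sub>R v))) * cmod (wedge y (b (u + t *\<^sub>R v)))"
    proof -
      have "m * (\<beta> (u + t *\<^sub>R v) * wedge y' (b (w + t *\<^sub>R v))) = wedge (m *s y') (\<beta> (u + t *\<^sub>R v) *s b (w + t *\<^sub>R v))"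
        by (simp add: wedge_smult_left wedge_smult_right)
      also have "\<dots> = wedge (B (u + t *\<^sub>R v) *v y) (B (u + t *\<^sub>R v) *v b (u + t *\<^sub>R v))"
        unfolding By Bb by (simp add: wu ac_simps)
      finally show ?thesis by (simp add: wedge_matrix norm_mult[symmetric] mult.assoc)
    qed
    have IH: "cmod (wedge y (a (u + t *\<^sub>R v))) * Xb \<le> \<kappa> ^ n * cmod (wedge y (b (u + t *\<^sub>R v))) * Xa"
      using Suc[of u] unfolding y_def Xa_def Xb_def zu .
    let ?c = "cmod m * cmod (\<alpha> (u + t *\<^sub>R v))"
    have cpos: "?c > 0" by (rule mult_pos_pos) (use m0 less_le_trans[OF al(2) al(1), of "u + t *\<^sub>R v"] in simp_all)
    have "?c * (cmod (wedge y' (a (w + t *\<^sub>R v))) * Xb) = cmod (det (B (u + t *\<^sub>R v))) * (cmod (wedge y (a (u + t *\<^sub>R v))) * Xb)"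
      using Ya by (simp add: mult.assoc[symmetric])
    also have "\<dots> \<le> cmod (det (B (u + t *\<^sub>R v))) * (\<kappa> ^ n * cmod (wedge y (b (u + t *\<^sub>R v))) * Xa)"
      by (intro mult_left_mono IH) auto
    also have "\<dots> = \<kappa> ^ n * (cmod (det (B (u + t *\<^sub>R v))) * cmod (wedge y (b (u + t *\<^sub>R v)))) * Xa"
      by (simp add: algebra_simps)
    also have "\<dots> = \<kappa> ^ n * (cmod m * cmod (\<beta> (u + t *\<^sub>R v)) * cmod (wedge y' (b (w + t *\<^sub>R v)))) * Xa"
      unfolding Yb ..
    also have "\<dots> \<le> \<kappa> ^ n * (cmod m * (\<kappa> * cmod (\<alpha> (u + t *\<^sub>R v))) * cmod (wedge y' (b (w + t *\<^sub>R v)))) * Xa"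
      by (intro mult_right_mono mult_left_mono dom) (auto simp: Xa_def dom)
    also have "\<dots> = ?c * (\<kappa> ^ Suc n * cmod (wedge y' (b (w + t *\<^sub>R v))) * Xa)"
      by (simp add: algebra_simps)
    finally have "cmod (wedge y' (a (w + t *\<^sub>R v))) * Xb \<le> \<kappa> ^ Suc n * cmod (wedge y' (b (w + t *\<^sub>R v))) * Xa"
      using cpos by (simp only: mult_le_cancel_left_pos)
    then show ?case unfolding y'_def Xa_def Xb_def z_def .
  qed
  have normy: "norm (a w + s *s b w') \<le> 2" if "cmod s \<le> 1" for w w' s
    using norm_triangle_ineq[of "a w" "s *s b w'"] that by (simp add: norm_smult unit)
  have par: "wedge (a w + G w (of_real t) *s b w) (a (w + t *\<^sub>R v)) = 0" if t: "\<bar>t\<bar> < r" for w t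
  proof -
    have tr: "cmod (complex_of_real t) < r" using t by simp
    have bnd: "cmod (wedge (a w + g n w (of_real t) 0 *s b w) (a (w + t *\<^sub>R v))) \<le> 48 / d * \<kappa> ^ n + 2 * q ^ n" for n
    proof -
      define z where "z = w - real n *\<^sub>R \<sigma>"
      define X where "X s = cmod (wedge (a z + s *s b z) (b (z + t *\<^sub>R v)))" for s
      \<comment> \<open>some initial slope is not close to \<open>b\<close>; the contraction makes its choice irrelevant in the limit\<close>
      have "\<exists>s. cmod s \<le> 1 \<and> X s \<ge> d / 3"
      proof (rule ccontr)
        assume no: "\<not> ?thesis"
        have x0: "X 0 < d / 3" using no by (metis norm_zero not_le zero_le_one)
        have x1: "X 1 < d / 3" using no by (metis norm_one not_le order_refl)
        have w0: "cmod (wedge (a z) (b (z + t *\<^sub>R v))) < d / 3" using x0 by (simp add: X_def)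
        have "wedge (b z) (b (z + t *\<^sub>R v)) = wedge (a z + 1 *s b z) (b (z + t *\<^sub>R v)) - wedge (a z) (b (z + t *\<^sub>R v))"
          by (simp add: wedge_add_left)
        then have w1: "cmod (wedge (b z) (b (z + t *\<^sub>R v))) < 2 * d / 3"
          using x1 w0 norm_triangle_ineq4[of "wedge (a z + 1 *s b z) (b (z + t *\<^sub>R v))" "wedge (a z) (b (z + t *\<^sub>R v))"]
          by (simp add: X_def)
        have "d \<le> norm (wedge (a z) (b z) *s b (z + t *\<^sub>R v))" using wd(1)[of z] by (simp add: norm_smult unit)
        also have "\<dots> = norm (wedge (b (z + t *\<^sub>R v)) (b z) *s a z + wedge (a z) (b (z + t *\<^sub>R v)) *s b z)"
          using wedge_decompose[of "a z" "b z" "b (z + t *\<^sub>R v)"] by simp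
        also have "\<dots> \<le> cmod (wedge (b (z + t *\<^sub>R v)) (b z)) + cmod (wedge (a z) (b (z + t *\<^sub>R v)))"
          by (rule order_trans[OF norm_triangle_ineq]) (simp add: norm_smult unit)
        also have "\<dots> = cmod (wedge (b z) (b (z + t *\<^sub>R v))) + cmod (wedge (a z) (b (z + t *\<^sub>R v)))"
          using wedge_swap[of "b z" "b (z + t *\<^sub>R v)"] by simp
        finally show False using w0 w1 by simp
      qed
      then obtain s where s: "cmod s \<le> 1" "X s \<ge> d / 3" by blast
      let ?y = "a w + g n w (of_real t) s *s b w"
      have b2: "cmod (wedge ?y (b (w + t *\<^sub>R v))) \<le> 4"
        using wedge_bound[of ?y "b (w + t *\<^sub>R v)"] normy[OF g1[OF tr s(1)], of w n w w] by (simp add: unit)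
      have b3: "cmod (wedge (a z + s *s b z) (a (z + t *\<^sub>R v))) \<le> 4"
        using wedge_bound[of "a z + s *s b z" "a (z + t *\<^sub>R v)"] normy[OF s(1), of z z] by (simp add: unit)
      have "cmod (wedge ?y (a (w + t *\<^sub>R v))) * (d / 3) \<le> cmod (wedge ?y (a (w + t *\<^sub>R v))) * X s"
        by (intro mult_left_mono s) auto
      also have "\<dots> \<le> \<kappa> ^ n * cmod (wedge ?y (b (w + t *\<^sub>R v))) * cmod (wedge (a z + s *s b z) (a (z + t *\<^sub>R v)))"
        using ind[OF t s(1), of w n] by (simp add: X_def z_def)
      also have "\<dots> \<le> \<kappa> ^ n * 4 * 4" using b2 b3 dom(2) by (intro mult_mono) simp_all
      finally have A: "cmod (wedge ?y (a (w + t *\<^sub>R v))) \<le> 48 / d * \<kappa> ^ n" using wd(2) by (simp add: field_simps)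
      have "wedge (a w + g n w (of_real t) 0 *s b w) (a (w + t *\<^sub>R v)) - wedge ?y (a (w + t *\<^sub>R v))
         = (g n w (of_real t) 0 - g n w (of_real t) s) * wedge (b w) (a (w + t *\<^sub>R v))"
        by (simp add: wedge_add_left wedge_smult_left algebra_simps)
      moreover have "cmod ((g n w (of_real t) 0 - g n w (of_real t) s) * wedge (b w) (a (w + t *\<^sub>R v))) \<le> (q ^ n * 1) * 2"
        unfolding norm_mult
      proof (intro mult_mono)
        have "cmod (g n w (of_real t) 0 - g n w (of_real t) s) \<le> q ^ n * cmod (0 - s)" by (intro g2 tr s) simp
        also have "\<dots> \<le> q ^ n * 1" using s q by (intro mult_left_mono) auto
        finally show "cmod (g n w (of_real t) 0 - g n w (of_real t) s) \<le> q ^ n * 1" .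
        show "cmod (wedge (b w) (a (w + t *\<^sub>R v))) \<le> 2" using wedge_bound[of "b w" "a (w + t *\<^sub>R v)"] by (simp add: unit)
      qed (use q in auto)
      ultimately have "cmod (wedge (a w + g n w (of_real t) 0 *s b w) (a (w + t *\<^sub>R v)) - wedge ?y (a (w + t *\<^sub>R v))) \<le> 2 * q ^ n"
        by simp
      then show ?thesis using A norm_triangle_sub[of "wedge (a w + g n w (of_real t) 0 *s b w) (a (w + t *\<^sub>R v))" "wedge ?y (a (w + t *\<^sub>R v))"]
        by linarith
    qed
    have "(\<lambda>n. 48 / d * \<kappa> ^ n + 2 * q ^ n) \<longlonglongrightarrow> 48 / d * 0 + 2 * 0"
      using dom(2,3) q by (intro tendsto_intros LIMSEQ_power_zero) auto
    then have "(\<lambda>n. 48 / d * \<kappa> ^ n + 2 * q ^ n) \<longlonglongrightarrow> 0" by simp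
    then have "(\<lambda>n. wedge (a w + g n w (of_real t) 0 *s b w) (a (w + t *\<^sub>R v))) \<longlonglongrightarrow> 0"
      by (rule Lim_null_comparison[rotated]) (use bnd in simp)
    moreover have "(\<lambda>n. wedge (a w + g n w (of_real t) 0 *s b w) (a (w + t *\<^sub>R v))) \<longlonglongrightarrow> wedge (a w + G w (of_real t) *s b w) (a (w + t *\<^sub>R v))"
      unfolding wedge_add_left wedge_smult_left by (intro tendsto_intros Glim tr)
    ultimately show ?thesis using LIMSEQ_unique by blast
  qed
  define Y where "Y w t = a w + G w t *s b w" for w t
  \<comment> \<open>the holomorphic extension of the squared norm of \<open>Y\<close>\<close>
  define N where "N w t = Y w t $ 1 * cnj (Y w (cnj t) $ 1) + Y w t $ 2 * cnj (Y w (cnj t) $ 2)" for w t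
  have hbG: "bdd_hol r 1 (G w)" for w using Ghol G1 by (auto simp: bdd_hol_def)
  have hbY: "bdd_hol r 2 (\<lambda>t. Y w t $ i)" for w i
  proof -
    have "bdd_hol r (1 + 1 * 1) (\<lambda>t. a w $ i + G w t * b w $ i)"
      using component_le_norm[of "a w" i] component_le_norm[of "b w" i] r by (intro bdd_hol_add bdd_hol_mult bdd_hol_const hbG) (auto simp: unit)
    then show ?thesis by (simp add: Y_def)
  qed
  have hbN: "bdd_hol r 8 (N w)" for w
  proof -
    have "bdd_hol r (2 * 2 + 2 * 2) (\<lambda>t. Y w t $ 1 * cnj (Y w (cnj t) $ 1) + Y w t $ 2 * cnj (Y w (cnj t) $ 2))"
      using r by (intro bdd_hol_add bdd_hol_mult hbY bdd_hol_cnj)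
    then show ?thesis by (simp add: N_def[abs_def])
  qed
  have Ynz: "norm (Y w t) \<ge> d / 2" for w t
  proof -
    have "d \<le> cmod (wedge (Y w t) (b w))" using wd(1)[of w] by (simp add: Y_def wedge_add_left wedge_smult_left wedge_self)
    also have "\<dots> \<le> 2 * norm (Y w t)" using wedge_bound[of "Y w t" "b w"] by (simp add: unit)
    finally show ?thesis by simp
  qed
  have N0: "cmod (N w 0) \<ge> (d / 2)\<^sup>2" for w
  proof -
    have "N w 0 = complex_of_real ((norm (Y w 0))\<^sup>2)" unfolding norm_sq_complex by (simp add: N_def)
    then have "cmod (N w 0) = (norm (Y w 0))\<^sup>2" by (simp only: norm_of_real) simp
    then show ?thesis using Ynz[of w 0] wd(2) by (simp add: power_mono)
  qed
  have d2: "(d / 2)\<^sup>2 > 0" using wd(2) by simp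
  define r' where "r' = min (r/2) ((d / 2)\<^sup>2 * r / (4 * 8))"
  have r': "r' > 0" "r' \<le> r" using r d2 by (auto simp: r'_def)
  have hbI: "bdd_hol r' (2 / (d / 2)\<^sup>2) (\<lambda>t. inverse (N w t))" for w
    unfolding r'_def by (rule bdd_hol_inverse(1)[OF hbN r(1) N0 d2])
  show ?thesis
  proof (rule analytic_alongI[of r' "2 * 2 * (2 / (d / 2)\<^sup>2)" "\<lambda>w t. Y w t $ i * cnj (Y w (cnj t) $ j) * inverse (N w t)"])
    show "bdd_hol r' (2 * 2 * (2 / (d / 2)\<^sup>2)) (\<lambda>t. Y w t $ i * cnj (Y w (cnj t) $ j) * inverse (N w t))" for w
      using r' bdd_hol_mono[OF hbY] by (intro bdd_hol_mult hbI bdd_hol_cnj[of _ _ "\<lambda>t. Y w t $ j"]) auto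
    fix w and t :: real assume "\<bar>t\<bar> < r'"
    then have t: "\<bar>t\<bar> < r" using r' by simp
    have "Y w (of_real t) \<noteq> 0" using Ynz[of w "of_real t"] wd(2) by auto
    from projection_parallel[OF _ this unit(1)[of "w + t *\<^sub>R v"], of i j] par[OF t, of w]
    show "Y w (of_real t) $ i * cnj (Y w (cnj (of_real t)) $ j) * inverse (N w (of_real t)) =
        a (w + t *\<^sub>R v) $ i * cnj (a (w + t *\<^sub>R v) $ j)"
      by (simp add: Y_def[symmetric] N_def)
  qed (use r' in auto)
qed

end

section \<open>Smooth normalized frames\<close>

lemma Ck_along_inner:
  assumes "v \<bullet> v = 1"
  shows "Ck_along v r (\<lambda>w. complex_of_real (w \<bullet> v))"
proof (cases r)
  case (Suc r')
  have "((\<lambda>t. complex_of_real ((w + t *\<^sub>R v) \<bullet> v)) has_vector_derivative 1) (at 0)" for w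
    using assms by (auto intro!: derivative_eq_intros simp: inner_add_left)
  then show ?thesis unfolding Suc by (intro Ck_along_SucI[OF _ Ck_along_const] continuous_intros)
qed (auto intro!: continuous_intros)

text \<open>An odd approximation of finite smoothness to the projection of the real line onto \<open>[-k, k]\<close>, within
  distance 1 of it and equal to the identity on this interval.\<close>

definition smooth_clamp :: "nat \<Rightarrow> nat \<Rightarrow> real \<Rightarrow> real" where
  "smooth_clamp r k x = x - (x - real k) * cutoff r (x - real k) - (x + real k) * cutoff r (- x - real k)"

lemma smooth_clamp_minus: "smooth_clamp r k (- x) = - smooth_clamp r k x"
proof -
  have "- x - real k = - x + - real k" "- x + real k = - (x - real k)" by simp_all
  then show ?thesis by (simp add: smooth_clamp_def algebra_simps)
qed

lemma smooth_clamp_id: "\<bar>x\<bar> \<le> real k \<Longrightarrow> smooth_clamp r k x = x"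
  by (simp add: smooth_clamp_def cutoff_0 abs_le_iff)

lemma smooth_clamp_range:
  assumes "x \<ge> 0"
  shows "min x (real k) \<le> smooth_clamp r k x" "smooth_clamp r k x \<le> min x (real k) + 1"
proof -
  have z: "cutoff r (- x - real k) = 0" using assms by (intro cutoff_0) simp
  have "min x (real k) \<le> smooth_clamp r k x \<and> smooth_clamp r k x \<le> min x (real k) + 1"
  proof (cases "x \<le> real k")
    case True
    then show ?thesis using assms by (simp add: smooth_clamp_id)
  next
    case False
    show ?thesis
    proof (cases "x \<le> real k + 1")
      case True
      have "0 \<le> (x - real k) * (1 - cutoff r (x - real k))" "(x - real k) * (1 - cutoff r (x - real k)) \<le> 1 * 1"
        using False True cutoff_range[of r "x - real k"] by (simp, intro mult_mono) auto
      moreover have "smooth_clamp r k x = real k + (x - real k) * (1 - cutoff r (x - real k))"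
        using z by (simp add: smooth_clamp_def algebra_simps)
      ultimately show ?thesis using False by simp
    next
      case False
      then have "cutoff r (x - real k) = 1" by (intro cutoff_1) simp
      then show ?thesis using z False by (simp add: smooth_clamp_def)
    qed
  qed
  then show "min x (real k) \<le> smooth_clamp r k x" "smooth_clamp r k x \<le> min x (real k) + 1" by auto
qed

lemma smooth_clamp_step: "\<bar>smooth_clamp r (Suc k) x - smooth_clamp r k x\<bar> \<le> 2" and smooth_clamp_0: "\<bar>smooth_clamp r 0 x\<bar> \<le> 2"
proof -
  have pos: "\<bar>smooth_clamp r (Suc k) x - smooth_clamp r k x\<bar> \<le> 2 \<and> \<bar>smooth_clamp r 0 x\<bar> \<le> 2" if "x \<ge> 0" for x
    using smooth_clamp_range[OF that, where k = k and r = r] smooth_clamp_range[OF that, where k = "Suc k" and r = r]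
      smooth_clamp_range[OF that, where k = 0 and r = r] that
    by (auto simp: min_def abs_le_iff split: if_splits)
  have "\<bar>smooth_clamp r (Suc k) x - smooth_clamp r k x\<bar> \<le> 2 \<and> \<bar>smooth_clamp r 0 x\<bar> \<le> 2"
  proof (cases "x \<ge> 0")
    case False
    then show ?thesis using pos[of "- x"] unfolding smooth_clamp_minus by (simp add: abs_minus_commute)
  qed (rule pos)
  then show "\<bar>smooth_clamp r (Suc k) x - smooth_clamp r k x\<bar> \<le> 2" "\<bar>smooth_clamp r 0 x\<bar> \<le> 2" by auto
qed

lemma Ck_along_smooth_clamp:
  assumes "v \<bullet> v = 1" "\<delta> > 0"
  shows "Ck_along v r (\<lambda>w. complex_of_real (\<delta> * smooth_clamp r k ((w \<bullet> v) / \<delta>)))"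
proof -
  have c: "Ck_along v r (\<lambda>w. complex_of_real (cutoff r (c * (w \<bullet> v) + d)))" for c d
    by (rule cutoff_Ck_along[OF assms(1)])
  have "Ck_along v r (\<lambda>w. of_real (w \<bullet> v) - (of_real (w \<bullet> v) - of_real (\<delta> * real k)) * of_real (cutoff r ((1/\<delta>) * (w \<bullet> v) + (- real k)))
     - (of_real (w \<bullet> v) + of_real (\<delta> * real k)) * of_real (cutoff r ((-1/\<delta>) * (w \<bullet> v) + (- real k))))"
    by (intro Ck_along_diff Ck_along_mult Ck_along_add Ck_along_inner[OF assms(1)] Ck_along_const c)
  moreover have "complex_of_real (\<delta> * smooth_clamp r k ((w \<bullet> v) / \<delta>)) = of_real (w \<bullet> v) - (of_real (w \<bullet> v) - of_real (\<delta> * real k)) * of_real (cutoff r ((1/\<delta>) * (w \<bullet> v) + (- real k)))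
     - (of_real (w \<bullet> v) + of_real (\<delta> * real k)) * of_real (cutoff r ((-1/\<delta>) * (w \<bullet> v) + (- real k)))" for w
  proof -
    define x where "x = w \<bullet> v"
    have arg: "(1/\<delta>) * x + (- real k) = x / \<delta> - real k" "(-1/\<delta>) * x + (- real k) = - (x / \<delta>) - real k" by simp_all
    define c1 where "c1 = cutoff r (x / \<delta> - real k)"
    define c2 where "c2 = cutoff r (- (x / \<delta>) - real k)"
    have "\<delta> * smooth_clamp r k (x / \<delta>) = x - (x - \<delta> * real k) * c1 - (x + \<delta> * real k) * c2"
    proof -
      have cx: "smooth_clamp r k (x / \<delta>) = x / \<delta> - (x / \<delta> - real k) * c1 - (x / \<delta> + real k) * c2"
        by (simp add: smooth_clamp_def c1_def c2_def)
      show ?thesis unfolding cx using assms(2) by (simp add: field_simps)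
    qed
    then show ?thesis unfolding x_def[symmetric] arg c1_def[symmetric] c2_def[symmetric]
      by (simp only: of_real_diff of_real_mult of_real_add)
  qed
  ultimately show ?thesis by simp
qed

lemma smooth_clamp_cont: "continuous_on UNIV (smooth_clamp r k)"
proof -
  have "continuous_on UNIV (\<lambda>w::plane. complex_of_real (1 * smooth_clamp r k ((w \<bullet> e1) / 1)))"
    by (rule Ck_along_continuous[OF Ck_along_smooth_clamp]) auto
  then have "continuous_on UNIV (\<lambda>x::real. Re (complex_of_real (1 * smooth_clamp r k (((x, 0::real) \<bullet> e1) / 1))))"
    by (intro continuous_on_Re) (rule continuous_on_compose2, auto intro!: continuous_intros)
  then show ?thesis by simp
qed

lemma projection_mv:
  fixes a x :: cvec
  shows "(\<chi> i j. a $ i * cnj (a $ j)) *v x = (cnj (a $ 1) * x $ 1 + cnj (a $ 2) * x $ 2) *s a"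
  by (simp add: vec_eq_iff matrix_vector_mult_2 algebra_simps)

lemma projection_fix:
  fixes a :: cvec
  assumes "norm a = 1"
  shows "(\<chi> i j. a $ i * cnj (a $ j)) *v (c *s a) = c *s a"
proof -
  have "a $ 1 * cnj (a $ 1) + a $ 2 * cnj (a $ 2) = 1"
    using norm_sq_complex[of a] assms by simp
  then have "cnj (a $ 1) * (c * a $ 1) + cnj (a $ 2) * (c * a $ 2) = c"
    by (metis (no_types, lifting) distrib_left mult.commute mult.left_commute mult.right_neutral)
  then show ?thesis unfolding projection_mv by simp
qed

lemma norm_le_components: "norm (x::cvec) \<le> cmod (x $ 1) + cmod (x $ 2)"
proof (rule power2_le_imp_le)
  show "(norm x)\<^sup>2 \<le> (cmod (x $ 1) + cmod (x $ 2))\<^sup>2"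
    unfolding norm_cvec by (simp add: power2_sum)
qed simp

text \<open>Parallel transport by projections. Exhaust the plane by squares of half side \<open>\<delta> * k\<close>, with \<open>\<gamma> k\<close> a
  smooth retraction to roughly the \<open>k\<close>-th square acting on each coordinate separately. Starting from
  a vector at the origin, project successively onto the lines over \<open>\<gamma> 0 w\<close>, \<open>\<gamma> 1 w\<close>, and so on.
  Consecutive points are so close that no projection kills the vector, and over a fixed square the
  process becomes stationary, so differentiability passes to the limit.\<close>

lemma smooth_unit_frame:
  fixes a :: "plane \<Rightarrow> cvec"
  assumes unit: "\<And>w. norm (a w) = 1"
    and UAp: "\<And>i j. analytic_along e1 (\<lambda>w. a w $ i * cnj (a w $ j))" "\<And>i j. analytic_along e2 (\<lambda>w. a w $ i * cnj (a w $ j))"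
    and cont: "\<And>i j. continuous_on UNIV (\<lambda>w. a w $ i * cnj (a w $ j))"
  obtains e where "\<And>w. norm (e w) = 1" "\<And>w. \<exists>c. e w = c *s a w"
    "\<And>i. Ck_along e1 r (\<lambda>w. e w $ i)" "\<And>i. Ck_along e2 r (\<lambda>w. e w $ i)"
proof -
  define p where "p w i j = a w $ i * cnj (a w $ j)" for w and i j :: 2
  define P where "P w = (\<chi> i j. p w i j)" for w
  have Pmv: "P w *v x = (cnj (a w $ 1) * x $ 1 + cnj (a w $ 2) * x $ 2) *s a w" for w x
    unfolding P_def p_def by (rule projection_mv)
  have Pfix: "P w *v (c *s a w) = c *s a w" for w c
    unfolding P_def p_def by (rule projection_fix[OF unit])
  have "\<exists>\<eta>>0. \<forall>i j w t. \<bar>t\<bar> \<le> \<eta> \<longrightarrow> cmod (p (w + t *\<^sub>R v) i j - p w i j) \<le> 1/16"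
    if v: "v = e1 \<or> v = e2" for v
  proof -
    have "\<forall>i j. \<exists>\<eta>>0. \<forall>w t. \<bar>t\<bar> \<le> \<eta> \<longrightarrow> cmod (p (w + t *\<^sub>R v) i j - p w i j) \<le> 1/16"
    proof (intro allI)
      fix i j
      have "analytic_along v (\<lambda>w. p w i j)" unfolding p_def using v UAp by blast
      then obtain \<eta> where "\<eta> > 0" "\<And>w t. \<bar>t\<bar> \<le> \<eta> \<Longrightarrow> cmod (p (w + t *\<^sub>R v) i j - p w i j) \<le> 1/16"
        by (rule analytic_along_small[where e = "1/16"]) auto
      then show "\<exists>\<eta>>0. \<forall>w t. \<bar>t\<bar> \<le> \<eta> \<longrightarrow> cmod (p (w + t *\<^sub>R v) i j - p w i j) \<le> 1/16" by blast
    qed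
    then obtain \<eta> where \<eta>: "\<And>i j. \<eta> i j > 0"
      "\<And>i j w t. \<bar>t\<bar> \<le> \<eta> i j \<Longrightarrow> cmod (p (w + t *\<^sub>R v) i j - p w i j) \<le> 1/16" by metis
    define \<eta>' where "\<eta>' = min (min (\<eta> 1 1) (\<eta> 1 2)) (min (\<eta> 2 1) (\<eta> 2 2))"
    have "\<eta>' \<le> \<eta> i j" for i j using exhaust_2[of i] exhaust_2[of j] by (auto simp: \<eta>'_def)
    then have "\<forall>i j w t. \<bar>t\<bar> \<le> \<eta>' \<longrightarrow> cmod (p (w + t *\<^sub>R v) i j - p w i j) \<le> 1/16"
      using \<eta>(2) order_trans by blast
    moreover have "\<eta>' > 0" using \<eta>(1) by (simp add: \<eta>'_def)
    ultimately show ?thesis by blast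
  qed
  note small = this
  obtain \<eta>1 where \<eta>1: "\<eta>1 > 0" "\<And>i j w t. \<bar>t\<bar> \<le> \<eta>1 \<Longrightarrow> cmod (p (w + t *\<^sub>R e1) i j - p w i j) \<le> 1/16"
    using small[of e1] by blast
  obtain \<eta>2 where \<eta>2: "\<eta>2 > 0" "\<And>i j w t. \<bar>t\<bar> \<le> \<eta>2 \<Longrightarrow> cmod (p (w + t *\<^sub>R e2) i j - p w i j) \<le> 1/16"
    using small[of e2] by blast
  define \<delta> where "\<delta> = min \<eta>1 \<eta>2 / 2"
  have \<delta>: "\<delta> > 0" "2 * \<delta> \<le> \<eta>1" "2 * \<delta> \<le> \<eta>2" using \<eta>1 \<eta>2 by (auto simp: \<delta>_def)
  have near: "cmod (p w' i j - p w i j) \<le> 1/8"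
    if "\<bar>fst w' - fst w\<bar> \<le> 2 * \<delta>" "\<bar>snd w' - snd w\<bar> \<le> 2 * \<delta>" for w w' i j
  proof -
    let ?s = "fst w' - fst w" and ?t = "snd w' - snd w"
    have eq: "(w + ?s *\<^sub>R e1) + ?t *\<^sub>R e2 = w'" by (simp add: prod_eq_iff)
    have "cmod (p ((w + ?s *\<^sub>R e1) + ?t *\<^sub>R e2) i j - p (w + ?s *\<^sub>R e1) i j) \<le> 1/16"
      by (rule \<eta>2(2)) (use that \<delta> in linarith)
    moreover have "cmod (p (w + ?s *\<^sub>R e1) i j - p w i j) \<le> 1/16"
      by (rule \<eta>1(2)) (use that \<delta> in linarith)
    ultimately show ?thesis unfolding eq
      using norm_triangle_ineq[of "p w' i j - p (w + ?s *\<^sub>R e1) i j" "p (w + ?s *\<^sub>R e1) i j - p w i j"] by simp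
  qed
  have step: "P w' *v (c *s a w) \<noteq> 0"
    if "\<bar>fst w' - fst w\<bar> \<le> 2 * \<delta>" "\<bar>snd w' - snd w\<bar> \<le> 2 * \<delta>" "c \<noteq> 0" for w w' c
  proof
    assume z: "P w' *v (c *s a w) = 0"
    define x where "x = c *s a w"
    have comp: "cmod ((P w' *v x - P w *v x) $ i) \<le> norm x / 4" for i
    proof -
      have "(P w' *v x - P w *v x) $ i = (p w' i 1 - p w i 1) * x $ 1 + (p w' i 2 - p w i 2) * x $ 2"
        by (simp add: matrix_vector_mult_2 P_def algebra_simps)
      also have "cmod \<dots> \<le> cmod (p w' i 1 - p w i 1) * cmod (x $ 1) + cmod (p w' i 2 - p w i 2) * cmod (x $ 2)"
        by (metis norm_mult norm_triangle_ineq)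
      also have "\<dots> \<le> 1/8 * norm x + 1/8 * norm x"
        by (intro add_mono mult_mono near that component_le_norm) auto
      finally show ?thesis by simp
    qed
    have "norm x = norm (P w' *v x - P w *v x)" using z Pfix[of w c] by (simp add: x_def)
    also have "\<dots> \<le> norm x / 4 + norm x / 4" by (rule order_trans[OF norm_le_components]) (intro add_mono comp)
    finally have "norm x \<le> 0" by simp
    then show False using that(3) unit[of w] by (simp add: x_def norm_smult)
  qed
  define \<gamma> where "\<gamma> k w = (\<delta> * smooth_clamp r k (fst w / \<delta>), \<delta> * smooth_clamp r k (snd w / \<delta>))" for k and w :: plane
  define E where "E = rec_nat (\<lambda>w. P (\<gamma> 0 w) *v a 0) (\<lambda>k F w. P (\<gamma> (Suc k) w) *v F w)"
  have E0: "E 0 w = P (\<gamma> 0 w) *v a 0" and ES: "E (Suc k) w = P (\<gamma> (Suc k) w) *v E k w" for k w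
    by (simp_all add: E_def)
  have Eform: "\<exists>c. c \<noteq> 0 \<and> E k w = c *s a (\<gamma> k w)" for k w
  proof (induction k)
    case 0
    have b: "\<bar>\<delta> * smooth_clamp r 0 x\<bar> \<le> 2 * \<delta>" for x
      using smooth_clamp_0[of r x] \<delta>(1) by (simp add: abs_mult mult.commute)
    have "P (\<gamma> 0 w) *v (1 *s a 0) \<noteq> 0" by (rule step) (use b in \<open>auto simp: \<gamma>_def\<close>)
    then show ?case unfolding E0 using Pmv[of "\<gamma> 0 w" "a 0"] by (metis vec.scale_zero_left vec.scale_one)
  next
    case (Suc k)
    then obtain c where c: "c \<noteq> 0" "E k w = c *s a (\<gamma> k w)" by blast
    have b: "\<bar>\<delta> * smooth_clamp r (Suc k) x - \<delta> * smooth_clamp r k x\<bar> \<le> 2 * \<delta>" for x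
      using smooth_clamp_step[of r k x] \<delta>(1) by (simp add: abs_mult mult.commute right_diff_distrib[symmetric])
    have "P (\<gamma> (Suc k) w) *v E k w \<noteq> 0" unfolding c(2) by (rule step) (use b c(1) in \<open>auto simp: \<gamma>_def\<close>)
    then show ?case unfolding ES using Pmv[of "\<gamma> (Suc k) w" "E k w"] by (metis vec.scale_zero_left)
  qed
  have \<gamma>id: "\<gamma> j w = w" if "\<bar>fst w\<bar> \<le> \<delta> * real k" "\<bar>snd w\<bar> \<le> \<delta> * real k" "k \<le> j" for j k w
  proof -
    have "\<delta> * real k \<le> \<delta> * real j" using that(3) \<delta>(1) by simp
    then have "\<bar>fst w\<bar> \<le> \<delta> * real j" "\<bar>snd w\<bar> \<le> \<delta> * real j" using that(1,2) by linarith+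
    then have "\<bar>fst w / \<delta>\<bar> \<le> real j" "\<bar>snd w / \<delta>\<bar> \<le> real j"
      using \<delta>(1) by (simp_all add: divide_le_eq mult.commute)
    then show ?thesis using \<delta>(1) by (simp add: \<gamma>_def smooth_clamp_id)
  qed
  have stab: "E j w = E k w" if "\<bar>fst w\<bar> \<le> \<delta> * real k" "\<bar>snd w\<bar> \<le> \<delta> * real k" "k \<le> j" for j k w
    using that(3)
  proof (induction j rule: dec_induct)
    case (step n)
    obtain c where "E n w = c *s a (\<gamma> n w)" using Eform by blast
    then have "E n w = c *s a w" using \<gamma>id[OF that(1,2) step(1)] by simp
    moreover have "\<gamma> (Suc n) w = w" using \<gamma>id[OF that(1,2)] step(1) by simp
    ultimately have "E (Suc n) w = E n w" unfolding ES by (simp add: Pfix)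
    then show ?case using step.IH by simp
  qed simp
  define K where "K w = nat \<lceil>(\<bar>fst w\<bar> + \<bar>snd w\<bar>) / \<delta>\<rceil>" for w :: plane
  have K: "\<bar>fst w\<bar> \<le> \<delta> * real (K w)" "\<bar>snd w\<bar> \<le> \<delta> * real (K w)" for w
  proof -
    have "(\<bar>fst w\<bar> + \<bar>snd w\<bar>) / \<delta> \<le> real (K w)" unfolding K_def by linarith
    then have "\<bar>fst w\<bar> + \<bar>snd w\<bar> \<le> \<delta> * real (K w)" using \<delta>(1) by (simp add: divide_le_eq mult.commute)
    then show "\<bar>fst w\<bar> \<le> \<delta> * real (K w)" "\<bar>snd w\<bar> \<le> \<delta> * real (K w)" by linarith+
  qed
  define F where "F w = E (K w) w" for w
  have FE: "F w = E k w" if "\<bar>fst w\<bar> \<le> \<delta> * real k" "\<bar>snd w\<bar> \<le> \<delta> * real k" for k w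
  proof -
    have "E (max k (K w)) w = E k w" by (rule stab[OF that]) simp
    moreover have "E (max k (K w)) w = E (K w) w" by (rule stab[OF K]) simp
    ultimately show ?thesis by (simp add: F_def)
  qed
  have Fform: "\<exists>c. c \<noteq> 0 \<and> F w = c *s a w" for w
    using Eform[of "K w" w] \<gamma>id[OF K, of w "K w"] by (simp add: F_def)
  have F0: "F w \<noteq> 0" for w
  proof -
    obtain c where "c \<noteq> 0" "F w = c *s a w" using Fform by blast
    then have "norm (F w) = cmod c" by (simp add: norm_smult unit)
    then show ?thesis using \<open>c \<noteq> 0\<close> by auto
  qed
  have \<gamma>c: "continuous_on UNIV (\<gamma> k)" for k
    unfolding \<gamma>_def by (intro continuous_intros continuous_on_compose2[OF smooth_clamp_cont]) (use \<delta>(1) in auto)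
  have Cp: "Ck_along v r (\<lambda>w. p (\<gamma> k w) i j)" if v: "v = e1 \<or> v = e2" for v k i j
  proof (rule Ck_along_reparam[where p = "\<lambda>x. \<delta> * smooth_clamp r k (x / \<delta>)", OF _ Ck_along_smooth_clamp _ \<gamma>c])
    show "Ck_along v r (\<lambda>w. p w i j)" unfolding p_def using v UAp cont analytic_along_imp_Ck_along by blast
    show "v \<bullet> v = 1" "v \<bullet> v = 1" using v by auto
    show "\<gamma> k (w + t *\<^sub>R v) = \<gamma> k w + (\<delta> * smooth_clamp r k ((w \<bullet> v + t) / \<delta>) - \<delta> * smooth_clamp r k ((w \<bullet> v) / \<delta>)) *\<^sub>R v" for w t
      using v by (auto simp: \<gamma>_def inner_prod_def)
  qed (use \<delta> in simp)
  have CE: "Ck_along v r (\<lambda>w. E k w $ i)" if v: "v = e1 \<or> v = e2" for v k i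
  proof (induction k arbitrary: i)
    case 0
    have "Ck_along v r (\<lambda>w. p (\<gamma> 0 w) i 1 * a 0 $ 1 + p (\<gamma> 0 w) i 2 * a 0 $ 2)"
      by (intro Ck_along_add Ck_along_mult Cp v Ck_along_const)
    then show ?case by (simp add: E0 matrix_vector_mult_2 P_def)
  next
    case (Suc k)
    have "Ck_along v r (\<lambda>w. p (\<gamma> (Suc k) w) i 1 * E k w $ 1 + p (\<gamma> (Suc k) w) i 2 * E k w $ 2)"
      by (intro Ck_along_add Ck_along_mult Cp v Suc)
    then show ?case by (simp add: ES matrix_vector_mult_2 P_def)
  qed
  have CF: "Ck_along v r (\<lambda>w. F w $ i)" if v: "v = e1 \<or> v = e2" for v i
  proof (rule Ck_along_local)
    fix w0 :: plane
    define k where "k = Suc (K w0)"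
    have "\<delta> * real (K w0) < \<delta> * real k" using \<delta>(1) by (simp add: k_def)
    then have "w0 \<in> {w. \<bar>fst w\<bar> < \<delta> * real k} \<inter> {w. \<bar>snd w\<bar> < \<delta> * real k}"
      using K[of w0] by auto
    moreover have "open ({w :: plane. \<bar>fst w\<bar> < \<delta> * real k} \<inter> {w. \<bar>snd w\<bar> < \<delta> * real k})"
      by (intro open_Int open_Collect_less continuous_intros)
    moreover have "\<forall>w \<in> {w. \<bar>fst w\<bar> < \<delta> * real k} \<inter> {w. \<bar>snd w\<bar> < \<delta> * real k}. F w $ i = E k w $ i"
      by (intro ballI arg_cong[where f = "\<lambda>x. x $ i"] FE) simp_all
    ultimately show "\<exists>S f'. open S \<and> w0 \<in> S \<and> Ck_along v r f' \<and> (\<forall>w\<in>S. F w $ i = f' w)"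
      using CE[OF v] by blast
  qed
  define L where "L w = complex_of_real (ln ((norm (F w))\<^sup>2))" for w
  have eL: "F w $ 1 * cnj (F w $ 1) + F w $ 2 * cnj (F w $ 2) = exp (L w)" for w
    unfolding norm_sq_complex[symmetric] L_def using F0[of w] by (simp only: exp_of_real) simp
  have Fc: "continuous_on UNIV (\<lambda>w. F w $ i)" for i by (rule Ck_along_continuous[OF CF[of e1]]) simp
  have nF: "(norm (F w))\<^sup>2 = Re (F w $ 1 * cnj (F w $ 1) + F w $ 2 * cnj (F w $ 2))" for w
    unfolding norm_sq_complex[symmetric] by simp
  have Lc: "continuous_on UNIV L"
  proof -
    have "continuous_on UNIV (\<lambda>w. (norm (F w))\<^sup>2)" unfolding nF by (intro continuous_intros Fc)
    then show ?thesis unfolding L_def using F0 by (intro continuous_on_of_real continuous_on_ln) simp_all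
  qed
  have CL: "Ck_along v r L" if v: "v = e1 \<or> v = e2" for v
    by (rule Ck_along_log[OF _ Lc eL]) (intro Ck_along_add Ck_along_mult Ck_along_cnj CF v)
  define e where "e w = exp (- (1/2) * L w) *s F w" for w
  have ex: "exp (- (1/2) * L w) = complex_of_real (inverse (norm (F w)))" for w
  proof -
    have "exp (- (1/2) * L w) = complex_of_real (exp (- (1/2) * ln ((norm (F w))\<^sup>2)))"
      by (simp add: L_def exp_of_real[symmetric])
    also have "exp (- (1/2) * ln ((norm (F w))\<^sup>2)) = inverse (norm (F w))"
    proof -
      have "ln ((norm (F w))\<^sup>2) = 2 * ln (norm (F w))" using F0[of w] by (simp add: ln_realpow)
      then have "- (1/2) * ln ((norm (F w))\<^sup>2) = - ln (norm (F w))" by simp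
      then show ?thesis using F0[of w] by (simp only: exp_minus) simp
    qed
    finally show ?thesis .
  qed
  show thesis
  proof (rule that[of e])
    show "norm (e w) = 1" for w using F0[of w] unfolding e_def ex norm_smult by (simp add: norm_inverse)
    show "\<exists>c. e w = c *s a w" for w using Fform[of w] by (auto simp: e_def)
    have "Ck_along v r (\<lambda>w. e w $ i)" if v: "v = e1 \<or> v = e2" for v i
      unfolding e_def vector_smult_component by (intro Ck_along_mult Ck_along_exp Ck_along_const CL CF v)
    then show "Ck_along e1 r (\<lambda>w. e w $ i)" "Ck_along e2 r (\<lambda>w. e w $ i)" for i by blast+
  qed
qed

text \<open>Cut \<open>L\<close> by a plateau function into a part \<open>fp\<close> vanishing for \<open>w \<bullet> u \<le> 0\<close> and a part \<open>fm\<close>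
  vanishing for \<open>w \<bullet> u \<ge> 1\<close>. The sum of the translates of \<open>fp\<close> by positive multiples of \<open>u\<close>
  minus the sum of the translates of \<open>fm\<close> by nonpositive multiples is locally finite and telescopes
  to \<open>L\<close>. The last two conclusions hold because the plateau function is real and does not depend on the
  coordinate orthogonal to \<open>u\<close>.\<close>

lemma difference_equation:
  assumes L: "Ck_along e1 r L" "Ck_along e2 r L" and u: "(u, u') = (e1, e2) \<or> (u, u') = (e2, e1)"
  obtains h where "Ck_along e1 r h" "Ck_along e2 r h" "\<And>w. h (w + u) - h w = L w"
    "(\<And>w. L (w + u') = L w) \<Longrightarrow> (\<And>w. h (w + u') = h w)"
    "(\<And>w. Re (L w) = 0) \<Longrightarrow> (\<And>w. Re (h w) = 0)"
proof -
  have uu: "u \<bullet> u = 1" "u' \<bullet> u = 0" using u by auto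
  define fp where "fp w = complex_of_real (cutoff r (1 * (w \<bullet> u) + 0)) * L w" for w
  define fm where "fm w = (1 - complex_of_real (cutoff r (1 * (w \<bullet> u) + 0))) * L w" for w
  have cut: "Ck_along v r (\<lambda>w. complex_of_real (cutoff r (1 * (w \<bullet> u) + 0)))" if v: "v = u \<or> v = u'" for v
  proof (cases "v = u")
    case True
    then show ?thesis using cutoff_Ck_along[OF uu(1)] by blast
  next
    case False
    then have v: "v = u'" using v by blast
    show ?thesis
    proof (rule Ck_along_along_const)
      show "continuous_on UNIV (\<lambda>w. complex_of_real (cutoff r (1 * (w \<bullet> u) + 0)))"
        by (rule Ck_along_continuous[OF cutoff_Ck_along[OF uu(1)]])
    qed (simp add: v inner_add_left uu)
  qed
  have L': "Ck_along v r L" if "v = u \<or> v = u'" for v using that L u by auto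
  have Cfp: "Ck_along v r fp" "Ck_along v r fm" if v: "v = u \<or> v = u'" for v
    unfolding fp_def fm_def by (intro Ck_along_mult Ck_along_diff Ck_along_const cut[OF v] L'[OF v])+
  have fp0: "fp w = 0" if "w \<bullet> u \<le> 0" for w using that by (simp add: fp_def cutoff_0)
  have fm0: "fm w = 0" if "w \<bullet> u \<ge> 1" for w using that by (simp add: fm_def cutoff_1)
  have fpm: "fp w + fm w = L w" for w by (simp add: fp_def fm_def algebra_simps)
  define S where "S N w = (\<Sum>n<N. fp (w + (- real (Suc n)) *\<^sub>R u) - fm (w + real n *\<^sub>R u))" for N :: nat and w
  have stab: "S M w = S N w" if N: "real N \<ge> \<bar>w \<bullet> u\<bar> + 1" "M \<ge> N" for M N w
    using N(2)
  proof (induction M rule: dec_induct)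
    case (step n)
    have "fp (w + (- real (Suc n)) *\<^sub>R u) = 0" by (rule fp0) (use N(1) step(1) uu in \<open>simp add: inner_add_left\<close>)
    moreover have "fm (w + real n *\<^sub>R u) = 0" by (rule fm0) (use N(1) step(1) uu in \<open>simp add: inner_add_left\<close>)
    ultimately have "S (Suc n) w = S n w" by (simp add: S_def)
    then show ?case using step.IH by simp
  qed simp
  define K where "K w = nat \<lceil>\<bar>w \<bullet> u\<bar>\<rceil> + 1" for w
  have K: "real (K w) \<ge> \<bar>w \<bullet> u\<bar> + 1" for w unfolding K_def by linarith
  define h where "h w = S (K w) w" for w
  have hS: "h w = S N w" if "real N \<ge> \<bar>w \<bullet> u\<bar> + 1" for N w
    using stab[OF that, of "max N (K w)"] stab[OF K, of w "max N (K w)"] by (simp add: h_def)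
  have CS: "Ck_along v r (S N)" if v: "v = u \<or> v = u'" for v N
    unfolding S_def by (intro Ck_along_sum Ck_along_diff Ck_along_translate Cfp[OF v])
  have Ch: "Ck_along v r h" if v: "v = u \<or> v = u'" for v
  proof (rule Ck_along_local)
    fix w0 :: plane
    define N where "N = Suc (K w0)"
    have "w0 \<in> {w. \<bar>w \<bullet> u\<bar> + 1 < real N}" using K[of w0] by (simp add: N_def)
    moreover have "open {w :: plane. \<bar>w \<bullet> u\<bar> + 1 < real N}" by (intro open_Collect_less continuous_intros)
    moreover have "\<forall>w\<in>{w. \<bar>w \<bullet> u\<bar> + 1 < real N}. h w = S N w" using hS by simp
    ultimately show "\<exists>T f'. open T \<and> w0 \<in> T \<and> Ck_along v r f' \<and> (\<forall>w\<in>T. h w = f' w)" using CS[OF v] by blast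
  qed
  have diff: "h (w + u) - h w = L w" for w
  proof -
    define N where "N = K w + 2"
    have N: "real N \<ge> \<bar>w \<bullet> u\<bar> + 3" using K[of w] by (simp add: N_def)
    have hu: "h (w + u) = S N (w + u)" "h w = S N w" by (rule hS, use N uu in \<open>simp add: inner_add_left\<close>)+
    have sh1: "w + u + (- real (Suc n)) *\<^sub>R u = w + (- real n) *\<^sub>R u" "w + u + real n *\<^sub>R u = w + real (Suc n) *\<^sub>R u" for n
      by (simp_all add: algebra_simps)
    have "S N (w + u) - S N w = (\<Sum>n<N. (fp (w + (- real n) *\<^sub>R u) - fp (w + (- real (Suc n)) *\<^sub>R u)) +
        (fm (w + real n *\<^sub>R u) - fm (w + real (Suc n) *\<^sub>R u)))"
      unfolding S_def sh1 sum_subtractf[symmetric] by (intro sum.cong refl) simp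
    also have "\<dots> = (fp w - fp (w + (- real N) *\<^sub>R u)) + (fm w - fm (w + real N *\<^sub>R u))"
      unfolding sum.distrib
      using sum_lessThan_telescope'[of "\<lambda>n. fp (w + (- real n) *\<^sub>R u)" N] sum_lessThan_telescope'[of "\<lambda>n. fm (w + real n *\<^sub>R u)" N]
      by simp
    also have "fp (w + (- real N) *\<^sub>R u) = 0" by (rule fp0) (use N uu in \<open>simp add: inner_diff_left\<close>)
    also have "fm (w + real N *\<^sub>R u) = 0" by (rule fm0) (use N uu in \<open>simp add: inner_add_left\<close>)
    finally show ?thesis unfolding hu using fpm by simp
  qed
  show thesis
  proof (rule that[of h])
    show "Ck_along e1 r h" "Ck_along e2 r h" using Ch u by auto
    show "h (w + u) - h w = L w" for w by (rule diff)
    show "h (w + u') = h w" if P: "\<And>w. L (w + u') = L w" for w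
    proof -
      have f: "fp (w + u') = fp w" "fm (w + u') = fm w" for w
        by (simp_all add: fp_def fm_def P inner_add_left uu)
      have sh: "w + u' + c *\<^sub>R u = (w + c *\<^sub>R u) + u'" for c by simp
      have "K (w + u') = K w" by (simp add: K_def inner_add_left uu)
      then show ?thesis unfolding h_def S_def sh f by simp
    qed
    show "Re (h w) = 0" if P: "\<And>w. Re (L w) = 0" for w
      by (simp add: h_def S_def fp_def fm_def P)
  qed
qed

section \<open>Fourier coefficients on the torus\<close>

definition periodic :: "(plane \<Rightarrow> 'a) \<Rightarrow> bool" where
  "periodic f \<longleftrightarrow> (\<forall>w. f (w + e1) = f w \<and> f (w + e2) = f w)"

text \<open>Boundedness everywhere and Borel measurability are convenient side conditions: such functions are
  integrable over the square, and the class is stable under products and translations.\<close>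

definition bdd_borel :: "(plane \<Rightarrow> 'a::{real_normed_vector}) \<Rightarrow> real \<Rightarrow> bool" where
  "bdd_borel f K \<longleftrightarrow> f \<in> borel_measurable borel \<and> (\<forall>w. norm (f w) \<le> K)"

definition mean :: "(plane \<Rightarrow> complex) \<Rightarrow> complex" where
  "mean f = (LINT w:fundamental_square|lborel. f w)"

definition character :: "int \<times> int \<Rightarrow> plane \<Rightarrow> complex" where
  "character n w = cis (2 * pi * (real_of_int (fst n) * fst w + real_of_int (snd n) * snd w))"

definition fcoeff :: "(plane \<Rightarrow> complex) \<Rightarrow> int \<times> int \<Rightarrow> complex" where
  "fcoeff f n = mean (\<lambda>w. f w * cnj (character n w))"

lemma bdd_borelD: "bdd_borel f K \<Longrightarrow> norm (f w) \<le> K"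
  and bdd_borel_measurable: "bdd_borel f K \<Longrightarrow> f \<in> borel_measurable borel"
  unfolding bdd_borel_def by blast+

lemma periodic_int_1:
  assumes "\<And>x::real. h (x + 1) = h x"
  shows "h (x + of_int n) = h x"
proof (induction n rule: int_induct[of _ 0])
  case (step1 i)
  then show ?case using assms[of "x + of_int i"] by (simp add: ac_simps)
next
  case (step2 i)
  then show ?case using assms[of "x + of_int (i - 1)"] by (simp add: ac_simps)
qed simp

lemma periodic_int:
  assumes "periodic f"
  shows "f (x + of_int m, y + of_int n) = f (x, y)"
proof -
  have "f (x + of_int m, y') = f (x, y')" for y'
    using assms by (intro periodic_int_1[of "\<lambda>x. f (x, y')"]) (auto simp: periodic_def)
  moreover have "f (x, y + of_int n) = f (x, y)"
    using assms by (intro periodic_int_1[of "\<lambda>y. f (x, y)"]) (auto simp: periodic_def)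
  ultimately show ?thesis by simp
qed

lemma periodic_frac: "periodic f \<Longrightarrow> f w = f (frac (fst w), frac (snd w))"
  using periodic_int[of f "frac (fst w)" "\<lfloor>fst w\<rfloor>" "frac (snd w)" "\<lfloor>snd w\<rfloor>"] by (simp add: frac_def)

lemma frac_in_square: "(frac x, frac y) \<in> fundamental_square"
  by (simp add: fundamental_square_def frac_lt_1)

lemma square_subset: "fundamental_square \<subseteq> cbox (0, 0) (1, 1)"
  by (auto simp: fundamental_square_def cbox_Pair_eq)

lemma periodic_attains:
  fixes f :: "plane \<Rightarrow> real"
  assumes "periodic f" "continuous_on UNIV f"
  obtains w0 where "\<And>w. f w0 \<le> f w"
proof -
  have "compact (cbox (0,0) (1,1::real) :: plane set)" by simp
  moreover have "cbox (0,0) (1,1::real) \<noteq> ({} :: plane set)"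
    using frac_in_square square_subset by blast
  ultimately obtain w0 where w0: "\<And>w. w \<in> cbox (0,0) (1,1) \<Longrightarrow> f w0 \<le> f w"
    using continuous_attains_inf[of "cbox (0,0) (1,1) :: plane set" f] assms(2) continuous_on_subset
    by (metis subset_UNIV)
  have "f w0 \<le> f w" for w
    unfolding periodic_frac[OF assms(1), of w] by (intro w0 subsetD[OF square_subset frac_in_square])
  then show thesis using that by blast
qed

lemma periodic_bounded:
  fixes f :: "plane \<Rightarrow> 'a::real_normed_vector"
  assumes "periodic f" "continuous_on UNIV f"
  obtains K where "\<And>w. norm (f w) \<le> K" "K > 0"
proof -
  have "periodic (\<lambda>w. - norm (f w))" using assms(1) by (simp add: periodic_def)
  moreover have "continuous_on UNIV (\<lambda>w. - norm (f w))" using assms(2) by (intro continuous_intros)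
  ultimately obtain w0 where w0: "\<And>w. - norm (f w0) \<le> - norm (f w)" using periodic_attains by blast
  show thesis
  proof (rule that[of "norm (f w0) + 1"])
    show "norm (f w) \<le> norm (f w0) + 1" for w using w0[of w] by simp
    show "norm (f w0) + 1 > 0" by (simp add: add_nonneg_pos)
  qed
qed

lemma square_measurable [measurable]: "fundamental_square \<in> sets borel"
  unfolding fundamental_square_def by (intro borel_Times) auto

lemma emeasure_square: "emeasure lborel fundamental_square = 1"
proof -
  have "emeasure (lborel \<Otimes>\<^sub>M lborel) ({0..<1::real} \<times> {0..<1::real}) = 1"
    by (subst lborel.emeasure_pair_measure_Times) auto
  then show ?thesis by (simp add: lborel_prod fundamental_square_def)
qed

lemma bdd_borel_integrable:
  fixes f :: "plane \<Rightarrow> 'a::{banach,second_countable_topology}"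
  shows "bdd_borel f K \<Longrightarrow> set_integrable lborel fundamental_square f"
  unfolding set_integrable_def bdd_borel_def
  by (rule integrableI_bounded_set_indicator[of _ _ _ K]) (auto simp: emeasure_square)

lemma periodic_cont_bdd_borel:
  fixes f :: "plane \<Rightarrow> 'a::{real_normed_vector,second_countable_topology}"
  assumes "periodic f" "continuous_on UNIV f"
  shows "\<exists>K. bdd_borel f K"
  using periodic_bounded[OF assms] borel_measurable_continuous_onI[OF assms(2)] unfolding bdd_borel_def by metis

lemma interval_integrable_1:
  fixes h :: "real \<Rightarrow> complex"
  assumes "h \<in> borel_measurable borel" "\<And>x. norm (h x) \<le> K" "A \<in> sets borel" "A \<subseteq> {a..b}"
  shows "set_integrable lborel A h"
  unfolding set_integrable_def
proof (rule integrableI_bounded_set_indicator[of _ _ _ K])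
  have "emeasure lborel A \<le> emeasure lborel {a..b}" using assms by (intro emeasure_mono) auto
  also have "\<dots> < \<infinity>" by (cases "a \<le> b") auto
  finally show "emeasure lborel A < \<infinity>" .
qed (use assms in auto)

lemma periodic_shift_1:
  fixes h :: "real \<Rightarrow> complex"
  assumes h: "h \<in> borel_measurable borel" "\<And>x. norm (h x) \<le> K" "\<And>x. h (x + 1) = h x"
  shows "(LINT x:{0..<1}|lborel. h (x + t)) = (LINT x:{0..<1}|lborel. h x)"
proof -
  define s where "s = frac t"
  have s: "0 \<le> s" "s < 1" by (simp_all add: s_def frac_lt_1)
  have sh: "(LINT x:A|lborel. h (x + c)) = (LINT x:((+) c ` A)|lborel. h x)" for A c
  proof -
    have "(LINT x:((+) c ` A)|lborel. h x) = (\<integral>x. indicator ((+) c ` A) (c + 1 * x) *\<^sub>R h (c + 1 * x) \<partial>lborel)"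
      unfolding set_lebesgue_integral_def by (subst lborel_integral_real_affine[of 1 _ c]) simp_all
    also have "\<dots> = (LINT x:A|lborel. h (x + c))"
      unfolding set_lebesgue_integral_def
      by (intro Bochner_Integration.integral_cong) (auto simp: indicator_def image_iff add.commute)
    finally show ?thesis ..
  qed
  have "h (x + t) = h (x + s)" for x
    using periodic_int_1[of h "x + s" "\<lfloor>t\<rfloor>"] h(3) by (simp add: s_def frac_def)
  then have "(LINT x:{0..<1}|lborel. h (x + t)) = (LINT x:{0..<1}|lborel. h (x + s))" by simp
  also have "\<dots> = (LINT x:((+) s ` {0..<1})|lborel. h x)" by (rule sh)
  also have "(+) s ` {0..<1} = {s..<1} \<union> {1..<1+s}"
    using s by (subst image_add_atLeastLessThan) auto
  also have "(LINT x:{s..<1} \<union> {1..<1+s}|lborel. h x) = (LINT x:{s..<1}|lborel. h x) + (LINT x:{1..<1+s}|lborel. h x)"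
    using s by (intro set_integral_Un interval_integrable_1[OF h(1,2), of _ 0 2]) auto
  also have "{1..<1+s} = (+) 1 ` {0..<s}" by (subst image_add_atLeastLessThan) auto
  also have "(LINT x:((+) 1 ` {0..<s})|lborel. h x) = (LINT x:{0..<s}|lborel. h x)"
    by (subst sh[symmetric]) (simp add: h(3))
  also have "(LINT x:{s..<1}|lborel. h x) + (LINT x:{0..<s}|lborel. h x) = (LINT x:{0..<s} \<union> {s..<1}|lborel. h x)"
    using s by (subst set_integral_Un) (auto intro!: interval_integrable_1[OF h(1,2), of _ 0 2])
  also have "{0..<s} \<union> {s..<1} = {0..<1}" using s by auto
  finally show ?thesis .
qed

lemma mean_iterated:
  assumes "bdd_borel f K"
  shows "mean f = (LINT x:{0..<1}|lborel. (LINT y:{0..<1}|lborel. f (x, y)))"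
proof -
  have i: "integrable (lborel \<Otimes>\<^sub>M lborel) (\<lambda>w. indicator fundamental_square w *\<^sub>R f w)"
    using bdd_borel_integrable[OF assms] by (simp add: set_integrable_def lborel_prod)
  have "mean f = integral\<^sup>L (lborel \<Otimes>\<^sub>M lborel) (\<lambda>w. indicator fundamental_square w *\<^sub>R f w)"
    by (simp add: mean_def set_lebesgue_integral_def lborel_prod)
  also have "\<dots> = (\<integral>x. (\<integral>y. indicator fundamental_square (x, y) *\<^sub>R f (x, y) \<partial>lborel) \<partial>lborel)"
    by (rule lborel_pair.integral_fst'[OF i, symmetric])
  also have "\<dots> = (LINT x:{0..<1}|lborel. (LINT y:{0..<1}|lborel. f (x, y)))"
    unfolding set_lebesgue_integral_def
    by (intro Bochner_Integration.integral_cong refl) (auto simp: fundamental_square_def indicator_def)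
  finally show ?thesis .
qed

text \<open>Invariance of the integral over the torus is reduced by Fubini's theorem to periodic functions of
  one variable.\<close>

lemma mean_translate:
  assumes "bdd_borel f K" "periodic f"
  shows "mean (\<lambda>w. f (w + t)) = mean f"
proof -
  have fm: "f \<in> borel_measurable (borel \<Otimes>\<^sub>M borel)" using assms by (simp add: bdd_borel_def borel_prod)
  have K: "norm (f w) \<le> K" for w using assms(1) by (rule bdd_borelD)
  have fx: "(\<lambda>y. f (x, y)) \<in> borel_measurable borel" for x
    using fm by (rule measurable_compose[rotated]) simp
  define h where "h x = (LINT y:{0..<1}|lborel. f (x, y))" for x
  have hm: "h \<in> borel_measurable borel"
  proof -
    have "(\<lambda>(x, y). indicator {0..<1::real} y *\<^sub>R f (x, y)) \<in> borel_measurable (borel \<Otimes>\<^sub>M lborel)"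
      using fm by (simp add: split_beta' measurable_lborel1 cong: measurable_cong_sets) measurable
    from lborel.borel_measurable_lebesgue_integral[OF this] show ?thesis
      unfolding h_def[abs_def] set_lebesgue_integral_def by simp
  qed
  have hK: "norm (h x) \<le> K" for x
  proof -
    have "norm (h x) \<le> (LINT y:{0..<1}|lborel. norm (f (x, y)))"
      unfolding h_def by (intro set_integral_norm_bound interval_integrable_1[OF fx K, of _ 0 1]) auto
    also have "\<dots> \<le> (LINT y:{0..<1::real}|lborel. K)"
      by (intro set_integral_mono set_integrable_norm interval_integrable_1[OF fx K, of _ 0 1] K)
         (auto simp: set_integrable_def)
    also have "\<dots> = K" by (simp add: set_lebesgue_integral_def)
    finally show ?thesis .
  qed
  have b2: "bdd_borel (\<lambda>w. f (w + t)) K"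
    unfolding bdd_borel_def using measurable_compose[of "\<lambda>w. w + t" borel borel f borel] bdd_borel_measurable[OF assms(1)] K by simp
  have "mean (\<lambda>w. f (w + t)) = (LINT x:{0..<1}|lborel. (LINT y:{0..<1}|lborel. f (x + fst t, y + snd t)))"
    unfolding mean_iterated[OF b2] by (simp add: plus_prod_def)
  also have "\<dots> = (LINT x:{0..<1}|lborel. h (x + fst t))"
  proof -
    have "(LINT y:{0..<1}|lborel. f (x + fst t, y + snd t)) = h (x + fst t)" for x
      unfolding h_def using assms(2) by (intro periodic_shift_1[OF fx K]) (auto simp: periodic_def)
    then show ?thesis by simp
  qed
  also have "\<dots> = (LINT x:{0..<1}|lborel. h x)"
  proof (rule periodic_shift_1[OF hm hK])
    show "h (x + 1) = h x" for x unfolding h_def using assms(2) by (auto simp: periodic_def)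
  qed
  also have "\<dots> = mean f" unfolding mean_iterated[OF assms(1)] h_def ..
  finally show ?thesis .
qed

lemma character_cont: "continuous_on UNIV (character n)"
  unfolding character_def[abs_def] cis_conv_exp by (intro continuous_intros)

lemma character_norm [simp]: "norm (character n w) = 1" by (simp add: character_def)

lemma character_add: "character n (w + t) = character n w * character n t"
  by (simp add: character_def cis_mult algebra_simps)

lemma character_mult: "character n w * character m w = character (n + m) w"
  by (simp add: character_def cis_mult algebra_simps)

lemma character_cnj: "cnj (character n w) = character (- n) w"
  by (simp add: character_def cis_cnj algebra_simps)

lemma character_zero [simp]: "character 0 w = 1" by (simp add: character_def)

lemma cis_2pi_int: "cis (2 * pi * real_of_int k) = 1"
  using cis_multiple_2pi[of "real_of_int k"] by simp

lemma character_periodic: "periodic (character n)"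
  unfolding periodic_def character_add by (simp add: character_def cis_2pi_int)

lemma bdd_borel_mult:
  fixes f g :: "plane \<Rightarrow> complex"
  assumes "bdd_borel f K" "bdd_borel g L"
  shows "bdd_borel (\<lambda>w. f w * g w) (K * L)"
  unfolding bdd_borel_def
proof safe
  show "(\<lambda>w. f w * g w) \<in> borel_measurable borel" using assms by (auto simp: bdd_borel_def)
  fix w :: plane
  have "0 \<le> K" using assms(1) norm_ge_zero order_trans unfolding bdd_borel_def by blast
  then show "cmod (f w * g w) \<le> K * L" unfolding norm_mult
    by (intro mult_mono bdd_borelD[OF assms(1)] bdd_borelD[OF assms(2)] \<open>0 \<le> K\<close>) simp
qed

lemma bdd_borel_character: "bdd_borel (character n) 1"
  using borel_measurable_continuous_onI[OF character_cont] by (simp add: bdd_borel_def)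

lemma bdd_borel_fcoeff: "bdd_borel f K \<Longrightarrow> bdd_borel (\<lambda>w. f w * cnj (character n w)) K"
  using bdd_borel_mult[OF _ bdd_borel_character, of f K "- n"] by (simp add: character_cnj)

lemma mean_add:
  assumes "bdd_borel f K" "bdd_borel g L"
  shows "mean (\<lambda>w. f w + g w) = mean f + mean g"
  unfolding mean_def using bdd_borel_integrable[OF assms(1)] bdd_borel_integrable[OF assms(2)]
  by (rule set_integral_add(2))

lemma mean_cmult: "mean (\<lambda>w. c * f w) = c * mean f"
  unfolding mean_def by simp

lemma bdd_borel_add:
  assumes "bdd_borel f K" "bdd_borel g L"
  shows "bdd_borel (\<lambda>w. f w + g w :: complex) (K + L)"
  using assms unfolding bdd_borel_def by (auto intro: norm_triangle_mono)

lemma fcoeff_add: "bdd_borel f K \<Longrightarrow> bdd_borel g L \<Longrightarrow> fcoeff (\<lambda>w. f w + g w) n = fcoeff f n + fcoeff g n"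
  unfolding fcoeff_def by (simp add: distrib_right mean_add[OF bdd_borel_fcoeff bdd_borel_fcoeff])

lemma fcoeff_cmult: "fcoeff (\<lambda>w. c * f w) n = c * fcoeff f n"
  unfolding fcoeff_def mult.assoc by (rule mean_cmult)

lemma fcoeff_character_mult: "fcoeff (\<lambda>w. f w * character k w) n = fcoeff f (n - k)"
proof -
  have "character k w * cnj (character n w) = cnj (character (n - k) w)" for w
    by (simp add: character_cnj character_mult)
  then show ?thesis by (simp add: fcoeff_def mult.assoc)
qed

lemma bdd_borel_imp: "bdd_borel f K \<Longrightarrow> \<exists>K. bdd_borel f K" by blast

text \<open>The torus as a subset of a Euclidean space, where the Stone-Weierstrass theorem for real
  polynomials applies.\<close>

definition torus_embed :: "plane \<Rightarrow> complex \<times> complex" where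
  "torus_embed w = (character (1, 0) w, character (0, 1) w)"

lemma torus_embed_cont: "continuous_on UNIV torus_embed"
  unfolding torus_embed_def[abs_def] by (intro continuous_intros character_cont)

text \<open>The coordinates of \<open>torus_embed\<close> are combinations of characters, and multiplication by a
  character shifts the Fourier coefficients. So the functions with vanishing Fourier coefficients
  are stable under multiplication by polynomials in these coordinates. The claim is quantified over
  \<open>f\<close> to let the induction pass through products.\<close>

lemma real_poly_annihilate:
  assumes "real_polynomial_function p"
  shows "\<forall>f. (\<exists>K. bdd_borel f K) \<and> (\<forall>n. fcoeff f n = 0) \<longrightarrow>
    (\<exists>K. bdd_borel (\<lambda>w. f w * of_real (p (torus_embed w))) K) \<and> (\<forall>n. fcoeff (\<lambda>w. f w * of_real (p (torus_embed w))) n = 0)"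
  using assms
proof (induction rule: real_polynomial_function.induct)
  case (linear p)
  interpret bounded_linear p by (rule linear)
  show ?case
  proof (intro allI impI, elim conjE exE)
    fix f K assume f: "bdd_borel f K" "\<forall>n. fcoeff f n = 0"
    define c1 where "c1 = Complex (p (1, 0) / 2) (- p (\<i>, 0) / 2)"
    define c2 where "c2 = Complex (p (0, 1) / 2) (- p (0, \<i>) / 2)"
    have pz: "p (a, b) = Re a * p (1, 0) + Im a * p (\<i>, 0) + (Re b * p (0, 1) + Im b * p (0, \<i>))" for a b
    proof -
      have "(a, b) = Re a *\<^sub>R (1, 0) + Im a *\<^sub>R (\<i>, 0) + (Re b *\<^sub>R (0, 1) + Im b *\<^sub>R (0, \<i>))"
        by (simp add: complex_eq_iff)
      then have "p (a, b) = p (Re a *\<^sub>R (1, 0) + Im a *\<^sub>R (\<i>, 0) + (Re b *\<^sub>R (0, 1) + Im b *\<^sub>R (0, \<i>)))"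
        by simp
      also have "\<dots> = Re a * p (1, 0) + Im a * p (\<i>, 0) + (Re b * p (0, 1) + Im b * p (0, \<i>))"
        by (simp only: add scaleR real_scaleR_def)
      finally show ?thesis .
    qed
    have "of_real (p (torus_embed w)) = (c1 * character (1, 0) w + cnj c1 * character (- (1, 0)) w) + (c2 * character (0, 1) w + cnj c2 * character (- (0, 1)) w)" for w
    proof -
      have "p (torus_embed w) = Re (character (1, 0) w) * p (1, 0) + Im (character (1, 0) w) * p (\<i>, 0)
          + (Re (character (0, 1) w) * p (0, 1) + Im (character (0, 1) w) * p (0, \<i>))"
        unfolding torus_embed_def by (rule pz)
      then show ?thesis
        unfolding character_cnj[symmetric] c1_def c2_def by (simp add: complex_eq_iff)
    qed
    then have eq: "(\<lambda>w. f w * of_real (p (torus_embed w))) = (\<lambda>w. (c1 * (f w * character (1, 0) w) + cnj c1 * (f w * character (- (1, 0)) w))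
       + (c2 * (f w * character (0, 1) w) + cnj c2 * (f w * character (- (0, 1)) w)))"
      by (simp add: fun_eq_iff algebra_simps)
    have b: "bdd_borel (\<lambda>w. c * (f w * character k w)) (norm c * (K * 1))" for c k
      using f(1) by (intro bdd_borel_mult bdd_borel_character) (auto simp: bdd_borel_def)
    have z: "fcoeff (\<lambda>w. c * (f w * character k w)) n = 0" for c k n
      unfolding fcoeff_cmult fcoeff_character_mult f(2)[rule_format] by simp
    show "(\<exists>K. bdd_borel (\<lambda>w. f w * of_real (p (torus_embed w))) K) \<and> (\<forall>n. fcoeff (\<lambda>w. f w * of_real (p (torus_embed w))) n = 0)"
      unfolding eq
      by (intro conjI allI bdd_borel_imp[OF bdd_borel_add[OF bdd_borel_add[OF b b] bdd_borel_add[OF b b]]])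
         (simp add: fcoeff_add[OF bdd_borel_add[OF b b] bdd_borel_add[OF b b]] fcoeff_add[OF b b] z)
  qed
next
  case (const c)
  show ?case
  proof (intro allI impI, elim conjE exE)
    fix f K assume f: "bdd_borel f K" "\<forall>n. fcoeff f n = 0"
    have "bdd_borel (\<lambda>w. of_real c * f w) (norm (complex_of_real c) * K)"
      by (rule bdd_borel_mult[OF _ f(1)]) (auto simp: bdd_borel_def)
    then show "(\<exists>K. bdd_borel (\<lambda>w. f w * of_real c) K) \<and> (\<forall>n. fcoeff (\<lambda>w. f w * of_real c) n = 0)"
      using f(2) fcoeff_cmult[of "of_real c" f] by (auto simp: mult.commute)
  qed
next
  case (add p q)
  show ?case
  proof (intro allI impI)
    fix f assume "(\<exists>K. bdd_borel f K) \<and> (\<forall>n. fcoeff f n = 0)"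
    with add.IH obtain K L where "bdd_borel (\<lambda>w. f w * of_real (p (torus_embed w))) K" "\<forall>n. fcoeff (\<lambda>w. f w * of_real (p (torus_embed w))) n = 0"
      "bdd_borel (\<lambda>w. f w * of_real (q (torus_embed w))) L" "\<forall>n. fcoeff (\<lambda>w. f w * of_real (q (torus_embed w))) n = 0" by meson
    then show "(\<exists>K. bdd_borel (\<lambda>w. f w * of_real (p (torus_embed w) + q (torus_embed w))) K) \<and> (\<forall>n. fcoeff (\<lambda>w. f w * of_real (p (torus_embed w) + q (torus_embed w))) n = 0)"
      by (auto simp: distrib_left fcoeff_add intro!: bdd_borel_imp[OF bdd_borel_add])
  qed
next
  case (mult p q)
  show ?case
  proof (intro allI impI)
    fix f assume "(\<exists>K. bdd_borel f K) \<and> (\<forall>n. fcoeff f n = 0)"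
    with mult.IH(1) have "(\<exists>K. bdd_borel (\<lambda>w. f w * of_real (p (torus_embed w))) K) \<and> (\<forall>n. fcoeff (\<lambda>w. f w * of_real (p (torus_embed w))) n = 0)"
      by meson
    with mult.IH(2) have "(\<exists>K. bdd_borel (\<lambda>w. f w * of_real (p (torus_embed w)) * of_real (q (torus_embed w))) K) \<and>
       (\<forall>n. fcoeff (\<lambda>w. f w * of_real (p (torus_embed w)) * of_real (q (torus_embed w))) n = 0)" by meson
    then show "(\<exists>K. bdd_borel (\<lambda>w. f w * of_real (p (torus_embed w) * q (torus_embed w))) K) \<and> (\<forall>n. fcoeff (\<lambda>w. f w * of_real (p (torus_embed w) * q (torus_embed w))) n = 0)"
      by (simp add: mult.assoc)
  qed
qed

lemma mean_bound:
  assumes "bdd_borel f K"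
  shows "norm (mean f) \<le> K"
proof -
  have "norm (mean f) \<le> (LINT w:fundamental_square|lborel. norm (f w))"
    unfolding mean_def by (intro set_integral_norm_bound bdd_borel_integrable[OF assms])
  also have "\<dots> \<le> (LINT w:fundamental_square|lborel. K)"
    using assms bdd_borel_integrable[OF assms]
    by (intro set_integral_mono set_integrable_norm) (auto simp: bdd_borel_def set_integrable_def emeasure_square)
  also have "\<dots> = K" by (simp add: set_lebesgue_integral_def measure_def emeasure_square)
  finally show ?thesis .
qed

lemma mean_continuous_annihilate:
  assumes f: "bdd_borel f K" "\<And>n. fcoeff f n = 0" and \<phi>: "continuous_on UNIV (\<phi> :: complex \<times> complex \<Rightarrow> real)"
  shows "mean (\<lambda>w. f w * of_real (\<phi> (torus_embed w))) = 0"
proof -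
  have K: "K \<ge> 0" using f(1) norm_ge_zero order_trans unfolding bdd_borel_def by blast
  have "norm (mean (\<lambda>w. f w * of_real (\<phi> (torus_embed w)))) \<le> K * e" if e: "e > 0" for e
  proof -
    have co: "compact (sphere 0 1 \<times> sphere 0 (1::real) :: (complex \<times> complex) set)"
      by (intro compact_Times) auto
    obtain p where p: "real_polynomial_function p"
      "\<And>x. x \<in> sphere 0 1 \<times> sphere 0 1 \<Longrightarrow> \<bar>\<phi> x - p x\<bar> < e"
      using Stone_Weierstrass_real_polynomial_function[OF co continuous_on_subset[OF \<phi>] e] by auto
    have torS: "torus_embed w \<in> sphere 0 1 \<times> sphere 0 1" for w by (simp add: torus_embed_def)
    have P: "\<exists>K. bdd_borel (\<lambda>w. f w * of_real (p (torus_embed w))) K" "fcoeff (\<lambda>w. f w * of_real (p (torus_embed w))) 0 = 0"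
      using real_poly_annihilate[OF p(1)] f by blast+
    then obtain L where L: "bdd_borel (\<lambda>w. f w * of_real (p (torus_embed w))) L" by blast
    have pc: "continuous_on UNIV p" using p(1)
      by (intro continuous_on_polymonial_function) (simp add: real_polynomial_function_eq)
    have dm: "(\<lambda>w. complex_of_real (\<phi> (torus_embed w) - p (torus_embed w))) \<in> borel_measurable borel"
      by (intro borel_measurable_continuous_onI continuous_intros continuous_on_compose2[OF \<phi> torus_embed_cont]
          continuous_on_compose2[OF pc torus_embed_cont]) auto
    have D: "bdd_borel (\<lambda>w. f w * of_real (\<phi> (torus_embed w) - p (torus_embed w))) (K * e)"
    proof (rule bdd_borel_mult[OF f(1)])
      show "bdd_borel (\<lambda>w. complex_of_real (\<phi> (torus_embed w) - p (torus_embed w))) e"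
        using dm p(2)[OF torS] unfolding bdd_borel_def norm_of_real by (auto intro: less_imp_le)
    qed
    have "mean (\<lambda>w. f w * of_real (\<phi> (torus_embed w))) =
       mean (\<lambda>w. f w * of_real (\<phi> (torus_embed w) - p (torus_embed w)) + f w * of_real (p (torus_embed w)))"
      by (simp add: algebra_simps)
    also have "\<dots> = mean (\<lambda>w. f w * of_real (\<phi> (torus_embed w) - p (torus_embed w)))"
      unfolding mean_add[OF D L] using P(2) by (simp add: fcoeff_def)
    finally show ?thesis using mean_bound[OF D] by simp
  qed
  note bnd = this
  have "norm (mean (\<lambda>w. f w * of_real (\<phi> (torus_embed w)))) \<le> 0"
  proof (rule field_le_epsilon)
    fix e :: real assume e: "e > 0"
    have "norm (mean (\<lambda>w. f w * of_real (\<phi> (torus_embed w)))) \<le> K * (e / (K + 1))"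
      by (rule bnd) (use e K in simp)
    also have "\<dots> \<le> e" using e K by (simp add: field_simps)
    finally show "norm (mean (\<lambda>w. f w * of_real (\<phi> (torus_embed w)))) \<le> 0 + e" by simp
  qed
  then show ?thesis by simp
qed

lemma cis_eqD:
  assumes "cis (2 * pi * x) = cis (2 * pi * y)"
  obtains n :: int where "x = y + of_int n"
proof -
  have "sin (2 * pi * x) = sin (2 * pi * y) \<and> cos (2 * pi * x) = cos (2 * pi * y)"
    using assms by (simp add: complex_eq_iff)
  then obtain n :: int where "2 * pi * x = 2 * pi * y + 2 * pi * of_int n"
    using sin_cos_eq_iff[of "2 * pi * x" "2 * pi * y"] by (auto simp: mult_ac)
  then have "2 * pi * x = 2 * pi * (y + of_int n)" by (simp add: distrib_left)
  then have "x = y + of_int n" by simp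
  then show thesis by (rule that)
qed

lemma torus_embed_inj: "inj_on torus_embed fundamental_square"
proof (rule inj_onI)
  fix w w' assume w: "w \<in> fundamental_square" "w' \<in> fundamental_square" "torus_embed w = torus_embed w'"
  have *: "x = y" if xy: "0 \<le> x" "x < 1" "0 \<le> y" "y < 1" and e: "cis (2 * pi * x) = cis (2 * pi * y)" for x y :: real
  proof -
    obtain n :: int where n: "x = y + of_int n" using cis_eqD[OF e] by blast
    then have "real_of_int n < 1" "-1 < real_of_int n" using xy by linarith+
    then have "n = 0" by linarith
    then show ?thesis using n by simp
  qed
  have "fst w = fst w'" "snd w = snd w'"
    using w by (auto intro!: * simp: torus_embed_def character_def fundamental_square_def)
  then show "w = w'" by (rule prod_eqI)
qed

text \<open>The indicator of a compact subset of the square is the limit of continuous functions of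
  \<open>torus_embed\<close>; this uses that \<open>torus_embed\<close> is injective on the half open square.\<close>

lemma compact_integral_zero:
  assumes f: "bdd_borel f K" "\<And>n. fcoeff f n = 0" and C: "compact C" "C \<subseteq> fundamental_square"
  shows "(LINT w:C|lborel. f w) = 0"
proof (cases "C = {}")
  case False
  define D where "D = torus_embed ` C"
  have D: "compact D" "D \<noteq> {}" unfolding D_def
    using False C(1) compact_continuous_image[OF continuous_on_subset[OF torus_embed_cont]] by auto
  define \<phi> where "\<phi> k x = max 0 (1 - real k * infdist x D)" for k :: nat and x
  have \<phi>c: "continuous_on UNIV (\<phi> k)" for k
    unfolding \<phi>_def by (intro continuous_intros)
  have \<phi>01: "0 \<le> \<phi> k x" "\<phi> k x \<le> 1" for k x by (auto simp: \<phi>_def infdist_nonneg)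
  have z: "mean (\<lambda>w. f w * of_real (\<phi> k (torus_embed w))) = 0" for k
    by (rule mean_continuous_annihilate[OF f \<phi>c])
  have lim: "(\<lambda>k. \<phi> k (torus_embed w)) \<longlonglongrightarrow> indicator C w" if w: "w \<in> fundamental_square" for w
  proof (cases "w \<in> C")
    case True
    then have "infdist (torus_embed w) D = 0" by (simp add: D_def)
    then show ?thesis using True by (simp add: \<phi>_def)
  next
    case False
    have "torus_embed w \<notin> D"
    proof
      assume "torus_embed w \<in> D"
      then obtain w' where "w' \<in> C" "torus_embed w = torus_embed w'" by (auto simp: D_def)
      then have "w = w'" using inj_onD[OF torus_embed_inj] w C(2) by blast
      then show False using \<open>w' \<in> C\<close> False by simp
    qed
    then have pos: "infdist (torus_embed w) D > 0"
      using in_closed_iff_infdist_zero[OF compact_imp_closed[OF D(1)] D(2), of "torus_embed w"] infdist_nonneg[of "torus_embed w" D] by simp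
    obtain k0 :: nat where k0: "1 / infdist (torus_embed w) D < real k0" using reals_Archimedean2 by blast
    have "\<phi> k (torus_embed w) = 0" if "k \<ge> k0" for k
    proof -
      have "1 / infdist (torus_embed w) D < real k" using k0 that by linarith
      then show ?thesis using pos by (simp add: \<phi>_def divide_less_eq)
    qed
    then have "eventually (\<lambda>k. \<phi> k (torus_embed w) = 0) sequentially" by (auto simp: eventually_sequentially)
    then show ?thesis using False by (simp add: tendsto_eventually)
  qed
  have fm: "f \<in> borel_measurable borel" by (rule bdd_borel_measurable[OF f(1)])
  have Cb: "C \<in> sets borel" using C(1) by (simp add: borel_compact)
  have "(\<lambda>k. \<integral>w. indicator fundamental_square w *\<^sub>R (f w * of_real (\<phi> k (torus_embed w))) \<partial>lborel) \<longlonglongrightarrow>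
      (\<integral>w. indicator fundamental_square w *\<^sub>R (f w * of_real (indicator C w)) \<partial>lborel)"
  proof (rule integral_dominated_convergence[where w = "\<lambda>w. indicator fundamental_square w *\<^sub>R K"])
    show "(\<lambda>w. indicator fundamental_square w *\<^sub>R (f w * of_real (indicator C w))) \<in> borel_measurable lborel"
      using fm Cb by simp
    show "(\<lambda>w. indicator fundamental_square w *\<^sub>R (f w * of_real (\<phi> k (torus_embed w)))) \<in> borel_measurable lborel" for k
    proof -
      have "(\<lambda>w. \<phi> k (torus_embed w)) \<in> borel_measurable borel"
        by (intro borel_measurable_continuous_onI continuous_on_compose2[OF \<phi>c torus_embed_cont]) auto
      then show ?thesis using fm by simp
    qed
    show "integrable lborel (\<lambda>w. indicator fundamental_square w *\<^sub>R K)"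
      by (simp add: emeasure_square)
    show "AE w in lborel. (\<lambda>k. indicator fundamental_square w *\<^sub>R (f w * of_real (\<phi> k (torus_embed w))))
       \<longlonglongrightarrow> indicator fundamental_square w *\<^sub>R (f w * of_real (indicator C w))"
    proof (rule AE_I2)
      fix w :: plane
      show "(\<lambda>k. indicator fundamental_square w *\<^sub>R (f w * of_real (\<phi> k (torus_embed w))))
       \<longlonglongrightarrow> indicator fundamental_square w *\<^sub>R (f w * of_real (indicator C w))"
        by (cases "w \<in> fundamental_square") (simp_all add: lim tendsto_intros del: of_real_indicator)
    qed
    show "AE w in lborel. norm (indicator fundamental_square w *\<^sub>R (f w * of_real (\<phi> k (torus_embed w)))) \<le> indicator fundamental_square w *\<^sub>R K" for k
    proof (rule AE_I2)
      fix w :: plane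
      have "norm (f w) * \<bar>\<phi> k (torus_embed w)\<bar> \<le> K * 1"
        using bdd_borelD[OF f(1), of w] \<phi>01 order_trans[OF norm_ge_zero bdd_borelD[OF f(1)]] by (intro mult_mono) (auto simp: abs_le_iff)
      then show "norm (indicator fundamental_square w *\<^sub>R (f w * of_real (\<phi> k (torus_embed w)))) \<le> indicator fundamental_square w *\<^sub>R K"
        by (simp add: indicator_def norm_mult)
    qed
  qed
  then have "(\<integral>w. indicator fundamental_square w *\<^sub>R (f w * of_real (indicator C w)) \<partial>lborel) = 0"
    using z LIMSEQ_unique[OF _ tendsto_const] unfolding mean_def set_lebesgue_integral_def by simp
  moreover have "indicator fundamental_square w *\<^sub>R (f w * of_real (indicator C w)) = indicator C w *\<^sub>R f w" for w
    using C(2) by (auto simp: indicator_def)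
  ultimately show ?thesis by (simp add: set_lebesgue_integral_def)
qed (simp add: set_lebesgue_integral_def)

text \<open>If a set \<open>{w. g w > 1 / (n + 1)}\<close> had positive measure, inner regularity would give a compact
  subset of positive measure, with a positive integral.\<close>

lemma AE_nonpos_of_compact:
  fixes g :: "plane \<Rightarrow> real"
  assumes g: "bdd_borel g K" and z: "\<And>C. compact C \<Longrightarrow> C \<subseteq> fundamental_square \<Longrightarrow> (LINT w:C|lborel. g w) = 0"
  shows "AE w in lborel. w \<in> fundamental_square \<longrightarrow> g w \<le> 0"
proof -
  have gm: "g \<in> borel_measurable borel" by (rule bdd_borel_measurable[OF g])
  define S where "S n = {w \<in> fundamental_square. g w > 1 / real (Suc n)}" for n
  have Sb: "S n \<in> sets borel" for n
  proof -
    have "S n = fundamental_square \<inter> g -` {1 / real (Suc n)<..}" by (auto simp: S_def)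
    then show ?thesis using measurable_sets[OF gm, of "{1 / real (Suc n)<..}"] by simp
  qed
  have null: "emeasure lborel (S n) = 0" for n
  proof (rule ccontr)
    assume nz: "emeasure lborel (S n) \<noteq> 0"
    have "emeasure lborel (S n) \<le> emeasure lborel fundamental_square"
      by (intro emeasure_mono) (auto simp: S_def)
    then have fin: "emeasure lborel (S n) \<le> 1" by (simp add: emeasure_square)
    then have fin': "emeasure lborel (S n) \<noteq> \<infinity>" by (auto simp: top_unique)
    define m where "m = measure lborel (S n)"
    have em: "emeasure lborel (S n) = ennreal m" unfolding m_def
      by (rule emeasure_eq_ennreal_measure) (use fin' in simp)
    have m: "m > 0" using nz em by (metis ennreal_0 m_def measure_nonneg less_eq_real_def)
    have "S n \<in> sets lebesgue" using Sb by simp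
    then obtain T where T: "closed T" "T \<subseteq> S n" "S n - T \<in> lmeasurable" "emeasure lebesgue (S n - T) < ennreal m"
      using sets_lebesgue_inner_closed m by blast
    have Tsq: "T \<subseteq> fundamental_square" using T(2) by (auto simp: S_def)
    have "bounded T" using bounded_subset[OF bounded_cbox] Tsq square_subset by (meson order_trans)
    then have cT: "compact T" using T(1) by (simp add: compact_eq_bounded_closed)
    have Tb: "T \<in> sets borel" using T(1) by simp
    have "emeasure lborel (S n - T) < ennreal m" using T(4) Sb Tb by simp
    moreover have "emeasure lborel (S n) = emeasure lborel T + emeasure lborel (S n - T)"
      using plus_emeasure[of T lborel "S n - T"] Tb Sb T(2) by (simp add: Un_absorb1)
    ultimately have eT: "emeasure lborel T \<noteq> 0" using em by auto
    have "emeasure lborel T \<le> emeasure lborel (S n)" using T(2) Sb by (intro emeasure_mono) auto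
    then have "emeasure lborel T < \<infinity>" using fin by (simp add: top.not_eq_extremum le_less_trans[OF _ ennreal_one_less_top])
    then have eT2: "emeasure lborel T \<noteq> \<infinity>" by simp
    have mT: "measure lborel T > 0"
      using eT eT2 by (metis emeasure_eq_ennreal_measure ennreal_0 infinity_ennreal_def less_eq_real_def measure_nonneg)
    have i1: "set_integrable lborel T g"
      by (rule set_integrable_subset[OF bdd_borel_integrable[OF g]]) (use Tb Tsq in auto)
    have i2: "set_integrable lborel T (\<lambda>w. 1 / real (Suc n))"
      using Tb eT2 by (simp add: set_integrable_def top.not_eq_extremum)
    have "(LINT w:T|lborel. 1 / real (Suc n)) \<le> (LINT w:T|lborel. g w)"
      using T(2) by (intro set_integral_mono i1 i2) (auto simp: S_def)
    moreover have "(LINT w:T|lborel. 1 / real (Suc n)) = measure lborel T / real (Suc n)"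
      using Tb eT2 by (simp add: set_lebesgue_integral_def top.not_eq_extremum)
    ultimately show False using z[OF cT Tsq] mT by (simp add: divide_le_0_iff)
  qed
  have "AE w in lborel. \<forall>n. w \<notin> S n"
    unfolding AE_all_countable
  proof
    show "AE w in lborel. w \<notin> S n" for n
      by (rule AE_I[of _ _ "S n"]) (use null Sb in auto)
  qed
  then show ?thesis
  proof eventually_elim
    case (elim w)
    show ?case
    proof
      assume w: "w \<in> fundamental_square"
      show "g w \<le> 0"
      proof (rule ccontr)
        assume "\<not> g w \<le> 0"
        then obtain n where "inverse (real (Suc n)) < g w" using reals_Archimedean[of "g w"] by auto
        then have "w \<in> S n" using w by (simp add: S_def inverse_eq_divide)
        then show False using elim by blast
      qed
    qed
  qed
qed

lemma negligible_periodic: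
  assumes "periodic f" "AE w in lborel. w \<in> fundamental_square \<longrightarrow> P (f w)"
  shows "negligible {w. \<not> P (f w)}"
proof -
  have "AE w in lebesgue. w \<in> fundamental_square \<longrightarrow> P (f w)"
    using assms(2) by (rule AE_completion)
  then have "\<exists>N\<in>null_sets lebesgue. {w. \<not> (w \<in> fundamental_square \<longrightarrow> P (f w))} \<subseteq> N"
    by (simp add: eventually_ae_filter)
  then obtain N where N: "negligible N" "{w. \<not> (w \<in> fundamental_square \<longrightarrow> P (f w))} \<subseteq> N"
    using negligible_iff_null_sets by blast
  have "{w. \<not> P (f w)} \<subseteq> (\<Union>n::int\<times>int. (+) (of_int (fst n), of_int (snd n)) ` N)"
  proof
    fix w :: plane assume "w \<in> {w. \<not> P (f w)}"
    then have "\<not> P (f (frac (fst w), frac (snd w)))" using periodic_frac[OF assms(1), of w] by simp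
    then have "(frac (fst w), frac (snd w)) \<in> N" using N(2) frac_in_square by blast
    moreover have "w = (of_int \<lfloor>fst w\<rfloor>, of_int \<lfloor>snd w\<rfloor>) + (frac (fst w), frac (snd w))"
      by (simp add: frac_def prod_eq_iff)
    ultimately have "w \<in> (+) (of_int (fst (\<lfloor>fst w\<rfloor>, \<lfloor>snd w\<rfloor>)), of_int (snd (\<lfloor>fst w\<rfloor>, \<lfloor>snd w\<rfloor>))) ` N"
      unfolding fst_conv snd_conv by (rule image_eqI[rotated])
    then show "w \<in> (\<Union>n::int\<times>int. (+) (of_int (fst n), of_int (snd n)) ` N)" by (rule UN_I[OF UNIV_I])
  qed
  moreover have "negligible (\<Union>n::int\<times>int. (+) (of_int (fst n), of_int (snd n)) ` N)"
    by (intro negligible_countable_Union) (auto intro: negligible_translation N(1))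
  ultimately show ?thesis using negligible_subset by blast
qed

text \<open>A function whose integrals over all compact subsets of the square vanish is zero: the real and the
  imaginary part and their negatives are nonpositive almost everywhere.\<close>

theorem fourier_unique:
  assumes f: "bdd_borel f K" "periodic f" "\<And>n. fcoeff f n = 0"
  shows "negligible {w. f w \<noteq> 0}"
proof -
  have fm: "f \<in> borel_measurable borel" by (rule bdd_borel_measurable[OF f(1)])
  have gen: "AE w in lborel. w \<in> fundamental_square \<longrightarrow> L (f w) \<le> 0"
    if L: "bounded_linear L" "\<And>z. \<bar>L z\<bar> \<le> norm z" for L :: "complex \<Rightarrow> real"
  proof (rule AE_nonpos_of_compact)
    have "L \<in> borel_measurable borel"
      using L(1) by (intro borel_measurable_continuous_onI linear_continuous_on)
    then have "(\<lambda>w. L (f w)) \<in> borel_measurable borel" by (rule measurable_compose[OF fm])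
    then show "bdd_borel (\<lambda>w. L (f w)) K"
      unfolding bdd_borel_def using order_trans[OF L(2) bdd_borelD[OF f(1)]] by simp
    fix C assume C: "compact C" "C \<subseteq> fundamental_square"
    have "set_integrable lborel C f"
      by (rule set_integrable_subset[OF bdd_borel_integrable[OF f(1)]]) (use C in \<open>auto simp: borel_compact\<close>)
    then have "(LINT w:C|lborel. L (f w)) = L (LINT w:C|lborel. f w)"
      using integral_bounded_linear[OF L(1), of lborel "\<lambda>w. indicator C w *\<^sub>R f w"] linear_cmul[OF bounded_linear.linear[OF L(1)]]
      by (simp add: set_integrable_def set_lebesgue_integral_def)
    then show "(LINT w:C|lborel. L (f w)) = 0"
      using compact_integral_zero[OF f(1,3) C] linear_0[OF bounded_linear.linear[OF L(1)]] by simp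
  qed
  have 1: "AE w in lborel. w \<in> fundamental_square \<longrightarrow> Re (f w) \<le> 0"
    by (rule gen[OF bounded_linear_Re abs_Re_le_cmod])
  have 2: "AE w in lborel. w \<in> fundamental_square \<longrightarrow> - Re (f w) \<le> 0"
    by (rule gen[OF bounded_linear_minus[OF bounded_linear_Re]]) (simp add: abs_Re_le_cmod)
  have 3: "AE w in lborel. w \<in> fundamental_square \<longrightarrow> Im (f w) \<le> 0"
    by (rule gen[OF bounded_linear_Im abs_Im_le_cmod])
  have 4: "AE w in lborel. w \<in> fundamental_square \<longrightarrow> - Im (f w) \<le> 0"
    by (rule gen[OF bounded_linear_minus[OF bounded_linear_Im]]) (simp add: abs_Im_le_cmod)
  have "AE w in lborel. w \<in> fundamental_square \<longrightarrow> f w = 0"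
    using 1 2 3 4 by eventually_elim (auto simp: complex_eq_iff)
  from negligible_periodic[OF f(2) this] show ?thesis .
qed

lemma negligible_AE: "negligible {w. \<not> P w} \<longleftrightarrow> (AE w in lebesgue. P w)"
proof
  assume "negligible {w. \<not> P w}"
  then show "AE w in lebesgue. P w" unfolding negligible_iff_null_sets by (rule AE_I') auto
next
  assume "AE w in lebesgue. P w"
  then obtain N where "N \<in> null_sets lebesgue" "{w. \<not> P w} \<subseteq> N" by (auto simp: eventually_ae_filter)
  then show "negligible {w. \<not> P w}" using negligible_iff_null_sets negligible_subset by blast
qed

lemma fourier_unique_continuous:
  assumes f: "continuous_on UNIV f" "periodic f" "\<And>n. fcoeff f n = 0"
  shows "f w = 0"
proof -
  obtain K where "bdd_borel f K" using periodic_cont_bdd_borel[OF f(2,1)] by blast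
  from fourier_unique[OF this f(2,3)] have "AE w in lebesgue. f w = 0"
    unfolding negligible_AE[symmetric] .
  then have "AE w in lebesgue. w \<in> {w. f w = 0}" by simp
  moreover have "closed {w. f w = 0}"
    using f(1) continuous_closed_preimage_constant[of UNIV f 0] by simp
  ultimately show ?thesis using mem_closed_if_AE_lebesgue[of "{w. f w = 0}" w] by simp
qed

text \<open>Difference quotients have mean zero by translation invariance, and they converge boundedly to the
  derivative.\<close>

lemma mean_derivative_zero:
  assumes "periodic \<Phi>" "periodic \<Psi>" "continuous_on UNIV \<Phi>" "continuous_on UNIV \<Psi>"
    and d: "\<And>w. ((\<lambda>t. \<Phi> (w + t *\<^sub>R v)) has_vector_derivative \<Psi> w) (at 0)"
  shows "mean \<Psi> = 0"
proof -
  obtain K where K: "\<And>w. norm (\<Psi> w) \<le> K" using periodic_bounded[OF assms(2,4)] by blast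
  obtain L where L: "bdd_borel \<Phi> L" using periodic_cont_bdd_borel[OF assms(1,3)] by blast
  have Pm: "\<Psi> \<in> borel_measurable borel" using assms(4) by (rule borel_measurable_continuous_onI)
  define h where "h k = inverse (real (Suc k))" for k
  have hpos: "h k > 0" for k by (simp add: h_def)
  define Q where "Q k w = (\<Phi> (w + h k *\<^sub>R v) + (-1) * \<Phi> w) / of_real (h k)" for k w
  have tr: "bdd_borel (\<lambda>w. \<Phi> (w + t)) L" for t
    unfolding bdd_borel_def using measurable_compose[of "\<lambda>w. w + t" borel borel \<Phi> borel] bdd_borel_measurable[OF L] bdd_borelD[OF L] by simp
  have mb: "bdd_borel (\<lambda>w. (-1) * \<Phi> w) L"
    using L unfolding bdd_borel_def by simp
  have z: "mean (Q k) = 0" for k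
  proof -
    have "mean (\<lambda>w. inverse (of_real (h k)) * (\<Phi> (w + h k *\<^sub>R v) + (-1) * \<Phi> w)) = 0"
      unfolding mean_cmult mean_add[OF tr mb] mean_translate[OF L assms(1)] by simp
    then show ?thesis by (simp add: Q_def[abs_def] divide_inverse mult.commute)
  qed
  have bnd: "norm (Q k w) \<le> K" for k w
  proof -
    have dt: "((\<lambda>t. \<Phi> (w + t *\<^sub>R v)) has_vector_derivative \<Psi> (w + s *\<^sub>R v)) (at s)" for s
    proof -
      have 1: "((\<lambda>t. t - s) has_vector_derivative 1) (at s)"
        unfolding has_real_derivative_iff_has_vector_derivative[symmetric] by (auto intro!: derivative_eq_intros)
      have 2: "((\<lambda>t. \<Phi> (w + s *\<^sub>R v + t *\<^sub>R v)) has_vector_derivative \<Psi> (w + s *\<^sub>R v)) (at (s - s))"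
        using d by simp
      have eq: "w + s *\<^sub>R v + (t - s) *\<^sub>R v = w + t *\<^sub>R v" for t by (simp add: algebra_simps)
      have "(\<lambda>t. \<Phi> (w + t *\<^sub>R v)) = (\<lambda>t. \<Phi> (w + s *\<^sub>R v + t *\<^sub>R v)) \<circ> (\<lambda>t. t - s)"
        by (rule ext) (simp only: o_def eq)
      then show ?thesis using vector_diff_chain_at[OF 1 2] by (simp only: scaleR_one)
    qed
    have "norm (\<Phi> (w + h k *\<^sub>R v) - \<Phi> (w + 0 *\<^sub>R v)) \<le> K * norm (h k - 0)"
    proof (rule differentiable_bound[of UNIV "\<lambda>t. \<Phi> (w + t *\<^sub>R v)" "\<lambda>s x. x *\<^sub>R \<Psi> (w + s *\<^sub>R v)"])
      show "((\<lambda>t. \<Phi> (w + t *\<^sub>R v)) has_derivative (\<lambda>x. x *\<^sub>R \<Psi> (w + s *\<^sub>R v))) (at s within UNIV)" for s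
        using dt by (simp add: has_vector_derivative_def)
      show "onorm (\<lambda>x. x *\<^sub>R \<Psi> (w + s *\<^sub>R v)) \<le> K" for s
        by (rule onorm_le) (simp add: K mult_left_mono mult.commute[of K])
    qed auto
    then have "norm (\<Phi> (w + h k *\<^sub>R v) + (-1) * \<Phi> w) \<le> K * h k" using hpos[of k] by simp
    then show ?thesis using hpos[of k] by (simp add: Q_def norm_divide divide_le_eq)
  qed
  have hlim: "h \<longlonglongrightarrow> 0" unfolding h_def by (rule LIMSEQ_inverse_real_of_nat)
  have lim: "(\<lambda>k. Q k w) \<longlonglongrightarrow> \<Psi> w" for w
  proof -
    have "((\<lambda>t. norm (\<Phi> (w + (0 + t) *\<^sub>R v) - \<Phi> (w + 0 *\<^sub>R v) - t *\<^sub>R \<Psi> w) / norm t) \<longlongrightarrow> 0) (at 0)"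
      using d[of w] unfolding has_vector_derivative_def has_derivative_at by blast
    moreover have "filterlim h (at 0) sequentially"
      using hlim hpos by (intro filterlim_atI) (auto simp: less_imp_neq[symmetric])
    ultimately have "(\<lambda>k. norm (\<Phi> (w + (0 + h k) *\<^sub>R v) - \<Phi> (w + 0 *\<^sub>R v) - h k *\<^sub>R \<Psi> w) / norm (h k)) \<longlonglongrightarrow> 0"
      by (rule filterlim_compose)
    moreover have "norm (\<Phi> (w + (0 + h k) *\<^sub>R v) - \<Phi> (w + 0 *\<^sub>R v) - h k *\<^sub>R \<Psi> w) / norm (h k) = norm (Q k w - \<Psi> w)" for k
    proof -
      have "Q k w - \<Psi> w = (\<Phi> (w + (0 + h k) *\<^sub>R v) - \<Phi> (w + 0 *\<^sub>R v) - h k *\<^sub>R \<Psi> w) / of_real (h k)"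
        using hpos[of k] by (simp add: Q_def scaleR_conv_of_real diff_divide_distrib)
      then show ?thesis by (simp add: norm_divide)
    qed
    ultimately have "(\<lambda>k. norm (Q k w - \<Psi> w)) \<longlonglongrightarrow> 0" by simp
    then show ?thesis using tendsto_norm_zero_iff LIM_zero_cancel by blast
  qed
  have Qm: "Q k \<in> borel_measurable borel" for k
    unfolding Q_def using bdd_borel_measurable[OF tr] bdd_borel_measurable[OF mb] by measurable
  have "(\<lambda>k. \<integral>w. indicator fundamental_square w *\<^sub>R Q k w \<partial>lborel) \<longlonglongrightarrow> (\<integral>w. indicator fundamental_square w *\<^sub>R \<Psi> w \<partial>lborel)"
  proof (rule integral_dominated_convergence[where w = "\<lambda>w. indicator fundamental_square w *\<^sub>R K"])
    show "AE w in lborel. (\<lambda>k. indicator fundamental_square w *\<^sub>R Q k w) \<longlonglongrightarrow> indicator fundamental_square w *\<^sub>R \<Psi> w"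
      by (intro AE_I2 tendsto_intros lim)
    show "AE w in lborel. norm (indicator fundamental_square w *\<^sub>R Q k w) \<le> indicator fundamental_square w *\<^sub>R K" for k
      by (intro AE_I2) (simp add: indicator_def bnd)
  qed (use Pm Qm in \<open>simp_all add: emeasure_square\<close>)
  then have "(\<lambda>k. mean (Q k)) \<longlonglongrightarrow> mean \<Psi>" by (simp add: mean_def set_lebesgue_integral_def)
  then show ?thesis using z LIMSEQ_unique[OF _ tendsto_const] by simp
qed

definition freq_along :: "plane \<Rightarrow> int \<times> int \<Rightarrow> real" where
  "freq_along v n = real_of_int (fst n) * fst v + real_of_int (snd n) * snd v"

text \<open>The derivative of \<open>f * cnj (character n)\<close> along \<open>v\<close> is periodic, hence has mean zero.\<close>

lemma fcoeff_derivative: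
  assumes "periodic f" "periodic g" "continuous_on UNIV f" "continuous_on UNIV g"
    and d: "\<And>w. ((\<lambda>t. f (w + t *\<^sub>R v)) has_vector_derivative g w) (at 0)"
  shows "fcoeff g n = 2 * of_real pi * \<i> * of_real (freq_along v n) * fcoeff f n"
proof -
  let ?c = "2 * complex_of_real pi * \<i> * of_real (freq_along v n)"
  obtain K where K: "bdd_borel f K" using periodic_cont_bdd_borel[OF assms(1,3)] by blast
  obtain L where L: "bdd_borel g L" using periodic_cont_bdd_borel[OF assms(2,4)] by blast
  have dc: "((\<lambda>t. cnj (character n (w + t *\<^sub>R v))) has_vector_derivative (- ?c) * cnj (character n w)) (at 0)" for w
  proof -
    have eq: "cnj (character n (w + t *\<^sub>R v)) = cnj (character n w) * exp (of_real t * (- ?c))" for t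
      unfolding character_add by (simp add: character_def freq_along_def cis_conv_exp exp_cnj algebra_simps)
    have "((\<lambda>z. exp (z * (- ?c))) has_field_derivative exp (of_real 0 * (- ?c)) * (- ?c)) (at (of_real 0))"
      by (auto intro!: derivative_eq_intros)
    then have "((\<lambda>t. exp (of_real t * (- ?c))) has_vector_derivative (- ?c)) (at 0)"
      using has_vector_derivative_real_field by fastforce
    then have "((\<lambda>t. cnj (character n w) * exp (of_real t * (- ?c))) has_vector_derivative cnj (character n w) * (- ?c)) (at 0)"
      by (rule bounded_linear.has_vector_derivative[OF bounded_linear_mult_right])
    then show ?thesis unfolding eq by (simp add: mult.commute)
  qed
  have cc: "continuous_on UNIV (\<lambda>w. cnj (character n w))" by (intro continuous_intros character_cont)
  have m0: "mean (\<lambda>w. f w * ((- ?c) * cnj (character n w)) + g w * cnj (character n w)) = 0"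
  proof (rule mean_derivative_zero[where \<Phi> = "\<lambda>w. f w * cnj (character n w)" and v = v])
    show "((\<lambda>t. f (w + t *\<^sub>R v) * cnj (character n (w + t *\<^sub>R v))) has_vector_derivative
       f w * ((- ?c) * cnj (character n w)) + g w * cnj (character n w)) (at 0)" for w
      using has_vector_derivative_mult[OF d[of w] dc[of w]] by simp
    have pc: "periodic (\<lambda>w. cnj (character n w))" using character_periodic[of n] unfolding periodic_def by metis
    show "periodic (\<lambda>w. f w * cnj (character n w))" using assms(1) pc unfolding periodic_def by metis
    show "periodic (\<lambda>w. f w * ((- ?c) * cnj (character n w)) + g w * cnj (character n w))"
      using assms(1,2) pc unfolding periodic_def by metis
    show "continuous_on UNIV (\<lambda>w. f w * cnj (character n w))" by (intro continuous_on_mult assms cc)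
    show "continuous_on UNIV (\<lambda>w. f w * ((- ?c) * cnj (character n w)) + g w * cnj (character n w))"
      by (intro continuous_on_mult continuous_on_add continuous_on_const assms cc)
  qed
  have feq: "(\<lambda>w. f w * ((- ?c) * cnj (character n w)) + g w * cnj (character n w)) =
      (\<lambda>w. (- ?c) * (f w * cnj (character n w)) + g w * cnj (character n w))" by (simp add: fun_eq_iff)
  have "bdd_borel (\<lambda>w. (- ?c) * (f w * cnj (character n w))) (norm (- ?c) * K)"
    by (rule bdd_borel_mult[OF _ bdd_borel_fcoeff[OF K]]) (simp add: bdd_borel_def)
  then have m1: "mean (\<lambda>w. (- ?c) * (f w * cnj (character n w)) + g w * cnj (character n w)) =
      mean (\<lambda>w. (- ?c) * (f w * cnj (character n w))) + mean (\<lambda>w. g w * cnj (character n w))"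
    by (rule mean_add[OF _ bdd_borel_fcoeff[OF L]])
  have m2: "mean (\<lambda>w. (- ?c) * (f w * cnj (character n w))) = (- ?c) * fcoeff f n"
    unfolding fcoeff_def by (rule mean_cmult)
  have "(- ?c) * fcoeff f n + fcoeff g n = 0"
    unfolding m2[symmetric] fcoeff_def[of g] m1[symmetric] feq[symmetric] by (rule m0)
  then show ?thesis by (simp add: algebra_simps)
qed

lemma fcoeff_decay:
  assumes "Ck_along v r f" "periodic f"
  shows "\<exists>C. \<forall>n. \<bar>2 * pi * freq_along v n\<bar> ^ r * norm (fcoeff f n) \<le> C"
  using assms
proof (induction r arbitrary: f)
  case 0
  then obtain K where K: "bdd_borel f K" using periodic_cont_bdd_borel by (auto simp: Ck_along.simps)
  have "norm (fcoeff f n) \<le> K" for n unfolding fcoeff_def by (rule mean_bound[OF bdd_borel_fcoeff[OF K]])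
  then show ?case by (intro exI[of _ K]) simp
next
  case (Suc r)
  obtain g where g: "Ck_along v r g" "\<And>w. ((\<lambda>t. f (w + t *\<^sub>R v)) has_vector_derivative g w) (at 0)"
    using Ck_along_SucD[OF Suc.prems(1)] by blast
  have pg: "periodic g"
  proof -
    have "g (w + a) = g w" if "\<And>w. f (w + a) = f w" for w a
    proof -
      have "(\<lambda>t. f (w + a + t *\<^sub>R v)) = (\<lambda>t. f (w + t *\<^sub>R v))"
      proof
        fix t
        have "w + a + t *\<^sub>R v = (w + t *\<^sub>R v) + a" by simp
        then show "f (w + a + t *\<^sub>R v) = f (w + t *\<^sub>R v)" by (simp only: that)
      qed
      then show ?thesis using g(2)[of "w + a"] g(2)[of w] vector_derivative_unique_at by metis
    qed
    then show ?thesis using Suc.prems(2) unfolding periodic_def by blast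
  qed
  obtain C where C: "\<And>n. \<bar>2 * pi * freq_along v n\<bar> ^ r * norm (fcoeff g n) \<le> C" using Suc.IH[OF g(1) pg] by blast
  have "norm (fcoeff g n) = \<bar>2 * pi * freq_along v n\<bar> * norm (fcoeff f n)" for n
    unfolding fcoeff_derivative[OF Suc.prems(2) pg Ck_along_continuous[OF Suc.prems(1)] Ck_along_continuous[OF g(1)] g(2)]
    by (simp add: norm_mult abs_mult)
  then have "\<bar>2 * pi * freq_along v n\<bar> ^ Suc r * norm (fcoeff f n) \<le> C" for n
    using C[of n] by (simp add: mult_ac)
  then show ?case by blast
qed

section \<open>The cohomological equation over a Diophantine translation\<close>

text \<open>A summable weight on the lattice of frequencies.\<close>

definition lattice_weight :: "int \<times> int \<Rightarrow> real" where
  "lattice_weight n = 1 / ((1 + real_of_int \<bar>fst n\<bar>)\<^sup>2 * (1 + real_of_int \<bar>snd n\<bar>)\<^sup>2)"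

text \<open>An enumeration of the frequencies turns double series into ordinary ones.\<close>

definition lattice_enum :: "nat \<Rightarrow> int \<times> int" where
  "lattice_enum = from_nat_into UNIV"

lemma lattice_enum_bij: "bij lattice_enum"
proof -
  have "infinite (UNIV :: (int \<times> int) set)" by (simp add: finite_prod)
  then show ?thesis unfolding lattice_enum_def by (intro bij_betw_from_nat_into) auto
qed

lemma sum_int_bound: "\<exists>S. \<forall>A::int set. finite A \<longrightarrow> (\<Sum>i\<in>A. 1 / (1 + real_of_int \<bar>i\<bar>)\<^sup>2) \<le> S"
proof -
  define q where "q k = 1 / (1 + real k)\<^sup>2" for k :: nat
  have sq: "summable q"
  proof -
    have "summable (\<lambda>k. inverse (real (Suc k) ^ 2))"
      using inverse_power_summable[of 2, where 'a = real] by (subst summable_Suc_iff) auto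
    then show ?thesis by (simp add: q_def[abs_def] inverse_eq_divide)
  qed
  have qn: "q k \<ge> 0" for k by (simp add: q_def)
  have "(\<Sum>i\<in>A. 1 / (1 + real_of_int \<bar>i\<bar>)\<^sup>2) \<le> suminf q + suminf q" if A: "finite A" for A :: "int set"
  proof -
    have part: "(\<Sum>i\<in>B. 1 / (1 + real_of_int \<bar>i\<bar>)\<^sup>2) \<le> suminf q" if B: "finite B" "inj_on (\<lambda>i. nat \<bar>i\<bar>) B" for B :: "int set"
    proof -
      have "(\<Sum>i\<in>B. 1 / (1 + real_of_int \<bar>i\<bar>)\<^sup>2) = (\<Sum>i\<in>B. q (nat \<bar>i\<bar>))"
        by (intro sum.cong refl) (simp add: q_def)
      also have "\<dots> = sum q ((\<lambda>i. nat \<bar>i\<bar>) ` B)" using sum.reindex[OF B(2), of q] by simp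
      also have "\<dots> \<le> suminf q" using B(1) by (intro sum_le_suminf sq) (auto simp: qn)
      finally show ?thesis .
    qed
    have "A = (A \<inter> {0..}) \<union> (A \<inter> {..<0})" by auto
    then have "(\<Sum>i\<in>A. 1 / (1 + real_of_int \<bar>i\<bar>)\<^sup>2) = (\<Sum>i\<in>(A \<inter> {0..}) \<union> (A \<inter> {..<0}). 1 / (1 + real_of_int \<bar>i\<bar>)\<^sup>2)" by simp
    also have "\<dots> = (\<Sum>i\<in>A \<inter> {0..}. 1 / (1 + real_of_int \<bar>i\<bar>)\<^sup>2) + (\<Sum>i\<in>A \<inter> {..<0}. 1 / (1 + real_of_int \<bar>i\<bar>)\<^sup>2)"
      using A by (intro sum.union_disjoint) auto
    also have "\<dots> \<le> suminf q + suminf q" using A by (intro add_mono part) (auto simp: inj_on_def)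
    finally show ?thesis .
  qed
  then show ?thesis by blast
qed

lemma lattice_weight_summable: "summable (\<lambda>k. lattice_weight (lattice_enum k))"
proof -
  obtain S where S: "\<And>A::int set. finite A \<Longrightarrow> (\<Sum>i\<in>A. 1 / (1 + real_of_int \<bar>i\<bar>)\<^sup>2) \<le> S"
    using sum_int_bound by blast
  have S0: "S \<ge> 0" using S[of "{}"] by simp
  have "(\<Sum>k<N. lattice_weight (lattice_enum k)) \<le> S * S" for N
  proof -
    define F where "F = lattice_enum ` {..<N}"
    have "(\<Sum>k<N. lattice_weight (lattice_enum k)) = sum lattice_weight F"
      unfolding F_def using lattice_enum_bij by (subst sum.reindex) (auto intro: inj_on_subset simp: bij_def)
    also have "\<dots> \<le> sum lattice_weight (fst ` F \<times> snd ` F)"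
      by (intro sum_mono2 subset_fst_snd) (auto simp: F_def lattice_weight_def)
    also have "\<dots> = (\<Sum>i\<in>fst ` F. \<Sum>j\<in>snd ` F. 1 / (1 + real_of_int \<bar>i\<bar>)\<^sup>2 * (1 / (1 + real_of_int \<bar>j\<bar>)\<^sup>2))"
      unfolding sum.cartesian_product by (intro sum.cong refl) (auto simp: lattice_weight_def)
    also have "\<dots> = (\<Sum>i\<in>fst ` F. 1 / (1 + real_of_int \<bar>i\<bar>)\<^sup>2) * (\<Sum>j\<in>snd ` F. 1 / (1 + real_of_int \<bar>j\<bar>)\<^sup>2)"
      by (rule sum_product[symmetric])
    also have "\<dots> \<le> S * S" using S0 by (intro mult_mono S sum_nonneg) (auto simp: F_def)
    finally show ?thesis .
  qed
  then show ?thesis by (intro summableI_nonneg_bounded) (auto simp: lattice_weight_def)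
qed

definition fourier_series :: "(int \<times> int \<Rightarrow> complex) \<Rightarrow> plane \<Rightarrow> complex" where
  "fourier_series a w = (\<Sum>k. a (lattice_enum k) * character (lattice_enum k) w)"

lemma fourier_series_props:
  assumes a: "\<And>n. norm (a n) \<le> C * lattice_weight n"
  shows "\<And>w. summable (\<lambda>k. a (lattice_enum k) * character (lattice_enum k) w)"
    and "uniform_limit UNIV (\<lambda>N w. \<Sum>k<N. a (lattice_enum k) * character (lattice_enum k) w) (fourier_series a) sequentially"
    and "continuous_on UNIV (fourier_series a)" and "periodic (fourier_series a)"
    and "fourier_series a (w + t) = fourier_series (\<lambda>n. a n * character n t) w"
proof -
  have sC: "summable (\<lambda>k. C * lattice_weight (lattice_enum k))" by (intro summable_mult lattice_weight_summable)
  have nb: "norm (a (lattice_enum k) * character (lattice_enum k) w) \<le> C * lattice_weight (lattice_enum k)" for k w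
    using a by (simp add: norm_mult)
  show "summable (\<lambda>k. a (lattice_enum k) * character (lattice_enum k) w)" for w
    by (rule summable_comparison_test'[OF sC nb])
  show u: "uniform_limit UNIV (\<lambda>N w. \<Sum>k<N. a (lattice_enum k) * character (lattice_enum k) w) (fourier_series a) sequentially"
    unfolding fourier_series_def[abs_def] by (rule Weierstrass_m_test[OF nb sC])
  show "continuous_on UNIV (fourier_series a)"
  proof (rule uniform_limit_theorem[OF _ u])
    show "\<forall>\<^sub>F N in sequentially. continuous_on UNIV (\<lambda>w. \<Sum>k<N. a (lattice_enum k) * character (lattice_enum k) w)"
      by (intro always_eventually allI continuous_intros character_cont)
  qed simp
  have "character n (w + e1) = character n w" "character n (w + e2) = character n w" for n w
    using character_periodic[of n] unfolding periodic_def by blast+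
  then show "periodic (fourier_series a)" unfolding periodic_def fourier_series_def by simp
  show "fourier_series a (w + t) = fourier_series (\<lambda>n. a n * character n t) w"
    unfolding fourier_series_def character_add by (simp add: mult_ac)
qed

lemma mean_character: "mean (character n) = (if n = 0 then 1 else 0)"
proof (cases "n = 0")
  case True
  then show ?thesis
    by (simp add: mean_def set_lebesgue_integral_def measure_def emeasure_square)
next
  case False
  have "\<exists>t. character n t \<noteq> 1"
  proof (cases "fst n = 0")
    case True
    then have "snd n \<noteq> 0" using False by (simp add: prod_eq_iff)
    then have "character n (0, 1 / (2 * real_of_int (snd n))) = -1" using True by (simp add: character_def)
    then show ?thesis by (metis one_neq_neg_one)
  next
    case False
    then have "character n (1 / (2 * real_of_int (fst n)), 0) = -1" by (simp add: character_def)
    then show ?thesis by (metis one_neq_neg_one)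
  qed
  then obtain t where t: "character n t \<noteq> 1" by blast
  have "mean (character n) = mean (\<lambda>w. character n (w + t))" by (rule mean_translate[OF bdd_borel_character character_periodic, symmetric])
  also have "\<dots> = mean (\<lambda>w. character n t * character n w)" unfolding character_add by (simp add: mult.commute)
  also have "\<dots> = character n t * mean (character n)" by (rule mean_cmult)
  finally have "(character n t - 1) * mean (character n) = 0" by (simp add: algebra_simps)
  then show ?thesis using t False by simp
qed

lemma fcoeff_character: "fcoeff (character m) n = (if m = n then 1 else 0)"
proof -
  have "fcoeff (character m) n = mean (character (m - n))"
    unfolding fcoeff_def character_cnj character_mult by simp
  then show ?thesis by (simp add: mean_character)
qed

lemma bdd_borel_trig:
  fixes N :: nat
  shows "\<exists>K. bdd_borel (\<lambda>w. \<Sum>k<N. a k * character (m k) w) K"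
proof (induction N)
  case 0
  have "bdd_borel (\<lambda>w. 0 :: complex) 0" by (simp add: bdd_borel_def)
  then show ?case by auto
next
  case (Suc N)
  then obtain K where K: "bdd_borel (\<lambda>w. \<Sum>k<N. a k * character (m k) w) K" by blast
  have "bdd_borel (\<lambda>w. a N * character (m N) w) (norm (a N) * 1)"
    by (rule bdd_borel_mult[OF _ bdd_borel_character]) (simp add: bdd_borel_def)
  from bdd_borel_add[OF K this] show ?case by auto
qed

lemma fcoeff_trig:
  fixes N :: nat
  shows "fcoeff (\<lambda>w. \<Sum>k<N. a k * character (m k) w) n = (\<Sum>k<N. if m k = n then a k else 0)"
proof (induction N)
  case 0
  show ?case using fcoeff_cmult[of 0 "\<lambda>w. 0" n] by simp
next
  case (Suc N)
  obtain K where K: "bdd_borel (\<lambda>w. \<Sum>k<N. a k * character (m k) w) K" using bdd_borel_trig by blast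
  have "bdd_borel (\<lambda>w. a N * character (m N) w) (norm (a N) * 1)"
    by (rule bdd_borel_mult[OF _ bdd_borel_character]) (simp add: bdd_borel_def)
  from fcoeff_add[OF K this, of n] show ?case
    using Suc by (simp add: fcoeff_cmult fcoeff_character)
qed

lemma fcoeff_diff: "bdd_borel f K \<Longrightarrow> bdd_borel g L \<Longrightarrow> fcoeff (\<lambda>w. f w - g w) n = fcoeff f n - fcoeff g n"
proof -
  assume f: "bdd_borel f K" and g: "bdd_borel g L"
  have "bdd_borel (\<lambda>w. (-1) * g w) L" using g by (simp add: bdd_borel_def)
  from fcoeff_add[OF f this, of n] show ?thesis unfolding fcoeff_cmult by simp
qed

lemma fcoeff_fourier_series:
  assumes a: "\<And>n. norm (a n) \<le> C * lattice_weight n"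
  shows "fcoeff (fourier_series a) n = a n"
proof -
  note sp = fourier_series_props[of a C, OF a]
  obtain L where L: "bdd_borel (fourier_series a) L" using periodic_cont_bdd_borel[OF sp(4,3)] by blast
  obtain k0 where k0: "lattice_enum k0 = n" using lattice_enum_bij by (metis bij_pointE)
  have part: "fcoeff (\<lambda>w. \<Sum>k<N. a (lattice_enum k) * character (lattice_enum k) w) n = a n" if "N > k0" for N
  proof -
    have "(\<Sum>k<N. if lattice_enum k = n then a (lattice_enum k) else 0) = (\<Sum>k<N. if k = k0 then a n else 0)"
      using lattice_enum_bij k0 by (intro sum.cong refl) (auto simp: bij_def inj_def)
    then show ?thesis unfolding fcoeff_trig using that by simp
  qed
  have "norm (a n - fcoeff (fourier_series a) n) \<le> 0 + e" if e: "e > 0" for e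
  proof -
    have "\<forall>\<^sub>F N in sequentially. \<forall>w\<in>UNIV. dist (\<Sum>k<N. a (lattice_enum k) * character (lattice_enum k) w) (fourier_series a w) < e"
      by (rule uniform_limitD[OF sp(2) e])
    then obtain N0 where N0: "\<And>N w. N \<ge> N0 \<Longrightarrow> dist (\<Sum>k<N. a (lattice_enum k) * character (lattice_enum k) w) (fourier_series a w) < e"
      by (auto simp: eventually_sequentially)
    define N where "N = max N0 (Suc k0)"
    obtain K where K: "bdd_borel (\<lambda>w. \<Sum>k<N. a (lattice_enum k) * character (lattice_enum k) w) K" using bdd_borel_trig[where N = N and a = "\<lambda>k. a (lattice_enum k)" and m = lattice_enum] by blast
    have D: "bdd_borel (\<lambda>w. (\<Sum>k<N. a (lattice_enum k) * character (lattice_enum k) w) - fourier_series a w) e"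
    proof -
      have "(\<lambda>w. (\<Sum>k<N. a (lattice_enum k) * character (lattice_enum k) w) - fourier_series a w) \<in> borel_measurable borel"
        using bdd_borel_measurable[OF K] bdd_borel_measurable[OF L] by simp
      moreover have "norm ((\<Sum>k<N. a (lattice_enum k) * character (lattice_enum k) w) - fourier_series a w) \<le> e" for w
        using N0[of N w] by (simp add: N_def dist_norm)
      ultimately show ?thesis by (simp add: bdd_borel_def)
    qed
    have "norm (fcoeff (\<lambda>w. (\<Sum>k<N. a (lattice_enum k) * character (lattice_enum k) w) - fourier_series a w) n) \<le> e"
      unfolding fcoeff_def by (rule mean_bound[OF bdd_borel_fcoeff[OF D]])
    then show ?thesis unfolding fcoeff_diff[OF K L] using part[of N] by (simp add: N_def)
  qed
  then have "norm (a n - fcoeff (fourier_series a) n) \<le> 0" by (rule field_le_epsilon)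
  then show ?thesis by simp
qed

text \<open>The chord \<open>norm (cis (2 * pi * x) - 1)\<close> equals \<open>2 * \<bar>sin (pi * y)\<bar>\<close> with \<open>y\<close> the signed distance
  of \<open>x\<close> to the nearest integer.\<close>

lemma small_divisor: "dist_nearest_int x \<le> norm (cis (2 * pi * x) - 1)"
proof -
  define y where "y = x - of_int (round x)"
  have y: "\<bar>y\<bar> \<le> 1/2" using of_int_round_abs_le[of x] by (simp add: y_def abs_minus_commute)
  have "cis (2 * pi * x) = cis (2 * pi * y + 2 * pi * of_int (round x))"
    by (simp add: y_def algebra_simps)
  also have "\<dots> = cis (2 * pi * y)" unfolding cis_mult[symmetric] using cis_multiple_2pi[of "real_of_int (round x)"] by simp
  finally have c: "cis (2 * pi * x) = cis (2 * pi * y)" .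
  have "(norm (cis (2 * pi * y) - 1))\<^sup>2 = (cos (2 * pi * y) - 1)\<^sup>2 + (sin (2 * pi * y))\<^sup>2"
    by (simp add: cmod_power2)
  also have "\<dots> = 2 - 2 * cos (2 * (pi * y))"
    using sin_cos_squared_add[of "2 * pi * y"] by (simp add: power2_eq_square algebra_simps)
  also have "\<dots> = (2 * sin (pi * y))\<^sup>2" unfolding cos_double_sin by (simp add: power2_eq_square)
  finally have n: "norm (cis (2 * pi * y) - 1) = \<bar>2 * sin (pi * y)\<bar>"
    by (metis abs_norm_cancel power2_eq_iff_nonneg abs_ge_zero norm_ge_zero power2_abs)
  define u where "u = pi * y"
  have u: "\<bar>u\<bar> \<le> 2" unfolding u_def abs_mult using y pi_less_4 pi_gt_zero
    using mult_mono[of "\<bar>pi\<bar>" 4 "\<bar>y\<bar>" "1/2"] by simp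
  have "\<bar>sin u - (\<Sum>m<3. sin_coeff m * u ^ m)\<bar> \<le> inverse (fact 3) * \<bar>u\<bar> ^ 3"
    by (rule Maclaurin_sin_bound)
  moreover have "(\<Sum>m<3. sin_coeff m * u ^ m) = u"
    by (simp add: eval_nat_numeral sin_coeff_def)
  moreover have "inverse (fact 3) * \<bar>u\<bar> ^ 3 \<le> 2/3 * \<bar>u\<bar>"
  proof -
    have "\<bar>u\<bar> * (\<bar>u\<bar> * \<bar>u\<bar>) \<le> \<bar>u\<bar> * (2 * 2)" using u by (intro mult_left_mono mult_mono) auto
    then show ?thesis by (simp add: fact_numeral power3_eq_cube)
  qed
  ultimately have "\<bar>sin u\<bar> \<ge> \<bar>u\<bar> / 3" by linarith
  then have "\<bar>2 * sin (pi * y)\<bar> \<ge> 2 * \<bar>u\<bar> / 3" by (simp add: u_def abs_mult)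
  moreover have "\<bar>u\<bar> \<ge> 3 * \<bar>y\<bar> / 2"
    unfolding u_def abs_mult using mult_right_mono[of "3/2" pi "\<bar>y\<bar>"] pi_gt3 by simp
  ultimately show ?thesis unfolding c n by (simp add: dist_nearest_int_def y_def[symmetric])
qed

lemma diophantine_divisor:
  assumes "diophantine c \<nu> \<tau>" "n \<noteq> 0"
  shows "c * real_of_int (\<bar>fst n\<bar> + \<bar>snd n\<bar>) powr (- \<nu>) \<le> norm (character n \<tau> - 1)"
proof -
  have "(fst n, snd n) \<noteq> (0, 0)" using assms(2) by (simp add: prod_eq_iff)
  then have "c * real_of_int (\<bar>fst n\<bar> + \<bar>snd n\<bar>) powr (- \<nu>) \<le> dist_nearest_int (real_of_int (fst n) * fst \<tau> + real_of_int (snd n) * snd \<tau>)"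
    using assms(1) unfolding diophantine_def by blast
  also have "\<dots> \<le> norm (character n \<tau> - 1)" unfolding character_def by (rule small_divisor)
  finally show ?thesis .
qed

text \<open>Comparison of Fourier coefficients forces \<open>H\<close> to have the coefficients
  \<open>fcoeff G n / (character n \<tau> - 1)\<close>. The divisors are bounded below by a multiple of the power \<open>- \<nu>\<close>
  of the frequency, so \<open>\<nu> + 4\<close> derivatives of \<open>G\<close> along each coordinate leave enough decay for a uniformly
  convergent series.\<close>

theorem cohomological_equation:
  assumes dc: "diophantine c \<nu> \<tau>" "c > 0" and G: "periodic G" "Ck_along e1 r G" "Ck_along e2 r G" and r: "\<nu> + 4 \<le> real r"
  obtains H where "continuous_on UNIV H" "periodic H" "\<And>w. G w = mean G + H (w + \<tau>) - H w"
proof -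
  obtain C1 where C1: "\<And>n. \<bar>2 * pi * freq_along e1 n\<bar> ^ r * norm (fcoeff G n) \<le> C1" using fcoeff_decay[OF G(2,1)] by blast
  obtain C2 where C2: "\<And>n. \<bar>2 * pi * freq_along e2 n\<bar> ^ r * norm (fcoeff G n) \<le> C2" using fcoeff_decay[OF G(3,1)] by blast
  define C where "C = max C1 C2"
  define N where "N n = real_of_int (\<bar>fst n\<bar> + \<bar>snd n\<bar>)" for n :: "int \<times> int"
  have N1: "N n \<ge> 1" if "n \<noteq> 0" for n
  proof -
    have "\<bar>fst n\<bar> + \<bar>snd n\<bar> \<ge> 1" using that by (cases n) (auto simp: zero_prod_def)
    then show ?thesis unfolding N_def by (metis of_int_1 of_int_le_iff)
  qed
  have pi1: "2 * x \<le> \<bar>2 * pi * x\<bar>" for x :: real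
    using pi_gt3 mult_right_mono[of 1 pi "\<bar>x\<bar>"] by (simp add: abs_mult)
  have dec: "N n ^ r * norm (fcoeff G n) \<le> C" for n
  proof (cases "\<bar>fst n\<bar> \<ge> \<bar>snd n\<bar>")
    case True
    have "N n \<le> \<bar>2 * pi * freq_along e1 n\<bar>" using True pi1[of "\<bar>real_of_int (fst n)\<bar>"] by (simp add: N_def freq_along_def abs_mult)
    then have "N n ^ r * norm (fcoeff G n) \<le> \<bar>2 * pi * freq_along e1 n\<bar> ^ r * norm (fcoeff G n)"
      by (intro mult_right_mono power_mono) (auto simp: N_def)
    then show ?thesis using C1[of n] by (simp add: C_def)
  next
    case False
    have "N n \<le> \<bar>2 * pi * freq_along e2 n\<bar>" using False pi1[of "\<bar>real_of_int (snd n)\<bar>"] by (simp add: N_def freq_along_def abs_mult)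
    then have "N n ^ r * norm (fcoeff G n) \<le> \<bar>2 * pi * freq_along e2 n\<bar> ^ r * norm (fcoeff G n)"
      by (intro mult_right_mono power_mono) (auto simp: N_def)
    then show ?thesis using C2[of n] by (simp add: C_def)
  qed
  have C0: "C \<ge> 0" using order_trans[OF _ dec[of 0]] by (simp add: N_def)
  define a where "a n = (if n = 0 then 0 else fcoeff G n / (character n \<tau> - 1))" for n
  have div0: "character n \<tau> - 1 \<noteq> 0" if "n \<noteq> 0" for n
  proof -
    have "0 < c * N n powr (- \<nu>)" using dc(2) N1[OF that] by simp
    also have "\<dots> \<le> norm (character n \<tau> - 1)" unfolding N_def by (rule diophantine_divisor[OF dc(1) that])
    finally show ?thesis by auto
  qed
  have abound: "norm (a n) \<le> 16 * C / c * lattice_weight n" for n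
  proof (cases "n = 0")
    case True
    then show ?thesis using C0 dc(2) by (simp add: a_def lattice_weight_def)
  next
    case False
    have N: "N n \<ge> 1" by (rule N1[OF False])
    have lattice_weight: "1 \<le> 16 * N n ^ 4 * lattice_weight n"
    proof -
      have le: "1 + real_of_int \<bar>fst n\<bar> \<le> 2 * N n" "1 + real_of_int \<bar>snd n\<bar> \<le> 2 * N n"
        using N by (auto simp: N_def)
      have "(1 + real_of_int \<bar>fst n\<bar>)\<^sup>2 * (1 + real_of_int \<bar>snd n\<bar>)\<^sup>2 \<le> (2 * N n)\<^sup>2 * (2 * N n)\<^sup>2"
        by (intro mult_mono power_mono le) auto
      also have "\<dots> = 16 * N n ^ 4" by (simp add: power2_eq_square power4_eq_xxxx)
      finally have le2: "(1 + real_of_int \<bar>fst n\<bar>)\<^sup>2 * (1 + real_of_int \<bar>snd n\<bar>)\<^sup>2 \<le> 16 * N n ^ 4" .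
      have "(1 + real_of_int \<bar>fst n\<bar>)\<^sup>2 * (1 + real_of_int \<bar>snd n\<bar>)\<^sup>2 > 0"
        by (intro mult_pos_pos zero_less_power) auto
      then show ?thesis using le2 by (simp add: lattice_weight_def)
    qed
    have pw: "N n powr \<nu> * N n ^ 4 \<le> N n ^ r"
    proof -
      have "N n powr \<nu> * N n ^ 4 = N n powr (\<nu> + 4)" using N by (simp add: powr_add powr_numeral)
      also have "\<dots> \<le> N n powr (real r)" using N r by (intro powr_mono) auto
      also have "\<dots> = N n ^ r" using N by (simp add: powr_realpow)
      finally show ?thesis .
    qed
    have "norm (a n) * c * N n powr (- \<nu>) \<le> norm (a n) * norm (character n \<tau> - 1)"
      using mult_left_mono[OF diophantine_divisor[OF dc(1) False], of "norm (a n)"] by (simp add: N_def mult_ac)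
    also have "\<dots> = norm (fcoeff G n)" using False div0[OF False] by (simp add: a_def norm_divide)
    finally have 1: "norm (a n) * c * N n powr (- \<nu>) \<le> norm (fcoeff G n)" .
    have "norm (a n) * c * N n ^ 4 = norm (a n) * c * N n powr (- \<nu>) * (N n powr \<nu> * N n ^ 4)"
      using N by (simp add: powr_minus field_simps)
    also have "\<dots> \<le> norm (fcoeff G n) * N n ^ r"
      using N dc(2) by (intro mult_mono 1 pw) auto
    also have "\<dots> \<le> C" using dec[of n] by (simp add: mult.commute)
    finally have 2: "norm (a n) * N n ^ 4 \<le> C / c" using dc(2) by (simp add: field_simps)
    have "norm (a n) * 1 \<le> norm (a n) * (16 * N n ^ 4 * lattice_weight n)" by (intro mult_left_mono lattice_weight) auto
    also have "\<dots> = 16 * lattice_weight n * (norm (a n) * N n ^ 4)" by simp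
    also have "\<dots> \<le> 16 * lattice_weight n * (C / c)" by (intro mult_left_mono 2) (simp add: lattice_weight_def)
    finally show ?thesis by (simp add: mult_ac)
  qed
  have atbound: "norm (a n * character n \<tau>) \<le> 16 * C / c * lattice_weight n" for n using abound by (simp add: norm_mult)
  note sa = fourier_series_props[of a, OF abound] and sat = fourier_series_props[of "\<lambda>n. a n * character n \<tau>", OF atbound]
  define H where "H = fourier_series a"
  have Hc: "continuous_on UNIV H" and Hp: "periodic H" unfolding H_def by (fact sa)+
  have Ht: "H (w + \<tau>) = fourier_series (\<lambda>n. a n * character n \<tau>) w" for w unfolding H_def by (rule sa(5))
  define D where "D w = G w - mean G - (fourier_series (\<lambda>n. a n * character n \<tau>) w - H w)" for w
  have Gc: "continuous_on UNIV G" by (rule Ck_along_continuous[OF G(2)])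
  have Dc: "continuous_on UNIV D" unfolding D_def by (intro continuous_intros Gc Hc sat(3))
  have Dp: "periodic D" using G(1) Hp sat(4) unfolding periodic_def D_def by simp
  obtain K1 where K1: "bdd_borel G K1" using periodic_cont_bdd_borel[OF G(1) Gc] by blast
  obtain K2 where K2: "bdd_borel H K2" using periodic_cont_bdd_borel[OF Hp Hc] by blast
  obtain K3 where K3: "bdd_borel (fourier_series (\<lambda>n. a n * character n \<tau>)) K3" using periodic_cont_bdd_borel[OF sat(4,3)] by blast
  have Kc: "bdd_borel (\<lambda>w. mean G * character 0 w) (norm (mean G) * 1)"
    by (rule bdd_borel_mult[OF _ bdd_borel_character]) (simp add: bdd_borel_def)
  have D': "D = (\<lambda>w. (G w - mean G * character 0 w) - (fourier_series (\<lambda>n. a n * character n \<tau>) w - H w))"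
    by (simp add: D_def fun_eq_iff)
  have b1: "\<exists>K. bdd_borel (\<lambda>w. G w - mean G * character 0 w) K"
    by (rule periodic_cont_bdd_borel) (use G(1) in \<open>simp add: periodic_def\<close>, intro continuous_intros Gc character_cont)
  have b2: "\<exists>K. bdd_borel (\<lambda>w. fourier_series (\<lambda>n. a n * character n \<tau>) w - H w) K"
    by (rule periodic_cont_bdd_borel) (use sat(4) Hp in \<open>simp add: periodic_def\<close>, intro continuous_intros Hc sat(3))
  obtain K4 where K4: "bdd_borel (\<lambda>w. G w - mean G * character 0 w) K4" using b1 by blast
  obtain K5 where K5: "bdd_borel (\<lambda>w. fourier_series (\<lambda>n. a n * character n \<tau>) w - H w) K5" using b2 by blast
  have "fcoeff D n = 0" for n
  proof -
    have "fcoeff D n = (fcoeff G n - mean G * fcoeff (character 0) n) - (a n * character n \<tau> - a n)"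
      unfolding D' fcoeff_diff[OF K4 K5] fcoeff_diff[OF K1 Kc] fcoeff_diff[OF K3 K2] fcoeff_cmult
      unfolding H_def by (simp add: fcoeff_fourier_series[of a, OF abound] fcoeff_fourier_series[of "\<lambda>n. a n * character n \<tau>", OF atbound] del: character_zero)
    also have "\<dots> = 0"
    proof (cases "n = 0")
      case True
      then show ?thesis by (simp add: fcoeff_character a_def del: character_zero) (simp add: fcoeff_def)
    next
      case False
      then have "a n * (character n \<tau> - 1) = fcoeff G n" using div0[OF False] by (simp add: a_def)
      then show ?thesis using False by (simp add: fcoeff_character algebra_simps del: character_zero)
    qed
    finally show ?thesis .
  qed
  then have "D w = 0" for w by (rule fourier_unique_continuous[OF Dc Dp])
  then have D0: "G w - mean G - (H (w + \<tau>) - H w) = 0" for w unfolding D_def Ht[symmetric] .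
  have "g - m - (x - y) = 0 \<Longrightarrow> g = m + x - y" for g m x y :: complex by (simp add: algebra_simps)
  from this[OF D0] have "G w = mean G + H (w + \<tau>) - H w" for w .
  with Hc Hp show thesis using that by blast
qed

section \<open>Lines of a dominated splitting\<close>

lemma line_through_iff: "x \<in> line_through v \<longleftrightarrow> (\<exists>c. x = c *s v)"
  by (auto simp: line_through_def)

lemma line_through_eq:
  assumes "x \<in> line_through v" "x \<noteq> 0"
  shows "line_through v = line_through x"
proof -
  obtain c where c: "x = c *s v" using assms(1) by (auto simp: line_through_iff)
  then have c0: "c \<noteq> 0" using assms(2) by auto
  have v: "v = inverse c *s x" using c c0 by (simp add: vector_smult_assoc)
  show ?thesis
    unfolding line_through_def
  proof (intro equalityI subsetI)
    fix y assume "y \<in> range (\<lambda>c. c *s v)"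
    then obtain d where "y = d *s v" by blast
    then have "y = (d * inverse c) *s x" using v by (metis vector_smult_assoc)
    then show "y \<in> range (\<lambda>c. c *s x)" by blast
  next
    fix y assume "y \<in> range (\<lambda>c. c *s x)"
    then obtain d where "y = d *s x" by blast
    then have "y = (d * c) *s v" using c by (simp add: vector_smult_assoc)
    then show "y \<in> range (\<lambda>c. c *s v)" by blast
  qed
qed

text \<open>An arbitrary unit vector on a line. No continuity in the line is possible in general; the
  expressions used below depend only on the line.\<close>

definition uvec :: "cvec set \<Rightarrow> cvec" where
  "uvec l = (SOME v. norm v = 1 \<and> l = line_through v)"

lemma uvec_props:
  assumes "l \<in> line_through ` (- {0})"
  shows "norm (uvec l) = 1" "l = line_through (uvec l)"
proof -
  obtain v where v: "v \<noteq> 0" "l = line_through v" using assms by auto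
  let ?x = "complex_of_real (inverse (norm v)) *s v"
  have "norm ?x = 1" using v(1) by (simp add: norm_smult norm_inverse)
  moreover have "l = line_through ?x"
    unfolding v(2) by (rule line_through_eq) (use v(1) in \<open>auto simp: line_through_iff\<close>)
  ultimately have "norm (uvec l) = 1 \<and> l = line_through (uvec l)"
    unfolding uvec_def by (intro someI[of "\<lambda>v. norm v = 1 \<and> l = line_through v" ?x] conjI)
  then show "norm (uvec l) = 1" "l = line_through (uvec l)" by auto
qed

lemma topspace_CP1: "topspace CP1 = line_through ` (- {0})"
proof -
  have "openin CP1 (line_through ` (- {0}))"
    unfolding openin_CP1
  proof
    have "{v. v \<noteq> 0 \<and> line_through v \<in> line_through ` (- {0})} = - {0}" by auto
    then show "open {v. v \<noteq> 0 \<and> line_through v \<in> line_through ` (- {0})}" by (simp add: open_Compl)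
  qed simp
  moreover have "\<U> \<subseteq> line_through ` (- {0})" if "openin CP1 \<U>" for \<U>
    using that unfolding openin_CP1 by blast
  ultimately show ?thesis unfolding topspace_def by blast
qed

text \<open>Functions on the projective line are continuous for the quotient topology as soon as they are
  continuous as functions of a nonzero vector.\<close>

lemma CP1_continuous_function:
  fixes \<phi> :: "cvec set \<Rightarrow> complex"
  assumes l: "continuous_map euclidean CP1 l" and \<phi>: "continuous_on (- {0}) (\<lambda>v. \<phi> (line_through v))"
  shows "continuous_on UNIV (\<lambda>w. \<phi> (l w))"
  unfolding continuous_on_open_invariant
proof (intro allI impI)
  fix T :: "complex set" assume T: "open T"
  define \<U> where "\<U> = {L \<in> line_through ` (- {0}). \<phi> L \<in> T}"
  have "{v. v \<noteq> 0 \<and> line_through v \<in> \<U>} = {v \<in> - {0}. \<phi> (line_through v) \<in> T}"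
    by (auto simp: \<U>_def)
  moreover have "open {v \<in> - {0}. \<phi> (line_through v) \<in> T}"
  proof -
    have "open ((- {0}) \<inter> (\<lambda>v. \<phi> (line_through v)) -` T)"
      by (rule continuous_open_preimage[OF \<phi> _ T]) (simp add: open_Compl)
    moreover have "(- {0}) \<inter> (\<lambda>v. \<phi> (line_through v)) -` T = {v \<in> - {0}. \<phi> (line_through v) \<in> T}"
      by blast
    ultimately show ?thesis by simp
  qed
  ultimately have "open {v. v \<noteq> 0 \<and> line_through v \<in> \<U>}" by simp
  moreover have "\<U> \<subseteq> line_through ` (- {0})" unfolding \<U>_def by blast
  ultimately have "openin CP1 \<U>" unfolding openin_CP1 by blast
  then have "openin euclidean {w \<in> topspace euclidean. l w \<in> \<U>}"
    by (rule openin_continuous_map_preimage[OF l])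
  then have "open {w. l w \<in> \<U>}" by simp
  moreover have "l w \<in> line_through ` (- {0})" for w
    using continuous_map_image_subset_topspace[OF l] topspace_CP1 by auto
  ultimately have "open {w. \<phi> (l w) \<in> T}" by (simp add: \<U>_def)
  then show "\<exists>A. open A \<and> A \<inter> UNIV = (\<lambda>w. \<phi> (l w)) -` T \<inter> UNIV"
    by (intro exI[of _ "{w. \<phi> (l w) \<in> T}"]) auto
qed

lemma line_projection_continuous:
  assumes l: "continuous_map euclidean CP1 l"
  shows "continuous_on UNIV (\<lambda>w. uvec (l w) $ i * cnj (uvec (l w) $ j))"
proof (rule CP1_continuous_function[OF l])
  have eq: "uvec (line_through v) $ i * cnj (uvec (line_through v) $ j) =
     v $ i * cnj (v $ j) * inverse (v $ 1 * cnj (v $ 1) + v $ 2 * cnj (v $ 2))" if v: "v \<in> - {0}" for v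
  proof (rule projection_parallel)
    have L: "line_through v \<in> line_through ` (- {0})" using v by blast
    have "uvec (line_through v) \<in> line_through (uvec (line_through v))" by (auto simp: line_through_iff intro: exI[of _ 1])
    then have "uvec (line_through v) \<in> line_through v" using uvec_props(2)[OF L] by simp
    then obtain c where "uvec (line_through v) = c *s v" by (auto simp: line_through_iff)
    then show "wedge v (uvec (line_through v)) = 0" by (simp add: wedge_smult_right wedge_self)
    show "norm (uvec (line_through v)) = 1" by (rule uvec_props(1)[OF L])
  qed (use v in simp)
  have nz: "v $ 1 * cnj (v $ 1) + v $ 2 * cnj (v $ 2) \<noteq> 0" if "v \<in> - {0}" for v :: cvec
    unfolding norm_sq_complex[symmetric] using that by simp
  have "continuous_on (- {0}) (\<lambda>v::cvec. v $ i * cnj (v $ j) * inverse (v $ 1 * cnj (v $ 1) + v $ 2 * cnj (v $ 2)))"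
    using nz by (intro continuous_intros) auto
  then show "continuous_on (- {0}) (\<lambda>v. uvec (line_through v) $ i * cnj (uvec (line_through v) $ j))"
    by (rule continuous_on_eq) (simp add: eq)
qed

lemma unitary_props:
  assumes "unitary_mat U"
  shows "norm (U *v x) = norm x" "cmod (det U) = 1"
proof -
  have u: "(\<chi> i j. cnj (U $ j $ i)) ** U = mat 1" using assms by (simp add: unitary_mat_def)
  have e: "cnj (U $ 1 $ i) * U $ 1 $ j + cnj (U $ 2 $ i) * U $ 2 $ j = (if i = j then 1 else 0)" for i j
  proof -
    have "((\<chi> i j. cnj (U $ j $ i)) ** U) $ i $ j = mat 1 $ i $ j" using u by simp
    then show ?thesis by (simp add: matrix_matrix_mult_def sum_2 mat_def)
  qed
  have "complex_of_real ((norm (U *v x))\<^sup>2) =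
     x $ 1 * cnj (x $ 1) * (cnj (U $ 1 $ 1) * U $ 1 $ 1 + cnj (U $ 2 $ 1) * U $ 2 $ 1)
   + x $ 2 * cnj (x $ 2) * (cnj (U $ 1 $ 2) * U $ 1 $ 2 + cnj (U $ 2 $ 2) * U $ 2 $ 2)
   + x $ 1 * cnj (x $ 2) * (cnj (U $ 1 $ 2) * U $ 1 $ 1 + cnj (U $ 2 $ 2) * U $ 2 $ 1)
   + x $ 2 * cnj (x $ 1) * (cnj (U $ 1 $ 1) * U $ 1 $ 2 + cnj (U $ 2 $ 1) * U $ 2 $ 2)"
    unfolding norm_sq_complex matrix_vector_mult_2 by (simp add: algebra_simps)
  also have "\<dots> = complex_of_real ((norm x)\<^sup>2)" unfolding e norm_sq_complex by simp
  finally have "(norm (U *v x))\<^sup>2 = (norm x)\<^sup>2" by (simp only: of_real_eq_iff)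
  then show "norm (U *v x) = norm x" by simp
  have "det ((\<chi> i j. cnj (U $ j $ i)) ** U) = 1" unfolding u by simp
  then have "cnj (det U) * det U = 1" by (simp add: det_mul) (simp add: det_2 mult.commute)
  then have "cmod (cnj (det U) * det U) = 1" by simp
  then have "(cmod (det U))\<^sup>2 = 1" by (simp add: norm_mult power2_eq_square)
  then show "cmod (det U) = 1" by (intro power2_eq_imp_eq[of _ 1]) auto
qed

lemma analytic_along_bounded:
  assumes "analytic_along v f"
  obtains K where "K > 0" "\<And>w. norm (f w) \<le> K"
proof -
  obtain \<delta> K F where F: "\<delta> > 0" "K > 0" "\<And>w. bdd_hol \<delta> K (F w)" "\<And>w t. \<bar>t\<bar> < \<delta> \<Longrightarrow> F w (of_real t) = f (w + t *\<^sub>R v)"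
    using analytic_alongE[OF assms(1)] by blast
  have "norm (f w) \<le> K" for w
    using bdd_holD[OF F(3), of 0 w] F(1) F(4)[of 0 w] by simp
  then show thesis using that F(2) by blast
qed

lemma matrix_bound:
  fixes M :: cmat
  assumes "\<And>i j. cmod (M $ i $ j) \<le> K"
  shows "norm (M *v x) \<le> 4 * K * norm x"
proof -
  have K: "0 \<le> K" using order_trans[OF norm_ge_zero assms] .
  have c: "cmod ((M *v x) $ i) \<le> 2 * K * norm x" for i
  proof -
    have "cmod ((M *v x) $ i) \<le> cmod (M $ i $ 1) * cmod (x $ 1) + cmod (M $ i $ 2) * cmod (x $ 2)"
      unfolding matrix_vector_mult_2 norm_mult[symmetric] by (rule norm_triangle_ineq)
    also have "\<dots> \<le> K * norm x + K * norm x" by (intro add_mono mult_mono assms component_le_norm K) auto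
    finally show ?thesis by simp
  qed
  have "(norm (M *v x))\<^sup>2 \<le> (4 * K * norm x)\<^sup>2"
  proof -
    have "(norm (M *v x))\<^sup>2 \<le> (2 * K * norm x)\<^sup>2 + (2 * K * norm x)\<^sup>2"
      unfolding norm_cvec by (intro add_mono power_mono c) auto
    also have "\<dots> \<le> (4 * K * norm x)\<^sup>2" by (simp add: power_mult_distrib)
    finally show ?thesis .
  qed
  then show ?thesis by (rule power2_le_imp_le) (simp add: K)
qed

lemma matrix_matrix_mult_2: "((M::cmat) ** N) $ i $ j = M $ i $ 1 * N $ 1 $ j + M $ i $ 2 * N $ 2 $ j"
  by (simp add: matrix_matrix_mult_def sum_2)

lemma analytic_along_iterate:
  assumes "\<And>i j. analytic_along v (\<lambda>w. A w $ i $ j)"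
  shows "analytic_along v (\<lambda>w. cocycle_iterate \<tau> A n w $ i $ j)"
proof (induction n arbitrary: i j)
  case 0
  show ?case by (simp add: analytic_along_const)
next
  case (Suc n)
  show ?case unfolding cocycle_iterate.simps matrix_matrix_mult_2
    by (intro analytic_along_add analytic_along_mult Suc analytic_along_translate[OF assms])
qed

lemma iterate_line:
  assumes "\<And>w. (\<lambda>v. A w *v v) ` l w = l (w + \<tau>)" "x \<in> l w"
  shows "cocycle_iterate \<tau> A n w *v x \<in> l (w + real n *\<^sub>R \<tau>)"
proof (induction n)
  case (Suc n)
  have "A (w + real n *\<^sub>R \<tau>) *v (cocycle_iterate \<tau> A n w *v x) \<in> l (w + real n *\<^sub>R \<tau> + \<tau>)"
    using Suc assms(1)[of "w + real n *\<^sub>R \<tau>"] by blast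
  moreover have "w + real n *\<^sub>R \<tau> + \<tau> = w + real (Suc n) *\<^sub>R \<tau>" by (simp add: algebra_simps)
  ultimately show ?case by (simp add: matrix_vector_mul_assoc)
qed (use assms in simp)

lemma iterate_det:
  assumes "\<And>w. d \<le> cmod (det (A w))" "0 \<le> d"
  shows "d ^ n \<le> cmod (det (cocycle_iterate \<tau> A n w))"
proof (induction n)
  case (Suc n)
  show ?case unfolding cocycle_iterate.simps det_mul norm_mult power_Suc
    by (intro mult_mono assms Suc) (auto simp: assms)
qed simp

text \<open>On a line all unit vectors are stretched by the same factor.\<close>

lemma restricted_values:
  assumes "norm b = 1" "M *v b = \<beta> *s b'" "norm b' = 1"
  shows "restricted_norm M (line_through b) = cmod \<beta>" "restricted_conorm M (line_through b) = cmod \<beta>"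
proof -
  have v: "norm (M *v v) = cmod \<beta>" if v: "v \<in> line_through b" "norm v = 1" for v
  proof -
    obtain c where c: "v = c *s b" using v by (auto simp: line_through_iff)
    then have "cmod c = 1" using v(2) assms(1) by (simp add: norm_smult)
    then show ?thesis unfolding c vec.scale assms(2) by (simp add: norm_smult norm_mult assms(3))
  qed
  have "b \<in> {v \<in> line_through b. norm v = 1}"
    using assms(1) by (auto simp: line_through_iff intro: exI[of _ 1])
  then have ne: "{v \<in> line_through b. norm v = 1} \<noteq> {}" by blast
  show "restricted_norm M (line_through b) = cmod \<beta>"
    unfolding restricted_norm_def using ne v by (subst SUP_cong[OF refl, of _ _ "\<lambda>v. cmod \<beta>"]) auto
  show "restricted_conorm M (line_through b) = cmod \<beta>"
    unfolding restricted_conorm_def using ne v by (subst INF_cong[OF refl, of _ _ "\<lambda>v. cmod \<beta>"]) auto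
qed

definition inverse_2 :: "cmat \<Rightarrow> cmat" where
  "inverse_2 M = (\<chi> i j. inverse (det M) * (if i = 1 then (if j = 1 then M $ 2 $ 2 else - M $ 1 $ 2)
      else (if j = 1 then - M $ 2 $ 1 else M $ 1 $ 1)))"

lemma inverse_2_left: "det M \<noteq> 0 \<Longrightarrow> inverse_2 M *v (M *v x) = x"
  by (simp add: vec_eq_iff forall_2 matrix_vector_mult_2 inverse_2_def field_simps) (simp add: det_2 algebra_simps)

lemma inverse_2_det: "det M \<noteq> 0 \<Longrightarrow> det (inverse_2 M) \<noteq> 0"
proof
  assume "det M \<noteq> 0" "det (inverse_2 M) = 0"
  have "wedge (inverse_2 M *v (M *v (\<chi> i. if i = 1 then 1 else 0))) (inverse_2 M *v (M *v (\<chi> i. if i = 1 then 0 else 1))) = 0"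
    unfolding wedge_matrix[of "inverse_2 M"] \<open>det (inverse_2 M) = 0\<close> by simp
  then show False unfolding inverse_2_left[OF \<open>det M \<noteq> 0\<close>] by (simp add: wedge_def)
qed

lemma analytic_along_det: "(\<And>i j. analytic_along v (\<lambda>w. B w $ i $ j)) \<Longrightarrow> analytic_along v (\<lambda>w. det (B w :: cmat))"
  unfolding det_2 by (intro analytic_along_diff analytic_along_mult)

lemma analytic_along_inverse_2:
  assumes "\<And>i j. analytic_along v (\<lambda>w. B w $ i $ j)" "\<And>w. d \<le> cmod (det (B w))" "d > 0"
  shows "analytic_along v (\<lambda>w. inverse_2 (B w) $ i $ j)"
proof -
  have i: "analytic_along v (\<lambda>w. inverse (det (B w)))" by (rule analytic_along_inverse[OF analytic_along_det[OF assms(1)] assms(2,3)])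
  show ?thesis
    using exhaust_2[of i] exhaust_2[of j]
    by (auto simp: inverse_2_def intro!: analytic_along_mult[OF i] assms(1) analytic_along_minus analytic_along_mult[OF i analytic_along_minus[OF assms(1)], simplified])
qed

text \<open>The moduli of \<open>wedge\<close> of the two lines and of \<open>det A\<close> are periodic because the sewing matrices are
  unitary, so they attain positive minima and all estimates are uniform over the plane. The line
  \<open>lu\<close> is the dominating line of the \<open>N\<close>-th iterate, and \<open>ls\<close> that of its inverse.\<close>

lemma dominated_lines_analytic:
  assumes adm: "strip_admissible \<tau> U1 U2 A" and dom: "dominated_splitting \<tau> U1 U2 A ls lu"
    and v: "v = e1 \<or> v = e2" and l: "l = ls \<or> l = lu"
  shows "analytic_along v (\<lambda>w. uvec (l w) $ i * cnj (uvec (l w) $ j))"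
proof -
  have inv: "invariant_line \<tau> U1 U2 A ls" "invariant_line \<tau> U1 U2 A lu" and ne: "\<And>w. ls w \<noteq> lu w"
    using dom by (auto simp: dominated_splitting_def)
  obtain N \<kappa> where N: "0 < \<kappa>" "\<kappa> < 1"
    and rat: "\<And>z. restricted_norm (cocycle_iterate \<tau> A N z) (ls z) / restricted_conorm (cocycle_iterate \<tau> A N z) (lu z) \<le> \<kappa>\<^sup>2"
    using dom unfolding dominated_splitting_def by blast
  obtain \<delta> where \<delta>: "\<delta> > 0" "strip_extendable \<delta> A" using adm by (auto simp: strip_admissible_def)
  have sew: "sewing_system U1 U2" and eq: "equivariant_cocycle \<tau> U1 U2 A" using adm by (auto simp: strip_admissible_def)
  have un: "unitary_mat (U1 w)" "unitary_mat (U2 w)" for w using sew unfolding sewing_system_def by blast+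
  define b where "b w = uvec (ls w)" for w
  define a where "a w = uvec (lu w)" for w
  have top: "ls w \<in> line_through ` (- {0})" "lu w \<in> line_through ` (- {0})" for w
    using inv continuous_map_image_subset_topspace topspace_CP1 unfolding invariant_line_def by (metis UNIV_I imageI subsetD topspace_euclidean)+
  have b: "norm (b w) = 1" "ls w = line_through (b w)" and a: "norm (a w) = 1" "lu w = line_through (a w)" for w
    unfolding a_def b_def using uvec_props[OF top(1)] uvec_props[OF top(2)] by auto
  have ain: "a w \<in> lu w" "b w \<in> ls w" for w unfolding a b by (auto simp: line_through_iff intro: exI[of _ 1])
  have W0: "wedge (a w) (b w) \<noteq> 0" for w
  proof
    assume z: "wedge (a w) (b w) = 0"
    have "a w \<noteq> 0" using a(1)[of w] by auto
    then obtain c where "b w = c *s a w" using wedge_zero_parallel[OF z] by blast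
    then have "b w \<in> lu w" unfolding a by (auto simp: line_through_iff)
    moreover have "b w \<noteq> 0" using b(1)[of w] by auto
    ultimately have "lu w = line_through (b w)" unfolding a by (intro line_through_eq)
    then show False using ne[of w] b(2)[of w] by simp
  qed
  have Wper: "cmod (wedge (a (w + u)) (b (w + u))) = cmod (wedge (a w) (b w))"
    if U: "unitary_mat U" "lu (w + u) = (\<lambda>v. U *v v) ` lu w" "ls (w + u) = (\<lambda>v. U *v v) ` ls w" for w u U
  proof -
    have "U *v a w \<in> line_through (a (w + u))" "U *v b w \<in> line_through (b (w + u))"
      using U(2,3) ain a(2) b(2) by (metis imageI)+
    then obtain c d where cd: "U *v a w = c *s a (w + u)" "U *v b w = d *s b (w + u)" by (auto simp: line_through_iff)
    have "cmod c = 1" "cmod d = 1"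
      using unitary_props(1)[OF U(1), of "a w"] unitary_props(1)[OF U(1), of "b w"] by (auto simp: cd norm_smult a b)
    moreover have "cmod (wedge (U *v a w) (U *v b w)) = cmod (wedge (a w) (b w))"
      unfolding wedge_matrix norm_mult unitary_props(2)[OF U(1)] by simp
    ultimately show ?thesis unfolding cd wedge_smult_left wedge_smult_right norm_mult by simp
  qed
  define W where "W w = (cmod (wedge (a w) (b w)))\<^sup>2" for w
  have Wp: "periodic W" unfolding periodic_def W_def
    using Wper[OF un(1), of _ e1] Wper[OF un(2), of _ e2] inv unfolding invariant_line_def by simp
  have Weq: "W w = Re (a w $ 1 * cnj (a w $ 1) * (b w $ 2 * cnj (b w $ 2)) - a w $ 1 * cnj (a w $ 2) * (b w $ 2 * cnj (b w $ 1))
      - a w $ 2 * cnj (a w $ 1) * (b w $ 1 * cnj (b w $ 2)) + a w $ 2 * cnj (a w $ 2) * (b w $ 1 * cnj (b w $ 1)))" for w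
  proof -
    have "complex_of_real (W w) = wedge (a w) (b w) * cnj (wedge (a w) (b w))" unfolding W_def by (rule complex_norm_square)
    also have "\<dots> = a w $ 1 * cnj (a w $ 1) * (b w $ 2 * cnj (b w $ 2)) - a w $ 1 * cnj (a w $ 2) * (b w $ 2 * cnj (b w $ 1))
      - a w $ 2 * cnj (a w $ 1) * (b w $ 1 * cnj (b w $ 2)) + a w $ 2 * cnj (a w $ 2) * (b w $ 1 * cnj (b w $ 1))"
      by (simp add: wedge_def algebra_simps)
    finally show ?thesis by (metis Re_complex_of_real)
  qed
  have pc: "continuous_on UNIV (\<lambda>w. a w $ i * cnj (a w $ j))" "continuous_on UNIV (\<lambda>w. b w $ i * cnj (b w $ j))" for i j
    unfolding a_def b_def using inv by (auto simp: invariant_line_def intro!: line_projection_continuous)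
  have Wc: "continuous_on UNIV W" unfolding Weq[abs_def] by (intro continuous_on_Re continuous_on_add continuous_on_diff continuous_on_mult pc)
  obtain w0 where w0: "\<And>w. W w0 \<le> W w" using periodic_attains[OF Wp Wc] by blast
  define d where "d = cmod (wedge (a w0) (b w0))"
  have d: "d > 0" "\<And>w. d \<le> cmod (wedge (a w) (b w))"
    using W0[of w0] w0 by (auto simp: d_def W_def intro: power2_le_imp_le)
  have detper: "cmod (det (A (w + u))) = cmod (det (A w))"
    if "unitary_mat U" "unitary_mat U'" "A (w + u) ** U = U' ** A w" for w u U U'
  proof -
    have "det (A (w + u)) * det U = det U' * det (A w)" using that(3) by (metis det_mul)
    then have "cmod (det (A (w + u))) * cmod (det U) = cmod (det U') * cmod (det (A w))" by (metis norm_mult)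
    then show ?thesis by (simp add: unitary_props(2)[OF that(1)] unitary_props(2)[OF that(2)])
  qed
  define DA where "DA w = cmod (det (A w))" for w
  have DAp: "periodic DA" unfolding periodic_def DA_def
    using detper[OF un(1) un(1), of _ e1] detper[OF un(2) un(2), of _ e2] eq unfolding equivariant_cocycle_def K2_def by blast
  have Ac: "continuous_on UNIV A" and Ad: "\<And>w. det (A w) \<noteq> 0" using eq by (auto simp: equivariant_cocycle_def)
  have DAc: "continuous_on UNIV DA" unfolding DA_def det_2 by (intro continuous_intros Ac)
  obtain w1 where w1: "\<And>w. DA w1 \<le> DA w" using periodic_attains[OF DAp DAc] by blast
  have dA: "DA w1 > 0" using Ad by (simp add: DA_def)
  define B where "B w = cocycle_iterate \<tau> A N w" for w
  define \<sigma> where "\<sigma> = real N *\<^sub>R \<tau>"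
  define dB where "dB = DA w1 ^ N"
  have dB: "dB > 0" "\<And>w. dB \<le> cmod (det (B w))"
    using iterate_det[of "DA w1" A N \<tau>] w1 dA by (auto simp: dB_def B_def DA_def)
  have Bd: "det (B w) \<noteq> 0" for w using dB(1) dB(2)[of w] by auto
  have UAB: "analytic_along v (\<lambda>w. B w $ i $ j)" for i j
    unfolding B_def by (rule analytic_along_iterate[OF strip_extendable_analytic_along[OF \<delta>(2,1) v]])
  have "\<forall>i j. \<exists>K. \<forall>w. cmod (B w $ i $ j) \<le> K" using analytic_along_bounded[OF UAB] by metis
  then obtain Kf where Kf: "\<And>i j w. cmod (B w $ i $ j) \<le> Kf i j" by metis
  define K where "K = max (max (Kf 1 1) (Kf 1 2)) (max (Kf 2 1) (Kf 2 2)) + 1"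
  have K: "cmod (B w $ i $ j) \<le> K" for w i j
    using Kf[of w i j] exhaust_2[of i] exhaust_2[of j] by (auto simp: K_def)
  have K0: "K > 0" using K[of 0 1 1] Kf[of 0 1 1] order_trans[OF norm_ge_zero Kf[of 0 1 1]] by (simp add: K_def)
  have "\<exists>c. B w *v a w = c *s a (w + \<sigma>)" "\<exists>c. B w *v b w = c *s b (w + \<sigma>)" for w
    using iterate_line[of A lu \<tau>, OF _ ain(1)[of w], of N] iterate_line[of A ls \<tau>, OF _ ain(2)[of w], of N] inv
    unfolding a(2) b(2) line_through_iff B_def \<sigma>_def invariant_line_def by auto
  then obtain \<alpha> \<beta> where Ba: "\<And>w. B w *v a w = \<alpha> w *s a (w + \<sigma>)" and Bb: "\<And>w. B w *v b w = \<beta> w *s b (w + \<sigma>)" by metis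
  have nb: "cmod (\<beta> w) \<le> 4 * K" "cmod (\<alpha> w) \<le> 4 * K" for w
    using matrix_bound[of "B w" K "b w"] matrix_bound[of "B w" K "a w"] K by (auto simp: Ba Bb norm_smult a b)
  have W2: "cmod (\<alpha> w) * cmod (\<beta> w) * 2 \<ge> dB * d" for w
  proof -
    have "dB * d \<le> cmod (det (B w)) * cmod (wedge (a w) (b w))" using dB d by (intro mult_mono) auto
    also have "\<dots> = cmod (wedge (B w *v a w) (B w *v b w))" unfolding wedge_matrix norm_mult ..
    also have "\<dots> \<le> 2 * norm (B w *v a w) * norm (B w *v b w)" by (rule wedge_bound)
    also have "\<dots> = cmod (\<alpha> w) * cmod (\<beta> w) * 2" by (simp add: Ba Bb norm_smult a b)
    finally show ?thesis .
  qed
  define c0 where "c0 = dB * d / (8 * K)"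
  have c0: "c0 > 0" using dB d K0 by (simp add: c0_def)
  have al: "c0 \<le> cmod (\<alpha> w)" for w
  proof -
    have "dB * d \<le> cmod (\<alpha> w) * (4 * K) * 2"
      using W2[of w] nb(1)[of w] mult_left_mono[OF nb(1)[of w], of "cmod (\<alpha> w)"] by simp
    then show ?thesis using K0 by (simp add: c0_def divide_le_eq mult_ac)
  qed
  have bnz: "\<beta> w \<noteq> 0" and anz: "\<alpha> w \<noteq> 0" for w
    using W2[of w] mult_pos_pos[OF dB(1) d(1)] by auto
  have dm: "cmod (\<beta> w) \<le> \<kappa>\<^sup>2 * cmod (\<alpha> w)" for w
  proof -
    have "cmod (\<beta> w) / cmod (\<alpha> w) \<le> \<kappa>\<^sup>2"
      using rat[of w] restricted_values(1)[OF b(1) Bb[of w] b(1)] restricted_values(2)[OF a(1) Ba[of w] a(1)]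
      unfolding B_def by (simp add: a(2)[symmetric] b(2)[symmetric])
    then show ?thesis using anz[of w] by (simp add: divide_le_eq)
  qed
  have k2: "0 \<le> \<kappa>\<^sup>2" "\<kappa>\<^sup>2 < 1" using N by (auto simp: power_less_one_iff)
  show ?thesis
  proof (cases "l = lu")
    case True
    interpret dominated_pair v \<sigma> B a b \<alpha> \<beta> d c0 "\<kappa>\<^sup>2"
      by unfold_locales (fact UAB Bd a b d Ba Bb al c0 dm k2)+
    show ?thesis using dominating_line_analytic unfolding True a_def .
  next
    case False
    then have ls: "l = ls" using l by blast
    define B' where "B' w = inverse_2 (B (w + - \<sigma>))" for w
    have UB': "analytic_along v (\<lambda>w. B' w $ i $ j)" for i j
      unfolding B'_def by (rule analytic_along_translate[OF analytic_along_inverse_2[OF UAB dB(2,1)]])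
    have "B' w *v b w = inverse (\<beta> (w + - \<sigma>)) *s b (w + - \<sigma>)" for w
    proof -
      have "inverse_2 (B (w + - \<sigma>)) *v (B (w + - \<sigma>) *v (inverse (\<beta> (w + - \<sigma>)) *s b (w + - \<sigma>))) = inverse (\<beta> (w + - \<sigma>)) *s b (w + - \<sigma>)"
        by (rule inverse_2_left[OF Bd])
      then show ?thesis using bnz[of "w + - \<sigma>"] by (simp add: vec.scale Bb B'_def)
    qed
    note B'b = this
    have "B' w *v a w = inverse (\<alpha> (w + - \<sigma>)) *s a (w + - \<sigma>)" for w
    proof -
      have "inverse_2 (B (w + - \<sigma>)) *v (B (w + - \<sigma>) *v (inverse (\<alpha> (w + - \<sigma>)) *s a (w + - \<sigma>))) = inverse (\<alpha> (w + - \<sigma>)) *s a (w + - \<sigma>)"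
        by (rule inverse_2_left[OF Bd])
      then show ?thesis using anz[of "w + - \<sigma>"] by (simp add: vec.scale Ba B'_def)
    qed
    note B'a = this
    have dp: "dominated_pair v (- \<sigma>) B' b a (\<lambda>w. inverse (\<beta> (w + - \<sigma>))) (\<lambda>w. inverse (\<alpha> (w + - \<sigma>))) d (inverse (4 * K)) (\<kappa>\<^sup>2)"
    proof unfold_locales
      show "det (B' w) \<noteq> 0" for w unfolding B'_def by (rule inverse_2_det[OF Bd])
      show "d \<le> cmod (wedge (b w) (a w))" for w using d(2)[of w] unfolding wedge_swap[of "b w"] by simp
      show "inverse (4 * K) \<le> cmod (inverse (\<beta> (w + - \<sigma>)))" for w
        unfolding norm_inverse using bnz nb(1) by (intro le_imp_inverse_le) auto
      show "cmod (inverse (\<alpha> (w + - \<sigma>))) \<le> \<kappa>\<^sup>2 * cmod (inverse (\<beta> (w + - \<sigma>)))" for w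
      proof -
        have gen: "inverse x \<le> k * inverse y" if "y \<le> k * x" "x > 0" "y > 0" for x y k :: real
          using that by (simp add: field_simps)
        show ?thesis unfolding norm_inverse
          by (rule gen[OF dm]) (use anz[of "w + - \<sigma>"] bnz[of "w + - \<sigma>"] in simp_all)
      qed
    qed (fact UB' b a d k2 B'b B'a | use K0 in simp)+
    show ?thesis using dominated_pair.dominating_line_analytic[OF dp] unfolding ls b_def .
  qed
qed

section \<open>Logarithms on the plane and on the torus\<close>

lemma plane_log:
  fixes f :: "plane \<Rightarrow> complex"
  assumes "continuous_on UNIV f" "\<And>w. f w \<noteq> 0"
  obtains L where "continuous_on UNIV L" "\<And>w. f w = exp (L w)"
proof -
  have "contractible (UNIV :: plane set)" by (intro convex_imp_contractible convex_UNIV)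
  then obtain L where "continuous_on UNIV L" "\<And>w. w \<in> UNIV \<Longrightarrow> f w = exp (L w)"
    using continuous_logarithm_on_contractible[OF assms(1)] assms(2) by blast
  then show thesis using that by blast
qed

lemma integer_valued_const:
  fixes f :: "plane \<Rightarrow> real"
  assumes "continuous_on UNIV f" "\<And>w. \<exists>n::int. f w = of_int n"
  obtains n :: int where "\<And>w. f w = of_int n"
proof -
  have "f constant_on UNIV"
  proof (rule continuous_discrete_range_constant[OF connected_UNIV assms(1)])
    fix x :: plane
    have "1 \<le> norm (f y - f x)" if "f y \<noteq> f x" for y
    proof -
      obtain m n :: int where mn: "f y = of_int m" "f x = of_int n" using assms(2) by metis
      then have "m \<noteq> n" using that by auto
      then have "1 \<le> \<bar>m - n\<bar>" by simp
      then have "(1::real) \<le> of_int \<bar>m - n\<bar>" by (metis of_int_1 of_int_le_iff)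
      then show ?thesis using mn by simp
    qed
    then show "\<exists>e>0. \<forall>y. y \<in> UNIV \<and> f y \<noteq> f x \<longrightarrow> e \<le> norm (f y - f x)"
      by (intro exI[of _ 1]) auto
  qed
  then obtain c where "\<And>w. f w = c" unfolding constant_on_def by blast
  moreover obtain n :: int where "f 0 = of_int n" using assms(2) by blast
  ultimately show thesis using that by metis
qed

lemma exp_one_const:
  fixes d :: "plane \<Rightarrow> complex"
  assumes "continuous_on UNIV d" "\<And>w. exp (d w) = 1"
  obtains n :: int where "\<And>w. d w = 2 * of_real pi * \<i> * of_int n"
proof -
  have ex: "\<exists>n::int. Re (d w) = 0 \<and> Im (d w) = of_int (2 * n) * pi" for w
    using assms(2)[of w] exp_eq_1 by blast
  have "continuous_on UNIV (\<lambda>w. Im (d w) / (2 * pi))"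
    by (intro continuous_intros assms) auto
  moreover have "\<exists>n::int. Im (d w) / (2 * pi) = of_int n" for w
    using ex[of w] by (auto simp: field_simps)
  ultimately obtain n :: int where n: "\<And>w. Im (d w) / (2 * pi) = of_int n"
    using integer_valued_const by blast
  have "d w = 2 * of_real pi * \<i> * of_int n" for w
  proof -
    have "Im (d w) = 2 * pi * of_int n" using n[of w] by (simp add: field_simps)
    then show ?thesis using ex[of w] by (auto simp: complex_eq_iff)
  qed
  then show thesis using that by blast
qed

definition lin_phase :: "int \<times> int \<Rightarrow> plane \<Rightarrow> complex" where
  "lin_phase k w = 2 * of_real pi * \<i> * of_real (real_of_int (fst k) * fst w + real_of_int (snd k) * snd w)"

lemma character_lin_phase: "character k w = exp (lin_phase k w)"
  by (simp add: character_def lin_phase_def cis_conv_exp mult_ac)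

lemma lin_phase_cont: "continuous_on UNIV (lin_phase k)"
  unfolding lin_phase_def[abs_def] by (intro continuous_intros)

lemma Ck_along_lin_phase: "v = e1 \<or> v = e2 \<Longrightarrow> Ck_along v r (lin_phase k)"
proof -
  assume v: "v = e1 \<or> v = e2"
  have c: "Ck_along v r (\<lambda>w. complex_of_real (w \<bullet> u))" if u: "u = e1 \<or> u = e2" for u
  proof (cases "u = v")
    case True
    then show ?thesis using v by (auto intro!: Ck_along_inner)
  next
    case False
    then show ?thesis using u v by (intro Ck_along_along_const continuous_intros) (auto simp: inner_add_left)
  qed
  have "Ck_along v r (\<lambda>w. 2 * of_real pi * \<i> * (of_int (fst k) * of_real (w \<bullet> e1) + of_int (snd k) * of_real (w \<bullet> e2)))"
    by (intro Ck_along_mult Ck_along_add Ck_along_const c) auto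
  then show ?thesis by (simp add: lin_phase_def[abs_def] inner_prod_def)
qed

text \<open>A continuous logarithm on the plane changes under the two periods by integer multiples of
  \<open>2 * pi * \<i>\<close>; these integers form the winding vector \<open>k\<close>, and the linear phase removes them.\<close>

lemma torus_log:
  assumes Q: "continuous_on UNIV Q" "\<And>w. Q w \<noteq> 0" "periodic Q"
  obtains k G where "continuous_on UNIV G" "periodic G" "\<And>w. Q w = character k w * exp (G w)"
proof -
  obtain L where L: "continuous_on UNIV L" "\<And>w. Q w = exp (L w)" using plane_log[OF Q(1,2)] by blast
  have "\<exists>n::int. \<forall>w. L (w + u) - L w = 2 * of_real pi * \<i> * of_int n" if u: "\<And>w. Q (w + u) = Q w" for u
  proof -
    have "continuous_on UNIV (\<lambda>w. L (w + u) - L w)"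
      by (intro continuous_intros L(1) continuous_on_compose2[OF L(1)]) auto
    moreover have "exp (L (w + u) - L w) = 1" for w
      using u[of w] L(2)[of w] L(2)[of "w + u"] by (simp add: exp_diff)
    ultimately obtain n :: int where "\<And>w. L (w + u) - L w = 2 * of_real pi * \<i> * of_int n"
      using exp_one_const[of "\<lambda>w. L (w + u) - L w"] by blast
    then show ?thesis by blast
  qed
  then obtain k1 k2 :: int where k: "\<And>w. L (w + e1) - L w = 2 * of_real pi * \<i> * of_int k1"
    "\<And>w. L (w + e2) - L w = 2 * of_real pi * \<i> * of_int k2"
    using Q(3) unfolding periodic_def by metis
  define G where "G w = L w - lin_phase (k1, k2) w" for w
  show thesis
  proof (rule that[of G "(k1, k2)"])
    show "continuous_on UNIV G" unfolding G_def by (intro continuous_intros L(1) lin_phase_cont)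
    have l: "lin_phase (k1, k2) (w + e1) = lin_phase (k1, k2) w + 2 * of_real pi * \<i> * of_int k1"
      "lin_phase (k1, k2) (w + e2) = lin_phase (k1, k2) w + 2 * of_real pi * \<i> * of_int k2" for w
      by (simp_all add: lin_phase_def algebra_simps)
    have g: "x - (y + z) = x' - y" if "x - x' = z" for x x' y z :: complex
      using that by (simp add: algebra_simps)
    show "periodic G" unfolding periodic_def G_def l using g[OF k(1)] g[OF k(2)] by blast
    show "Q w = character (k1, k2) w * exp (G w)" for w
      unfolding character_lin_phase G_def by (simp add: exp_add[symmetric] L(2))
  qed
qed

lemma torus_log_unique:
  assumes P: "continuous_on UNIV P" "periodic P" "\<And>w. character k w * exp (P w) = 1"
  obtains N :: int where "k = 0" "\<And>w. P w = 2 * of_real pi * \<i> * of_int N"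
proof -
  have "continuous_on UNIV (\<lambda>w. lin_phase k w + P w)" by (intro continuous_intros lin_phase_cont P(1))
  moreover have "exp (lin_phase k w + P w) = 1" for w using P(3)[of w] by (simp add: character_lin_phase exp_add)
  ultimately obtain N :: int where N: "\<And>w. lin_phase k w + P w = 2 * of_real pi * \<i> * of_int N"
    using exp_one_const[of "\<lambda>w. lin_phase k w + P w"] by blast
  have "P (0 + e1) = P 0" "P (0 + e2) = P 0" using P(2) unfolding periodic_def by blast+
  then have "lin_phase k (0 + e1) = lin_phase k 0" "lin_phase k (0 + e2) = lin_phase k 0"
    using N[of 0] N[of "0 + e1"] N[of "0 + e2"] by (metis add_right_cancel)+
  then have "fst k = 0" "snd k = 0" by (simp_all add: lin_phase_def)
  then have k: "k = 0" by (simp add: prod_eq_iff)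
  then have "P w = 2 * of_real pi * \<i> * of_int N" for w using N[of w] by (simp add: lin_phase_def)
  with k show thesis using that by blast
qed

section \<open>Normalized frames and multipliers\<close>

lemma cinner2: "cinner x y = cnj (x $ 1) * y $ 1 + cnj (x $ 2) * y $ 2"
  by (simp add: cinner_def sum_2)

lemma cinner_unit: "norm x = 1 \<Longrightarrow> cinner x (c *s x) = c"
proof -
  assume "norm x = 1"
  then have "x $ 1 * cnj (x $ 1) + x $ 2 * cnj (x $ 2) = 1" using norm_sq_complex[of x] by simp
  then have "c * (x $ 1 * cnj (x $ 1) + x $ 2 * cnj (x $ 2)) = c" by simp
  then show ?thesis by (simp add: cinner2 algebra_simps)
qed

lemma Ck_along_cinner:
  assumes "\<And>i. Ck_along v r (\<lambda>w. f w $ i)" "\<And>i. Ck_along v r (\<lambda>w. g w $ i)"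
  shows "Ck_along v r (\<lambda>w. cinner (f w) (g w))"
  unfolding cinner2 by (intro Ck_along_add Ck_along_mult Ck_along_cnj assms)

lemma Ck_along_mv:
  assumes "\<And>i j. Ck_along v r (\<lambda>w. M w $ i $ j)" "\<And>i. Ck_along v r (\<lambda>w. f w $ i)"
  shows "Ck_along v r (\<lambda>w. ((M w :: cmat) *v f w) $ i)"
  unfolding matrix_vector_mult_2 by (intro Ck_along_add Ck_along_mult assms)

lemma continuous_components:
  "(\<And>i. continuous_on UNIV (\<lambda>w. f w $ i)) \<Longrightarrow> continuous_on UNIV (f :: plane \<Rightarrow> cvec)"
  by (rule continuous_on_vec_lambda[of UNIV "\<lambda>i w. f w $ i", simplified])

lemma cis_exp: "cis x = exp (\<i> * of_real x)" by (simp add: cis_conv_exp)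

text \<open>A unit frame \<open>e0\<close> changes by unimodular factors \<open>exp L1\<close>, \<open>exp L2\<close> under the two sewing maps. The
  equation \<open>h (w + e1) - h w = L1 w\<close> gives a frame \<open>b\<close> in which the first factor is trivial. The
  relation between the sewing maps then makes the second factor periodic in the first coordinate; its
  logarithm \<open>M2\<close> is periodic up to \<open>2 * pi * \<i> * N\<close>, and \<open>- N\<close> is the charge. After subtracting
  the corresponding linear phase, a second difference equation, solved periodically in the first
  coordinate, removes what is left.\<close>

lemma smooth_normalized_frame:
  assumes sew: "sewing_system U1 U2"
    and U: "\<And>v i j. v = e1 \<or> v = e2 \<Longrightarrow> Ck_along v r (\<lambda>w. U1 w $ i $ j)" "\<And>v i j. v = e1 \<or> v = e2 \<Longrightarrow> Ck_along v r (\<lambda>w. U2 w $ i $ j)"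
    and l: "\<And>w. l (w + e1) = (\<lambda>v. U1 w *v v) ` l w" "\<And>w. l (w + e2) = (\<lambda>v. U2 w *v v) ` l w"
    and e0: "\<And>w. norm (e0 w) = 1" "\<And>w. l w = line_through (e0 w)" "\<And>v i. v = e1 \<or> v = e2 \<Longrightarrow> Ck_along v r (\<lambda>w. e0 w $ i)"
  obtains m e where "normalized_frame U1 U2 l m e" "\<And>v i. v = e1 \<or> v = e2 \<Longrightarrow> Ck_along v r (\<lambda>w. e w $ i)"
proof -
  have un: "unitary_mat (U1 w)" "unitary_mat (U2 w)" for w using sew unfolding sewing_system_def by blast+
  have in0: "e0 w \<in> l w" for w unfolding e0(2) by (auto simp: line_through_iff intro: exI[of _ 1])
  have log: "\<exists>L. (\<forall>v. v = e1 \<or> v = e2 \<longrightarrow> Ck_along v r L) \<and> (\<forall>w. Re (L w) = 0) \<and> (\<forall>w. U w *v e0 w = exp (L w) *s e0 (w + u))"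
    if U: "\<And>w. unitary_mat (U w)" "\<And>w. l (w + u) = (\<lambda>v. U w *v v) ` l w" "\<And>v i j. v = e1 \<or> v = e2 \<Longrightarrow> Ck_along v r (\<lambda>w. U w $ i $ j)"
    for U u
  proof -
    define c where "c w = cinner (e0 (w + u)) (U w *v e0 w)" for w
    have c: "U w *v e0 w = c w *s e0 (w + u)" for w
    proof -
      have "U w *v e0 w \<in> l (w + u)" unfolding U(2) using in0 by blast
      then obtain d where "U w *v e0 w = d *s e0 (w + u)" unfolding e0(2) by (auto simp: line_through_iff)
      then show ?thesis using cinner_unit[OF e0(1)] by (simp add: c_def)
    qed
    have n: "cmod (c w) = 1" for w
      using unitary_props(1)[OF U(1), of w "e0 w"] by (simp add: c norm_smult e0)
    have C: "Ck_along v r c" if v: "v = e1 \<or> v = e2" for v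
      unfolding c_def by (intro Ck_along_cinner Ck_along_mv Ck_along_translate[OF e0(3)[OF v]] e0(3)[OF v] U(3)[OF v])
    have cc: "continuous_on UNIV c" by (rule Ck_along_continuous[OF C[of e1]]) simp
    have c0: "c w \<noteq> 0" for w using n[of w] by auto
    obtain L where L: "continuous_on UNIV L" "\<And>w. c w = exp (L w)"
      using plane_log[OF cc c0] by blast
    have "Ck_along v r L" if "v = e1 \<or> v = e2" for v by (rule Ck_along_log[OF C[OF that] L])
    moreover have "Re (L w) = 0" for w using n[of w] by (simp add: L(2))
    moreover have "U w *v e0 w = exp (L w) *s e0 (w + u)" for w by (simp add: c L(2))
    ultimately show ?thesis by blast
  qed
  obtain L1 where L1: "\<And>v. v = e1 \<or> v = e2 \<Longrightarrow> Ck_along v r L1" "\<And>w. Re (L1 w) = 0" "\<And>w. U1 w *v e0 w = exp (L1 w) *s e0 (w + e1)"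
    using log[OF un(1) l(1) U(1)] by blast
  obtain L2 where L2: "\<And>v. v = e1 \<or> v = e2 \<Longrightarrow> Ck_along v r L2" "\<And>w. Re (L2 w) = 0" "\<And>w. U2 w *v e0 w = exp (L2 w) *s e0 (w + e2)"
    using log[OF un(2) l(2) U(2)] by blast
  obtain h where h: "Ck_along e1 r h" "Ck_along e2 r h" "\<And>w. h (w + e1) - h w = L1 w" "\<And>w. Re (h w) = 0"
    by (rule difference_equation[of r L1 e1 e2]) (use L1 in auto)
  define b where "b w = exp (h w) *s e0 w" for w
  define M2 where "M2 w = L2 w + h w - h (w + e2)" for w
  have b1: "U1 w *v b w = b (w + e1)" for w
  proof -
    have "U1 w *v b w = (exp (h w) * exp (L1 w)) *s e0 (w + e1)" by (simp add: b_def vec.scale L1(3))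
    also have "exp (h w) * exp (L1 w) = exp (h (w + e1))" unfolding h(3)[symmetric] exp_add[symmetric] by simp
    finally show ?thesis by (simp add: b_def)
  qed
  have b2: "U2 w *v b w = exp (M2 w) *s b (w + e2)" for w
  proof -
    have "U2 w *v b w = (exp (h w) * exp (L2 w)) *s e0 (w + e2)" by (simp add: b_def vec.scale L2(3))
    also have "exp (h w) * exp (L2 w) = exp (M2 w) * exp (h (w + e2))"
      unfolding M2_def exp_add[symmetric] by (simp add: add.commute)
    finally show ?thesis by (simp add: b_def)
  qed
  have CM2: "Ck_along v r M2" if v: "v = e1 \<or> v = e2" for v
  proof -
    have "Ck_along v r h" using v h by auto
    then show ?thesis unfolding M2_def by (intro Ck_along_diff Ck_along_add Ck_along_translate L2(1)[OF v])
  qed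
  have M2c: "continuous_on UNIV M2" by (rule Ck_along_continuous[OF CM2[of e1]]) simp
  have bn: "norm (b w) = 1" for w by (simp add: b_def norm_smult e0 h(4))
  have "exp (M2 (w + e1) - M2 w) = 1" for w
  proof -
    have "U1 (w + e2) ** U2 w = U2 (w + e1) ** U1 w" using sew unfolding sewing_system_def K1_def by blast
    then have "U1 (w + e2) *v (U2 w *v b w) = U2 (w + e1) *v (U1 w *v b w)" by (simp only: matrix_vector_mul_assoc)
    then have "exp (M2 w) *s b (w + e2 + e1) = exp (M2 (w + e1)) *s b (w + e1 + e2)"
      unfolding b2 vec.scale b1 by (simp only: b2)
    moreover have "w + e2 + e1 = w + e1 + e2" by (simp add: add.assoc add.commute)
    ultimately have "exp (M2 w) *s b (w + e1 + e2) = exp (M2 (w + e1)) *s b (w + e1 + e2)" by (simp only:)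
    moreover have "b (w + e1 + e2) \<noteq> 0" using bn[of "w + e1 + e2"] by auto
    ultimately have "exp (M2 w) = exp (M2 (w + e1))" by (simp only: vec.scale_cancel_right simp_thms)
    then show ?thesis by (simp add: exp_diff)
  qed
  moreover have "continuous_on UNIV (\<lambda>w. M2 (w + e1) - M2 w)"
    by (intro continuous_intros M2c continuous_on_compose2[OF M2c]) auto
  ultimately obtain N :: int where N: "\<And>w. M2 (w + e1) - M2 w = 2 * of_real pi * \<i> * of_int N"
    using exp_one_const[of "\<lambda>w. M2 (w + e1) - M2 w"] by blast
  define M3 where "M3 w = M2 w - lin_phase (N, 0) w" for w
  have CM3: "Ck_along v r M3" if v: "v = e1 \<or> v = e2" for v
    unfolding M3_def by (intro Ck_along_diff CM2[OF v] Ck_along_lin_phase v)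
  have M3per: "M3 (w + e1) = M3 w" for w
  proof -
    have l: "lin_phase (N, 0) (w + e1) = lin_phase (N, 0) w + 2 * of_real pi * \<i> * of_int N" by (simp add: lin_phase_def algebra_simps)
    have "M2 (w + e1) = M2 w + 2 * of_real pi * \<i> * of_int N" using N[of w] by (simp only: diff_eq_eq add.commute)
    then show ?thesis unfolding M3_def l by simp
  qed
  have M3re: "Re (M3 w) = 0" for w by (simp add: M3_def M2_def L2(2) h(4) lin_phase_def)
  obtain h2 where h2: "Ck_along e1 r h2" "Ck_along e2 r h2" "\<And>w. h2 (w + e2) - h2 w = M3 w"
     "\<And>w. h2 (w + e1) = h2 w" "\<And>w. Re (h2 w) = 0"
    by (rule difference_equation[of r M3 e2 e1]) (use CM3 M3per M3re in auto)
  define e where "e w = exp (h2 w) *s b w" for w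
  have en: "norm (e w) = 1" for w by (simp add: e_def norm_smult bn h2(5))
  have Ce: "Ck_along v r (\<lambda>w. e w $ i)" if v: "v = e1 \<or> v = e2" for v i
  proof -
    have "Ck_along v r h" "Ck_along v r h2" using v h h2 by auto
    then show ?thesis unfolding e_def b_def vector_smult_component by (intro Ck_along_mult Ck_along_exp e0(3)[OF v])
  qed
  have "normalized_frame U1 U2 l (- N) e"
    unfolding normalized_frame_def unit_frame_def
  proof (intro conjI allI)
    show "continuous_on UNIV e"
      by (intro continuous_components Ck_along_continuous[OF Ce[of e1]]) simp
    show "norm (e w) = 1" for w by (rule en)
    show "e w \<in> l w" for w
    proof -
      have "e w = (exp (h2 w) * exp (h w)) *s e0 w" by (simp add: e_def b_def)
      then show ?thesis unfolding e0(2) line_through_iff by blast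
    qed
    show "e (w + e1) = U1 w *v e w" for w by (simp add: e_def vec.scale b1 h2(4))
    show "e (w + e2) = cis (2 * pi * real_of_int (- N) * fst w) *s (U2 w *v e w)" for w
    proof -
      have c: "cis (2 * pi * real_of_int (- N) * fst w) = exp (- lin_phase (N, 0) w)"
        by (simp add: lin_phase_def cis_exp mult_ac)
      have "exp (- lin_phase (N, 0) w) * (exp (h2 w) * exp (M2 w)) = exp (h2 (w + e2))"
      proof -
        have "h2 (w + e2) = h2 w + M3 w" using h2(3)[of w] by (simp only: diff_eq_eq add.commute)
        then show ?thesis by (simp add: M3_def exp_add[symmetric] add_diff_eq)
      qed
      note ex = this
      show ?thesis unfolding c unfolding e_def vec.scale b2 vector_smult_assoc mult.assoc ex ..
    qed
  qed
  then show thesis using that Ce by blast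
qed

section \<open>Invariants of an invariant line\<close>

lemma invariant_line_point:
  assumes "invariant_line \<tau> U1 U2 A l" "x \<in> l w" "x \<noteq> 0"
  shows "l w = line_through x"
proof -
  have "l w \<in> topspace CP1"
    using assms(1) continuous_map_image_subset_topspace unfolding invariant_line_def by fastforce
  then obtain v where "l w = line_through v" unfolding topspace_CP1 by blast
  with assms(2,3) show ?thesis using line_through_eq by simp
qed

lemma unit_frame_line:
  assumes "invariant_line \<tau> U1 U2 A l" "unit_frame l e"
  shows "l w = line_through (e w)"
proof (rule invariant_line_point[OF assms(1)])
  have "norm (e w) = 1" using assms(2) unfolding unit_frame_def by blast
  then show "e w \<noteq> 0" by auto
  show "e w \<in> l w" using assms(2) unfolding unit_frame_def by blast
qed

lemma unit_frame_norm: "unit_frame l e \<Longrightarrow> norm (e w) = 1"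
  and unit_frame_continuous: "unit_frame l e \<Longrightarrow> continuous_on UNIV e"
  and unit_frame_in: "unit_frame l e \<Longrightarrow> e w \<in> l w"
  unfolding unit_frame_def by blast+

lemma cinner_continuous:
  assumes "continuous_on UNIV f" "continuous_on UNIV g"
  shows "continuous_on UNIV (\<lambda>w. cinner (f w) (g w))"
  unfolding cinner2 by (intro continuous_intros assms)

lemma mv_continuous:
  assumes "continuous_on UNIV (M :: plane \<Rightarrow> cmat)" "continuous_on UNIV f"
  shows "continuous_on UNIV (\<lambda>w. M w *v f w)"
  by (intro continuous_components) (auto simp: matrix_vector_mult_2 intro!: continuous_intros assms)

lemma two_unit_frames:
  assumes inv: "invariant_line \<tau> U1 U2 A l" and e: "unit_frame l e" "unit_frame l e'"
  obtains c where "continuous_on UNIV c" "\<And>w. cmod (c w) = 1" "\<And>w. e' w = c w *s e w"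
proof (rule that[of "\<lambda>w. cinner (e w) (e' w)"])
  show eq: "e' w = cinner (e w) (e' w) *s e w" for w
  proof -
    have "e' w \<in> line_through (e w)" using unit_frame_in[OF e(2), of w] unit_frame_line[OF inv e(1), of w] by simp
    then obtain d where "e' w = d *s e w" by (auto simp: line_through_iff)
    then show ?thesis using cinner_unit[OF unit_frame_norm[OF e(1)], of w d] by simp
  qed
  show "cmod (cinner (e w) (e' w)) = 1" for w
    using arg_cong[OF eq[of w], of norm] unit_frame_norm[OF e(1), of w] unit_frame_norm[OF e(2), of w]
    by (simp add: norm_smult)
qed (rule cinner_continuous[OF unit_frame_continuous[OF e(1)] unit_frame_continuous[OF e(2)]])

lemma cis_one_int:
  fixes d :: "plane \<Rightarrow> real"
  assumes "continuous_on UNIV d" "\<And>w. cis (2 * pi * d w) = 1"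
  obtains n :: int where "\<And>w. d w = of_int n"
proof -
  have "continuous_on UNIV (\<lambda>w. 2 * of_real pi * \<i> * complex_of_real (d w))"
    by (intro continuous_intros assms)
  moreover have "exp (2 * of_real pi * \<i> * complex_of_real (d w)) = 1" for w
    using assms(2)[of w] by (simp add: cis_exp mult_ac)
  ultimately obtain n :: int where n: "\<And>w. 2 * of_real pi * \<i> * complex_of_real (d w) = 2 * of_real pi * \<i> * of_int n"
    using exp_one_const[of "\<lambda>w. 2 * of_real pi * \<i> * complex_of_real (d w)"] by blast
  have "d w = of_int n" for w
    using n[of w] by simp (metis of_real_eq_iff of_real_of_int_eq)
  then show thesis using that by blast
qed

text \<open>Two unit frames differ by a factor \<open>cis (2 * pi * h)\<close> with \<open>h\<close> continuous on the plane. The exponents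
  of the factors of automorphy change by the coboundary of \<open>h\<close> and by integer constants, and both
  drop out of the alternating sum defining the class.\<close>

lemma chern_unique:
  assumes inv: "invariant_line \<tau> U1 U2 A l"
    and e: "unit_frame l e" "continuous_on UNIV f1" "continuous_on UNIV f2"
      "\<And>w. U1 w *v e w = cis (2 * pi * f1 w) *s e (w + e1)"
      "\<And>w. U2 w *v e w = cis (2 * pi * f2 w) *s e (w + e2)"
      "\<And>w. f1 (w + e2) + f2 w - f2 (w + e1) - f1 w = real_of_int n"
    and e': "unit_frame l e'" "continuous_on UNIV f1'" "continuous_on UNIV f2'"
      "\<And>w. U1 w *v e' w = cis (2 * pi * f1' w) *s e' (w + e1)"
      "\<And>w. U2 w *v e' w = cis (2 * pi * f2' w) *s e' (w + e2)"
      "\<And>w. f1' (w + e2) + f2' w - f2' (w + e1) - f1' w = real_of_int n'"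
  shows "n' = n"
proof -
  obtain c where c: "continuous_on UNIV c" "\<And>w. cmod (c w) = 1" "\<And>w. e' w = c w *s e w"
    using two_unit_frames[OF inv e(1) e'(1)] by blast
  have c0: "c w \<noteq> 0" for w using c(2)[of w] by auto
  obtain L where L: "continuous_on UNIV L" "\<And>w. c w = exp (L w)" using plane_log[OF c(1) c0] by blast
  define h where "h w = Im (L w) / (2 * pi)" for w
  have hc: "continuous_on UNIV h" unfolding h_def by (intro continuous_intros L(1)) simp
  have ch: "c w = cis (2 * pi * h w)" for w
  proof -
    have "Re (L w) = 0" using c(2)[of w] by (simp add: L(2))
    then show ?thesis unfolding L(2) h_def by (simp add: exp_eq_polar)
  qed
  have step: "\<exists>N::int. \<forall>w. f' w = f w + h w - h (w + u) + of_int N"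
    if "continuous_on UNIV f" "continuous_on UNIV f'"
      "\<And>w. U w *v e w = cis (2 * pi * f w) *s e (w + u)" "\<And>w. U w *v e' w = cis (2 * pi * f' w) *s e' (w + u)"
    for U :: "plane \<Rightarrow> cmat" and f f' :: "plane \<Rightarrow> real" and u :: plane
  proof -
    have "cis (2 * pi * (f' w - (f w + h w - h (w + u)))) = 1" for w
    proof -
      have "cis (2 * pi * f' w) *s (c (w + u) *s e (w + u)) = U w *v (c w *s e w)"
        using that(4)[of w] unfolding c(3) by simp
      also have "\<dots> = c w *s (cis (2 * pi * f w) *s e (w + u))" unfolding vec.scale that(3) ..
      finally have "(cis (2 * pi * f' w) * c (w + u)) *s e (w + u) = (c w * cis (2 * pi * f w)) *s e (w + u)" by simp
      moreover have "e (w + u) \<noteq> 0" using unit_frame_norm[OF e(1), of "w + u"] by auto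
      ultimately have "cis (2 * pi * f' w) * c (w + u) = c w * cis (2 * pi * f w)"
        by (simp only: vec.scale_cancel_right simp_thms)
      then have "cis (2 * pi * (f' w + h (w + u))) = cis (2 * pi * (f w + h w))"
        by (simp add: ch cis_mult distrib_left add.commute)
      then have "cis (2 * pi * (f' w + h (w + u))) * cis (- (2 * pi * (f w + h w))) = 1"
        by (simp add: cis_mult)
      then show ?thesis unfolding cis_mult by (simp add: algebra_simps)
    qed
    moreover have "continuous_on UNIV (\<lambda>w. f' w - (f w + h w - h (w + u)))"
      by (intro continuous_intros that hc continuous_on_compose2[OF hc]) auto
    ultimately obtain N :: int where "\<And>w. f' w - (f w + h w - h (w + u)) = of_int N"
      using cis_one_int[of "\<lambda>w. f' w - (f w + h w - h (w + u))"] by blast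
    then have "f' w = f w + h w - h (w + u) + of_int N" for w by (simp add: diff_eq_eq add.commute)
    then show ?thesis by blast
  qed
  obtain N1 :: int where N1: "\<And>w. f1' w = f1 w + h w - h (w + e1) + of_int N1" using step[OF e(2) e'(2) e(4) e'(4)] by blast
  obtain N2 :: int where N2: "\<And>w. f2' w = f2 w + h w - h (w + e2) + of_int N2" using step[OF e(3) e'(3) e(5) e'(5)] by blast
  have sw: "(0::plane) + e2 + e1 = 0 + e1 + e2" by simp
  have "real_of_int n' = f1' (0 + e2) + f2' 0 - f2' (0 + e1) - f1' 0" by (rule e'(6)[symmetric])
  also have "\<dots> = f1 (0 + e2) + f2 0 - f2 (0 + e1) - f1 0" unfolding N1 N2 sw by simp
  also have "\<dots> = real_of_int n" by (rule e(6))
  finally show ?thesis by simp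
qed

lemma first_chern_eq:
  assumes inv: "invariant_line \<tau> U1 U2 A l" and nf: "normalized_frame U1 U2 l m e"
  shows "first_chern U1 U2 l = m"
  unfolding first_chern_def
proof (rule the_equality)
  show ex: "\<exists>e f1 f2. unit_frame l e \<and>
    continuous_on UNIV f1 \<and> continuous_on UNIV f2 \<and>
    (\<forall>w. U1 w *v e w = cis (2 * pi * f1 w) *s e (w + e1)) \<and>
    (\<forall>w. U2 w *v e w = cis (2 * pi * f2 w) *s e (w + e2)) \<and>
    (\<forall>w. f1 (w + e2) + f2 w - f2 (w + e1) - f1 w = real_of_int m)"
    by (rule normalized_frame_chern_datum[OF nf])
  fix n assume n: "\<exists>e f1 f2. unit_frame l e \<and>
    continuous_on UNIV f1 \<and> continuous_on UNIV f2 \<and>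
    (\<forall>w. U1 w *v e w = cis (2 * pi * f1 w) *s e (w + e1)) \<and>
    (\<forall>w. U2 w *v e w = cis (2 * pi * f2 w) *s e (w + e2)) \<and>
    (\<forall>w. f1 (w + e2) + f2 w - f2 (w + e1) - f1 w = real_of_int n)"
  show "n = m"
    using ex n
    apply (elim exE conjE)
    subgoal for e e' f1 f1' f2 f2'
      by (rule chern_unique[OF inv, of e f1 f2 m e' f1' f2' n]) blast+
    done
qed

text \<open>The multiplier itself is only periodic up to a phase under \<open>e2\<close>, because the frame is; the phase
  factor in the last conclusion compensates for this.\<close>

lemma frame_multiplier:
  assumes eq: "equivariant_cocycle \<tau> U1 U2 A" and inv: "invariant_line \<tau> U1 U2 A l"
    and nf: "normalized_frame U1 U2 l m e" and q: "\<And>w. q w = cinner (e (w + \<tau>)) (A w *v e w)"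
  shows "A w *v e w = q w *s e (w + \<tau>)" "q w \<noteq> 0" "continuous_on UNIV q"
    "periodic (\<lambda>w. q w * cis (2 * pi * real_of_int m * fst \<tau> * snd w))"
proof -
  have uf: "unit_frame l e" using nf by (simp add: normalized_frame_def)
  have n1: "norm (e w) = 1" for w by (rule unit_frame_norm[OF uf])
  have ne: "e w \<noteq> 0" for w using n1[of w] by auto
  have E1: "e (w + e1) = U1 w *v e w" and E2: "e (w + e2) = cis (2 * pi * real_of_int m * fst w) *s (U2 w *v e w)" for w
    using nf unfolding normalized_frame_def by blast+
  show Ae: "A w *v e w = q w *s e (w + \<tau>)" for w
  proof -
    have "A w *v e w \<in> l (w + \<tau>)" using inv unit_frame_in[OF uf, of w] unfolding invariant_line_def by blast
    then obtain d where "A w *v e w = d *s e (w + \<tau>)"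
      unfolding unit_frame_line[OF inv uf] by (auto simp: line_through_iff)
    then show ?thesis unfolding q using cinner_unit[OF n1] by simp
  qed
  have Ac: "continuous_on UNIV A" and Ad: "\<And>w. det (A w) \<noteq> 0" and K: "K2 \<tau> U1 U2 A"
    using eq unfolding equivariant_cocycle_def by blast+
  have ec: "continuous_on UNIV e" by (rule unit_frame_continuous[OF uf])
  have q0: "q w \<noteq> 0" for w
  proof
    assume "q w = 0"
    then have "A w *v e w = 0" using Ae[of w] by simp
    then have "inverse_2 (A w) *v (A w *v e w) = 0" by simp
    then show False using inverse_2_left[OF Ad] ne by simp
  qed
  then show "q w \<noteq> 0" .
  show "continuous_on UNIV q"
    unfolding q[abs_def]
    by (intro cinner_continuous mv_continuous Ac ec continuous_on_compose2[OF ec] continuous_intros) auto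
  have K1': "A (w + e1) *v (U1 w *v x) = U1 (w + \<tau>) *v (A w *v x)" and K2': "A (w + e2) *v (U2 w *v x) = U2 (w + \<tau>) *v (A w *v x)" for w x
  proof -
    have "A (w + e1) ** U1 w = U1 (w + \<tau>) ** A w" "A (w + e2) ** U2 w = U2 (w + \<tau>) ** A w"
      using K unfolding K2_def by blast+
    then show "A (w + e1) *v (U1 w *v x) = U1 (w + \<tau>) *v (A w *v x)" "A (w + e2) *v (U2 w *v x) = U2 (w + \<tau>) *v (A w *v x)"
      by (simp_all only: matrix_vector_mul_assoc)
  qed
  have c1: "q (w + e1) = q w" for w
  proof -
    have "q (w + e1) *s e (w + e1 + \<tau>) = A (w + e1) *v e (w + e1)" by (rule Ae[symmetric])
    also have "\<dots> = q w *s (U1 (w + \<tau>) *v e (w + \<tau>))" unfolding E1 K1' Ae vec.scale ..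
    also have "\<dots> = q w *s e (w + \<tau> + e1)" unfolding E1 ..
    also have "w + \<tau> + e1 = w + e1 + \<tau>" by (simp only: add.assoc add.commute add.left_commute)
    finally show ?thesis using ne[of "w + e1 + \<tau>"] by (simp only: vec.scale_cancel_right simp_thms)
  qed
  have c2: "q (w + e2) = q w * cis (- (2 * pi * real_of_int m * fst \<tau>))" for w
  proof -
    let ?c = "\<lambda>x. cis (2 * pi * real_of_int m * x)"
    have "q (w + e2) *s e (w + e2 + \<tau>) = A (w + e2) *v e (w + e2)" by (rule Ae[symmetric])
    also have "\<dots> = (?c (fst w) * q w) *s (U2 (w + \<tau>) *v e (w + \<tau>))" unfolding E2 vec.scale K2' Ae by simp
    also have "U2 (w + \<tau>) *v e (w + \<tau>) = ?c (- fst (w + \<tau>)) *s e (w + \<tau> + e2)"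
    proof -
      have "?c (- x) * ?c x = 1" for x by (simp add: cis_mult)
      then show ?thesis by (simp only: E2 vector_smult_assoc vector_smult_lid)
    qed
    also have "(?c (fst w) * q w) *s (?c (- fst (w + \<tau>)) *s e (w + \<tau> + e2)) =
        (q w * cis (- (2 * pi * real_of_int m * fst \<tau>))) *s e (w + \<tau> + e2)"
    proof -
      have "?c (fst w) * ?c (- fst (w + \<tau>)) = cis (- (2 * pi * real_of_int m * fst \<tau>))"
        unfolding cis_mult by (simp add: algebra_simps)
      then show ?thesis unfolding vector_smult_assoc by (simp add: mult_ac)
    qed
    also have "w + \<tau> + e2 = w + e2 + \<tau>" by (simp only: add.assoc add.commute add.left_commute)
    finally show ?thesis using ne[of "w + e2 + \<tau>"] by (simp only: vec.scale_cancel_right simp_thms)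
  qed
  have "cis (- (2 * pi * real_of_int m * fst \<tau>)) * cis (2 * pi * real_of_int m * fst \<tau> * (snd w + 1)) = cis (2 * pi * real_of_int m * fst \<tau> * snd w)" for w
    unfolding cis_mult by (simp add: algebra_simps)
  note H = this
  show "periodic (\<lambda>w. q w * cis (2 * pi * real_of_int m * fst \<tau> * snd w))"
    unfolding periodic_def
  proof (intro allI conjI)
    fix w
    have s: "snd (w + e1) = snd w" "snd (w + e2) = snd w + 1" by simp_all
    show "q (w + e1) * cis (2 * pi * real_of_int m * fst \<tau> * snd (w + e1)) = q w * cis (2 * pi * real_of_int m * fst \<tau> * snd w)"
      unfolding s c1 ..
    have a: "q w * x * y = q w * (x * y)" for x y by simp
    show "q (w + e2) * cis (2 * pi * real_of_int m * fst \<tau> * snd (w + e2)) = q w * cis (2 * pi * real_of_int m * fst \<tau> * snd w)"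
      unfolding s c2 a H ..
  qed
qed

lemma torus_mean_mean:
  assumes "h \<in> borel_measurable borel"
  shows "complex_of_real (torus_mean h) = mean (\<lambda>w. of_real (h w))"
proof -
  have "torus_mean h = (\<integral>w. indicator fundamental_square w *\<^sub>R h w \<partial>lborel)"
    unfolding torus_mean_def set_lebesgue_integral_def
    by (rule integral_completion) (use assms in simp)
  then have "complex_of_real (torus_mean h) = (\<integral>w. complex_of_real (indicator fundamental_square w *\<^sub>R h w) \<partial>lborel)"
    by (simp only: integral_complex_of_real)
  also have "\<dots> = mean (\<lambda>w. of_real (h w))"
    unfolding mean_def set_lebesgue_integral_def
    by (intro Bochner_Integration.integral_cong refl) (simp add: scaleR_conv_of_real)
  finally show ?thesis .
qed

text \<open>Modulus and phase are combined into one complex exponent \<open>G\<close>, whose mean is the exponent of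
  \<open>lambda0\<close>.\<close>

lemma multiplier_dataE:
  assumes eq: "equivariant_cocycle \<tau> U1 U2 A" and inv: "invariant_line \<tau> U1 U2 A l"
    and md: "multiplier_data \<tau> U1 U2 A l q k g"
  obtains m e G where "normalized_frame U1 U2 l m e" "\<And>w. q w = cinner (e (w + \<tau>)) (A w *v e w)"
    "\<And>w. q w = character k w * exp (G w) * cis (- (2 * pi * real_of_int m * fst \<tau> * snd w))"
    "continuous_on UNIV G" "periodic G" "lambda0 q g = exp (mean G)"
proof -
  obtain m e where nf: "normalized_frame U1 U2 l m e" and q: "\<And>w. q w = cinner (e (w + \<tau>)) (A w *v e w)"
    and g: "continuous_on UNIV g" "\<And>w. g (w + e1) = g w" "\<And>w. g (w + e2) = g w"
    and p: "\<And>w. q w / complex_of_real (norm (q w)) * cis (2 * pi * real_of_int m * fst \<tau> * snd w) =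
        cis (2 * pi * (real_of_int (fst k) * fst w + real_of_int (snd k) * snd w + g w))"
    using md unfolding multiplier_data_def by blast
  note fm = frame_multiplier[OF eq inv nf q]
  define G where "G w = complex_of_real (ln (norm (q w))) + 2 * of_real pi * \<i> * of_real (g w)" for w
  have nq: "continuous_on UNIV (\<lambda>w. ln (norm (q w)))"
    using fm(2,3) by (intro continuous_on_ln continuous_on_norm) auto
  have Gc: "continuous_on UNIV G" unfolding G_def by (intro continuous_intros nq g(1))
  have nper: "norm (q (w + e1)) = norm (q w)" "norm (q (w + e2)) = norm (q w)" for w
  proof -
    have *: "norm (q w * cis x) = norm (q w)" for w x by (simp add: norm_mult)
    show "norm (q (w + e1)) = norm (q w)" "norm (q (w + e2)) = norm (q w)"
      using fm(4) unfolding periodic_def by (metis *)+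
  qed
  have Gp: "periodic G" unfolding periodic_def G_def by (simp add: nper g)
  have qe: "q w = character k w * exp (G w) * cis (- (2 * pi * real_of_int m * fst \<tau> * snd w))" for w
  proof -
    have nz: "complex_of_real (norm (q w)) \<noteq> 0" using fm(2)[of w] by simp
    have eG: "exp (G w) = complex_of_real (norm (q w)) * cis (2 * pi * g w)"
      unfolding G_def exp_add exp_of_real using fm(2)[of w] by (simp add: cis_exp mult_ac)
    have "q w = complex_of_real (norm (q w)) * (q w / complex_of_real (norm (q w)) * cis (2 * pi * real_of_int m * fst \<tau> * snd w))
        * cis (- (2 * pi * real_of_int m * fst \<tau> * snd w))"
      using nz by (simp add: cis_mult mult.assoc)
    also have "\<dots> = complex_of_real (norm (q w)) * cis (2 * pi * (real_of_int (fst k) * fst w + real_of_int (snd k) * snd w + g w))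
        * cis (- (2 * pi * real_of_int m * fst \<tau> * snd w))" unfolding p ..
    also have "cis (2 * pi * (real_of_int (fst k) * fst w + real_of_int (snd k) * snd w + g w)) = character k w * cis (2 * pi * g w)"
      unfolding character_def cis_mult by (simp add: distrib_left)
    finally show ?thesis unfolding eG by (simp add: mult_ac)
  qed
  have "lambda0 q g = exp (mean G)"
  proof -
    have b1: "\<exists>K. bdd_borel (\<lambda>w. complex_of_real (ln (norm (q w)))) K"
      by (rule periodic_cont_bdd_borel) (auto simp: periodic_def nper intro!: continuous_on_of_real nq)
    have b2: "\<exists>K. bdd_borel (\<lambda>w. 2 * of_real pi * \<i> * complex_of_real (g w)) K"
      by (rule periodic_cont_bdd_borel) (auto simp: periodic_def g intro!: continuous_intros g(1))
    have "mean G = mean (\<lambda>w. complex_of_real (ln (norm (q w)))) + mean (\<lambda>w. 2 * of_real pi * \<i> * complex_of_real (g w))"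
      unfolding G_def[abs_def] using b1 b2 mean_add by blast
    also have "\<dots> = complex_of_real (torus_mean (\<lambda>w. ln (norm (q w)))) + 2 * complex_of_real pi * \<i> * complex_of_real (torus_mean g)"
      unfolding mean_cmult by (simp add: torus_mean_mean borel_measurable_continuous_onI[OF nq] borel_measurable_continuous_onI[OF g(1)])
    finally show ?thesis by (simp add: lambda0_def)
  qed
  with nf q qe Gc Gp show thesis using that by blast
qed

lemma multiplier_dataI:
  assumes eq: "equivariant_cocycle \<tau> U1 U2 A" and inv: "invariant_line \<tau> U1 U2 A l"
    and nf: "normalized_frame U1 U2 l m e" and q: "\<And>w. q w = cinner (e (w + \<tau>)) (A w *v e w)"
    and qe: "\<And>w. q w = character k w * exp (G w) * cis (- (2 * pi * real_of_int m * fst \<tau> * snd w))"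
    and G: "continuous_on UNIV G" "periodic G"
  shows "multiplier_data \<tau> U1 U2 A l q k (\<lambda>w. Im (G w) / (2 * pi))"
  unfolding multiplier_data_def
proof (intro exI[of _ m] exI[of _ e] conjI allI nf q)
  show "continuous_on UNIV (\<lambda>w. Im (G w) / (2 * pi))" by (intro continuous_intros G) simp
  show "Im (G (w + e1)) / (2 * pi) = Im (G w) / (2 * pi)" "Im (G (w + e2)) / (2 * pi) = Im (G w) / (2 * pi)" for w
    using G(2)[unfolded periodic_def, rule_format, of w] by simp_all
  fix w
  have n: "norm (q w) = exp (Re (G w))" unfolding qe by (simp add: norm_mult)
  have "exp (G w) = complex_of_real (exp (Re (G w))) * cis (Im (G w))" by (rule exp_eq_polar)
  then have "q w / complex_of_real (norm (q w)) = character k w * cis (Im (G w)) * cis (- (2 * pi * real_of_int m * fst \<tau> * snd w))"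
    unfolding n unfolding qe by simp
  then have "q w / complex_of_real (norm (q w)) * cis (2 * pi * real_of_int m * fst \<tau> * snd w) = character k w * cis (Im (G w))"
    by (simp add: mult.assoc cis_mult)
  also have "\<dots> = cis (2 * pi * (real_of_int (fst k) * fst w + real_of_int (snd k) * snd w + Im (G w) / (2 * pi)))"
    unfolding character_def cis_mult by (simp add: distrib_left)
  finally show "q w / complex_of_real (norm (q w)) * cis (2 * pi * real_of_int m * fst \<tau> * snd w) =
        cis (2 * pi * (real_of_int (fst k) * fst w + real_of_int (snd k) * snd w + Im (G w) / (2 * pi)))" .
qed

lemma coset_eq_character: "eigenvalue_coset \<tau> \<rho> = {\<rho> * character n \<tau> | n. True}"
proof -
  have "exp (- 2 * complex_of_real pi * \<i> * complex_of_real (real_of_int n1 * fst \<tau> + real_of_int n2 * snd \<tau>)) = character (- (n1, n2)) \<tau>" for n1 n2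
    unfolding character_lin_phase lin_phase_def by (simp add: algebra_simps)
  then have eq: "eigenvalue_coset \<tau> \<rho> = {\<rho> * character (- (n1, n2)) \<tau> | n1 n2. True}"
    unfolding eigenvalue_coset_def by simp
  show ?thesis unfolding eq
  proof (intro equalityI subsetI)
    fix x assume "x \<in> {\<rho> * character n \<tau> | n. True}"
    then obtain n where "x = \<rho> * character n \<tau>" by blast
    then have "x = \<rho> * character (- (- fst n, - snd n)) \<tau>" by (simp add: uminus_prod_def)
    then show "x \<in> {\<rho> * character (- (n1, n2)) \<tau> | n1 n2. True}" by blast
  qed blast
qed

lemma coset_shift: "eigenvalue_coset \<tau> (\<rho> * character j \<tau>) = eigenvalue_coset \<tau> \<rho>"
proof -
  have "{\<rho> * character j \<tau> * character n \<tau> | n. True} = {\<rho> * character n \<tau> | n. True}"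
  proof (intro equalityI subsetI)
    fix x assume "x \<in> {\<rho> * character j \<tau> * character n \<tau> | n. True}"
    then obtain n where "x = \<rho> * character j \<tau> * character n \<tau>" by blast
    then have "x = \<rho> * character (j + n) \<tau>" by (simp add: mult.assoc character_mult)
    then show "x \<in> {\<rho> * character n \<tau> | n. True}" by blast
  next
    fix x assume "x \<in> {\<rho> * character n \<tau> | n. True}"
    then obtain n where "x = \<rho> * character n \<tau>" by blast
    then have "x = \<rho> * character j \<tau> * character (n - j) \<tau>" by (simp add: mult.assoc character_mult)
    then show "x \<in> {\<rho> * character j \<tau> * character n \<tau> | n. True}" by blast
  qed
  then show ?thesis by (simp add: coset_eq_character)
qed

text \<open>Two normalized frames differ by a periodic unimodular factor \<open>character j * exp \<Gamma>\<close>. The multipliers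
  then differ by \<open>exp (\<Gamma> w - \<Gamma> (w + \<tau>))\<close>, which affects neither the winding vector nor the mean, and
  by \<open>character (- j) \<tau>\<close>, which moves \<open>lambda0\<close> inside its coset.\<close>

lemma multiplier_compare:
  assumes eq: "equivariant_cocycle \<tau> U1 U2 A" and inv: "invariant_line \<tau> U1 U2 A l"
    and md: "multiplier_data \<tau> U1 U2 A l q k g" "multiplier_data \<tau> U1 U2 A l q' k' g'"
  shows "k' = k" "eigenvalue_coset \<tau> (lambda0 q' g') = eigenvalue_coset \<tau> (lambda0 q g)"
proof -
  obtain m e G where 1: "normalized_frame U1 U2 l m e" "\<And>w. q w = cinner (e (w + \<tau>)) (A w *v e w)"
    "\<And>w. q w = character k w * exp (G w) * cis (- (2 * pi * real_of_int m * fst \<tau> * snd w))"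
    "continuous_on UNIV G" "periodic G" "lambda0 q g = exp (mean G)"
    by (rule multiplier_dataE[OF eq inv md(1)]) blast
  obtain m' e' G' where 2: "normalized_frame U1 U2 l m' e'" "\<And>w. q' w = cinner (e' (w + \<tau>)) (A w *v e' w)"
    "\<And>w. q' w = character k' w * exp (G' w) * cis (- (2 * pi * real_of_int m' * fst \<tau> * snd w))"
    "continuous_on UNIV G'" "periodic G'" "lambda0 q' g' = exp (mean G')"
    by (rule multiplier_dataE[OF eq inv md(2)]) blast
  have mm: "m' = m" using first_chern_eq[OF inv 1(1)] first_chern_eq[OF inv 2(1)] by simp
  have uf: "unit_frame l e" "unit_frame l e'" using 1(1) 2(1) by (auto simp: normalized_frame_def)
  obtain c where c: "continuous_on UNIV c" "\<And>w. cmod (c w) = 1" "\<And>w. e' w = c w *s e w"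
    using two_unit_frames[OF inv uf] by blast
  have c0: "c w \<noteq> 0" for w using c(2)[of w] by auto
  have ne: "e w \<noteq> 0" for w using unit_frame_norm[OF uf(1), of w] by auto
  have E: "e (w + e1) = U1 w *v e w" "e (w + e2) = cis (2 * pi * real_of_int m * fst w) *s (U2 w *v e w)"
    "e' (w + e1) = U1 w *v e' w" "e' (w + e2) = cis (2 * pi * real_of_int m * fst w) *s (U2 w *v e' w)" for w
    using 1(1) 2(1) unfolding normalized_frame_def mm by blast+
  have "c (w + e1) = c w" for w
  proof -
    have "c (w + e1) *s e (w + e1) = U1 w *v e' w" using E(3)[of w] c(3)[of "w + e1"] by simp
    also have "\<dots> = c w *s e (w + e1)" unfolding c(3) vec.scale E(1) ..
    finally show ?thesis using ne[of "w + e1"] by (simp only: vec.scale_cancel_right simp_thms)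
  qed
  moreover have "c (w + e2) = c w" for w
  proof -
    have "c (w + e2) *s e (w + e2) = cis (2 * pi * real_of_int m * fst w) *s (U2 w *v e' w)"
      unfolding c(3)[symmetric] by (rule E(4))
    also have "\<dots> = cis (2 * pi * real_of_int m * fst w) *s (c w *s (U2 w *v e w))"
      by (simp only: c(3) vec.scale)
    also have "\<dots> = c w *s e (w + e2)" unfolding E(2) by (rule vec.scale_left_commute)
    finally show ?thesis using ne[of "w + e2"] by (simp only: vec.scale_cancel_right simp_thms)
  qed
  ultimately have cp: "periodic c" by (simp add: periodic_def)
  obtain j \<Gamma> where \<Gamma>: "continuous_on UNIV \<Gamma>" "periodic \<Gamma>" "\<And>w. c w = character j w * exp (\<Gamma> w)"
    using torus_log[OF c(1) c0 cp] by blast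
  note Ae = frame_multiplier(1)[OF eq inv 1(1,2)] and Ae' = frame_multiplier(1)[OF eq inv 2(1,2)]
  have qq: "q' w * c (w + \<tau>) = c w * q w" for w
  proof -
    have "(q' w * c (w + \<tau>)) *s e (w + \<tau>) = q' w *s e' (w + \<tau>)" by (simp only: c(3) vector_smult_assoc)
    also have "\<dots> = A w *v e' w" by (rule Ae'[symmetric])
    also have "\<dots> = c w *s (A w *v e w)" by (simp only: c(3) vec.scale)
    also have "\<dots> = (c w * q w) *s e (w + \<tau>)" by (simp only: Ae vector_smult_assoc)
    finally show ?thesis using ne[of "w + \<tau>"] by (simp only: vec.scale_cancel_right simp_thms)
  qed
  define P where "P w = G' w - G w + lin_phase j \<tau> + \<Gamma> (w + \<tau>) - \<Gamma> w" for w
  have Pc: "continuous_on UNIV P"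
    unfolding P_def by (intro continuous_intros 1(4) 2(4) \<Gamma>(1) continuous_on_compose2[OF \<Gamma>(1)]) auto
  have \<Gamma>t: "\<Gamma> (w + u + \<tau>) = \<Gamma> (w + \<tau>)" if "u = e1 \<or> u = e2" for w u
  proof -
    have "w + u + \<tau> = (w + \<tau>) + u" by (simp only: add.assoc add.commute add.left_commute)
    then show ?thesis using \<Gamma>(2) that unfolding periodic_def by metis
  qed
  have Pp: "periodic P"
    using 1(5) 2(5) \<Gamma>(2) \<Gamma>t unfolding periodic_def P_def by simp
  have "character (k' - k) w * exp (P w) = 1" for w
  proof -
    let ?u = "cis (- (2 * pi * real_of_int m * fst \<tau> * snd w))"
    have "(character k' w * exp (G' w) * ?u) * (character j w * character j \<tau> * exp (\<Gamma> (w + \<tau>))) = (character j w * exp (\<Gamma> w)) * (character k w * exp (G w) * ?u)"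
      using qq[of w] unfolding 1(3) 2(3) \<Gamma>(3) mm character_add .
    moreover have "?u \<noteq> 0" "character j w \<noteq> 0" "character k w \<noteq> 0" by (simp_all add: character_def)
    ultimately have A: "character k' w * exp (G' w) * character j \<tau> * exp (\<Gamma> (w + \<tau>)) = exp (\<Gamma> w) * character k w * exp (G w)"
      by (simp add: mult_ac)
    have "character (k' - k) w * exp (P w) = (character k' w * exp (G' w) * character j \<tau> * exp (\<Gamma> (w + \<tau>))) * (cnj (character k w) * inverse (exp (G w)) * inverse (exp (\<Gamma> w)))"
    proof -
      have ck: "character (k' - k) w = character k' w * cnj (character k w)" by (simp add: character_cnj character_mult)
      show ?thesis
        unfolding P_def exp_add exp_diff character_lin_phase[symmetric] ck by (simp add: divide_inverse mult_ac)
    qed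
    also have "\<dots> = (character k w * cnj (character k w)) * (exp (\<Gamma> w) * inverse (exp (\<Gamma> w))) * (exp (G w) * inverse (exp (G w)))"
      unfolding A by (simp add: mult_ac)
    also have "\<dots> = 1" unfolding complex_norm_square[symmetric] by simp
    finally show ?thesis .
  qed
  then obtain N :: int where N: "k' - k = 0" "\<And>w. P w = 2 * of_real pi * \<i> * of_int N"
    by (rule torus_log_unique[OF Pc Pp]) blast
  then show "k' = k" by simp
  obtain K where K: "bdd_borel \<Gamma> K" using periodic_cont_bdd_borel[OF \<Gamma>(2,1)] by blast
  obtain K1 where K1: "bdd_borel G K1" using periodic_cont_bdd_borel[OF 1(5,4)] by blast
  define C where "C = 2 * of_real pi * \<i> * of_int N - lin_phase j \<tau>"
  have "G' w = G w + C + (-1) * \<Gamma> (w + \<tau>) + \<Gamma> w" for w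
    using N(2)[of w] unfolding P_def C_def by (simp add: algebra_simps)
  then have G': "G' = (\<lambda>w. G w + C + (-1) * \<Gamma> (w + \<tau>) + \<Gamma> w)" by blast
  have tr: "bdd_borel (\<lambda>w. (-1) * \<Gamma> (w + \<tau>)) K"
    unfolding bdd_borel_def using measurable_compose[of "\<lambda>w. w + \<tau>" borel borel \<Gamma> borel] bdd_borel_measurable[OF K] bdd_borelD[OF K] by simp
  have bC: "bdd_borel (\<lambda>w. C) (norm C)" by (simp add: bdd_borel_def)
  have mC: "mean (\<lambda>w. C) = C" using mean_cmult[of C "character 0"] by (simp add: mean_character del: character_zero) simp
  have "mean G' = mean G + C + (-1) * mean \<Gamma> + mean \<Gamma>"
    unfolding G' mean_add[OF bdd_borel_add[OF bdd_borel_add[OF K1 bC] tr] K] mean_add[OF bdd_borel_add[OF K1 bC] tr] mean_add[OF K1 bC]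
      mean_cmult mean_translate[OF K \<Gamma>(2)] mC ..
  then have "mean G' = mean G + C" by simp
  moreover have "exp C = character (- j) \<tau>"
  proof -
    have "exp (2 * of_real pi * \<i> * of_int N) = (1::complex)" by (auto simp: exp_eq_1 intro: exI[of _ N])
    then show ?thesis unfolding C_def exp_diff character_lin_phase[symmetric] character_cnj[symmetric]
      by (simp add: character_def cis_cnj cis_inverse[symmetric] inverse_eq_divide)
  qed
  ultimately have "lambda0 q' g' = lambda0 q g * character (- j) \<tau>" unfolding 1(6) 2(6) by (simp add: exp_add)
  then show "eigenvalue_coset \<tau> (lambda0 q' g') = eigenvalue_coset \<tau> (lambda0 q g)" by (simp add: coset_shift)
qed

lemma winding_vector_eq:
  assumes "equivariant_cocycle \<tau> U1 U2 A" "invariant_line \<tau> U1 U2 A l" "multiplier_data \<tau> U1 U2 A l q k g"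
  shows "winding_vector \<tau> U1 U2 A l = k"
  unfolding winding_vector_def using assms(3) multiplier_compare(1)[OF assms(1,2,3)] by blast

section \<open>Measurable rigidity\<close>

lemma AE_translate:
  fixes t :: plane
  assumes "AE w in lebesgue. P w"
  shows "AE w in lebesgue. P (w + t)"
proof -
  have "negligible {w. \<not> P w}" using assms unfolding negligible_AE .
  then have "negligible ((+) (- t) ` {w. \<not> P w})" by (rule negligible_translation)
  moreover have "{w. \<not> P (w + t)} \<subseteq> (+) (- t) ` {w. \<not> P w}"
    by (rule subsetI, rule image_eqI[of _ _ "_ + t"]) auto
  ultimately have "negligible {w. \<not> P (w + t)}" by (rule negligible_subset)
  then show ?thesis unfolding negligible_AE .
qed

lemma AE_lebesgue_lborel:
  assumes "AE w in lebesgue. P w" "{w. P w} \<in> sets borel"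
  shows "AE w in lborel. P w"
proof -
  obtain N where N: "N \<in> null_sets lebesgue" "{w. \<not> P w} \<subseteq> N"
    using assms(1) by (auto simp: eventually_ae_filter)
  have "{w. \<not> P w} \<in> null_sets lebesgue"
    using N negligible_iff_null_sets negligible_subset by blast
  moreover have "{w. \<not> P w} \<in> sets borel"
    using sets.compl_sets[OF assms(2)] by (simp add: Collect_neg_eq Compl_eq_Diff_UNIV)
  ultimately have "{w. \<not> P w} \<in> null_sets lborel" by (simp add: null_sets_completion_iff)
  then show ?thesis by (rule AE_I') auto
qed

lemma AE_periodic_floor:
  assumes "AE w in lebesgue. f (w + e1) = f w" "AE w in lebesgue. f (w + e2) = f w"
  shows "AE w in lebesgue. f (frac (fst w), frac (snd w)) = f w"
proof -
  have step: "AE w in lebesgue. f (w + of_int n *\<^sub>R u) = f w" if u: "AE w in lebesgue. f (w + u) = f w" for u and n :: int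
  proof (induction n rule: int_induct[of _ 0])
    case (step1 i)
    from step1(2) AE_translate[OF u, of "of_int i *\<^sub>R u"] show ?case
    proof eventually_elim
      case (elim w)
      have eq: "w + of_int (i + 1) *\<^sub>R u = w + of_int i *\<^sub>R u + u" by (simp add: algebra_simps)
      show ?case unfolding eq using elim by (simp only:)
    qed
  next
    case (step2 i)
    from step2(2) AE_translate[OF u, of "of_int (i - 1) *\<^sub>R u"] show ?case
    proof eventually_elim
      case (elim w)
      have eq: "w + of_int i *\<^sub>R u = w + of_int (i - 1) *\<^sub>R u + u" by (simp add: algebra_simps)
      show ?case using elim unfolding eq by (simp only:)
    qed
  qed simp
  have both: "AE w in lebesgue. f (w + (of_int m, of_int n)) = f w" for m n :: int
    using step[OF assms(1), of m] AE_translate[OF step[OF assms(2), of n], of "of_int m *\<^sub>R e1"]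
  proof eventually_elim
    case (elim w)
    have eq: "w + (of_int m, of_int n) = w + of_int m *\<^sub>R e1 + of_int n *\<^sub>R e2" by (simp add: prod_eq_iff)
    show ?case unfolding eq using elim by (simp only:)
  qed
  have "AE w in lebesgue. \<forall>mn :: int \<times> int. f (w + (of_int (fst mn), of_int (snd mn))) = f w"
    unfolding AE_all_countable by (intro allI both)
  then show ?thesis
  proof eventually_elim
    case (elim w)
    have "(frac (fst w), frac (snd w)) = w + (of_int (fst (- \<lfloor>fst w\<rfloor>, - \<lfloor>snd w\<rfloor>)), of_int (snd (- \<lfloor>fst w\<rfloor>, - \<lfloor>snd w\<rfloor>)))"
      by (simp add: prod_eq_iff frac_def)
    then show ?case using elim by metis
  qed
qed

lemma borel_translate:
  fixes b :: "plane \<Rightarrow> complex"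
  assumes "b \<in> borel_measurable borel"
  shows "(\<lambda>w. b (w + s)) \<in> borel_measurable borel"
  by (rule measurable_compose[OF _ assms]) simp

lemma cnj_measurable:
  fixes b :: "'a \<Rightarrow> complex"
  assumes "b \<in> borel_measurable M"
  shows "(\<lambda>w. cnj (b w)) \<in> borel_measurable M"
  by (rule measurable_compose[OF assms]) (intro borel_measurable_continuous_onI continuous_intros)

lemma complex_borel_representative:
  fixes f :: "plane \<Rightarrow> complex"
  assumes "f \<in> borel_measurable lebesgue"
  obtains b where "b \<in> borel_measurable borel" "AE w in lebesgue. f w = b w"
proof -
  have "(\<lambda>w. Re (f w)) \<in> borel_measurable lebesgue" "(\<lambda>w. Im (f w)) \<in> borel_measurable lebesgue"
    using assms by measurable
  note m = this
  obtain u where u: "u \<in> borel_measurable lborel" "AE w in lborel. Re (f w) = u w"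
    using completion_ex_borel_measurable_real[OF m(1)] by blast
  obtain v where v: "v \<in> borel_measurable lborel" "AE w in lborel. Im (f w) = v w"
    using completion_ex_borel_measurable_real[OF m(2)] by blast
  note uv = u v
  show thesis
  proof (rule that[of "\<lambda>w. Complex (u w) (v w)"])
    have "(\<lambda>w. complex_of_real (u w) + \<i> * complex_of_real (v w)) \<in> borel_measurable borel"
      using uv(1,3) by simp
    then show "(\<lambda>w. Complex (u w) (v w)) \<in> borel_measurable borel" by (simp add: Complex_eq)
    show "AE w in lebesgue. f w = Complex (u w) (v w)"
      using AE_completion[OF uv(2)] AE_completion[OF uv(4)] by eventually_elim (simp add: complex_eq_iff)
  qed
qed

text \<open>Periodicity up to null sets becomes exact by evaluating a Borel version at fractional parts.\<close>

lemma periodic_representative: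
  fixes f :: "plane \<Rightarrow> complex"
  assumes f: "f \<in> borel_measurable lebesgue" "AE w in lebesgue. f (w + e1) = f w" "AE w in lebesgue. f (w + e2) = f w"
    and K: "\<And>w. norm (f w) \<le> K"
  obtains g where "bdd_borel g K" "periodic g" "AE w in lebesgue. g w = f w"
proof -
  obtain f0 where f0: "f0 \<in> borel_measurable borel" "AE w in lebesgue. f w = f0 w"
    using complex_borel_representative[OF f(1)] by blast
  have K0: "K \<ge> 0" using order_trans[OF norm_ge_zero K] .
  define f1 where "f1 w = (if norm (f0 w) \<le> K then f0 w else 0)" for w
  have f1: "f1 \<in> borel_measurable borel" unfolding f1_def using f0(1) by measurable
  have f1f: "AE w in lebesgue. f1 w = f w"
    using f0(2) by eventually_elim (metis K f1_def)
  have p1: "AE w in lebesgue. f1 (w + e1) = f1 w"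
    using f1f AE_translate[OF f1f, of e1] f(2) by eventually_elim simp
  have p2: "AE w in lebesgue. f1 (w + e2) = f1 w"
    using f1f AE_translate[OF f1f, of e2] f(3) by eventually_elim simp
  define g where "g w = f1 (frac (fst w), frac (snd w))" for w
  have "(\<lambda>w::plane. (frac (fst w), frac (snd w))) \<in> borel \<rightarrow>\<^sub>M borel"
    unfolding borel_prod[symmetric] frac_def by measurable
  then have gm: "g \<in> borel_measurable borel" unfolding g_def using f1 by (rule measurable_compose)
  have gK: "norm (g w) \<le> K" for w using K0 by (simp add: g_def f1_def)
  have gp: "periodic g" unfolding periodic_def g_def by (simp add: frac_1_eq)
  have "AE w in lebesgue. g w = f w"
    using AE_periodic_floor[OF p1 p2] f1f by eventually_elim (simp add: g_def)
  with gm gK gp show thesis using that unfolding bdd_borel_def by blast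
qed

lemma mean_cong_AE:
  assumes "AE w in lebesgue. f w = g w" "f \<in> borel_measurable borel" "g \<in> borel_measurable borel"
  shows "mean f = mean g"
  unfolding mean_def
proof (rule set_lebesgue_integral_cong_AE)
  have "AE w in lborel. f w = g w"
  proof (rule AE_lebesgue_lborel[OF assms(1)])
    have "{w. f w = g w} = (\<lambda>w. f w - g w) -` {0} \<inter> space borel" by auto
    also have "\<dots> \<in> sets borel" by (rule measurable_sets[of _ _ borel]) (use assms in measurable)
    finally show "{w. f w = g w} \<in> sets borel" .
  qed
  then show "AE w\<in>fundamental_square in lborel. f w = g w" by (auto elim: eventually_mono)
qed (use assms in auto)

text \<open>The Fourier coefficients satisfy \<open>fcoeff f n * character n \<tau> = \<theta> * fcoeff f n\<close> by
  translation invariance, so all of them vanish unless \<open>\<theta>\<close> is the value of a character.\<close>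

lemma rotation_eigenvalue:
  fixes f :: "plane \<Rightarrow> complex"
  assumes f: "f \<in> borel_measurable lebesgue" "AE w in lebesgue. f (w + e1) = f w" "AE w in lebesgue. f (w + e2) = f w"
    and K: "\<And>w. norm (f w) \<le> K"
    and ev: "AE w in lebesgue. f (w + \<tau>) = \<theta> * f w"
    and nz: "\<not> (AE w in lebesgue. f w = 0)"
  shows "\<exists>n. \<theta> = character n \<tau>"
proof (rule ccontr)
  assume no: "\<nexists>n. \<theta> = character n \<tau>"
  obtain g where g: "bdd_borel g K" "periodic g" "AE w in lebesgue. g w = f w"
    using periodic_representative[OF f K] by blast
  have gev: "AE w in lebesgue. g (w + \<tau>) = \<theta> * g w"
    using g(3) AE_translate[OF g(3), of \<tau>] ev by eventually_elim simp
  have "fcoeff g n = 0" for n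
  proof -
    define h where "h w = g w * cnj (character n w)" for w
    have bdd_hol: "bdd_borel h K" unfolding h_def by (rule bdd_borel_fcoeff[OF g(1)])
    have pc: "periodic (\<lambda>w. cnj (character n w))" using character_periodic[of n] unfolding periodic_def by metis
    have hp: "periodic h" using g(2) pc unfolding periodic_def h_def by metis
    have "AE w in lebesgue. h (w + \<tau>) = (\<theta> * cnj (character n \<tau>)) * h w"
      using gev by eventually_elim (simp add: h_def character_add mult_ac)
    then have "mean (\<lambda>w. h (w + \<tau>)) = mean (\<lambda>w. (\<theta> * cnj (character n \<tau>)) * h w)"
      by (rule mean_cong_AE) (use bdd_borel_measurable[OF bdd_hol] measurable_compose[of "\<lambda>w. w + \<tau>" borel borel h borel] in auto)
    then have "mean h = (\<theta> * cnj (character n \<tau>)) * mean h"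
      unfolding mean_translate[OF bdd_hol hp] mean_cmult .
    moreover have "\<theta> * cnj (character n \<tau>) \<noteq> 1"
    proof
      assume a: "\<theta> * cnj (character n \<tau>) = 1"
      have "\<theta> = \<theta> * (cnj (character n \<tau>) * character n \<tau>)" by (simp add: character_cnj character_mult)
      also have "\<dots> = character n \<tau>" using a by (simp add: mult.assoc[symmetric])
      finally show False using no by blast
    qed
    ultimately have "mean h = 0" by (metis mult_cancel_right1)
    moreover have "h = (\<lambda>w. g w * cnj (character n w))" by (simp add: h_def fun_eq_iff)
    ultimately show ?thesis unfolding fcoeff_def by simp
  qed
  from fourier_unique[OF g(1,2) this] have "AE w in lebesgue. g w = 0" unfolding negligible_AE .
  then have "AE w in lebesgue. f w = 0" using g(3) by eventually_elim simp
  then show False using nz by blast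
qed

text \<open>Otherwise Fubini's theorem gives a point \<open>w\<close> with \<open>a w \<noteq> 0\<close> and \<open>a (w + s) = 0\<close> for almost every
  \<open>s\<close>, so that \<open>a\<close> vanishes almost everywhere after all.\<close>

lemma product_vanish:
  fixes a :: "plane \<Rightarrow> complex"
  assumes a: "a \<in> borel_measurable lebesgue"
    and s: "AE s in lebesgue. AE w in lebesgue. a (w + s) * cnj (a w) = 0"
  shows "AE w in lebesgue. a w = 0"
proof -
  obtain b where b: "b \<in> borel_measurable borel" "AE w in lebesgue. a w = b w"
    using complex_borel_representative[OF a] by blast
  have bp: "{w. b (w + s) * cnj (b w) = 0} \<in> sets borel" for s
  proof -
    have "(\<lambda>w. b (w + s) * cnj (b w)) \<in> borel_measurable borel"
      by (intro borel_measurable_times borel_translate cnj_measurable b(1))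
    from measurable_sets[OF this, of "{0}"] show ?thesis by (simp add: vimage_def)
  qed
  have "AE s in lebesgue. AE w in lborel. b (w + s) * cnj (b w) = 0"
    using s
  proof eventually_elim
    case (elim s)
    have "AE w in lebesgue. b (w + s) * cnj (b w) = 0"
      using elim b(2) AE_translate[OF b(2), of s] by eventually_elim simp
    then show ?case by (rule AE_lebesgue_lborel[OF _ bp])
  qed
  note s1 = this
  define D where "D = {x :: plane \<times> plane. b (snd x + fst x) * cnj (b (snd x)) = 0}"
  have Dm: "D \<in> sets (lborel \<Otimes>\<^sub>M lborel)"
  proof -
    have m: "(\<lambda>x. b (snd x + fst x)) \<in> borel_measurable (borel \<Otimes>\<^sub>M borel)" "(\<lambda>x. b (snd x)) \<in> borel_measurable (borel \<Otimes>\<^sub>M borel)"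
      using b(1) by measurable
    have "(\<lambda>x. b (snd x + fst x) * cnj (b (snd x))) \<in> borel_measurable (borel \<Otimes>\<^sub>M borel)"
      by (intro borel_measurable_times cnj_measurable m)
    from measurable_sets[OF this, of "{0}"] have "D \<in> sets (borel \<Otimes>\<^sub>M borel)"
      by (simp add: vimage_def D_def space_pair_measure)
    moreover have "sets (lborel \<Otimes>\<^sub>M lborel) = sets (borel \<Otimes>\<^sub>M (borel :: plane measure))"
      by (intro sets_pair_measure_cong) auto
    ultimately show ?thesis by (metis sets_lborel sets_pair_measure_cong)
  qed
  have Dm': "{x \<in> space (lborel \<Otimes>\<^sub>M lborel). (\<lambda>s w. b (w + s) * cnj (b w) = 0) (fst x) (snd x)} \<in> sets (lborel \<Otimes>\<^sub>M (lborel :: plane measure))"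
    using Dm by (simp add: D_def space_pair_measure)
  have s2: "AE s in lborel. AE w in lborel. b (w + s) * cnj (b w) = 0"
  proof (rule AE_lebesgue_lborel[OF s1])
    have Dc: "space (lborel \<Otimes>\<^sub>M lborel) - D \<in> sets (lborel \<Otimes>\<^sub>M (lborel :: plane measure))"
      using Dm by (rule sets.compl_sets)
    have "(AE w in lborel. b (w + s) * cnj (b w) = 0) \<longleftrightarrow> emeasure lborel (Pair s -` (space (lborel \<Otimes>\<^sub>M lborel) - D)) = 0" for s
      by (rule AE_iff_measurable) (use sets_Pair1[OF Dc, of s] in simp, auto simp: D_def space_pair_measure)
    then have "{s. AE w in lborel. b (w + s) * cnj (b w) = 0} =
        (\<lambda>s. emeasure lborel (Pair s -` (space (lborel \<Otimes>\<^sub>M lborel) - D))) -` {0} \<inter> space lborel"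
      by auto
    also have "\<dots> \<in> sets lborel"
      by (rule measurable_sets[OF lborel.measurable_emeasure_Pair[OF Dc]]) simp
    finally show "{s. AE w in lborel. b (w + s) * cnj (b w) = 0} \<in> sets borel" by simp
  qed
  then have "AE w in lborel. AE s in lborel. b (w + s) * cnj (b w) = 0"
    using lborel_pair.AE_commute[OF Dm'] by simp
  then have w: "AE w in lebesgue. AE s in lborel. b (w + s) * cnj (b w) = 0" by (rule AE_completion)
  show ?thesis
  proof (rule ccontr)
    assume na: "\<not> (AE w in lebesgue. a w = 0)"
    have "\<exists>w. b w \<noteq> 0 \<and> (AE s in lborel. b (w + s) * cnj (b w) = 0)"
    proof (rule ccontr)
      assume no: "\<not> ?thesis"
      have "AE w in lebesgue. a w = 0" using w b(2) by eventually_elim (use no in auto)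
      then show False using na by blast
    qed
    then obtain w where w: "b w \<noteq> 0" "AE s in lborel. b (w + s) * cnj (b w) = 0" by blast
    have "AE s in lebesgue. b (w + s) * cnj (b w) = 0" by (rule AE_completion[OF w(2)])
    then have "AE s in lebesgue. b (s + w) = 0" by eventually_elim (use w(1) in \<open>simp add: add.commute\<close>)
    from AE_translate[OF this, of "- w"] have "AE s in lebesgue. b s = 0" by simp
    then have "AE w in lebesgue. a w = 0" using b(2) by eventually_elim simp
    then show False using na by blast
  qed
qed

lemma negligible_affine_line:
  fixes L1 L2 x :: real
  assumes "(L1, L2) \<noteq> (0, 0)"
  shows "negligible {s :: plane. L1 * fst s + L2 * snd s = x}"
proof -
  have "negligible {s :: plane. (L1, L2) \<bullet> s = x}"
    by (rule negligible_hyperplane) (use assms in \<open>auto simp: zero_prod_def\<close>)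
  moreover have "(L1, L2) \<bullet> s = L1 * fst s + L2 * snd s" for s by (simp add: inner_prod_def)
  ultimately show ?thesis by simp
qed

definition irrational_pair :: "plane \<Rightarrow> bool" where
  "irrational_pair \<tau> \<longleftrightarrow> (\<forall>n1 n2 n3 :: int. real_of_int n1 * fst \<tau> + real_of_int n2 * snd \<tau> = real_of_int n3 \<longrightarrow> n1 = 0 \<and> n2 = 0)"

lemma diophantine_irrational:
  assumes "diophantine c \<nu> \<tau>" "c > 0"
  shows "irrational_pair \<tau>"
  unfolding irrational_pair_def
proof (intro allI impI, rule ccontr)
  fix n1 n2 n3 :: int
  assume e: "real_of_int n1 * fst \<tau> + real_of_int n2 * snd \<tau> = real_of_int n3" and n: "\<not> (n1 = 0 \<and> n2 = 0)"
  then have "(n1, n2) \<noteq> (0, 0)" by simp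
  then have "c * real_of_int (\<bar>n1\<bar> + \<bar>n2\<bar>) powr (- \<nu>) \<le> dist_nearest_int (real_of_int n3)"
    using assms(1) e unfolding diophantine_def by metis
  moreover have "dist_nearest_int (real_of_int n3) = 0" by (simp add: dist_nearest_int_def)
  moreover have "c * real_of_int (\<bar>n1\<bar> + \<bar>n2\<bar>) powr (- \<nu>) > 0"
  proof -
    have "0 < \<bar>n1\<bar> + \<bar>n2\<bar>" using n by linarith
    then have "0 < real_of_int (\<bar>n1\<bar> + \<bar>n2\<bar>)" by (simp only: of_int_0_less_iff)
    then show ?thesis using assms(2) by (intro mult_pos_pos) (auto simp: powr_gt_zero)
  qed
  ultimately show False by simp
qed

text \<open>The twist is removed by multiplying \<open>a (w + s)\<close> with the conjugate of \<open>a w\<close> and a phase: the result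
  \<open>b s\<close> is periodic and is an eigenfunction of the translation by \<open>\<tau>\<close> with eigenvalue
  \<open>cis (2 * pi * (L1 * fst s + L2 * snd s))\<close>. If \<open>(L1, L2)\<close> is not zero, this is one of the countably
  many values of characters at \<open>\<tau>\<close> only for \<open>s\<close> in countably many lines, so \<open>b s\<close> vanishes for almost
  every \<open>s\<close> and so does \<open>a\<close>. Hence \<open>L1 = L2 = 0\<close>, and the irrationality of \<open>\<tau>\<close> gives \<open>m = 0\<close> and then
  \<open>k = 0\<close>.\<close>

theorem twisted_rigidity:
  fixes a :: "plane \<Rightarrow> complex"
  assumes irr: "irrational_pair \<tau>"
    and a: "a \<in> borel_measurable lebesgue" "\<And>w. norm (a w) \<le> K"
    and p1: "AE w in lebesgue. a (w + e1) = a w"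
    and p2: "AE w in lebesgue. a (w + e2) = cis (- (2 * pi * real_of_int m * fst w)) * a w"
    and ev: "AE w in lebesgue. a (w + \<tau>) = \<theta> * character k w * cis (- (2 * pi * real_of_int m * fst \<tau> * snd w)) * a w"
    and \<theta>: "cmod \<theta> = 1"
    and nz: "\<not> (AE w in lebesgue. a w = 0)"
  shows "m = 0" "k = 0" "\<exists>n. \<theta> = character n \<tau>"
proof -
  define L1 where "L1 = real_of_int (fst k) + real_of_int m * snd \<tau>"
  define L2 where "L2 = real_of_int (snd k) - real_of_int m * fst \<tau>"
  define b where "b s w = a (w + s) * cnj (a w) * cis (2 * pi * real_of_int m * fst s * snd w)" for s w
  have am: "(\<lambda>w. a (w + s)) \<in> borel_measurable lebesgue" for s
  proof -
    obtain b where b: "b \<in> borel_measurable borel" "AE w in lebesgue. a w = b w"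
      using complex_borel_representative[OF a(1)] by blast
    have "(\<lambda>w. b (w + s)) \<in> borel_measurable lebesgue"
      by (intro measurable_completion) (simp add: borel_translate[OF b(1)])
    moreover have "AE w in lebesgue. b (w + s) = a (w + s)"
      using AE_translate[OF b(2), of s] by eventually_elim simp
    ultimately show ?thesis by (rule borel_measurable_AE)
  qed
  show mk: "m = 0" "k = 0"
  proof -
    have "(L1, L2) = (0, 0)"
    proof (rule ccontr)
      assume L: "(L1, L2) \<noteq> (0, 0)"
      have neg: "negligible (\<Union>nj :: (int \<times> int) \<times> int. {s :: plane. L1 * fst s + L2 * snd s =
          real_of_int (fst (fst nj)) * fst \<tau> + real_of_int (snd (fst nj)) * snd \<tau> + real_of_int (snd nj)})"
        by (intro negligible_countable_Union) (auto intro: negligible_affine_line[OF L])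
      have "AE s in lebesgue. s \<notin> (\<Union>nj :: (int \<times> int) \<times> int. {s :: plane. L1 * fst s + L2 * snd s =
          real_of_int (fst (fst nj)) * fst \<tau> + real_of_int (snd (fst nj)) * snd \<tau> + real_of_int (snd nj)})"
        unfolding negligible_AE[symmetric] not_not Collect_mem_eq by (rule neg)
      then have "AE s in lebesgue. AE w in lebesgue. a (w + s) * cnj (a w) = 0"
      proof eventually_elim
        case (elim s)
        \<comment> \<open>the eigenvalue of \<open>b s\<close> under the translation by \<open>\<tau>\<close>\<close>
      define \<theta>' where "\<theta>' = cis (2 * pi * (L1 * fst s + L2 * snd s))"
        have no: "\<nexists>n. \<theta>' = character n \<tau>"
        proof
          assume "\<exists>n. \<theta>' = character n \<tau>"
          then obtain n where "cis (2 * pi * (L1 * fst s + L2 * snd s)) = cis (2 * pi * (real_of_int (fst n) * fst \<tau> + real_of_int (snd n) * snd \<tau>))"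
            unfolding \<theta>'_def character_def by blast
          then obtain j :: int where "L1 * fst s + L2 * snd s = real_of_int (fst n) * fst \<tau> + real_of_int (snd n) * snd \<tau> + of_int j"
            by (rule cis_eqD)
          then have "s \<in> (\<Union>nj :: (int \<times> int) \<times> int. {s :: plane. L1 * fst s + L2 * snd s =
          real_of_int (fst (fst nj)) * fst \<tau> + real_of_int (snd (fst nj)) * snd \<tau> + real_of_int (snd nj)})"
            by (intro UN_I[of "(n, j)"]) auto
          then show False using elim by blast
        qed
        have bm: "b s \<in> borel_measurable lebesgue"
        proof -
          have "(\<lambda>w::plane. cis (2 * pi * real_of_int m * fst s * snd w)) \<in> borel_measurable borel"
            unfolding cis_exp by (intro borel_measurable_continuous_onI continuous_intros)
          then have "(\<lambda>w::plane. cis (2 * pi * real_of_int m * fst s * snd w)) \<in> borel_measurable lebesgue"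
            by (intro measurable_completion) (simp only: measurable_lborel2)
          then show ?thesis unfolding b_def by (intro borel_measurable_times am cnj_measurable a(1))
        qed
        have bp1: "AE w in lebesgue. b s (w + e1) = b s w"
          using p1 AE_translate[OF p1, of s]
        proof eventually_elim
          case (elim w)
          have eq: "w + e1 + s = w + s + e1" by (simp only: add.assoc add.commute)
          have sn: "snd (w + e1) = snd w" by simp
          show ?case unfolding b_def eq sn elim ..
        qed
        have bp2: "AE w in lebesgue. b s (w + e2) = b s w"
          using p2 AE_translate[OF p2, of s]
        proof eventually_elim
          case (elim w)
          have eq: "w + e2 + s = w + s + e2" by (simp only: add.assoc add.commute)
          let ?x = "2 * pi * real_of_int m"
          have "b s (w + e2) = (a (w + s) * cnj (a w)) *
              (cis (- (?x * fst (w + s))) * cnj (cis (- (?x * fst w))) * cis (?x * fst s * (snd w + 1)))"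
            unfolding b_def eq elim by simp
          also have "cis (- (?x * fst (w + s))) * cnj (cis (- (?x * fst w))) * cis (?x * fst s * (snd w + 1)) = cis (?x * fst s * snd w)"
            unfolding cis_cnj cis_mult by (simp add: algebra_simps)
          finally show ?case by (simp add: b_def)
        qed
        have bev: "AE w in lebesgue. b s (w + \<tau>) = \<theta>' * b s w"
          using ev AE_translate[OF ev, of s]
        proof eventually_elim
          case (elim w)
          have eq: "w + \<tau> + s = w + s + \<tau>" by (simp add: algebra_simps)
          let ?x = "2 * pi * real_of_int m"
          have tt: "\<theta> * cnj \<theta> = 1" unfolding complex_norm_square[symmetric] by (simp add: \<theta>)
          have kk: "character k (w + s) * cnj (character k w) = character k s"
            unfolding character_add character_cnj by (metis character_mult character_zero mult.assoc mult.commute mult_1 right_minus)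
          have "b s (w + \<tau>) = (a (w + s) * cnj (a w)) * (\<theta> * cnj \<theta>) * (character k (w + s) * cnj (character k w)) *
              (cis (- (?x * fst \<tau> * snd (w + s))) * cnj (cis (- (?x * fst \<tau> * snd w))) * cis (?x * fst s * snd (w + \<tau>)))"
            unfolding b_def eq elim by simp
          also have "\<dots> = (a (w + s) * cnj (a w)) * (character k s *
              (cis (- (?x * fst \<tau> * snd (w + s))) * cnj (cis (- (?x * fst \<tau> * snd w))) * cis (?x * fst s * snd (w + \<tau>))))"
            unfolding tt kk by simp
          also have "character k s * (cis (- (?x * fst \<tau> * snd (w + s))) * cnj (cis (- (?x * fst \<tau> * snd w))) * cis (?x * fst s * snd (w + \<tau>)))
             = \<theta>' * cis (?x * fst s * snd w)"
            unfolding character_def \<theta>'_def cis_cnj cis_mult L1_def L2_def by (simp add: algebra_simps)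
          finally show ?case by (simp add: b_def mult_ac)
        qed
        have bK: "norm (b s w) \<le> K * K" for w
          unfolding b_def norm_mult using a(2) order_trans[OF norm_ge_zero a(2)] by (simp add: mult_mono)
        have "AE w in lebesgue. b s w = 0"
          using rotation_eigenvalue[OF bm bp1 bp2 bK bev] no by blast
        then show ?case by eventually_elim (auto simp: b_def)
      qed
      then have "AE w in lebesgue. a w = 0" by (rule product_vanish[OF a(1)])
      then show False using nz by blast
    qed
    then have "L1 = 0" "L2 = 0" by simp_all
    then have z: "real_of_int 0 * fst \<tau> + real_of_int m * snd \<tau> = real_of_int (- fst k)"
      "real_of_int m * fst \<tau> + real_of_int 0 * snd \<tau> = real_of_int (snd k)"
      by (simp_all add: L1_def L2_def)
    have "m = 0" using irr z(1) unfolding irrational_pair_def by blast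
    moreover from this have "fst k = 0" "snd k = 0" using z by simp_all
    ultimately show "m = 0" "k = 0" by (simp_all add: prod_eq_iff)
  qed
  show "\<exists>n. \<theta> = character n \<tau>"
    by (rule rotation_eigenvalue[OF a(1) p1 _ a(2) _ nz]) (use p2 ev mk in \<open>simp_all\<close>)
qed

text \<open>The bounded function \<open>x / (1 + x)\<close> of \<open>cmod (a w)\<close> has the same integral over the torus as its
  translate. If \<open>\<rho> \<noteq> 1\<close>, the difference of the two has constant sign and vanishes only where \<open>a\<close>
  does.\<close>

lemma modulus_rigidity:
  fixes \<rho> :: real and a :: "plane \<Rightarrow> complex"
  assumes a: "a \<in> borel_measurable lebesgue"
    and p: "AE w in lebesgue. cmod (a (w + e1)) = cmod (a w)" "AE w in lebesgue. cmod (a (w + e2)) = cmod (a w)"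
    and ev: "AE w in lebesgue. cmod (a (w + \<tau>)) = \<rho> * cmod (a w)" and \<rho>: "\<rho> > 0"
    and nz: "\<not> (AE w in lebesgue. a w = 0)"
  shows "\<rho> = 1"
proof (rule ccontr)
  assume r1: "\<rho> \<noteq> 1"
  define \<phi> where "\<phi> x = x / (1 + x)" for x :: real
  define f where "f w = complex_of_real (\<phi> (cmod (a w)))" for w
  have fm: "f \<in> borel_measurable lebesgue" unfolding f_def \<phi>_def using a by measurable
  have fK: "norm (f w) \<le> 1" for w
  proof -
    have "1 + cmod (a w) > 0" by (simp add: add_pos_nonneg)
    then show ?thesis unfolding f_def norm_of_real by (simp add: \<phi>_def divide_le_eq)
  qed
  have fp: "AE w in lebesgue. f (w + e1) = f w" "AE w in lebesgue. f (w + e2) = f w"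
    using p(1) by (eventually_elim, simp add: f_def) (use p(2) in \<open>eventually_elim, simp add: f_def\<close>)
  obtain g where g: "bdd_borel g 1" "periodic g" "AE w in lebesgue. g w = f w"
    using periodic_representative[OF fm fp fK] by blast
  define d where "d w = Re (g (w + \<tau>) - g w)" for w
  have gm: "g \<in> borel_measurable borel" by (rule bdd_borel_measurable[OF g(1)])
  have gt: "bdd_borel (\<lambda>w. g (w + \<tau>)) 1"
    unfolding bdd_borel_def using measurable_compose[of "\<lambda>w. w + \<tau>" borel borel g borel] gm bdd_borelD[OF g(1)] by simp
  have mg: "bdd_borel (\<lambda>w. (-1) * g w) 1" using g(1) by (simp add: bdd_borel_def)
  have dm: "d \<in> borel_measurable borel" unfolding d_def using bdd_borel_measurable[OF gt] gm by simp
  have di: "set_integrable lborel fundamental_square d"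
  proof (rule bdd_borel_integrable)
    show "bdd_borel d 2"
      unfolding bdd_borel_def
    proof (intro conjI allI dm)
      fix w
      have "\<bar>d w\<bar> \<le> norm (g (w + \<tau>) - g w)" unfolding d_def by (rule abs_Re_le_cmod)
      also have "\<dots> \<le> 1 + 1" using norm_triangle_ineq4[of "g (w + \<tau>)" "g w"] bdd_borelD[OF g(1), of w] bdd_borelD[OF g(1), of "w + \<tau>"] by linarith
      finally show "norm (d w) \<le> 2" by simp
    qed
  qed
  have int0: "(LINT w:fundamental_square|lborel. d w) = 0"
  proof -
    have "mean (\<lambda>w. g (w + \<tau>) + (-1) * g w) = 0"
      unfolding mean_add[OF gt mg] mean_cmult mean_translate[OF g(1,2)] by simp
    then have "Re (mean (\<lambda>w. g (w + \<tau>) + (-1) * g w)) = 0" by simp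
    moreover have "Re (mean (\<lambda>w. g (w + \<tau>) + (-1) * g w)) = (LINT w:fundamental_square|lborel. d w)"
    proof -
      have "set_integrable lborel fundamental_square (\<lambda>w. g (w + \<tau>) + (-1) * g w)"
        by (rule bdd_borel_integrable[OF bdd_borel_add[OF gt mg]])
      then have "Re (mean (\<lambda>w. g (w + \<tau>) + (-1) * g w)) = (\<integral>w. Re (indicator fundamental_square w *\<^sub>R (g (w + \<tau>) + (-1) * g w)) \<partial>lborel)"
        unfolding mean_def set_lebesgue_integral_def set_integrable_def by (rule integral_Re[symmetric])
      then show ?thesis by (simp add: set_lebesgue_integral_def d_def)
    qed
    ultimately show ?thesis by simp
  qed
  have dval: "AE w in lebesgue. d w = \<phi> (\<rho> * cmod (a w)) - \<phi> (cmod (a w))"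
    using g(3) AE_translate[OF g(3), of \<tau>] ev by eventually_elim (simp add: d_def f_def)
  have \<phi>eq: "\<phi> (\<rho> * x) - \<phi> x = (\<rho> - 1) * (x / ((1 + \<rho> * x) * (1 + x)))" if "x \<ge> 0" for x
  proof -
    have "1 + \<rho> * x > 0" "1 + x > 0" using that \<rho> by (auto intro: add_pos_nonneg)
    then show ?thesis by (simp add: \<phi>_def field_simps)
  qed
  define sg where "sg = (if \<rho> > 1 then 1 else -1 :: real)"
  have sgd: "sg * (\<phi> (\<rho> * x) - \<phi> x) \<ge> 0" "sg * (\<phi> (\<rho> * x) - \<phi> x) = 0 \<Longrightarrow> x = 0" if "x \<ge> 0" for x
  proof -
    have q: "x / ((1 + \<rho> * x) * (1 + x)) \<ge> 0" using that \<rho> by simp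
    have s: "sg * (\<rho> - 1) > 0" using r1 by (auto simp: sg_def)
    have e: "sg * (\<phi> (\<rho> * x) - \<phi> x) = (sg * (\<rho> - 1)) * (x / ((1 + \<rho> * x) * (1 + x)))"
      unfolding \<phi>eq[OF that] by simp
    show "sg * (\<phi> (\<rho> * x) - \<phi> x) \<ge> 0" unfolding e by (intro mult_nonneg_nonneg less_imp_le[OF s] q)
    assume "sg * (\<phi> (\<rho> * x) - \<phi> x) = 0"
    then have "(sg * (\<rho> - 1)) * (x / ((1 + \<rho> * x) * (1 + x))) = 0" by (simp only: e)
    then have "x / ((1 + \<rho> * x) * (1 + x)) = 0" using s by (metis mult_eq_0_iff less_irrefl)
    moreover have "1 + \<rho> * x > 0" "1 + x > 0" using that \<rho> by (auto intro: add_pos_nonneg)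
    ultimately show "x = 0" by simp
  qed
  have pos: "AE w in lebesgue. sg * d w \<ge> 0"
    using dval by eventually_elim (simp add: sgd(1))
  have pos': "AE w in lborel. sg * d w \<ge> 0"
  proof (rule AE_lebesgue_lborel[OF pos])
    have "(\<lambda>w. sg * d w) \<in> borel_measurable borel" using dm by simp
    from measurable_sets[OF this, of "{0..}"] show "{w. 0 \<le> sg * d w} \<in> sets borel" by (simp add: vimage_def)
  qed
  have "AE w in lborel. indicator fundamental_square w *\<^sub>R (sg * d w) = 0"
  proof -
    have i: "integrable lborel (\<lambda>w. indicator fundamental_square w *\<^sub>R (sg * d w))"
      using set_integrable_mult_right[OF di, of sg] by (simp add: set_integrable_def)
    have "(\<integral>w. indicator fundamental_square w *\<^sub>R (sg * d w) \<partial>lborel) = 0"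
    proof -
      have "(LINT w:fundamental_square|lborel. sg * d w) = sg * (LINT w:fundamental_square|lborel. d w)"
        by (rule set_integral_mult_right)
      then show ?thesis using int0 unfolding set_lebesgue_integral_def by simp
    qed
    moreover have "AE w in lborel. 0 \<le> indicator fundamental_square w *\<^sub>R (sg * d w)"
      using pos' by eventually_elim (simp add: indicator_def)
    ultimately show ?thesis using integral_nonneg_eq_0_iff_AE[OF i] by simp
  qed
  then have "AE w in lebesgue. indicator fundamental_square w *\<^sub>R (sg * d w) = 0" by (rule AE_completion)
  then have "AE w in lebesgue. w \<in> fundamental_square \<longrightarrow> g w = 0"
    using dval g(3)
  proof eventually_elim
    case (elim w)
    show ?case
    proof
      assume "w \<in> fundamental_square"
      then have "sg * (\<phi> (\<rho> * cmod (a w)) - \<phi> (cmod (a w))) = 0" using elim by simp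
      from sgd(2)[OF norm_ge_zero this] have "cmod (a w) = 0" .
      then show "g w = 0" using elim by (simp add: f_def \<phi>_def)
    qed
  qed
  then have "AE w in lborel. w \<in> fundamental_square \<longrightarrow> g w = 0"
  proof (rule AE_lebesgue_lborel)
    have "{w. w \<in> fundamental_square \<longrightarrow> g w = 0} = (- fundamental_square) \<union> (g -` {0} \<inter> space borel)" by auto
    also have "\<dots> \<in> sets borel" using measurable_sets[OF gm, of "{0}"] by auto
    finally show "{w. w \<in> fundamental_square \<longrightarrow> g w = 0} \<in> sets borel" .
  qed
  from negligible_periodic[OF g(2) this] have "AE w in lebesgue. g w = 0" unfolding negligible_AE .
  then have "AE w in lebesgue. a w = 0" using g(3)
  proof eventually_elim
    case (elim w)
    then have "f w = 0" by simp
    then have "cmod (a w) / (1 + cmod (a w)) = 0" by (simp only: f_def \<phi>_def of_real_eq_0_iff)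
    moreover have "1 + cmod (a w) > 0" by (simp add: add_pos_nonneg)
    ultimately show ?case by simp
  qed
  then show False using nz by blast
qed

section \<open>Two examples\<close>

lemma sqrt_ratio_irrational:
  fixes a b :: int and p :: nat
  assumes "prime p" "a\<^sup>2 = int p * b\<^sup>2"
  shows "b = 0"
proof (rule ccontr)
  assume b: "b \<noteq> 0"
  have p: "prime (int p)" using assms(1) by simp
  have "multiplicity (int p) (a\<^sup>2) = multiplicity (int p) (int p * b\<^sup>2)" using assms(2) by simp
  moreover have "a \<noteq> 0" using assms(2) b assms(1) by (auto dest: prime_gt_0_nat)
  moreover have "int p \<noteq> 0" using p by auto
  ultimately have "2 * multiplicity (int p) a = Suc (2 * multiplicity (int p) b)"
    using b p by (simp add: prime_elem_multiplicity_power_distrib prime_elem_multiplicity_mult_distrib)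
  then show False by presburger
qed

text \<open>The left side is the product of the four conjugates of \<open>j + a * sqrt 2 + b * sqrt 3\<close>. A zero would
  make \<open>3\<close>, \<open>2\<close> or \<open>2 / 3\<close> the square of a rational number.\<close>

lemma norm_form_nonzero:
  fixes j a b :: int
  assumes "(a, b) \<noteq> (0, 0)"
  shows "(j\<^sup>2 + 3 * b\<^sup>2 - 2 * a\<^sup>2)\<^sup>2 - 12 * (j * b)\<^sup>2 \<noteq> 0"
proof
  assume z: "(j\<^sup>2 + 3 * b\<^sup>2 - 2 * a\<^sup>2)\<^sup>2 - 12 * (j * b)\<^sup>2 = 0"
  then have e: "(j\<^sup>2 + 3 * b\<^sup>2 - 2 * a\<^sup>2)\<^sup>2 = int 3 * (2 * (j * b))\<^sup>2" by (simp add: power_mult_distrib)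
  have "2 * (j * b) = 0" by (rule sqrt_ratio_irrational[OF _ e]) simp
  then have jb: "j = 0 \<or> b = 0" by simp
  then have x: "j\<^sup>2 + 3 * b\<^sup>2 - 2 * a\<^sup>2 = 0" using z by auto
  show False
  proof (cases "b = 0")
    case True
    then have "j\<^sup>2 = int 2 * a\<^sup>2" using x by simp
    then have "a = 0" by (intro sqrt_ratio_irrational[of 2]) auto
    then show False using True assms by simp
  next
    case False
    then have q: "3 * b\<^sup>2 = 2 * a\<^sup>2" using jb x by simp
    have m: "multiplicity (2::int) (3 * b\<^sup>2) = multiplicity 2 (2 * a\<^sup>2)" using q by simp
    have "a \<noteq> 0" using q False by auto
    moreover have "multiplicity (2::int) 3 = 0" by (rule not_dvd_imp_multiplicity_0) simp
    ultimately have "2 * multiplicity (2::int) b = Suc (2 * multiplicity (2::int) a)"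
      using m False by (simp add: prime_elem_multiplicity_power_distrib prime_elem_multiplicity_mult_distrib)
    then show False by presburger
  qed
qed

text \<open>With \<open>- j\<close> the integer nearest to \<open>a * sqrt 2 + b * sqrt 3\<close>, the norm of
  \<open>j + a * sqrt 2 + b * sqrt 3\<close> is a nonzero integer, while each of the other three conjugates is at
  most \<open>8 * (\<bar>a\<bar> + \<bar>b\<bar>)\<close>. This gives the exponent 3.\<close>

lemma diophantine_example: "\<exists>c. 0 < c \<and> diophantine c 3 (sqrt 2, sqrt 3)"
proof (intro exI conjI)
  define c where "c = 1 / (8 :: real) ^ 3"
  show "0 < c" by (simp add: c_def)
  show "diophantine c 3 (sqrt 2, sqrt 3)"
    unfolding diophantine_def
  proof (intro allI impI)
    fix a b :: int assume ab: "(a, b) \<noteq> (0, 0)"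
    define x where "x = real_of_int a * sqrt 2 + real_of_int b * sqrt 3"
    define j where "j = - round x"
    define N where "N = real_of_int (\<bar>a\<bar> + \<bar>b\<bar>)"
    have N1: "N \<ge> 1"
    proof -
      have "\<bar>a\<bar> + \<bar>b\<bar> \<ge> 1" using ab by auto
      then show ?thesis unfolding N_def by (metis of_int_1 of_int_le_iff)
    qed
    have s2: "sqrt 2 \<le> 2" "sqrt 3 \<le> 2" by (simp_all add: real_le_lsqrt real_sqrt_le_iff)
    have A: "\<bar>real_of_int a * sqrt 2\<bar> \<le> 2 * \<bar>real_of_int a\<bar>" "\<bar>real_of_int b * sqrt 3\<bar> \<le> 2 * \<bar>real_of_int b\<bar>"
      using mult_right_mono[OF s2(1), of "\<bar>real_of_int a\<bar>"] mult_right_mono[OF s2(2), of "\<bar>real_of_int b\<bar>"]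
      by (simp_all add: abs_mult mult.commute)
    have NN: "N = \<bar>real_of_int a\<bar> + \<bar>real_of_int b\<bar>" by (simp add: N_def)
    have jx: "\<bar>real_of_int j + x\<bar> \<le> 1/2" using of_int_round_abs_le[of x] by (simp add: j_def abs_minus_commute)
    have gen1: "\<bar>J\<bar> \<le> 2 * (P + Q) + 1/2" if "\<bar>J + (u + v)\<bar> \<le> 1/2" "\<bar>u\<bar> \<le> 2 * P" "\<bar>v\<bar> \<le> 2 * Q" for J u v P Q :: real
      using that by argo
    have gen2: "f \<le> 8 * (P + Q)"
      if "f \<le> J + u + v" "J \<le> 2 * (P + Q) + 1/2" "u \<le> 2 * P" "v \<le> 2 * Q" "1 \<le> P + Q" for f J u v P Q :: real
      using that by argo
    have jb: "\<bar>real_of_int j\<bar> \<le> 2 * N + 1/2" unfolding NN by (rule gen1[OF jx[unfolded x_def] A])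
    define F where "F s t = real_of_int j + s * (real_of_int a * sqrt 2) + t * (real_of_int b * sqrt 3)" for s t :: real
    have Fb: "\<bar>F s t\<bar> \<le> 8 * N" if "\<bar>s\<bar> = 1" "\<bar>t\<bar> = 1" for s t
    proof -
      have "\<bar>F s t\<bar> \<le> \<bar>real_of_int j\<bar> + \<bar>s * (real_of_int a * sqrt 2)\<bar> + \<bar>t * (real_of_int b * sqrt 3)\<bar>"
        unfolding F_def by linarith
      also have "\<dots> = \<bar>real_of_int j\<bar> + \<bar>real_of_int a * sqrt 2\<bar> + \<bar>real_of_int b * sqrt 3\<bar>"
        by (simp only: abs_mult[of s] abs_mult[of t] that mult_1)
      finally show ?thesis using jb A N1 unfolding NN by (rule gen2)
    qed
    have prod: "F 1 1 * F (-1) 1 * F 1 (-1) * F (-1) (-1) = real_of_int ((j\<^sup>2 + 3 * b\<^sup>2 - 2 * a\<^sup>2)\<^sup>2 - 12 * (j * b)\<^sup>2)"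
    proof -
      define u where "u = real_of_int a * sqrt 2"
      define v where "v = real_of_int b * sqrt 3"
      define J where "J = real_of_int j"
      have u2: "u\<^sup>2 = 2 * (real_of_int a)\<^sup>2" and v2: "v\<^sup>2 = 3 * (real_of_int b)\<^sup>2"
        by (simp_all add: u_def v_def power_mult_distrib)
      have "F 1 1 * F (-1) 1 * F 1 (-1) * F (-1) (-1) = (J + u + v) * (J - u + v) * (J + u - v) * (J - u - v)"
        by (simp add: F_def u_def v_def J_def)
      also have "\<dots> = (J\<^sup>2 + v\<^sup>2 - u\<^sup>2)\<^sup>2 - 4 * J\<^sup>2 * v\<^sup>2"
        by (simp add: power2_eq_square algebra_simps)
      also have "\<dots> = real_of_int ((j\<^sup>2 + 3 * b\<^sup>2 - 2 * a\<^sup>2)\<^sup>2 - 12 * (j * b)\<^sup>2)"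
        unfolding u2 v2 J_def by (simp add: power_mult_distrib)
      finally show ?thesis .
    qed
    have "1 \<le> \<bar>(j\<^sup>2 + 3 * b\<^sup>2 - 2 * a\<^sup>2)\<^sup>2 - 12 * (j * b)\<^sup>2\<bar>" using norm_form_nonzero[OF ab, of j] by linarith
    then have "1 \<le> \<bar>F 1 1 * F (-1) 1 * F 1 (-1) * F (-1) (-1)\<bar>" unfolding prod by (metis of_int_1 of_int_abs of_int_le_iff)
    also have "\<dots> = \<bar>F 1 1\<bar> * (\<bar>F (-1) 1\<bar> * \<bar>F 1 (-1)\<bar> * \<bar>F (-1) (-1)\<bar>)" by (simp add: abs_mult mult_ac)
    also have "\<dots> \<le> \<bar>F 1 1\<bar> * (8 * N * (8 * N) * (8 * N))"
      by (intro mult_left_mono mult_mono Fb) (use N1 in auto)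
    finally have "1 \<le> \<bar>F 1 1\<bar> * (8 ^ 3 * N ^ 3)" by (simp add: power3_eq_cube mult_ac)
    then have "1 / (8 ^ 3 * N ^ 3) \<le> \<bar>F 1 1\<bar>" using N1 by (simp add: divide_le_eq)
    moreover have "dist_nearest_int x = \<bar>F 1 1\<bar>"
      by (simp add: dist_nearest_int_def F_def x_def j_def)
    moreover have "c * N powr (- 3) = 1 / (8 ^ 3 * N ^ 3)"
    proof -
      have "N powr (- 3) = inverse (N powr 3)" by (rule powr_minus)
      also have "N powr 3 = N ^ 3" using N1 powr_realpow[of N 3] by simp
      finally have p: "N powr (- 3) = inverse (N ^ 3)" .
      show ?thesis unfolding p c_def by (simp only: divide_inverse mult_1 inverse_mult_distrib)
    qed
    ultimately have "c * N powr (- 3) \<le> dist_nearest_int x" by (simp only:)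
    then show "c * real_of_int (\<bar>a\<bar> + \<bar>b\<bar>) powr (- 3) \<le>
      dist_nearest_int (real_of_int a * fst (sqrt 2, sqrt 3) + real_of_int b * snd (sqrt 2, sqrt 3))"
      unfolding x_def N_def by (simp only: fst_conv snd_conv)
  qed
qed

definition diag_mat :: "complex \<Rightarrow> complex \<Rightarrow> cmat" where
  "diag_mat s u = (\<chi> i j. if i = j then (if i = 1 then s else u) else 0)"

definition basis_vec :: "2 \<Rightarrow> cvec" where
  "basis_vec k = (\<chi> i. if i = k then 1 else 0)"

lemma diag_mat_basis_vec: "diag_mat s u *v basis_vec k = (if k = 1 then s else u) *s basis_vec k"
  using exhaust_2[of k] by (auto simp: vec_eq_iff forall_2 matrix_vector_mult_2 diag_mat_def basis_vec_def)

lemma basis_vec_norm: "norm (basis_vec k) = 1"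
proof -
  have "(norm (basis_vec k))\<^sup>2 = 1" using exhaust_2[of k] by (auto simp: norm_cvec basis_vec_def)
  then show ?thesis by (simp add: power2_eq_1_iff) (metis norm_ge_zero not_one_le_zero neg_0_le_iff_le)
qed

lemma constant_invariant_line:
  assumes "s \<noteq> 0" "u \<noteq> 0"
  shows "invariant_line \<tau> (\<lambda>w. mat 1) (\<lambda>w. mat 1) (\<lambda>w. diag_mat s u) (\<lambda>w. line_through (basis_vec k))"
  unfolding invariant_line_def
proof (intro conjI allI)
  have "basis_vec k \<noteq> 0" using basis_vec_norm[of k] by auto
  then have "line_through (basis_vec k) \<in> topspace CP1" unfolding topspace_CP1 by blast
  then show "continuous_map euclidean CP1 (\<lambda>w::plane. line_through (basis_vec k))" by simp
  let ?c = "if k = 1 then s else u"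
  have c: "?c \<noteq> 0" using assms by simp
  show "(\<lambda>v. diag_mat s u *v v) ` line_through (basis_vec k) = line_through (basis_vec k)"
  proof (intro equalityI subsetI)
    fix x assume "x \<in> (\<lambda>v. diag_mat s u *v v) ` line_through (basis_vec k)"
    then obtain d where "x = diag_mat s u *v (d *s basis_vec k)" by (auto simp: line_through_iff)
    then have "x = (d * ?c) *s basis_vec k" unfolding vec.scale diag_mat_basis_vec by (simp add: vector_smult_assoc)
    then show "x \<in> line_through (basis_vec k)" unfolding line_through_iff by blast
  next
    fix x assume "x \<in> line_through (basis_vec k)"
    then obtain d where d: "x = d *s basis_vec k" by (auto simp: line_through_iff)
    have "x = diag_mat s u *v ((d / ?c) *s basis_vec k)" unfolding vec.scale diag_mat_basis_vec using c by (simp add: d vector_smult_assoc)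
    moreover have "(d / ?c) *s basis_vec k \<in> line_through (basis_vec k)" unfolding line_through_iff by blast
    ultimately show "x \<in> (\<lambda>v. diag_mat s u *v v) ` line_through (basis_vec k)" by blast
  qed
qed simp_all

lemma strip_constant: "strip_extendable \<delta> (\<lambda>w. M)"
  unfolding strip_extendable_def
proof (intro exI[of _ UNIV] exI[of _ "\<lambda>z. M"] conjI allI)
  show "holomorphic2_on (\<lambda>z. M $ i $ j) UNIV" for i j
    unfolding holomorphic2_on_def by (intro ballI exI[of _ 0]) simp
  show "bounded ((\<lambda>z. M) ` closed_strip \<delta>)" by (rule bounded_subset[of "{M}"]) auto
qed auto

lemma constant_admissible:
  assumes "s \<noteq> 0" "u \<noteq> 0"
  shows "strip_admissible \<tau> (\<lambda>w. mat 1) (\<lambda>w. mat 1) (\<lambda>w. diag_mat s u)"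
  unfolding strip_admissible_def sewing_system_def equivariant_cocycle_def K1_def K2_def
proof (intro conjI allI)
  have "(\<chi> i j. cnj ((mat 1 :: cmat) $ j $ i)) = mat 1" by (simp add: vec_eq_iff mat_def)
  then show "unitary_mat (mat 1)" "unitary_mat (mat 1)" by (simp_all add: unitary_mat_def)
  show "det (diag_mat s u) \<noteq> 0" using assms by (simp add: det_2 diag_mat_def)
  show "\<exists>\<delta>>0. strip_extendable \<delta> (\<lambda>w. mat 1) \<and> strip_extendable \<delta> (\<lambda>w. mat 1) \<and> strip_extendable \<delta> (\<lambda>w. diag_mat s u)"
    by (intro exI[of _ 1] conjI strip_constant) simp
qed (simp_all add: matrix_mul_lid matrix_mul_rid)

lemma constant_dominated:
  assumes "s \<noteq> 0" "u \<noteq> 0" "2 * cmod s \<le> cmod u"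
  shows "dominated_splitting \<tau> (\<lambda>w. mat 1) (\<lambda>w. mat 1) (\<lambda>w. diag_mat s u)
     (\<lambda>w. line_through (basis_vec 1)) (\<lambda>w. line_through (basis_vec 2))"
  unfolding dominated_splitting_def
proof (intro conjI allI constant_invariant_line assms)
  show "line_through (basis_vec 1) \<noteq> line_through (basis_vec 2)"
  proof
    assume e: "line_through (basis_vec 1) = line_through (basis_vec 2)"
    have "basis_vec 1 \<in> line_through (basis_vec 1)" by (auto simp: line_through_iff intro: exI[of _ 1])
    then obtain c where "basis_vec 1 = c *s basis_vec 2" unfolding e by (auto simp: line_through_iff)
    then have "basis_vec 1 $ 1 = (c *s basis_vec 2) $ 1" by simp
    then show False by (simp add: basis_vec_def)
  qed
  have it: "cocycle_iterate \<tau> (\<lambda>w. diag_mat s u) 1 z = diag_mat s u" for z by simp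
  have "restricted_norm (diag_mat s u) (line_through (basis_vec 1)) = cmod s"
    by (rule restricted_values(1)[OF basis_vec_norm[of 1] _ basis_vec_norm[of 1]]) (simp add: diag_mat_basis_vec)
  moreover have "restricted_conorm (diag_mat s u) (line_through (basis_vec 2)) = cmod u"
    by (rule restricted_values(2)[OF basis_vec_norm[of 2] _ basis_vec_norm[of 2]]) (simp add: diag_mat_basis_vec)
  moreover have "cmod s / cmod u \<le> (3/4)\<^sup>2"
  proof -
    have "cmod s / cmod u \<le> 1/2" using assms by (simp add: divide_le_eq)
    also have "(1/2 :: real) \<le> (3/4)\<^sup>2" by (simp add: power2_eq_square)
    finally show ?thesis .
  qed
  ultimately have r: "restricted_norm (cocycle_iterate \<tau> (\<lambda>w. diag_mat s u) 1 z) (line_through (basis_vec 1)) /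
        restricted_conorm (cocycle_iterate \<tau> (\<lambda>w. diag_mat s u) 1 z) (line_through (basis_vec 2)) \<le> (3/4)\<^sup>2" for z
    unfolding it by (simp only:)
  show "\<exists>N \<kappa>. 1 \<le> N \<and> 0 < \<kappa> \<and> \<kappa> < 1 \<and>
      (\<forall>z. restricted_norm (cocycle_iterate \<tau> (\<lambda>w. diag_mat s u) N z) (line_through (basis_vec 1)) /
        restricted_conorm (cocycle_iterate \<tau> (\<lambda>w. diag_mat s u) N z) (line_through (basis_vec 2)) \<le> \<kappa>\<^sup>2)"
    by (intro exI[of _ 1] exI[of _ "3/4"] conjI allI r) simp_all
qed

lemma constant_multiplier:
  fixes x y :: real
  assumes "x > 0" "y > 0"
  shows "normalized_frame (\<lambda>w. mat 1) (\<lambda>w. mat 1) (\<lambda>w. line_through (basis_vec k)) 0 (\<lambda>w. basis_vec k)"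
    and "multiplier_data \<tau> (\<lambda>w. mat 1) (\<lambda>w. mat 1) (\<lambda>w. diag_mat (of_real x) (of_real y)) (\<lambda>w. line_through (basis_vec k))
       (\<lambda>w. of_real (if k = 1 then x else y)) (0, 0) (\<lambda>w. 0)"
    and "lambda0 (\<lambda>w. of_real (if k = 1 then x else y)) (\<lambda>w. 0) = of_real (if k = 1 then x else y)"
proof -
  let ?z = "if k = 1 then x else y"
  have z: "?z > 0" using assms by simp
  show nf: "normalized_frame (\<lambda>w. mat 1) (\<lambda>w. mat 1) (\<lambda>w. line_through (basis_vec k)) 0 (\<lambda>w. basis_vec k)"
    unfolding normalized_frame_def unit_frame_def
    by (auto simp: basis_vec_norm line_through_iff intro: exI[of _ 1])
  show "multiplier_data \<tau> (\<lambda>w. mat 1) (\<lambda>w. mat 1) (\<lambda>w. diag_mat (of_real x) (of_real y)) (\<lambda>w. line_through (basis_vec k))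
       (\<lambda>w. of_real ?z) (0, 0) (\<lambda>w. 0)"
    unfolding multiplier_data_def
  proof (intro exI[of _ 0] exI[of _ "\<lambda>w. basis_vec k"] conjI allI nf)
    show "of_real ?z = cinner (basis_vec k) (diag_mat (of_real x) (of_real y) *v basis_vec k)"
      unfolding diag_mat_basis_vec cinner_unit[OF basis_vec_norm] by simp
  qed (use z in auto)
  have "complex_of_real (torus_mean (\<lambda>w. ln (norm (complex_of_real ?z)))) = complex_of_real (ln ?z)"
  proof -
    have "complex_of_real (torus_mean (\<lambda>w. ln (norm (complex_of_real ?z)))) = mean (\<lambda>w. of_real (ln ?z) * character 0 w)"
      using z by (subst torus_mean_mean) auto
    then show ?thesis unfolding mean_cmult mean_character by simp
  qed
  moreover have "torus_mean (\<lambda>w. 0) = 0" by (simp add: torus_mean_def set_lebesgue_integral_def)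
  ultimately have "lambda0 (\<lambda>w. of_real ?z) (\<lambda>w. 0) = exp (complex_of_real (ln ?z))"
    unfolding lambda0_def by simp
  also have "\<dots> = of_real ?z" using z by (simp only: exp_of_real exp_ln)
  finally show "lambda0 (\<lambda>w. of_real ?z) (\<lambda>w. 0) = of_real ?z" .
qed

lemma coset_modulus:
  assumes "cmod \<rho> \<noteq> cmod \<rho>'"
  shows "eigenvalue_coset \<tau> \<rho> \<noteq> eigenvalue_coset \<tau> \<rho>'"
proof
  assume e: "eigenvalue_coset \<tau> \<rho> = eigenvalue_coset \<tau> \<rho>'"
  have "\<rho> = \<rho> * character 0 \<tau>" by simp
  then have "\<rho> \<in> eigenvalue_coset \<tau> \<rho>" unfolding coset_eq_character by blast
  then have "\<rho> \<in> eigenvalue_coset \<tau> \<rho>'" using e by simp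
  then obtain n where "\<rho> = \<rho>' * character n \<tau>" unfolding coset_eq_character by blast
  then have "cmod \<rho> = cmod \<rho>'" by (simp add: norm_mult)
  then show False using assms by simp
qed

section \<open>Eigensections\<close>

text \<open>A frame of \<open>l\<close>, no longer of unit length, whose multiplier is as simple as the topology permits: a
  constant, a character, and the phase dictated by the charge \<open>m\<close>.\<close>

definition reduced_frame ::
    "plane \<Rightarrow> (plane \<Rightarrow> cmat) \<Rightarrow> (plane \<Rightarrow> cmat) \<Rightarrow> (plane \<Rightarrow> cmat) \<Rightarrow> (plane \<Rightarrow> cvec set)
      \<Rightarrow> int \<Rightarrow> int \<times> int \<Rightarrow> complex \<Rightarrow> (plane \<Rightarrow> cvec) \<Rightarrow> bool" where
  "reduced_frame \<tau> U1 U2 A l m k \<mu> \<epsilon> \<longleftrightarrow>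
    continuous_on UNIV \<epsilon> \<and> (\<forall>w. \<epsilon> w \<noteq> 0) \<and> (\<forall>w. l w = line_through (\<epsilon> w)) \<and>
    (\<forall>w. \<epsilon> (w + e1) = U1 w *v \<epsilon> w) \<and>
    (\<forall>w. \<epsilon> (w + e2) = cis (2 * pi * real_of_int m * fst w) *s (U2 w *v \<epsilon> w)) \<and>
    \<mu> \<noteq> 0 \<and>
    (\<forall>w. A w *v \<epsilon> w = (\<mu> * character k w * cis (- (2 * pi * real_of_int m * fst \<tau> * snd w))) *s \<epsilon> (w + \<tau>))"

text \<open>The logarithm \<open>G\<close> of the multiplier of a sufficiently differentiable normalized frame is a constant
  plus a coboundary \<open>H (w + \<tau>) - H w\<close>, and the factor \<open>exp H\<close> absorbs the coboundary into the frame.\<close>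

lemma invariant_line_reduced:
  assumes adm: "strip_admissible \<tau> U1 U2 A" and dom: "dominated_splitting \<tau> U1 U2 A ls lu"
    and dio: "diophantine c \<nu> \<tau>" "c > 0" and l: "l = ls \<or> l = lu"
  obtains m k \<mu> \<epsilon> where "reduced_frame \<tau> U1 U2 A l m k \<mu> \<epsilon>"
    "first_chern U1 U2 l = m" "winding_vector \<tau> U1 U2 A l = k"
    "\<exists>q g. multiplier_data \<tau> U1 U2 A l q k g"
    "\<And>q g. multiplier_data \<tau> U1 U2 A l q k g \<Longrightarrow> eigenvalue_coset \<tau> (lambda0 q g) = eigenvalue_coset \<tau> \<mu>"
proof -
  \<comment> \<open>the number of derivatives consumed by the small divisors\<close>
  define r where "r = nat \<lceil>\<nu> + 4\<rceil>"
  have r: "\<nu> + 4 \<le> real r" unfolding r_def by linarith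
  have sew: "sewing_system U1 U2" and eq: "equivariant_cocycle \<tau> U1 U2 A"
    using adm unfolding strip_admissible_def by blast+
  obtain \<delta> where \<delta>: "\<delta> > 0" "strip_extendable \<delta> U1" "strip_extendable \<delta> U2" "strip_extendable \<delta> A"
    using adm unfolding strip_admissible_def by blast
  have cont: "continuous_on UNIV U1" "continuous_on UNIV U2" "continuous_on UNIV A"
    using sew eq unfolding sewing_system_def equivariant_cocycle_def by blast+
  have C: "Ck_along v r (\<lambda>w. U1 w $ i $ j)" "Ck_along v r (\<lambda>w. U2 w $ i $ j)" "Ck_along v r (\<lambda>w. A w $ i $ j)"
    if v: "v = e1 \<or> v = e2" for v i j
    by (rule analytic_along_imp_Ck_along[OF strip_extendable_analytic_along[OF \<delta>(2,1) v]], intro continuous_intros cont)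
       (rule analytic_along_imp_Ck_along[OF strip_extendable_analytic_along[OF \<delta>(3,1) v]], intro continuous_intros cont,
        rule analytic_along_imp_Ck_along[OF strip_extendable_analytic_along[OF \<delta>(4,1) v]], intro continuous_intros cont)
  have inv: "invariant_line \<tau> U1 U2 A l"
    using dom l unfolding dominated_splitting_def by blast
  have lc: "continuous_map euclidean CP1 l" and li: "\<And>w. l (w + e1) = (\<lambda>v. U1 w *v v) ` l w" "\<And>w. l (w + e2) = (\<lambda>v. U2 w *v v) ` l w"
    using inv unfolding invariant_line_def by blast+
  have top: "l w \<in> line_through ` (- {0})" for w
    using continuous_map_image_subset_topspace[OF lc] unfolding topspace_CP1 by auto
  define a where "a w = uvec (l w)" for w
  have a: "norm (a w) = 1" "l w = line_through (a w)" for w unfolding a_def by (rule uvec_props[OF top])+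
  obtain e0 where e0: "\<And>w. norm (e0 w) = 1" "\<And>w. \<exists>c. e0 w = c *s a w"
    "\<And>i. Ck_along e1 r (\<lambda>w. e0 w $ i)" "\<And>i. Ck_along e2 r (\<lambda>w. e0 w $ i)"
  proof (rule smooth_unit_frame[of a r])
    show "analytic_along e1 (\<lambda>w. a w $ i * cnj (a w $ j))" "analytic_along e2 (\<lambda>w. a w $ i * cnj (a w $ j))" for i j
      unfolding a_def by (rule dominated_lines_analytic[OF adm dom _ l]; simp)+
    show "continuous_on UNIV (\<lambda>w. a w $ i * cnj (a w $ j))" for i j
      unfolding a_def by (rule line_projection_continuous[OF lc])
  qed (use a in blast)+
  have l0: "l w = line_through (e0 w)" for w
  proof (rule invariant_line_point[OF inv])
    show "e0 w \<in> l w" using e0(2)[of w] unfolding a(2) line_through_iff .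
    show "e0 w \<noteq> 0" using e0(1)[of w] by auto
  qed
  have C0: "Ck_along v r (\<lambda>w. e0 w $ i)" if "v = e1 \<or> v = e2" for v i using that e0(3,4) by blast
  obtain m e where nf: "normalized_frame U1 U2 l m e" and Ce: "\<And>v i. v = e1 \<or> v = e2 \<Longrightarrow> Ck_along v r (\<lambda>w. e w $ i)"
    using smooth_normalized_frame[OF sew C(1,2) li e0(1) l0 C0] by blast
  define q where "q w = cinner (e (w + \<tau>)) (A w *v e w)" for w
  note fm = frame_multiplier[OF eq inv nf q_def]
  define u where "u w = cis (2 * pi * real_of_int m * fst \<tau> * snd w)" for w :: plane
  have ulin: "u w = exp (of_real (real_of_int m * fst \<tau>) * lin_phase (0, 1) w)" for w
    by (simp add: u_def cis_exp lin_phase_def mult_ac)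
  have uinv: "u w * cis (- (2 * pi * real_of_int m * fst \<tau> * snd w)) = 1" for w
    unfolding u_def cis_mult by simp
  have u0: "u w \<noteq> 0" for w using uinv[of w] by auto
  have Cu: "Ck_along v r u" if v: "v = e1 \<or> v = e2" for v
    unfolding ulin[abs_def] by (intro Ck_along_exp Ck_along_mult Ck_along_const Ck_along_lin_phase v)
  have Cq: "Ck_along v r q" if v: "v = e1 \<or> v = e2" for v
    unfolding q_def[abs_def] by (intro Ck_along_cinner Ck_along_mv Ck_along_translate C(3)[OF v] Ce[OF v] Ck_along_translate[OF Ce[OF v]])
  have CQ: "Ck_along v r (\<lambda>w. q w * u w)" if v: "v = e1 \<or> v = e2" for v by (intro Ck_along_mult Cq Cu v)
  have Qp: "periodic (\<lambda>w. q w * u w)" unfolding u_def by (rule fm(4))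
  have Q0: "q w * u w \<noteq> 0" for w using fm(2) u0 by simp
  have Qc: "continuous_on UNIV (\<lambda>w. q w * u w)" by (rule Ck_along_continuous[OF CQ[of e1]]) simp
  obtain k G where G: "continuous_on UNIV G" "periodic G" "\<And>w. q w * u w = character k w * exp (G w)"
    by (rule torus_log[OF Qc Q0 Qp], rule that)
  have CG: "Ck_along v r G" if v: "v = e1 \<or> v = e2" for v
  proof (rule Ck_along_log[OF _ G(1)])
    show "Ck_along v r (\<lambda>w. q w * u w * exp (- lin_phase k w))"
      by (intro Ck_along_mult[OF CQ[OF v]] Ck_along_exp Ck_along_minus Ck_along_lin_phase v)
    show "q w * u w * exp (- lin_phase k w) = exp (G w)" for w
      unfolding G(3) character_lin_phase by (simp add: exp_minus field_simps)
  qed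
  have qG: "q w = character k w * exp (G w) * cis (- (2 * pi * real_of_int m * fst \<tau> * snd w))" for w
  proof -
    have "q w = q w * u w * cis (- (2 * pi * real_of_int m * fst \<tau> * snd w))" using uinv[of w] by (simp add: mult.assoc)
    then show ?thesis unfolding G(3) .
  qed
  obtain H where H: "continuous_on UNIV H" "periodic H" "\<And>w. G w = mean G + H (w + \<tau>) - H w"
    by (rule cohomological_equation[OF dio G(2) CG[of e1] CG[of e2] r]) simp_all
  define \<epsilon> where "\<epsilon> w = exp (H w) *s e w" for w
  have uf: "unit_frame l e" using nf unfolding normalized_frame_def by blast
  have E: "e (w + e1) = U1 w *v e w" "e (w + e2) = cis (2 * pi * real_of_int m * fst w) *s (U2 w *v e w)" for w
    using nf unfolding normalized_frame_def by blast+
  have Hp: "H (w + e1) = H w" "H (w + e2) = H w" for w using H(2) unfolding periodic_def by blast+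
  have red: "reduced_frame \<tau> U1 U2 A l m k (exp (mean G)) \<epsilon>"
    unfolding reduced_frame_def
  proof (intro conjI allI)
    show "continuous_on UNIV \<epsilon>"
      by (intro continuous_components) (auto simp: \<epsilon>_def intro!: continuous_intros H(1) unit_frame_continuous[OF uf])
    show ne: "\<epsilon> w \<noteq> 0" for w using unit_frame_norm[OF uf, of w] by (auto simp: \<epsilon>_def)
    show "l w = line_through (\<epsilon> w)" for w
    proof (rule invariant_line_point[OF inv _ ne])
      show "\<epsilon> w \<in> l w" unfolding unit_frame_line[OF inv uf] line_through_iff \<epsilon>_def by blast
    qed
    show "\<epsilon> (w + e1) = U1 w *v \<epsilon> w" for w by (simp only: \<epsilon>_def E Hp vec.scale)
    show "\<epsilon> (w + e2) = cis (2 * pi * real_of_int m * fst w) *s (U2 w *v \<epsilon> w)" for w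
      unfolding \<epsilon>_def E Hp vec.scale by (rule vec.scale_left_commute)
    show "A w *v \<epsilon> w = (exp (mean G) * character k w * cis (- (2 * pi * real_of_int m * fst \<tau> * snd w))) *s \<epsilon> (w + \<tau>)" for w
    proof -
      have "exp (H w) * exp (G w) = exp (mean G) * exp (H (w + \<tau>))"
        unfolding exp_add[symmetric] by (subst H(3)) simp
      then have "exp (H w) * q w = (exp (mean G) * character k w * cis (- (2 * pi * real_of_int m * fst \<tau> * snd w))) * exp (H (w + \<tau>))"
        unfolding qG by (simp add: mult_ac)
      then show ?thesis unfolding \<epsilon>_def vec.scale fm(1) vector_smult_assoc by simp
    qed
  qed simp
  have md: "multiplier_data \<tau> U1 U2 A l q k (\<lambda>w. Im (G w) / (2 * pi))"
    by (rule multiplier_dataI[OF eq inv nf q_def qG G(1,2)])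
  have l0eq: "lambda0 q (\<lambda>w. Im (G w) / (2 * pi)) = exp (mean G)"
  proof -
    obtain m' e' G' where 2: "normalized_frame U1 U2 l m' e'"
      "\<And>w. q w = character k w * exp (G' w) * cis (- (2 * pi * real_of_int m' * fst \<tau> * snd w))"
      "continuous_on UNIV G'" "periodic G'" "lambda0 q (\<lambda>w. Im (G w) / (2 * pi)) = exp (mean G')"
      by (rule multiplier_dataE[OF eq inv md]) blast
    have mm: "m' = m" using first_chern_eq[OF inv nf] first_chern_eq[OF inv 2(1)] by simp
    have ex: "exp (G' w) = exp (G w)" for w
      using 2(2)[of w] unfolding mm qG[of w] by (simp add: character_def)
    have P: "continuous_on UNIV (\<lambda>w. G' w - G w)" "periodic (\<lambda>w. G' w - G w)"
      using 2(4) G(2) by (auto intro!: continuous_intros 2(3) G(1)) (simp add: periodic_def)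
    obtain N :: int where N: "\<And>w. G' w - G w = 2 * of_real pi * \<i> * of_int N"
      by (rule exp_one_const[OF P(1)]) (simp_all add: exp_diff ex)
    have "G' = (\<lambda>w. G w + (2 * of_real pi * \<i> * of_int N) * character 0 w)"
      using N by (simp add: fun_eq_iff diff_eq_eq add.commute)
    moreover obtain K where "bdd_borel G K" using periodic_cont_bdd_borel[OF G(2,1)] by blast
    moreover have "bdd_borel (\<lambda>w. (2 * of_real pi * \<i> * of_int N) * character 0 w) (norm (2 * of_real pi * \<i> * complex_of_int N) * 1)"
      by (rule bdd_borel_mult[OF _ bdd_borel_character]) (simp add: bdd_borel_def)
    ultimately have "mean G' = mean G + (2 * of_real pi * \<i> * of_int N) * mean (character 0)"
      by (simp only: mean_add mean_cmult)
    then have "mean G' = mean G + 2 * of_real pi * \<i> * of_int N" unfolding mean_character by simp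
    moreover have "exp (2 * of_real pi * \<i> * of_int N) = (1::complex)" by (auto simp: exp_eq_1 intro: exI[of _ N])
    ultimately show ?thesis unfolding 2(5) by (simp add: exp_add)
  qed
  show thesis
  proof (rule that[OF red first_chern_eq[OF inv nf] winding_vector_eq[OF eq inv md]])
    show "\<exists>q g. multiplier_data \<tau> U1 U2 A l q k g" using md by blast
    show "eigenvalue_coset \<tau> (lambda0 q' g') = eigenvalue_coset \<tau> (exp (mean G))"
      if "multiplier_data \<tau> U1 U2 A l q' k g'" for q' g'
      using multiplier_compare(2)[OF eq inv md that] unfolding l0eq .
  qed
qed

lemma reducedD:
  assumes "reduced_frame \<tau> U1 U2 A l m k \<mu> \<epsilon>"
  shows "continuous_on UNIV \<epsilon>" "\<epsilon> w \<noteq> 0" "l w = line_through (\<epsilon> w)" "\<epsilon> (w + e1) = U1 w *v \<epsilon> w"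
    "\<epsilon> (w + e2) = cis (2 * pi * real_of_int m * fst w) *s (U2 w *v \<epsilon> w)" "\<mu> \<noteq> 0"
    "A w *v \<epsilon> w = (\<mu> * character k w * cis (- (2 * pi * real_of_int m * fst \<tau> * snd w))) *s \<epsilon> (w + \<tau>)"
  using assms unfolding reduced_frame_def by blast+

lemma nth_measurable:
  fixes F :: "'a \<Rightarrow> cvec"
  assumes "F \<in> borel_measurable M"
  shows "(\<lambda>w. F w $ i) \<in> borel_measurable M"
  by (rule measurable_compose[OF assms]) (intro borel_measurable_continuous_onI continuous_intros)

lemma eigensectionD:
  assumes "eigensection \<tau> U1 U2 A \<rho> F"
  shows "F \<in> borel_measurable lebesgue" "AE w in lebesgue. F (w + e1) = U1 w *v F w"
    "AE w in lebesgue. F (w + e2) = U2 w *v F w" "\<not> (AE w in lebesgue. F w = 0)"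
    "AE w in lebesgue. A w *v F w = \<rho> *s F (w + \<tau>)"
proof -
  show "F \<in> borel_measurable lebesgue" "AE w in lebesgue. F (w + e1) = U1 w *v F w"
    "AE w in lebesgue. F (w + e2) = U2 w *v F w" "\<not> (AE w in lebesgue. F w = 0)"
    using assms unfolding eigensection_def measurable_section_def by blast+
  have "AE w in lebesgue. transfer \<tau> A F w = \<rho> *s F w"
    using assms unfolding eigensection_def by blast
  from AE_translate[OF this, of \<tau>] show "AE w in lebesgue. A w *v F w = \<rho> *s F (w + \<tau>)"
    by eventually_elim (simp add: transfer_def)
qed

lemma eigenvalue_nonzero:
  assumes "eigensection \<tau> U1 U2 A \<rho> F" "equivariant_cocycle \<tau> U1 U2 A"
  shows "\<rho> \<noteq> 0"
proof
  assume z: "\<rho> = 0"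
  have d: "det (A w) \<noteq> 0" for w using assms(2) unfolding equivariant_cocycle_def by blast
  have "AE w in lebesgue. F w = 0" using eigensectionD(5)[OF assms(1)]
  proof eventually_elim
    case (elim w)
    then have "A w *v F w = 0" by (simp add: z)
    then have "inverse_2 (A w) *v (A w *v F w) = 0" by simp
    then show ?case using inverse_2_left[OF d] by simp
  qed
  then show False using eigensectionD(4)[OF assms(1)] by blast
qed

text \<open>If \<open>F\<close> is not carried by the other line, its coefficient along \<open>\<epsilon>\<close> is not almost everywhere zero.
  It satisfies the twisted equation of the reduced frame with the factor \<open>\<mu> / \<rho>\<close>. Its modulus gives
  \<open>cmod \<mu> = cmod \<rho>\<close>; once this is known, the coefficient can be made bounded by a factor that depends
  only on its modulus, and the twisted equation persists.\<close>

lemma coefficient_rigidity: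
  assumes eig: "eigensection \<tau> U1 U2 A \<rho> F" and eqc: "equivariant_cocycle \<tau> U1 U2 A"
    and irr: "irrational_pair \<tau>"
    and red: "reduced_frame \<tau> U1 U2 A l m k \<mu> \<epsilon>" "reduced_frame \<tau> U1 U2 A l' m' k' \<mu>' \<epsilon>'"
    and ne: "\<And>w. wedge (\<epsilon> w) (\<epsilon>' w) \<noteq> 0"
    and nc: "\<not> carried_by F l'"
  shows "m = 0" "k = 0" "cmod \<mu> = cmod \<rho>" "\<rho> \<in> eigenvalue_coset \<tau> \<mu>"
proof -
  note e = eigensectionD[OF eig] and R = reducedD[OF red(1)] and R' = reducedD[OF red(2)]
  have \<rho>: "\<rho> \<noteq> 0" by (rule eigenvalue_nonzero[OF eig eqc])
  define a where "a w = wedge (F w) (\<epsilon>' w) * inverse (wedge (\<epsilon> w) (\<epsilon>' w))" for w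
  define b where "b w = wedge (\<epsilon> w) (F w) * inverse (wedge (\<epsilon> w) (\<epsilon>' w))" for w
  have Fab: "F w = a w *s \<epsilon> w + b w *s \<epsilon>' w" for w
  proof -
    have "wedge (\<epsilon> w) (\<epsilon>' w) *s (a w *s \<epsilon> w + b w *s \<epsilon>' w) = wedge (\<epsilon> w) (\<epsilon>' w) *s F w"
      unfolding wedge_decompose[of "\<epsilon> w" "\<epsilon>' w" "F w"] using ne[of w]
      by (simp add: a_def b_def vec.scale_right_distrib vector_smult_assoc mult.left_commute[of "wedge (\<epsilon> w) (\<epsilon>' w)"])
    then show ?thesis using ne[of w] by (metis vec.scale_cancel_left)
  qed
  have coord: "a w = x" if "F w = x *s \<epsilon> w + y *s \<epsilon>' w" for w x y
    unfolding a_def that wedge_add_left wedge_smult_left wedge_self using ne[of w] by simp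
  have ec: "continuous_on UNIV (\<lambda>w. \<epsilon> w $ i)" "continuous_on UNIV (\<lambda>w. \<epsilon>' w $ i)" for i
    by (intro continuous_intros R(1) R'(1))+
  have cm: "f \<in> borel_measurable lebesgue" if "continuous_on UNIV f" for f :: "plane \<Rightarrow> complex"
    by (intro measurable_completion) (simp add: measurable_lborel2 borel_measurable_continuous_onI that)
  have am: "a \<in> borel_measurable lebesgue"
  proof -
    have "continuous_on UNIV (\<lambda>w. inverse (wedge (\<epsilon> w) (\<epsilon>' w)))"
      using ne unfolding wedge_def by (intro continuous_intros ec) auto
    then show ?thesis
      unfolding a_def[abs_def] wedge_def[of "F _"]
      by (intro borel_measurable_times borel_measurable_diff nth_measurable e(1) cm ec)
  qed
  have p1: "AE w in lebesgue. a (w + e1) = a w"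
    using e(2)
  proof eventually_elim
    case (elim w)
    have "F (w + e1) = a w *s \<epsilon> (w + e1) + b w *s \<epsilon>' (w + e1)"
      unfolding elim Fab[of w] R(4) R'(4) by (simp add: matrix_vector_right_distrib vec.scale)
    then show ?case by (rule coord)
  qed
  have p2: "AE w in lebesgue. a (w + e2) = cis (- (2 * pi * real_of_int m * fst w)) * a w"
    using e(3)
  proof eventually_elim
    case (elim w)
    have c: "U2 w *v \<epsilon> w = cis (- (2 * pi * real_of_int m * fst w)) *s \<epsilon> (w + e2)"
      "U2 w *v \<epsilon>' w = cis (- (2 * pi * real_of_int m' * fst w)) *s \<epsilon>' (w + e2)"
      unfolding R(5) R'(5) vector_smult_assoc cis_mult by simp_all
    have "F (w + e2) = (cis (- (2 * pi * real_of_int m * fst w)) * a w) *s \<epsilon> (w + e2)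
       + (cis (- (2 * pi * real_of_int m' * fst w)) * b w) *s \<epsilon>' (w + e2)"
      unfolding elim Fab[of w] matrix_vector_right_distrib vec.scale c by (simp add: vector_smult_assoc mult.commute)
    then show ?case by (rule coord)
  qed
  define \<theta> where "\<theta> = \<mu> / \<rho>"
  have ev: "AE w in lebesgue. a (w + \<tau>) = \<theta> * character k w * cis (- (2 * pi * real_of_int m * fst \<tau> * snd w)) * a w"
    using e(5)
  proof eventually_elim
    case (elim w)
    define x where "x = \<mu> * character k w * cis (- (2 * pi * real_of_int m * fst \<tau> * snd w))"
    define y where "y = \<mu>' * character k' w * cis (- (2 * pi * real_of_int m' * fst \<tau> * snd w))"
    have "F (w + \<tau>) = inverse \<rho> *s (A w *v F w)" unfolding elim using \<rho> by (simp add: vector_smult_assoc)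
    also have "\<dots> = (inverse \<rho> * (a w * x)) *s \<epsilon> (w + \<tau>) + (inverse \<rho> * (b w * y)) *s \<epsilon>' (w + \<tau>)"
      unfolding Fab[of w] matrix_vector_right_distrib vec.scale R(7) R'(7) x_def[symmetric] y_def[symmetric]
      by (simp add: vec.scale_right_distrib vector_smult_assoc)
    finally have "a (w + \<tau>) = inverse \<rho> * (a w * x)" by (rule coord)
    then show ?case by (simp add: x_def \<theta>_def divide_inverse mult_ac)
  qed
  have nz: "\<not> (AE w in lebesgue. a w = 0)"
  proof
    assume "AE w in lebesgue. a w = 0"
    then have "AE w in lebesgue. F w \<in> l' w"
    proof eventually_elim
      case (elim w)
      then have "F w = b w *s \<epsilon>' w" using Fab[of w] by simp
      then show ?case unfolding R'(3) line_through_iff by blast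
    qed
    then show False using nc unfolding carried_by_def by blast
  qed
  have \<theta>0: "\<theta> \<noteq> 0" using \<rho> R(6) by (simp add: \<theta>_def)
  have "cmod \<theta> = 1"
  proof (rule modulus_rigidity[OF am])
    show "AE w in lebesgue. cmod (a (w + e1)) = cmod (a w)" using p1 by eventually_elim simp
    show "AE w in lebesgue. cmod (a (w + e2)) = cmod (a w)" using p2 by eventually_elim (simp add: norm_mult)
    show "AE w in lebesgue. cmod (a (w + \<tau>)) = cmod \<theta> * cmod (a w)" using ev by eventually_elim (simp add: norm_mult)
  qed (use \<theta>0 nz in auto)
  note \<theta>1 = this
  then show "cmod \<mu> = cmod \<rho>" using \<rho> by (simp add: \<theta>_def norm_divide)
  \<comment> \<open>a bounded function with the same argument as \<open>a\<close>, solving the same equation as \<open>cmod \<theta> = 1\<close>\<close>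
  define a' where "a' w = a w * of_real (inverse (1 + cmod (a w)))" for w
  have am': "a' \<in> borel_measurable lebesgue" unfolding a'_def using am by measurable
  have aK: "cmod (a' w) \<le> 1" for w
  proof -
    have "1 + cmod (a w) > 0" by (simp add: add_pos_nonneg)
    then have "cmod (a' w) = cmod (a w) / (1 + cmod (a w))"
      unfolding a'_def norm_mult norm_of_real by (simp add: divide_inverse)
    then show ?thesis using \<open>1 + cmod (a w) > 0\<close> by (simp add: divide_le_eq)
  qed
  have sc: "a' w' = x * a' w" if "a w' = x * a w" "cmod x = 1" for w w' x
    unfolding a'_def that(1) norm_mult that(2) by simp
  have q1: "AE w in lebesgue. a' (w + e1) = a' w"
    using p1 by eventually_elim (simp add: a'_def)
  have q2: "AE w in lebesgue. a' (w + e2) = cis (- (2 * pi * real_of_int m * fst w)) * a' w"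
    using p2 by eventually_elim (rule sc, assumption, simp)
  have q3: "AE w in lebesgue. a' (w + \<tau>) = \<theta> * character k w * cis (- (2 * pi * real_of_int m * fst \<tau> * snd w)) * a' w"
    using ev by eventually_elim (rule sc, assumption, simp add: norm_mult \<theta>1)
  have qn: "\<not> (AE w in lebesgue. a' w = 0)"
  proof
    assume "AE w in lebesgue. a' w = 0"
    then have "AE w in lebesgue. a w = 0"
    proof eventually_elim
      case (elim w)
      have "1 + cmod (a w) > 0" by (simp add: add_pos_nonneg)
      then have "complex_of_real (inverse (1 + cmod (a w))) \<noteq> 0" by (simp only: of_real_eq_0_iff) simp
      then show ?case using elim unfolding a'_def by simp
    qed
    then show False using nz by blast
  qed
  note tr = twisted_rigidity[OF irr am' aK q1 q2 q3 \<theta>1 qn]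
  show "m = 0" "k = 0" by (rule tr)+
  obtain n where n: "\<theta> = character n \<tau>" using tr(3) by blast
  have "\<rho> = \<mu> * character (- n) \<tau>"
  proof -
    have "\<mu> = \<rho> * character n \<tau>" using n \<rho> by (simp add: \<theta>_def field_simps)
    then show ?thesis by (simp add: mult.assoc character_mult)
  qed
  then show "\<rho> \<in> eigenvalue_coset \<tau> \<mu>" unfolding coset_eq_character by blast
qed

lemma carried_both_lines:
  assumes eig: "eigensection \<tau> U1 U2 A \<rho> F"
    and red: "reduced_frame \<tau> U1 U2 A l m k \<mu> \<epsilon>" "reduced_frame \<tau> U1 U2 A l' m' k' \<mu>' \<epsilon>'"
    and ne: "\<And>w. wedge (\<epsilon> w) (\<epsilon>' w) \<noteq> 0"
    and c: "carried_by F l"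
  shows "\<not> carried_by F l'"
proof
  assume c': "carried_by F l'"
  have "AE w in lebesgue. F w = 0"
    using c c' unfolding carried_by_def
  proof eventually_elim
    case (elim w)
    obtain x y where x: "F w = x *s \<epsilon> w" and y: "F w = y *s \<epsilon>' w"
      using elim unfolding reducedD(3)[OF red(1)] reducedD(3)[OF red(2)] line_through_iff by blast
    have "x * wedge (\<epsilon> w) (\<epsilon>' w) = wedge (F w) (\<epsilon>' w)" unfolding x wedge_smult_left ..
    also have "\<dots> = 0" unfolding y wedge_smult_left wedge_self by simp
    finally have "x = 0" using ne[of w] by simp
    then show ?case using x by simp
  qed
  then show False using eigensectionD(4)[OF eig] by blast
qed

text \<open>Multiplying the reduced frame by characters realizes every element of the coset.\<close>

lemma trivial_line_eigensection:
  assumes red: "reduced_frame \<tau> U1 U2 A l 0 0 \<mu> \<epsilon>" and \<rho>: "\<rho> \<in> eigenvalue_coset \<tau> \<mu>"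
  shows "\<exists>F. eigensection \<tau> U1 U2 A \<rho> F \<and> carried_by F l"
proof -
  note R = reducedD[OF red]
  obtain n where n: "\<rho> = \<mu> * character n \<tau>" using \<rho> unfolding coset_eq_character by blast
  define F where "F w = character (- n) w *s \<epsilon> w" for w
  have cp: "character (- n) (w + e1) = character (- n) w" "character (- n) (w + e2) = character (- n) w" for w
    using character_periodic[of "- n"] unfolding periodic_def by blast+
  have Fn: "F w \<noteq> 0" for w using R(2)[of w] by (auto simp: F_def character_def)
  have Fc: "continuous_on UNIV F"
    unfolding F_def by (intro continuous_components) (auto intro!: continuous_intros character_cont R(1))
  have AF: "A w *v F w = \<rho> *s F (w + \<tau>)" for w
  proof -
    have "\<rho> * character (- n) (w + \<tau>) = \<mu> * character (- n) w * (character n \<tau> * character (- n) \<tau>)"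
      unfolding n character_add by (simp only: mult_ac)
    also have "\<dots> = \<mu> * character (- n) w" unfolding character_mult by simp
    finally have x: "\<rho> * character (- n) (w + \<tau>) = \<mu> * character (- n) w" .
    have "A w *v F w = character (- n) w *s (\<mu> *s \<epsilon> (w + \<tau>))"
      unfolding F_def vec.scale R(7) by simp
    also have "\<dots> = (\<rho> * character (- n) (w + \<tau>)) *s \<epsilon> (w + \<tau>)" unfolding x by (simp add: mult.commute)
    finally show ?thesis by (simp add: F_def)
  qed
  have "eigensection \<tau> U1 U2 A \<rho> F"
    unfolding eigensection_def measurable_section_def
  proof (intro conjI)
    show "F \<in> borel_measurable lebesgue"
      by (intro measurable_completion) (simp add: measurable_lborel2 borel_measurable_continuous_onI Fc)
    show "AE w in lebesgue. F (w + e1) = U1 w *v F w"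
      by (intro AE_I2) (simp only: F_def cp vec.scale R(4))
    have "F (w + e2) = U2 w *v F w" for w
      unfolding F_def cp vec.scale R(5) by simp
    then show "AE w in lebesgue. F (w + e2) = U2 w *v F w" by (intro AE_I2)
    show "\<not> (AE w in lebesgue. F w = 0)"
    proof
      assume "AE w in lebesgue. F w = 0"
      then have "negligible {w. \<not> F w = 0}" unfolding negligible_AE .
      then have "negligible (UNIV :: plane set)" using Fn by simp
      then show False using non_negligible_UNIV by blast
    qed
    have "transfer \<tau> A F w = \<rho> *s F w" for w
      unfolding transfer_def using AF[of "w - \<tau>"] by simp
    then show "AE w in lebesgue. transfer \<tau> A F w = \<rho> *s F w" by (intro AE_I2)
  qed
  moreover have "carried_by F l"
    unfolding carried_by_def R(3) line_through_iff F_def by (intro AE_I2) blast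
  ultimately show ?thesis by blast
qed

lemma reduced_iterate:
  assumes red: "reduced_frame \<tau> U1 U2 A l m k \<mu> \<epsilon>"
  shows "\<exists>c. cmod c = cmod \<mu> ^ n \<and> cocycle_iterate \<tau> A n w *v \<epsilon> w = c *s \<epsilon> (w + real n *\<^sub>R \<tau>)"
proof (induction n)
  case 0
  show ?case by (intro exI[of _ 1]) simp
next
  case (Suc n)
  then obtain c where c: "cmod c = cmod \<mu> ^ n" "cocycle_iterate \<tau> A n w *v \<epsilon> w = c *s \<epsilon> (w + real n *\<^sub>R \<tau>)" by blast
  define z where "z = w + real n *\<^sub>R \<tau>"
  define d where "d = \<mu> * character k z * cis (- (2 * pi * real_of_int m * fst \<tau> * snd z))"
  have z': "w + real (Suc n) *\<^sub>R \<tau> = z + \<tau>" unfolding z_def by (simp add: algebra_simps)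
  have "cocycle_iterate \<tau> A (Suc n) w *v \<epsilon> w = A z *v (cocycle_iterate \<tau> A n w *v \<epsilon> w)"
    by (simp add: matrix_vector_mul_assoc z_def)
  also have "\<dots> = (c * d) *s \<epsilon> (w + real (Suc n) *\<^sub>R \<tau>)"
    unfolding c(2) z_def[symmetric] vec.scale reducedD(7)[OF red] d_def[symmetric] z' by (simp add: vector_smult_assoc)
  moreover have "cmod (c * d) = cmod \<mu> ^ Suc n" by (simp add: norm_mult c(1) d_def)
  ultimately show ?case by (metis (no_types))
qed

lemma reduced_restricted:
  assumes red: "reduced_frame \<tau> U1 U2 A l m k \<mu> \<epsilon>"
  shows "restricted_norm (cocycle_iterate \<tau> A n w) (l w) = cmod \<mu> ^ n * norm (\<epsilon> (w + real n *\<^sub>R \<tau>)) / norm (\<epsilon> w)"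
    "restricted_conorm (cocycle_iterate \<tau> A n w) (l w) = cmod \<mu> ^ n * norm (\<epsilon> (w + real n *\<^sub>R \<tau>)) / norm (\<epsilon> w)"
proof -
  obtain c where c: "cmod c = cmod \<mu> ^ n" "cocycle_iterate \<tau> A n w *v \<epsilon> w = c *s \<epsilon> (w + real n *\<^sub>R \<tau>)"
    using reduced_iterate[OF red] by blast
  define s where "s x = complex_of_real (inverse (norm (\<epsilon> x)))" for x
  define b where "b x = s x *s \<epsilon> x" for x
  have n0: "norm (\<epsilon> x) > 0" for x using reducedD(2)[OF red, of x] by simp
  have b1: "norm (b x) = 1" for x using n0[of x] by (simp add: b_def s_def norm_smult norm_inverse)
  have b0: "b x \<noteq> 0" for x using b1[of x] by auto
  have lb: "l w = line_through (b w)"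
    unfolding reducedD(3)[OF red]
    by (rule line_through_eq[OF _ b0]) (auto simp: line_through_iff b_def)
  define \<beta> where "\<beta> = s w * c * of_real (norm (\<epsilon> (w + real n *\<^sub>R \<tau>)))"
  have M: "cocycle_iterate \<tau> A n w *v b w = \<beta> *s b (w + real n *\<^sub>R \<tau>)"
  proof -
    have "\<epsilon> (w + real n *\<^sub>R \<tau>) = complex_of_real (norm (\<epsilon> (w + real n *\<^sub>R \<tau>))) *s b (w + real n *\<^sub>R \<tau>)"
      unfolding b_def s_def vector_smult_assoc using n0[of "w + real n *\<^sub>R \<tau>"] by (simp flip: of_real_mult)
    then have "cocycle_iterate \<tau> A n w *v b w = s w *s (c *s (complex_of_real (norm (\<epsilon> (w + real n *\<^sub>R \<tau>))) *s b (w + real n *\<^sub>R \<tau>)))"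
      unfolding b_def[of w] vec.scale c(2) by simp
    then show ?thesis by (simp add: \<beta>_def mult.assoc)
  qed
  have "cmod \<beta> = cmod \<mu> ^ n * norm (\<epsilon> (w + real n *\<^sub>R \<tau>)) / norm (\<epsilon> w)"
    unfolding \<beta>_def norm_mult c(1) by (simp add: s_def norm_inverse divide_inverse mult_ac)
  then show "restricted_norm (cocycle_iterate \<tau> A n w) (l w) = cmod \<mu> ^ n * norm (\<epsilon> (w + real n *\<^sub>R \<tau>)) / norm (\<epsilon> w)"
    "restricted_conorm (cocycle_iterate \<tau> A n w) (l w) = cmod \<mu> ^ n * norm (\<epsilon> (w + real n *\<^sub>R \<tau>)) / norm (\<epsilon> w)"
    unfolding lb using restricted_values[OF b1 M b1] by simp_all
qed

text \<open>At a point where the periodic function \<open>norm (\<epsilon> w) / norm (\<epsilon>' w)\<close> is smallest, the domination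
  ratio is at least \<open>(cmod \<mu> / cmod \<mu>') ^ N\<close>.\<close>

lemma dominated_modulus:
  assumes dom: "dominated_splitting \<tau> U1 U2 A ls lu" and sew: "sewing_system U1 U2"
    and red: "reduced_frame \<tau> U1 U2 A ls m k \<mu> \<epsilon>" "reduced_frame \<tau> U1 U2 A lu m' k' \<mu>' \<epsilon>'"
  shows "cmod \<mu> < cmod \<mu>'"
proof (rule ccontr)
  assume no: "\<not> cmod \<mu> < cmod \<mu>'"
  obtain N \<kappa> where N: "0 < \<kappa>" "\<kappa> < 1"
    and rat: "\<And>z. restricted_norm (cocycle_iterate \<tau> A N z) (ls z) / restricted_conorm (cocycle_iterate \<tau> A N z) (lu z) \<le> \<kappa>\<^sup>2"
    using dom unfolding dominated_splitting_def by blast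
  have un: "unitary_mat (U1 w)" "unitary_mat (U2 w)" for w using sew unfolding sewing_system_def by blast+
  define R where "R w = norm (\<epsilon> w) / norm (\<epsilon>' w)" for w
  have pos: "norm (\<epsilon> w) > 0" "norm (\<epsilon>' w) > 0" for w using reducedD(2)[OF red(1)] reducedD(2)[OF red(2)] by simp_all
  have np: "norm (\<epsilon> (w + e1)) = norm (\<epsilon> w)" "norm (\<epsilon> (w + e2)) = norm (\<epsilon> w)"
    "norm (\<epsilon>' (w + e1)) = norm (\<epsilon>' w)" "norm (\<epsilon>' (w + e2)) = norm (\<epsilon>' w)" for w
    unfolding reducedD(4,5)[OF red(1)] reducedD(4,5)[OF red(2)] norm_smult unitary_props(1)[OF un(1)] unitary_props(1)[OF un(2)] by simp_all
  have Rp: "periodic R" unfolding periodic_def R_def np by simp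
  have Rc: "continuous_on UNIV R"
    unfolding R_def using pos(2) by (intro continuous_intros reducedD(1)[OF red(1)] reducedD(1)[OF red(2)]) (auto simp: less_imp_neq)
  obtain w0 where w0: "\<And>w. R w0 \<le> R w" using periodic_attains[OF Rp Rc] by blast
  define w1 where "w1 = w0 + real N *\<^sub>R \<tau>"
  have l': "cmod \<mu>' > 0" using reducedD(6)[OF red(2)] by simp
  have ratio: "1 \<le> (cmod \<mu> / cmod \<mu>') ^ N" using no l' by (intro one_le_power) simp
  have "R w0 > 0" unfolding R_def by (rule divide_pos_pos[OF pos])
  then have "1 \<le> R w1 / R w0" using w0[of w1] by simp
  with ratio have "1 * 1 \<le> (cmod \<mu> / cmod \<mu>') ^ N * (R w1 / R w0)"
    by (intro mult_mono) auto
  also have "\<dots> = restricted_norm (cocycle_iterate \<tau> A N w0) (ls w0) / restricted_conorm (cocycle_iterate \<tau> A N w0) (lu w0)"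
    unfolding reduced_restricted(1)[OF red(1)] reduced_restricted(2)[OF red(2)] w1_def[symmetric] R_def
    by (simp add: power_divide mult_ac)
  also have "\<dots> \<le> \<kappa>\<^sup>2" by (rule rat)
  also have "\<dots> < 1" using N by (simp add: power_less_one_iff)
  finally show False by simp
qed

lemma transverse_frames:
  assumes red: "reduced_frame \<tau> U1 U2 A l m k \<mu> \<epsilon>" "reduced_frame \<tau> U1 U2 A l' m' k' \<mu>' \<epsilon>'"
    and ne: "l w \<noteq> l' w"
  shows "wedge (\<epsilon> w) (\<epsilon>' w) \<noteq> 0"
proof
  assume z: "wedge (\<epsilon> w) (\<epsilon>' w) = 0"
  obtain c where c: "\<epsilon>' w = c *s \<epsilon> w" using wedge_zero_parallel[OF z reducedD(2)[OF red(1)]] by blast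
  then have "\<epsilon>' w \<in> line_through (\<epsilon> w)" unfolding line_through_iff by blast
  then have "line_through (\<epsilon> w) = line_through (\<epsilon>' w)" by (rule line_through_eq[OF _ reducedD(2)[OF red(2)]])
  then show False using ne unfolding reducedD(3)[OF red(1)] reducedD(3)[OF red(2)] by simp
qed

lemma carried_iff:
  assumes eqc: "equivariant_cocycle \<tau> U1 U2 A" and irr: "irrational_pair \<tau>"
    and red: "reduced_frame \<tau> U1 U2 A l m k \<mu> \<epsilon>" "reduced_frame \<tau> U1 U2 A l' m' k' \<mu>' \<epsilon>'"
    and ne: "\<And>w. wedge (\<epsilon> w) (\<epsilon>' w) \<noteq> 0"
  shows "(\<exists>\<rho> F. eigensection \<tau> U1 U2 A \<rho> F \<and> carried_by F l) \<longleftrightarrow> m = 0 \<and> k = (0, 0)"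
    and "m = 0 \<and> k = (0, 0) \<Longrightarrow> carried_eigenvalues \<tau> U1 U2 A l = eigenvalue_coset \<tau> \<mu>"
proof -
  have fwd: "m = 0 \<and> k = (0, 0) \<and> \<rho> \<in> eigenvalue_coset \<tau> \<mu>" if "eigensection \<tau> U1 U2 A \<rho> F" "carried_by F l" for \<rho> F
    using coefficient_rigidity[OF that(1) eqc irr red ne carried_both_lines[OF that(1) red ne that(2)]]
    by (simp add: zero_prod_def)
  have bwd: "\<exists>F. eigensection \<tau> U1 U2 A \<rho> F \<and> carried_by F l" if "m = 0 \<and> k = (0, 0)" "\<rho> \<in> eigenvalue_coset \<tau> \<mu>" for \<rho>
    using trivial_line_eigensection[of \<tau> U1 U2 A l \<mu> \<epsilon> \<rho>] red(1) that by (simp add: zero_prod_def)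
  have in0: "\<mu> \<in> eigenvalue_coset \<tau> \<mu>"
  proof -
    have "\<mu> = \<mu> * character 0 \<tau>" by simp
    then show ?thesis unfolding coset_eq_character by blast
  qed
  show "(\<exists>\<rho> F. eigensection \<tau> U1 U2 A \<rho> F \<and> carried_by F l) \<longleftrightarrow> m = 0 \<and> k = (0, 0)"
    using fwd bwd in0 by blast
  show "carried_eigenvalues \<tau> U1 U2 A l = eigenvalue_coset \<tau> \<mu>" if "m = 0 \<and> k = (0, 0)"
    unfolding carried_eigenvalues_def using fwd bwd[OF that] by blast
qed

text \<open>The constant cocycles \<open>diag (1, 2)\<close> and \<open>diag (3, 6)\<close> on the trivial bundle: elements of one coset
  have the same modulus, so different moduli give different cosets.\<close>

lemma constant_examples:
  "\<exists>U1 U2 A ls lu U1' U2' A' ls' lu'.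
          strip_admissible \<tau> U1 U2 A \<and> dominated_splitting \<tau> U1 U2 A ls lu \<and>
          strip_admissible \<tau> U1' U2' A' \<and> dominated_splitting \<tau> U1' U2' A' ls' lu' \<and>
          (\<forall>(l, l')\<in>{(ls, ls'), (lu, lu')}.
            first_chern U1 U2 l = 0 \<and> first_chern U1' U2' l' = 0 \<and>
            winding_vector \<tau> U1 U2 A l = (0, 0) \<and> winding_vector \<tau> U1' U2' A' l' = (0, 0) \<and>
            (\<exists>q g q' g'. multiplier_data \<tau> U1 U2 A l q (0, 0) g \<and>
              multiplier_data \<tau> U1' U2' A' l' q' (0, 0) g' \<and>
              eigenvalue_coset \<tau> (lambda0 q g) \<noteq> eigenvalue_coset \<tau> (lambda0 q' g')))"
proof -
  let ?I = "\<lambda>w::plane. mat 1 :: cmat"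
  let ?A = "\<lambda>x y (w::plane). diag_mat (complex_of_real x) (complex_of_real y)"
  let ?l = "\<lambda>k (w::plane). line_through (basis_vec k)"
  have adm: "strip_admissible \<tau> ?I ?I (?A x y)" if "x > 0" "y > 0" for x y
    using that by (intro constant_admissible) auto
  have dom: "dominated_splitting \<tau> ?I ?I (?A x y) (?l 1) (?l 2)" if "x > 0" "y = 2 * x" for x y
    using that by (intro constant_dominated) auto
  have inv: "invariant_line \<tau> ?I ?I (?A x y) (?l k)" if "x > 0" "y > 0" for x y k
    using that by (intro constant_invariant_line) auto
  have ch: "first_chern ?I ?I (?l k) = 0" for k
    by (rule first_chern_eq[OF inv[of 1 1 k] constant_multiplier(1)[of 1 1 k]]) simp_all
  have md: "multiplier_data \<tau> ?I ?I (?A x y) (?l k) (\<lambda>w. of_real (if k = 1 then x else y)) (0, 0) (\<lambda>w. 0)"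
    if "x > 0" "y > 0" for x y k
    by (rule constant_multiplier(2)[OF that])
  have wv: "winding_vector \<tau> ?I ?I (?A x y) (?l k) = (0, 0)" if "x > 0" "y > 0" for x y k
  proof (rule winding_vector_eq[OF _ inv[OF that] md[OF that]])
    show "equivariant_cocycle \<tau> ?I ?I (?A x y)" using adm[OF that] unfolding strip_admissible_def by blast
  qed
  have each: "first_chern ?I ?I (?l k) = 0 \<and> first_chern ?I ?I (?l k) = 0 \<and>
      winding_vector \<tau> ?I ?I (?A 1 2) (?l k) = (0, 0) \<and> winding_vector \<tau> ?I ?I (?A 3 6) (?l k) = (0, 0) \<and>
      (\<exists>q g q' g'. multiplier_data \<tau> ?I ?I (?A 1 2) (?l k) q (0, 0) g \<and>
        multiplier_data \<tau> ?I ?I (?A 3 6) (?l k) q' (0, 0) g' \<and>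
        eigenvalue_coset \<tau> (lambda0 q g) \<noteq> eigenvalue_coset \<tau> (lambda0 q' g'))" for k
  proof (intro conjI ch)
    show "winding_vector \<tau> ?I ?I (?A 1 2) (?l k) = (0, 0)" by (rule wv) simp_all
    show "winding_vector \<tau> ?I ?I (?A 3 6) (?l k) = (0, 0)" by (rule wv) simp_all
    have "eigenvalue_coset \<tau> (lambda0 (\<lambda>w. of_real (if k = 1 then 1 else 2)) (\<lambda>w. 0)) \<noteq>
        eigenvalue_coset \<tau> (lambda0 (\<lambda>w. of_real (if k = 1 then 3 else 6)) (\<lambda>w. 0))"
      by (rule coset_modulus, subst constant_multiplier(3), simp, simp, subst constant_multiplier(3), simp, simp) simp
    moreover have "multiplier_data \<tau> ?I ?I (?A 1 2) (?l k) (\<lambda>w. of_real (if k = 1 then 1 else 2)) (0, 0) (\<lambda>w. 0)"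
      by (rule md) simp_all
    moreover have "multiplier_data \<tau> ?I ?I (?A 3 6) (?l k) (\<lambda>w. of_real (if k = 1 then 3 else 6)) (0, 0) (\<lambda>w. 0)"
      by (rule md) simp_all
    ultimately show "\<exists>q g q' g'. multiplier_data \<tau> ?I ?I (?A 1 2) (?l k) q (0, 0) g \<and>
        multiplier_data \<tau> ?I ?I (?A 3 6) (?l k) q' (0, 0) g' \<and>
        eigenvalue_coset \<tau> (lambda0 q g) \<noteq> eigenvalue_coset \<tau> (lambda0 q' g')"
      by blast
  qed
  have "\<forall>(l, l')\<in>{(?l 1, ?l 1), (?l 2, ?l 2)}.
      first_chern ?I ?I l = 0 \<and> first_chern ?I ?I l' = 0 \<and>
      winding_vector \<tau> ?I ?I (?A 1 2) l = (0, 0) \<and> winding_vector \<tau> ?I ?I (?A 3 6) l' = (0, 0) \<and>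
      (\<exists>q g q' g'. multiplier_data \<tau> ?I ?I (?A 1 2) l q (0, 0) g \<and>
        multiplier_data \<tau> ?I ?I (?A 3 6) l' q' (0, 0) g' \<and>
        eigenvalue_coset \<tau> (lambda0 q g) \<noteq> eigenvalue_coset \<tau> (lambda0 q' g'))"
    using each[of 1] each[of 2] by (simp only: ball_simps prod.case simp_thms)
  moreover have "strip_admissible \<tau> ?I ?I (?A 1 2)" "strip_admissible \<tau> ?I ?I (?A 3 6)" by (intro adm; simp)+
  moreover have "dominated_splitting \<tau> ?I ?I (?A 1 2) (?l 1) (?l 2)" "dominated_splitting \<tau> ?I ?I (?A 3 6) (?l 1) (?l 2)"
    by (intro dom; simp)+
  ultimately show ?thesis by blast
qed

lemma eigensections_of_splitting:
  assumes "0 < c \<and> 1 \<le> \<nu> \<and> diophantine c \<nu> \<tau> \<and>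
        strip_admissible \<tau> U1 U2 A \<and> dominated_splitting \<tau> U1 U2 A ls lu"
  shows "(\<forall>\<rho> F. eigensection \<tau> U1 U2 A \<rho> F \<longrightarrow> carried_by F ls \<or> carried_by F lu) \<and>
        (first_chern U1 U2 ls \<noteq> 0 \<and> first_chern U1 U2 lu \<noteq> 0 \<longrightarrow>
          (\<nexists>\<rho> F. eigensection \<tau> U1 U2 A \<rho> F) \<and> point_spectrum \<tau> U1 U2 A = {}) \<and>
        (first_chern U1 U2 ls = 0 \<and> first_chern U1 U2 lu \<noteq> 0 \<longrightarrow>
          (\<forall>\<rho> F. eigensection \<tau> U1 U2 A \<rho> F \<longrightarrow> carried_by F ls)) \<and>
        (first_chern U1 U2 ls \<noteq> 0 \<and> first_chern U1 U2 lu = 0 \<longrightarrow>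
          (\<forall>\<rho> F. eigensection \<tau> U1 U2 A \<rho> F \<longrightarrow> carried_by F lu)) \<and>
        (\<forall>l\<in>{ls, lu}.
          ((\<exists>\<rho> F. eigensection \<tau> U1 U2 A \<rho> F \<and> carried_by F l) \<longleftrightarrow>
            first_chern U1 U2 l = 0 \<and> winding_vector \<tau> U1 U2 A l = (0, 0)) \<and>
          (first_chern U1 U2 l = 0 \<and> winding_vector \<tau> U1 U2 A l = (0, 0) \<longrightarrow>
            (\<exists>q g. multiplier_data \<tau> U1 U2 A l q (0, 0) g) \<and>
            (\<forall>q g. multiplier_data \<tau> U1 U2 A l q (0, 0) g \<longrightarrow>
              carried_eigenvalues \<tau> U1 U2 A l = eigenvalue_coset \<tau> (lambda0 q g))))"
proof -
  have c: "0 < c" and dio: "diophantine c \<nu> \<tau>" and adm: "strip_admissible \<tau> U1 U2 A"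
    and dom: "dominated_splitting \<tau> U1 U2 A ls lu" using assms by blast+
  have irr: "irrational_pair \<tau>" by (rule diophantine_irrational[OF dio c])
  have sew: "sewing_system U1 U2" and eqc: "equivariant_cocycle \<tau> U1 U2 A"
    using adm unfolding strip_admissible_def by blast+
  have nel: "ls w \<noteq> lu w" for w using dom unfolding dominated_splitting_def by blast
  obtain m k \<mu> \<epsilon> where s: "reduced_frame \<tau> U1 U2 A ls m k \<mu> \<epsilon>"
    "first_chern U1 U2 ls = m" "winding_vector \<tau> U1 U2 A ls = k"
    "\<exists>q g. multiplier_data \<tau> U1 U2 A ls q k g"
    "\<And>q g. multiplier_data \<tau> U1 U2 A ls q k g \<Longrightarrow> eigenvalue_coset \<tau> (lambda0 q g) = eigenvalue_coset \<tau> \<mu>"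
    using invariant_line_reduced[OF adm dom dio c, of ls] by blast
  obtain m' k' \<mu>' \<epsilon>' where u: "reduced_frame \<tau> U1 U2 A lu m' k' \<mu>' \<epsilon>'"
    "first_chern U1 U2 lu = m'" "winding_vector \<tau> U1 U2 A lu = k'"
    "\<exists>q g. multiplier_data \<tau> U1 U2 A lu q k' g"
    "\<And>q g. multiplier_data \<tau> U1 U2 A lu q k' g \<Longrightarrow> eigenvalue_coset \<tau> (lambda0 q g) = eigenvalue_coset \<tau> \<mu>'"
    using invariant_line_reduced[OF adm dom dio c, of lu] by blast
  have ne: "wedge (\<epsilon> w) (\<epsilon>' w) \<noteq> 0" "wedge (\<epsilon>' w) (\<epsilon> w) \<noteq> 0" for w
    using transverse_frames[OF s(1) u(1) nel] transverse_frames[OF u(1) s(1)] nel[of w] by metis+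
  have lt: "cmod \<mu> < cmod \<mu>'" by (rule dominated_modulus[OF dom sew s(1) u(1)])
  have one: "carried_by F ls \<or> carried_by F lu" if e: "eigensection \<tau> U1 U2 A \<rho> F" for \<rho> F
  proof (rule ccontr)
    assume "\<not> ?thesis"
    then have n: "\<not> carried_by F lu" "\<not> carried_by F ls" by blast+
    have "cmod \<mu> = cmod \<rho>" by (rule coefficient_rigidity(3)[OF e eqc irr s(1) u(1) ne(1) n(1)])
    moreover have "cmod \<mu>' = cmod \<rho>" by (rule coefficient_rigidity(3)[OF e eqc irr u(1) s(1) ne(2) n(2)])
    ultimately show False using lt by simp
  qed
  note cs = carried_iff[OF eqc irr s(1) u(1) ne(1)] and cu = carried_iff[OF eqc irr u(1) s(1) ne(2)]
  have cms: "m = 0" if "eigensection \<tau> U1 U2 A \<rho> F" "carried_by F ls" for \<rho> F using cs(1) that by blast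
  have cmu: "m' = 0" if "eigensection \<tau> U1 U2 A \<rho> F" "carried_by F lu" for \<rho> F using cu(1) that by blast
  have none: "(\<nexists>\<rho> F. eigensection \<tau> U1 U2 A \<rho> F) \<and> point_spectrum \<tau> U1 U2 A = {}" if "m \<noteq> 0" "m' \<noteq> 0"
  proof -
    have a: "\<not> eigensection \<tau> U1 U2 A \<rho> F" for \<rho> F using one cms cmu that by blast
    moreover have "point_spectrum \<tau> U1 U2 A = {}"
    proof (rule ccontr)
      assume "point_spectrum \<tau> U1 U2 A \<noteq> {}"
      then obtain \<rho> F where F: "F \<in> L2_sections U1 U2" "\<not> (AE w in lebesgue. F w = 0)"
        "AE w in lebesgue. transfer \<tau> A F w = \<rho> *s F w"
        unfolding point_spectrum_def by blast
      have "measurable_section U1 U2 F" using F(1) unfolding L2_sections_def by blast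
      then have "eigensection \<tau> U1 U2 A \<rho> F" using F(2,3) unfolding eigensection_def by blast
      then show False using a by blast
    qed
    ultimately show ?thesis by blast
  qed
  have four_s: "((\<exists>\<rho> F. eigensection \<tau> U1 U2 A \<rho> F \<and> carried_by F ls) \<longleftrightarrow> m = 0 \<and> k = (0, 0)) \<and>
      (m = 0 \<and> k = (0, 0) \<longrightarrow> (\<exists>q g. multiplier_data \<tau> U1 U2 A ls q (0, 0) g) \<and>
        (\<forall>q g. multiplier_data \<tau> U1 U2 A ls q (0, 0) g \<longrightarrow> carried_eigenvalues \<tau> U1 U2 A ls = eigenvalue_coset \<tau> (lambda0 q g)))"
    using cs s(4,5) by metis
  have four_u: "((\<exists>\<rho> F. eigensection \<tau> U1 U2 A \<rho> F \<and> carried_by F lu) \<longleftrightarrow> m' = 0 \<and> k' = (0, 0)) \<and>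
      (m' = 0 \<and> k' = (0, 0) \<longrightarrow> (\<exists>q g. multiplier_data \<tau> U1 U2 A lu q (0, 0) g) \<and>
        (\<forall>q g. multiplier_data \<tau> U1 U2 A lu q (0, 0) g \<longrightarrow> carried_eigenvalues \<tau> U1 U2 A lu = eigenvalue_coset \<tau> (lambda0 q g)))"
    using cu u(4,5) by metis
  show ?thesis
    unfolding s(2) u(2)
  proof (intro conjI)
    show "\<forall>\<rho> F. eigensection \<tau> U1 U2 A \<rho> F \<longrightarrow> carried_by F ls \<or> carried_by F lu" using one by blast
    show "m \<noteq> 0 \<and> m' \<noteq> 0 \<longrightarrow> (\<nexists>\<rho> F. eigensection \<tau> U1 U2 A \<rho> F) \<and> point_spectrum \<tau> U1 U2 A = {}"
      using none by blast
    show "m = 0 \<and> m' \<noteq> 0 \<longrightarrow> (\<forall>\<rho> F. eigensection \<tau> U1 U2 A \<rho> F \<longrightarrow> carried_by F ls)" using one cmu by blast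
    show "m \<noteq> 0 \<and> m' = 0 \<longrightarrow> (\<forall>\<rho> F. eigensection \<tau> U1 U2 A \<rho> F \<longrightarrow> carried_by F lu)" using one cms by blast
    show "\<forall>l\<in>{ls, lu}.
          ((\<exists>\<rho> F. eigensection \<tau> U1 U2 A \<rho> F \<and> carried_by F l) \<longleftrightarrow>
            first_chern U1 U2 l = 0 \<and> winding_vector \<tau> U1 U2 A l = (0, 0)) \<and>
          (first_chern U1 U2 l = 0 \<and> winding_vector \<tau> U1 U2 A l = (0, 0) \<longrightarrow>
            (\<exists>q g. multiplier_data \<tau> U1 U2 A l q (0, 0) g) \<and>
            (\<forall>q g. multiplier_data \<tau> U1 U2 A l q (0, 0) g \<longrightarrow>
              carried_eigenvalues \<tau> U1 U2 A l = eigenvalue_coset \<tau> (lambda0 q g)))" (is "\<forall>l\<in>_. ?four l")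
    proof (rule ballI)
      fix l assume "l \<in> {ls, lu}"
      then consider "l = ls" | "l = lu" by blast
      then show "?four l"
      proof cases
        case 1
        show ?thesis unfolding 1 s(2,3) by (rule four_s)
      next
        case 2
        show ?thesis unfolding 2 u(2,3) by (rule four_u)
      qed
    qed
  qed
qed

section \<open>The theorem\<close>

theorem corollaryC:
  shows
    "(\<forall>c \<nu> \<tau> U1 U2 A ls lu.
        0 < c \<and> 1 \<le> \<nu> \<and> diophantine c \<nu> \<tau> \<and>
        strip_admissible \<tau> U1 U2 A \<and> dominated_splitting \<tau> U1 U2 A ls lu \<longrightarrow>
        (\<forall>\<rho> F. eigensection \<tau> U1 U2 A \<rho> F \<longrightarrow> carried_by F ls \<or> carried_by F lu) \<and>
        (first_chern U1 U2 ls \<noteq> 0 \<and> first_chern U1 U2 lu \<noteq> 0 \<longrightarrow>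
          (\<nexists>\<rho> F. eigensection \<tau> U1 U2 A \<rho> F) \<and> point_spectrum \<tau> U1 U2 A = {}) \<and>
        (first_chern U1 U2 ls = 0 \<and> first_chern U1 U2 lu \<noteq> 0 \<longrightarrow>
          (\<forall>\<rho> F. eigensection \<tau> U1 U2 A \<rho> F \<longrightarrow> carried_by F ls)) \<and>
        (first_chern U1 U2 ls \<noteq> 0 \<and> first_chern U1 U2 lu = 0 \<longrightarrow>
          (\<forall>\<rho> F. eigensection \<tau> U1 U2 A \<rho> F \<longrightarrow> carried_by F lu)) \<and>
        (\<forall>l\<in>{ls, lu}.
          ((\<exists>\<rho> F. eigensection \<tau> U1 U2 A \<rho> F \<and> carried_by F l) \<longleftrightarrow>
            first_chern U1 U2 l = 0 \<and> winding_vector \<tau> U1 U2 A l = (0, 0)) \<and>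
          (first_chern U1 U2 l = 0 \<and> winding_vector \<tau> U1 U2 A l = (0, 0) \<longrightarrow>
            (\<exists>q g. multiplier_data \<tau> U1 U2 A l q (0, 0) g) \<and>
            (\<forall>q g. multiplier_data \<tau> U1 U2 A l q (0, 0) g \<longrightarrow>
              carried_eigenvalues \<tau> U1 U2 A l = eigenvalue_coset \<tau> (lambda0 q g))))) \<and>
     (\<exists>c \<nu> \<tau>. 0 < c \<and> 1 \<le> \<nu> \<and> diophantine c \<nu> \<tau>) \<and>
     (\<forall>c \<nu> \<tau>. 0 < c \<and> 1 \<le> \<nu> \<and> diophantine c \<nu> \<tau> \<longrightarrow>
        (\<exists>U1 U2 A ls lu U1' U2' A' ls' lu'.
          strip_admissible \<tau> U1 U2 A \<and> dominated_splitting \<tau> U1 U2 A ls lu \<and>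
          strip_admissible \<tau> U1' U2' A' \<and> dominated_splitting \<tau> U1' U2' A' ls' lu' \<and>
          (\<forall>(l, l')\<in>{(ls, ls'), (lu, lu')}.
            first_chern U1 U2 l = 0 \<and> first_chern U1' U2' l' = 0 \<and>
            winding_vector \<tau> U1 U2 A l = (0, 0) \<and> winding_vector \<tau> U1' U2' A' l' = (0, 0) \<and>
            (\<exists>q g q' g'. multiplier_data \<tau> U1 U2 A l q (0, 0) g \<and>
              multiplier_data \<tau> U1' U2' A' l' q' (0, 0) g' \<and>
              eigenvalue_coset \<tau> (lambda0 q g) \<noteq> eigenvalue_coset \<tau> (lambda0 q' g')))))"
proof (intro conjI)
  show "\<exists>c \<nu> \<tau>. 0 < c \<and> 1 \<le> \<nu> \<and> diophantine c \<nu> \<tau>"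
  proof -
    obtain c where "0 < c" "diophantine c 3 (sqrt 2, sqrt 3)" using diophantine_example by blast
    moreover have "(1::real) \<le> 3" by simp
    ultimately show ?thesis by blast
  qed
qed ((intro allI impI)?, (rule constant_examples | erule eigensections_of_splitting))+

end
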